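(* Let $N=2$, $\alpha\in\mathbb R$ and $1<q<p<2$. There is a constant $C$, independent of $t$, such that for every $t>0$ and every $g\in L^2(\mathbb R^2)\cap L^q(\mathbb R^2)$, $$\|\nabla e^{\Delta_\alpha t}P_{ac}g\|_{L^p(\mathbb R^2)}\le C\,t^{-\frac12-\left(\frac1q-\frac1p\right)}\|P_{ac}g\|_{L^q(\mathbb R^2)}.$$
   Context: Point-interaction Laplacian in $\mathbb R^2$: for $\lambda>0$ let $G_\lambda(x)=\frac{1}{2\pi}K_0(\sqrt\lambda|x|)$ ($K_0$ modified Bessel function of the second kind of order zero), $c(\lambda)=\frac{\gamma_E-\ln2}{2\pi}+\frac{1}{2\pi}\ln\sqrt\lambda$ ($\gamma_E$ Euler–Mascheroni), $E_\alpha=4e^{-4\pi\alpha-2\gamma_E}$. $\Delta_\alpha$ is the self-adjoint operator on $L^2(\mathbb R^2)$ with domain $\{u=\phi_\lambda+\frac{\phi_\lambda(0)}{\alpha+c(\lambda)}G_\lambda:\phi_\lambda\in H^2\}$ and action $(\lambda-\Delta_\alpha)u=(\lambda-\Delta)\phi_\lambda$ ($\lambda>0$, $\lambda\ne E_\alpha$); spectrum $(-\infty,0]\cup\{E_\alpha\}$, simple eigenvalue $E_\alpha$ with normalized eigenfunction $\psi_\alpha=G_{E_\alpha}/\|G_{E_\alpha}\|_{L^2}$. $P_d\varphi=\langle\varphi,\psi_\alpha\rangle_{L^2}\psi_\alpha$, $P_{ac}=I-P_d$, extended to $L^p$, $1<p<\infty$. *)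

theory Defs
  imports "HOL-Analysis.Analysis"
begin

type_synonym R2 = "real^2"

text \<open>Modified Bessel function of the second kind of order zero,
  via its standard integral representation \<open>K_0(r) = \<integral>_0^\<infinity> exp(-r cosh s) ds\<close>, r > 0.\<close>
definition K0 :: "real \<Rightarrow> real" where
  "K0 r = (LBINT s:{0<..}. exp (- r * cosh s))"

definition Gk :: "real \<Rightarrow> R2 \<Rightarrow> real" where
  "Gk lam x = K0 (sqrt lam * norm x) / (2 * pi)"

definition cc :: "real \<Rightarrow> real" where
  "cc lam = (euler_mascheroni - ln 2) / (2 * pi) + ln (sqrt lam) / (2 * pi)"

definition Ealpha :: "real \<Rightarrow> real" where
  "Ealpha alpha = 4 * exp (- 4 * pi * alpha - 2 * euler_mascheroni)"

definition Lp_mem :: "real \<Rightarrow> (R2 \<Rightarrow> 'b::real_normed_vector) \<Rightarrow> bool" where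
  "Lp_mem p f \<longleftrightarrow> f \<in> borel_measurable lborel \<and>
     (\<integral>\<^sup>+ x. ennreal (norm (f x) powr p) \<partial>lborel) < \<infinity>"

definition Lp_norm :: "real \<Rightarrow> (R2 \<Rightarrow> 'b::real_normed_vector) \<Rightarrow> real" where
  "Lp_norm p f = enn2real (\<integral>\<^sup>+ x. ennreal (norm (f x) powr p) \<partial>lborel) powr (1 / p)"

text \<open>Resolvent \<open>(\<lambda> - \<Delta>_\<alpha>)^{-1}\<close> (Krein formula, equivalent to the definition of the
  domain and action of \<open>\<Delta>_\<alpha>\<close> in the context): for \<open>f\<close>,
  \<open>\<phi>_\<lambda> = (\<lambda>-\<Delta>)^{-1} f = G_\<lambda> * f\<close>, so \<open>\<phi>_\<lambda>(0) = \<integral> G_\<lambda>(y) f(y) dy\<close> and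
  \<open>(\<lambda>-\<Delta>_\<alpha>)^{-1} f = \<phi>_\<lambda> + \<phi>_\<lambda>(0)/(\<alpha>+c(\<lambda>)) G_\<lambda>\<close>.\<close>
definition resolv :: "real \<Rightarrow> real \<Rightarrow> (R2 \<Rightarrow> complex) \<Rightarrow> R2 \<Rightarrow> complex" where
  "resolv alpha lam f x =
     (\<integral> y. complex_of_real (Gk lam (x - y)) * f y \<partial>lborel)
     + ((\<integral> y. complex_of_real (Gk lam y) * f y \<partial>lborel) / complex_of_real (alpha + cc lam))
       * complex_of_real (Gk lam x)"

text \<open>The heat semigroup \<open>e^{t\<Delta>_\<alpha>}\<close> via the exponential (Euler/Post--Widder) formula
  \<open>e^{tA} g = lim_n (n/t \<cdot> (n/t - A)^{-1})^n g\<close> in \<open>L^2\<close>.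
  \<open>heat_sg alpha t g u\<close> says that \<open>u\<close> is (a representative of) \<open>e^{t\<Delta>_\<alpha>} g\<close>.\<close>
definition heat_sg :: "real \<Rightarrow> real \<Rightarrow> (R2 \<Rightarrow> complex) \<Rightarrow> (R2 \<Rightarrow> complex) \<Rightarrow> bool" where
  "heat_sg alpha t g u \<longleftrightarrow> Lp_mem 2 u \<and>
     ((\<lambda>n::nat. Lp_norm 2 (\<lambda>x.
         (((\<lambda>f y. complex_of_real (real n / t) * resolv alpha (real n / t) f y) ^^ n) g) x - u x))
      \<longlonglongrightarrow> 0)"

definition psi :: "real \<Rightarrow> R2 \<Rightarrow> real" where
  "psi alpha x = Gk (Ealpha alpha) x / Lp_norm 2 (Gk (Ealpha alpha))"

definition Pd :: "real \<Rightarrow> (R2 \<Rightarrow> complex) \<Rightarrow> R2 \<Rightarrow> complex" where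
  "Pd alpha phi x =
     (\<integral> y. phi y * complex_of_real (psi alpha y) \<partial>lborel) * complex_of_real (psi alpha x)"

definition Pac :: "real \<Rightarrow> (R2 \<Rightarrow> complex) \<Rightarrow> R2 \<Rightarrow> complex" where
  "Pac alpha phi x = phi x - Pd alpha phi x"

definition partial :: "2 \<Rightarrow> (R2 \<Rightarrow> real) \<Rightarrow> R2 \<Rightarrow> real" where
  "partial j f x = frechet_derivative f (at x) (axis j 1)"

fun iter_partial :: "2 list \<Rightarrow> (R2 \<Rightarrow> real) \<Rightarrow> R2 \<Rightarrow> real" where
  "iter_partial [] f = f"
| "iter_partial (j # js) f = partial j (iter_partial js f)"

definition test_fun :: "(R2 \<Rightarrow> real) \<Rightarrow> bool" where
  "test_fun phi \<longleftrightarrow> (\<forall>js. iter_partial js phi differentiable_on UNIV) \<and> bounded {x. phi x \<noteq> 0}"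

definition weak_grad :: "(R2 \<Rightarrow> complex) \<Rightarrow> (R2 \<Rightarrow> complex^2) \<Rightarrow> bool" where
  "weak_grad u h \<longleftrightarrow> (\<forall>j. (\<lambda>x. h x $ j) \<in> borel_measurable lborel) \<and>
     (\<forall>phi. test_fun phi \<longrightarrow> (\<forall>j::2.
        (\<integral> x. u x * complex_of_real (partial j phi x) \<partial>lborel)
        = - (\<integral> x. h x $ j * complex_of_real (phi x) \<partial>lborel)))"

end

theory Submission
  imports Defs "HOL-Probability.Probability"
begin

text \<open>
  Write \<open>E = Ealpha alpha\<close>. Krein's formula contains the factor \<open>1 / (alpha + cc l) = 4 pi / ln (l / E)\<close>, and
  \<open>4 pi / ln (l / E) = 4 pi E / (l - E) + L k (l)\<close>, where \<open>L\<close> is the Laplace transform and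
  \<open>k t = 4 pi \<integral> exp (- t s) / (pi\<^sup>2 + (ln (s / E))\<^sup>2) ds\<close> over \<open>s > 0\<close> is positive, integrable and \<open>O (1 / t)\<close>.
  On functions \<open>f\<close> orthogonal to the eigenfunction \<open>Gk E\<close> the pole at \<open>l = E\<close> disappears, and the semigroup is
  \<open>u t x = (hk t * f) x + \<integral> hk (t - r) x m r dr\<close> over \<open>0 < r < t\<close>, where, with \<open>a s = (hk s * f) 0\<close>,
  \<open>m s = - 4 pi E \<integral> exp (- E r) a (s + r) dr + (k * a) s\<close>. Hence \<open>m s\<close>, like \<open>a s\<close>, is bounded by
  \<open>C s powr (- 1 / q)\<close> times the \<open>L\<^sup>q\<close> norm of \<open>f\<close>, with \<open>C\<close> independent of \<open>s\<close>, and the gradient estimate follows from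
  Gaussian bounds and Jensen's inequality; \<open>p < 2\<close> makes the \<open>L\<^sup>p\<close> norm of the gradient of \<open>hk\<close> integrable in time near 0.
  That \<open>u t\<close> is the Post--Widder limit follows from the resolvent identity, which turns powers of the resolvent
  into averages of \<open>u\<close> against Erlang densities concentrating at \<open>t\<close>.
\<close>

section \<open>Integration on Euclidean spaces\<close>

text \<open>The eigenvalue \<open>E\<close> makes the semigroup grow like
  \<open>exp (E * t)\<close>, so a bound uniform in time has to use the orthogonality
  quantitatively. Inverting the pole term \<open>4 pi E / (l - E)\<close> in the usual way gives the
  causal convolution with \<open>exp (E * s)\<close>, which grows. Because the transform of
  \<open>a\<close> vanishes at \<open>E\<close>, the same function is minus an average of
  \<open>exp (- E * r) * a (s + r)\<close> over the future; this average has mass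
  \<open>1 / E\<close> and reads \<open>a\<close> only where its power bound is smaller, so the
  decay survives and \<open>E\<close> cancels. The remaining kernel \<open>k\<close> has mass
  \<open>4 pi\<close> for every \<open>E\<close> and the bound \<open>4 / (pi t)\<close>, hence no
  time scale enters the charge estimate. The density \<open>1 / (pi^2 + (ln r)^2)\<close> is, up to
  a factor, the jump of \<open>1 / ln\<close> across the negative half axis; it is found without
  contour integration by averaging the Stieltjes formula for \<open>l powr (- s)\<close> over
  \<open>0 < s < 1\<close>. The evolution is transformed only at \<open>x \<noteq> 0\<close>,
  because \<open>hk s 0 = 1 / (4 pi s)\<close> has no Laplace transform; this costs a null
  set.\<close>

lemma lborel_Fubini:
  fixes f :: "'a::euclidean_space \<Rightarrow> 'b::euclidean_space \<Rightarrow> 'c::{banach, second_countable_topology}"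
  assumes [measurable]: "case_prod f \<in> borel_measurable (lborel \<Otimes>\<^sub>M lborel)"
    and fin: "(\<integral>\<^sup>+ x. \<integral>\<^sup>+ y. ennreal (norm (f x y)) \<partial>lborel \<partial>lborel) < \<infinity>"
  shows "(\<integral>x. \<integral>y. f x y \<partial>lborel \<partial>lborel) = (\<integral>y. \<integral>x. f x y \<partial>lborel \<partial>lborel)"
    and "integrable lborel (\<lambda>x. \<integral>y. f x y \<partial>lborel)"
    and "integrable lborel (\<lambda>y. \<integral>x. f x y \<partial>lborel)"
    and "AE x in lborel. integrable lborel (f x)"
proof -
  have i: "integrable (lborel \<Otimes>\<^sub>M lborel) (case_prod f)"
  proof (rule integrableI_bounded)
    show "(\<integral>\<^sup>+ z. ennreal (norm (case z of (x, y) \<Rightarrow> f x y)) \<partial>(lborel \<Otimes>\<^sub>M lborel)) < \<infinity>"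
      using fin by (subst lborel.nn_integral_fst[symmetric]) auto
  qed simp
  show "(\<integral>x. \<integral>y. f x y \<partial>lborel \<partial>lborel) = (\<integral>y. \<integral>x. f x y \<partial>lborel \<partial>lborel)"
    using lborel_pair.Fubini_integral[OF i] by simp
  show "integrable lborel (\<lambda>x. \<integral>y. f x y \<partial>lborel)"
    using lborel_pair.integrable_fst[OF i] by simp
  show "integrable lborel (\<lambda>y. \<integral>x. f x y \<partial>lborel)"
    using lborel_pair.integrable_snd[OF i] by simp
  show "AE x in lborel. integrable lborel (f x)"
    using lborel_pair.AE_integrable_fst[OF i] by simp
qed

lemma lborel_Tonelli:
  fixes f :: "'a::euclidean_space \<Rightarrow> 'b::euclidean_space \<Rightarrow> ennreal"
  assumes "case_prod f \<in> borel_measurable (lborel \<Otimes>\<^sub>M lborel)"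
  shows "(\<integral>\<^sup>+ x. \<integral>\<^sup>+ y. f x y \<partial>lborel \<partial>lborel) = (\<integral>\<^sup>+ y. \<integral>\<^sup>+ x. f x y \<partial>lborel \<partial>lborel)"
  using lborel_pair.Fubini'[OF assms] by simp

lemma nn_integral_lborel_shift:
  fixes f :: "'a::euclidean_space \<Rightarrow> ennreal"
  assumes [measurable]: "f \<in> borel_measurable borel"
  shows "(\<integral>\<^sup>+ x. f (t + x) \<partial>lborel) = (\<integral>\<^sup>+ x. f x \<partial>lborel)"
proof -
  have "(\<integral>\<^sup>+ x. f x \<partial>lborel) = (\<integral>\<^sup>+ x. f x \<partial>distr lborel borel (\<lambda>x. t + x))"
    using lborel_affine[of 1 t] by (simp add: density_1)
  then show ?thesis by (simp add: nn_integral_distr)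
qed

lemma nn_integral_lborel_reflect:
  fixes f :: "'a::euclidean_space \<Rightarrow> ennreal"
  assumes [measurable]: "f \<in> borel_measurable borel"
  shows "(\<integral>\<^sup>+ x. f (t - x) \<partial>lborel) = (\<integral>\<^sup>+ x. f x \<partial>lborel)"
proof -
  have "(\<integral>\<^sup>+ x. f x \<partial>lborel) = (\<integral>\<^sup>+ x. f x \<partial>distr lborel borel (\<lambda>x. t - x))"
    using lborel_affine[of "-1" t] by (simp add: density_1)
  then show ?thesis by (simp add: nn_integral_distr)
qed

lemma integral_lborel_shift:
  fixes f :: "'a::euclidean_space \<Rightarrow> 'b::{banach, second_countable_topology}"
  assumes [measurable]: "f \<in> borel_measurable borel"
  shows "(\<integral> x. f (t + x) \<partial>lborel) = (\<integral> x. f x \<partial>lborel)"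
proof -
  have "(\<integral> x. f x \<partial>lborel) = (\<integral> x. f x \<partial>distr lborel borel (\<lambda>x. t + x))"
    using lborel_affine[of 1 t] by (simp add: density_1)
  then show ?thesis by (simp add: integral_distr)
qed

section \<open>Young's and Jensen's inequalities for real powers\<close>

lemma Young_powr:
  fixes c v p :: real
  assumes "1 < p" "0 < c" "0 \<le> v"
  shows "v \<le> (1 - 1 / p) * c + c powr (1 - p) * (v powr p) / p"
proof (cases "v = 0")
  case False
  have "c powr (1 - 1/p) * (c powr (1-p) * v powr p) powr (1/p)
     \<le> (1 - 1/p) * c + 1/p * (c powr (1-p) * v powr p)"
    using assms False by (intro Youngs_inequality_0) auto
  moreover have "c powr (1 - 1/p) * (c powr (1-p) * v powr p) powr (1/p) = v"
  proof -
    have "(1 - p) / p + (1 - 1 / p) = 0" using assms by (simp add: field_simps)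
    then have "c powr (1 - 1/p) * c powr ((1-p)/p) = 1"
      using assms by (simp add: powr_add[symmetric] add.commute)
    moreover have "(v powr p) powr (1/p) = v" using assms by (simp add: powr_powr)
    moreover have "(c powr (1-p) * v powr p) powr (1/p) = c powr ((1-p)/p) * (v powr p) powr (1/p)"
      using assms by (simp add: powr_mult powr_powr)
    ultimately show ?thesis by (simp add: mult.assoc[symmetric])
  qed
  ultimately show ?thesis by simp
qed (use assms in simp)

text \<open>Hoelder's inequality for the measure \<open>w dM\<close>, obtained by integrating the
  pointwise inequality \<open>Young_powr\<close> and optimising its free parameter \<open>c\<close>
  afterwards. Only upper bounds \<open>W\<close> and \<open>B\<close> for the two integrals enter,
  so the weight may have any finite mass.\<close>

lemma nn_integral_Jensen_powr:
  fixes w F :: "'a \<Rightarrow> real"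
  assumes [measurable]: "w \<in> borel_measurable M" "F \<in> borel_measurable M"
    and nn: "\<And>x. 0 \<le> w x" "\<And>x. 0 \<le> F x" and p: "1 < p" and W: "0 < W" and B: "0 \<le> B"
    and w: "(\<integral>\<^sup>+ x. ennreal (w x) \<partial>M) \<le> ennreal W"
    and F: "(\<integral>\<^sup>+ x. ennreal (w x * F x powr p) \<partial>M) \<le> ennreal B"
  shows "(\<integral>\<^sup>+ x. ennreal (w x * F x) \<partial>M) \<le> ennreal (W powr (1 - 1 / p) * B powr (1 / p))"
proof (cases "B = 0")
  case True
  \<comment> \<open>For \<open>B = 0\<close> the optimal \<open>c\<close> would be 0, outside the
    range of \<open>Young_powr\<close>; here the product \<open>w * F\<close> vanishes almost
    everywhere.\<close>
  with F have "AE x in M. ennreal (w x * F x powr p) = 0"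
    by (subst nn_integral_0_iff_AE[symmetric]) auto
  then have "AE x in M. ennreal (w x * F x) = 0"
    by eventually_elim (use nn p in \<open>auto simp: ennreal_eq_0_iff mult_le_0_iff\<close>)
  then have "(\<integral>\<^sup>+ x. ennreal (w x * F x) \<partial>M) = 0"
    by (subst nn_integral_0_iff_AE) auto
  then show ?thesis by simp
next
  case False
  with B have B: "0 < B" by simp
  \<comment> \<open>The minimiser of \<open>(1 - 1 / p) * c * W + c powr (1 - p) / p * B\<close>. At
    it \<open>c powr (1 - p) * B = c * W\<close>, so the weights \<open>1 - 1 / p\<close> and
    \<open>1 / p\<close> simply add up.\<close>
  define c where "c = (B / W) powr (1 / p)"
  have c: "0 < c" using B W by (simp add: c_def)
  have "(\<integral>\<^sup>+ x. ennreal (w x * F x) \<partial>M)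
    \<le> (\<integral>\<^sup>+ x. ennreal ((1 - 1 / p) * c) * ennreal (w x) + ennreal (c powr (1 - p) / p) * ennreal (w x * F x powr p) \<partial>M)"
  proof (rule nn_integral_mono)
    fix x
    have "w x * F x \<le> w x * ((1 - 1 / p) * c + c powr (1 - p) * (F x powr p) / p)"
      by (intro mult_left_mono Young_powr) (use p c nn in auto)
    also have "\<dots> = (1 - 1 / p) * c * w x + c powr (1 - p) / p * (w x * F x powr p)"
      by (simp add: field_simps)
    finally show "ennreal (w x * F x) \<le> ennreal ((1 - 1 / p) * c) * ennreal (w x) + ennreal (c powr (1 - p) / p) * ennreal (w x * F x powr p)"
      using p c nn by (simp add: ennreal_mult'[symmetric] ennreal_plus[symmetric] del: ennreal_plus)
  qed
  also have "\<dots> = ennreal ((1 - 1 / p) * c) * (\<integral>\<^sup>+ x. ennreal (w x) \<partial>M) + ennreal (c powr (1 - p) / p) * (\<integral>\<^sup>+ x. ennreal (w x * F x powr p) \<partial>M)"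
    by (simp add: nn_integral_add nn_integral_cmult)
  also have "\<dots> \<le> ennreal ((1 - 1 / p) * c) * ennreal W + ennreal (c powr (1 - p) / p) * ennreal B"
    by (intro add_mono mult_left_mono w F) auto
  also have "\<dots> = ennreal ((1 - 1 / p) * c * W + c powr (1 - p) / p * B)"
    using p c W B by (simp add: ennreal_mult'[symmetric] ennreal_plus[symmetric] del: ennreal_plus)
  also have "(1 - 1 / p) * c * W + c powr (1 - p) / p * B = W powr (1 - 1 / p) * B powr (1 / p)"
  proof -
    have cW: "c * W = W powr (1 - 1 / p) * B powr (1 / p)"
      unfolding c_def using B W by (simp add: powr_divide powr_diff)
    have "c powr p = B / W" unfolding c_def using B W p by (simp add: powr_powr)
    then have "c powr (1 - p) * B = c * W"
      using B W c by (simp add: powr_diff)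
    then have "c powr (1 - p) / p * B = c * W / p" by simp
    then show ?thesis unfolding cW[symmetric] using p by (simp add: field_simps)
  qed
  finally show ?thesis .
qed

text \<open>Meant to be applied pointwise in a space variable before Tonelli, hence the
  \<open>ennreal\<close> form: the right side may be infinite, and a non-integrable \<open>g\<close>
  has Bochner integral 0.\<close>

lemma integral_Jensen_powr:
  fixes w F :: "'a \<Rightarrow> real" and g :: "'a \<Rightarrow> 'b::{banach, second_countable_topology}"
  assumes [measurable]: "w \<in> borel_measurable M" "F \<in> borel_measurable M"
    and nn: "\<And>x. 0 \<le> w x" "\<And>x. 0 \<le> F x" and p: "1 < p" and W: "0 < W"
    and w: "(\<integral>\<^sup>+ x. ennreal (w x) \<partial>M) \<le> ennreal W"
    and g: "\<And>x. norm (g x) \<le> w x * F x"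
  shows "ennreal (norm (integral\<^sup>L M g) powr p)
     \<le> ennreal (W powr (p - 1)) * (\<integral>\<^sup>+ x. ennreal (w x * F x powr p) \<partial>M)"
proof (cases "(\<integral>\<^sup>+ x. ennreal (w x * F x powr p) \<partial>M)")
  case (real B)
  have "ennreal (norm (integral\<^sup>L M g)) \<le> ennreal (W powr (1 - 1 / p) * B powr (1 / p))"
  proof (cases "integrable M g")
    case True
    have "ennreal (norm (integral\<^sup>L M g)) \<le> (\<integral>\<^sup>+ x. ennreal (norm (g x)) \<partial>M)"
      by (rule integral_norm_bound_ennreal[OF True])
    also have "\<dots> \<le> (\<integral>\<^sup>+ x. ennreal (w x * F x) \<partial>M)"
      by (intro nn_integral_mono ennreal_leI g)
    also have "\<dots> \<le> ennreal (W powr (1 - 1 / p) * B powr (1 / p))"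
      by (rule nn_integral_Jensen_powr) (use assms real in auto)
    finally show ?thesis .
  next
    case False
    then show ?thesis by (simp add: not_integrable_integral_eq)
  qed
  then have "norm (integral\<^sup>L M g) \<le> W powr (1 - 1 / p) * B powr (1 / p)"
    by (simp add: ennreal_le_iff)
  then have "norm (integral\<^sup>L M g) powr p \<le> (W powr (1 - 1 / p) * B powr (1 / p)) powr p"
    using p by (intro powr_mono2) auto
  also have "\<dots> = W powr (p - 1) * B"
    using p W \<open>0 \<le> B\<close> by (simp add: powr_mult powr_powr algebra_simps)
  finally show ?thesis using real W by (simp add: ennreal_mult'[symmetric] ennreal_leI)
next
  case top
  then show ?thesis using W by (simp add: ennreal_mult_top)
qed

section \<open>The heat kernel and the Green function\<close>

text \<open>The heat kernel is extended by 0 to \<open>t \<le> 0\<close>, so that a time convolution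
  over the whole line stops at \<open>r < t\<close> by itself.\<close>

definition hk :: "real \<Rightarrow> R2 \<Rightarrow> real" where
  "hk t x = (if 0 < t then exp (- (norm x)\<^sup>2 / (4 * t)) / (4 * pi * t) else 0)"

lemma hk_nonneg [simp]: "0 \<le> hk t x"
  by (simp add: hk_def)

lemma hk_minus [simp]: "hk t (- x) = hk t x"
  by (simp add: hk_def)

lemma hk_diff_commute: "hk t (x - y) = hk t (y - x)"
  by (simp add: hk_def norm_minus_commute)

lemma hk_nonpos [simp]: "t \<le> 0 \<Longrightarrow> hk t x = 0"
  by (simp add: hk_def)

lemma hk_measurable [measurable (raw)]:
  "f \<in> borel_measurable M \<Longrightarrow> g \<in> borel_measurable M \<Longrightarrow> (\<lambda>z. hk (f z) (g z)) \<in> borel_measurable M"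
proof -
  assume [measurable]: "f \<in> borel_measurable M" "g \<in> borel_measurable M"
  show ?thesis unfolding hk_def by measurable
qed

lemma hk_le: "0 < t \<Longrightarrow> hk t x \<le> 1 / (4 * pi * t)"
  by (auto simp: hk_def intro!: divide_right_mono)

text \<open>Uniform in time, from \<open>z * exp (- z) \<le> 1\<close>. Away from the origin it
  replaces the bound \<open>1 / (4 pi t)\<close>, which is not integrable at
  \<open>t = 0\<close>.\<close>

lemma hk_le_norm:
  assumes "x \<noteq> 0"
  shows "hk t x \<le> 1 / (pi * (norm x)\<^sup>2)"
proof (cases "0 < t")
  case True
  define z where "z = (norm x)\<^sup>2 / (4 * t)"
  have z: "0 < z" using assms True by (simp add: z_def)
  have "z \<le> exp z" using exp_ge_add_one_self[of z] by linarith
  then have "exp (- z) \<le> 1 / z" using z by (simp add: exp_minus field_simps)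
  then have "exp (- z) / (4 * pi * t) \<le> 1 / z / (4 * pi * t)"
    using True by (intro divide_right_mono) auto
  then show ?thesis using True by (simp add: hk_def z_def field_simps)
qed simp

text \<open>One kernel dominates all times within a factor 2 of \<open>t\<close>: the Gaussian
  widens with time, and the prefactor loses at most 4. This provides the majorants for dominated
  convergence in the time variable.\<close>

lemma hk_le_dilated:
  assumes "0 < t" "t / 2 \<le> s" "s \<le> 2 * t"
  shows "hk s x \<le> 4 * hk (2 * t) x"
proof -
  have s: "0 < s" using assms by simp
  have "- (norm x)\<^sup>2 / (4 * s) \<le> - (norm x)\<^sup>2 / (4 * (2 * t))"
    using assms s by (simp add: frac_le)
  then have "exp (- (norm x)\<^sup>2 / (4 * s)) / (4 * pi * s) \<le> exp (- (norm x)\<^sup>2 / (4 * (2 * t))) / (4 * pi * (t / 2))"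
    using assms s by (intro frac_le) auto
  then show ?thesis using assms s by (simp add: hk_def)
qed

lemma hk_isCont: "0 < t \<Longrightarrow> isCont (\<lambda>t. hk t x) t"
proof -
  assume t: "0 < t"
  have "isCont (\<lambda>t. exp (- (norm x)\<^sup>2 / (4 * t)) / (4 * pi * t)) t"
    using t by (intro continuous_intros) auto
  moreover have "eventually (\<lambda>s. hk s x = exp (- (norm x)\<^sup>2 / (4 * s)) / (4 * pi * s)) (nhds t)"
    by (rule eventually_mono[OF eventually_nhds_in_open[of "{0<..}" t]]) (use t in \<open>auto simp: hk_def\<close>)
  ultimately show ?thesis by (simp add: isCont_cong)
qed

text \<open>In coordinates the kernel is a product of normal densities of variance
  \<open>2 * t\<close>.\<close>

lemma nn_integral_hk:
  assumes t: "0 < t"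
  shows "(\<integral>\<^sup>+ x. ennreal (hk t x) \<partial>lborel) = 1"
proof -
  have n1: "(\<integral>\<^sup>+ x. ennreal (normal_density 0 (sqrt (2 * t)) x) \<partial>lborel) = 1"
    using t by (subst nn_integral_eq_integral) auto
  have eq: "ennreal (hk t x) = (\<Prod>b\<in>Basis. ennreal (normal_density 0 (sqrt (2 * t)) (x \<bullet> b)))" for x :: R2
  proof -
    have "(norm x)\<^sup>2 = (\<Sum>b\<in>Basis. (x \<bullet> b)\<^sup>2)"
      unfolding power2_norm_eq_inner by (subst euclidean_inner) (simp add: power2_eq_square)
    then have "exp (- (norm x)\<^sup>2 / (4 * t)) = (\<Prod>b\<in>Basis. exp (- (x \<bullet> b)\<^sup>2 / (4 * t)))"
      by (simp add: exp_sum[symmetric] sum_negf[symmetric] sum_divide_distrib)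
    then have "hk t x = (\<Prod>b\<in>Basis. normal_density 0 (sqrt (2 * t)) (x \<bullet> b))"
      using t unfolding normal_density_def prod.distrib by (simp add: hk_def power_divide)
    then show ?thesis by (simp add: prod_ennreal)
  qed
  have "(\<integral>\<^sup>+ x. ennreal (hk t x) \<partial>lborel) = (\<Prod>b\<in>(Basis :: R2 set). \<integral>\<^sup>+ x. ennreal (normal_density 0 (sqrt (2 * t)) x) \<partial>lborel)"
    unfolding eq by (rule nn_integral_lborel_prod) auto
  then show ?thesis by (simp add: n1)
qed

lemma nn_integral_hk_shift:
  assumes t: "0 < t"
  shows "(\<integral>\<^sup>+ y. ennreal (hk t (x - y)) \<partial>lborel) = 1" "(\<integral>\<^sup>+ y. ennreal (hk t (y - x)) \<partial>lborel) = 1"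
proof -
  show "(\<integral>\<^sup>+ y. ennreal (hk t (x - y)) \<partial>lborel) = 1"
    using nn_integral_lborel_reflect[of "\<lambda>x. ennreal (hk t x)" x] nn_integral_hk[OF t] by simp
  then show "(\<integral>\<^sup>+ y. ennreal (hk t (y - x)) \<partial>lborel) = 1"
    by (simp add: hk_diff_commute)
qed

text \<open>A power of a Gaussian is a multiple of the Gaussian at time \<open>t / p\<close>. The
  prefactor carries the scaling \<open>t powr (1 - p)\<close> on which the exponents of the later
  estimates rest.\<close>

lemma nn_integral_hk_powr:
  assumes t: "0 < t" and p: "0 < p"
  shows "(\<integral>\<^sup>+ x. ennreal (hk t x powr p) \<partial>lborel) = ennreal ((4 * pi * t) powr (1 - p) / p)"
proof -
  have "hk t x powr p = (4 * pi * t) powr (1 - p) / p * hk (t / p) x" for x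
  proof -
    have "(4 * pi * t) powr (1 - p) = (4 * pi * t) / (4 * pi * t) powr p"
      using t by (simp add: powr_diff)
    then show ?thesis
      using t p by (simp add: hk_def powr_divide powr_mult exp_powr_real field_simps)
  qed
  then have "(\<integral>\<^sup>+ x. ennreal (hk t x powr p) \<partial>lborel)
      = (\<integral>\<^sup>+ x. ennreal ((4 * pi * t) powr (1 - p) / p) * ennreal (hk (t / p) x) \<partial>lborel)"
    using p by (subst ennreal_mult'[symmetric]) simp_all
  then show ?thesis using t p by (simp add: nn_integral_cmult nn_integral_hk)
qed

text \<open>Completing the square in \<open>y\<close>: the second factor on the right is a Gaussian
  in \<open>y\<close> of mass 1, so integration gives the semigroup law.\<close>

lemma hk_mult:
  assumes "0 < s" "0 < t"
  shows "hk s (x - y) * hk t y = hk (s + t) x * hk (s * t / (s + t)) (y - (t / (s + t)) *\<^sub>R x)"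
proof -
  define X where "X = inner x x"
  define Y where "Y = inner y y"
  define Z where "Z = inner x y"
  have e: "(norm (x - y))\<^sup>2 = X - 2 * Z + Y" "(norm y)\<^sup>2 = Y" "(norm x)\<^sup>2 = X"
    "(norm (y - (t / (s + t)) *\<^sub>R x))\<^sup>2 = Y - 2 * (t / (s + t)) * Z + (t / (s + t))\<^sup>2 * X"
    unfolding power2_norm_eq_inner X_def Y_def Z_def
    by (simp_all add: inner_diff inner_commute power2_eq_square algebra_simps)
  have st: "s + t \<noteq> 0" "s \<noteq> 0" "t \<noteq> 0" using assms by auto
  have "- (X - 2 * Z + Y) / (4 * s) + - Y / (4 * t)
     = - X / (4 * (s + t)) + - (Y - 2 * (t / (s + t)) * Z + (t / (s + t))\<^sup>2 * X) / (4 * (s * t / (s + t)))"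
    using st by (simp add: divide_simps) (simp add: algebra_simps power2_eq_square)
  then have "exp (- (X - 2 * Z + Y) / (4 * s)) * exp (- Y / (4 * t))
     = exp (- X / (4 * (s + t))) * exp (- (Y - 2 * (t / (s + t)) * Z + (t / (s + t))\<^sup>2 * X) / (4 * (s * t / (s + t))))"
    unfolding exp_add[symmetric] by simp
  moreover have "4 * pi * s * (4 * pi * t) = 4 * pi * (s + t) * (4 * pi * (s * t / (s + t)))"
    using st by simp
  ultimately show ?thesis
    using assms unfolding hk_def e by (simp add: add_pos_pos)
qed

lemma nn_integral_hk_mult:
  assumes "0 < s" "0 < t"
  shows "(\<integral>\<^sup>+ y. ennreal (hk s (x - y)) * ennreal (hk t y) \<partial>lborel) = ennreal (hk (s + t) x)"
proof -
  have "(\<integral>\<^sup>+ y. ennreal (hk s (x - y)) * ennreal (hk t y) \<partial>lborel)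
    = (\<integral>\<^sup>+ y. ennreal (hk (s + t) x) * ennreal (hk (s * t / (s + t)) (y - (t / (s + t)) *\<^sub>R x)) \<partial>lborel)"
    using hk_mult[OF assms, of x] by (simp add: ennreal_mult'[symmetric])
  also have "\<dots> = ennreal (hk (s + t) x)"
    using assms by (simp add: nn_integral_cmult nn_integral_hk_shift)
  finally show ?thesis .
qed

section \<open>The Green function as Laplace transform of the heat kernel\<close>

lemma nn_integral_exp_substitution:
  fixes f :: "real \<Rightarrow> real"
  assumes [measurable]: "f \<in> borel_measurable borel" and c: "0 < c"
  shows "(\<integral>\<^sup>+ t. ennreal (f t) * indicator {0<..} t \<partial>lborel) = (\<integral>\<^sup>+ s. ennreal (f (c * exp s) * (c * exp s)) \<partial>lborel)"
proof (rule LIMSEQ_unique)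
  \<comment> \<open>Substitution is applied on the compact intervals \<open>[- n, n]\<close>; both
    sides increase to the full integrals.\<close>
  let ?X = "\<lambda>n::nat. \<integral>\<^sup>+ t. ennreal (f t) * indicator {c * exp (- real n) .. c * exp (real n)} t \<partial>lborel"
  let ?Y = "\<lambda>n::nat. \<integral>\<^sup>+ s. ennreal (f (c * exp s) * (c * exp s)) * indicator {- real n .. real n} s \<partial>lborel"
  have XY: "?X n = ?Y n" for n
  proof -
    have "?X n = (\<integral>\<^sup>+ t. ennreal (f t * indicator {c * exp (- real n) .. c * exp (real n)} t) \<partial>lborel)"
      by (intro nn_integral_cong) (auto split: split_indicator)
    also have "\<dots> = (\<integral>\<^sup>+ s. ennreal (f (c * exp s) * (c * exp s) * indicator {- real n .. real n} s) \<partial>lborel)"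
      using c by (intro nn_integral_substitution)
        (auto intro!: derivative_eq_intros continuous_intros simp: set_borel_measurable_def)
    also have "\<dots> = ?Y n"
      by (intro nn_integral_cong) (auto split: split_indicator)
    finally show ?thesis .
  qed
  show "?X \<longlonglongrightarrow> (\<integral>\<^sup>+ t. ennreal (f t) * indicator {0<..} t \<partial>lborel)"
  proof (rule nn_integral_LIMSEQ)
    show "incseq (\<lambda>n t. ennreal (f t) * indicator {c * exp (- real n) .. c * exp (real n)} t)"
    proof (intro incseq_SucI le_funI mult_left_mono)
      fix n t
      have "c * exp (- real (Suc n)) \<le> c * exp (- real n)" "c * exp (real n) \<le> c * exp (real (Suc n))" using c by auto
      then show "indicator {c * exp (- real n) .. c * exp (real n)} t \<le> (indicator {c * exp (- real (Suc n)) .. c * exp (real (Suc n))} t :: ennreal)"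
        by (auto split: split_indicator)
    qed auto
    fix t :: real
    show "(\<lambda>n. ennreal (f t) * indicator {c * exp (- real n) .. c * exp (real n)} t) \<longlonglongrightarrow> ennreal (f t) * indicator {0<..} t"
    proof (cases "0 < t")
      case True
      obtain N :: nat where N: "\<bar>ln (t / c)\<bar> \<le> real N" using real_arch_simple by blast
      show ?thesis
      proof (rule tendsto_eventually, rule eventually_sequentiallyI[of N])
        fix n assume "N \<le> n"
        then have "- real n \<le> ln (t / c)" "ln (t / c) \<le> real n" using N by auto
        then have "exp (- real n) \<le> exp (ln (t / c))" "exp (ln (t / c)) \<le> exp (real n)"
          by auto
        then have "exp (- real n) \<le> t / c" "t / c \<le> exp (real n)"
          using True c by simp_all
        then show "ennreal (f t) * indicator {c * exp (- real n)..c * exp (real n)} t = ennreal (f t) * indicator {0<..} t"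
          using c True by (auto simp: field_simps split: split_indicator)
      qed
    next
      case False
      then have "indicator {c * exp (- real n) .. c * exp (real n)} t = (0 :: ennreal)" for n
      proof -
        have "0 < c * exp (- real n)" using c by simp
        with False have "t < c * exp (- real n)" by linarith
        then show ?thesis by simp
      qed
      then show ?thesis using False by simp
    qed
  qed auto
  have "?Y \<longlonglongrightarrow> (\<integral>\<^sup>+ s. ennreal (f (c * exp s) * (c * exp s)) \<partial>lborel)"
  proof (rule nn_integral_LIMSEQ)
    show "incseq (\<lambda>n s. ennreal (f (c * exp s) * (c * exp s)) * indicator {- real n .. real n} s)"
      by (intro incseq_SucI le_funI mult_left_mono) (auto split: split_indicator)
    fix s :: real
    obtain N :: nat where N: "\<bar>s\<bar> \<le> real N" using real_arch_simple by blast
    show "(\<lambda>n. ennreal (f (c * exp s) * (c * exp s)) * indicator {- real n .. real n} s) \<longlonglongrightarrow> ennreal (f (c * exp s) * (c * exp s))"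
      by (rule tendsto_eventually, rule eventually_sequentiallyI[of N]) (use N in \<open>auto split: split_indicator\<close>)
  qed auto
  then show "?X \<longlonglongrightarrow> (\<integral>\<^sup>+ s. ennreal (f (c * exp s) * (c * exp s)) \<partial>lborel)"
    unfolding XY .
qed

lemma nn_integral_exp_decay:
  assumes l: "0 < (l::real)"
  shows "(\<integral>\<^sup>+ s. ennreal (exp (- l * s)) * indicator {0<..} s \<partial>lborel) = ennreal (1 / l)"
proof -
  have "(\<integral>\<^sup>+ s. ennreal (exp (- l * s)) * indicator {0<..} s \<partial>lborel)
      = (\<integral>\<^sup>+ s. ennreal (1 / l) * ennreal (erlang_density 0 l s * s ^ 0) \<partial>lborel)"
  proof (rule nn_integral_cong_AE, rule AE_mp[OF AE_lborel_singleton[of 0]], rule AE_I2, rule impI)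
    fix s :: real assume "s \<noteq> 0"
    then show "ennreal (exp (- l * s)) * indicator {0<..} s = ennreal (1 / l) * ennreal (erlang_density 0 l s * s ^ 0)"
      using l by (auto simp: erlang_density_def ennreal_mult'[symmetric] split: split_indicator)
  qed
  also have "\<dots> = ennreal (1 / l)"
    using nn_integral_erlang_ith_moment[OF l, of 0 0]
    by (simp add: nn_integral_cmult)
  finally show ?thesis .
qed

text \<open>Since \<open>s \<le> cosh s\<close>, the integrand lies below
  \<open>exp (- r * s)\<close>; the Bochner integral in \<open>K0\<close> is therefore a genuine one
  and not the default value 0.\<close>

lemma K0_nn_integral:
  assumes "0 < r"
  shows "(\<integral>\<^sup>+ s. ennreal (exp (- r * cosh s)) * indicator {0<..} s \<partial>lborel) = ennreal (K0 r)"
proof -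
  have b: "exp (- r * cosh s) \<le> exp (- r * s)" if "0 < s" for s
  proof -
    have "s \<le> cosh s"
    proof -
      have "2 * s \<le> exp s"
      proof -
        have "0 \<le> (s - 1)\<^sup>2" by simp
        then have "2 * s \<le> 1 + s + s\<^sup>2 / 2" by (simp add: power2_eq_square algebra_simps)
        also have "\<dots> \<le> exp s" using exp_lower_Taylor_quadratic[of s] that by simp
        finally show ?thesis .
      qed
      then have "2 * s + 0 \<le> exp s + exp (- s)" by (intro add_mono) auto
      then show ?thesis by (simp add: cosh_field_def)
    qed
    then show ?thesis using assms by simp
  qed
  have "(\<integral>\<^sup>+ s. ennreal (exp (- r * cosh s)) * indicator {0<..} s \<partial>lborel) \<le> (\<integral>\<^sup>+ s. ennreal (exp (- r * s)) * indicator {0<..} s \<partial>lborel)"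
    by (intro nn_integral_mono) (auto split: split_indicator intro!: ennreal_leI simp: b[simplified])
  also have "\<dots> < \<infinity>" using nn_integral_exp_decay[OF assms] by simp
  finally have fin: "(\<integral>\<^sup>+ s. ennreal (exp (- r * cosh s)) * indicator {0<..} s \<partial>lborel) < \<infinity>" .
  have eq: "(\<integral>\<^sup>+ s. ennreal (exp (- r * cosh s)) * indicator {0<..} s \<partial>lborel) = (\<integral>\<^sup>+ s. ennreal (indicator {0<..} s * exp (- r * cosh s)) \<partial>lborel)"
    by (intro nn_integral_cong) (auto split: split_indicator)
  have "integrable lborel (\<lambda>s. indicator {0<..} s * exp (- r * cosh s))"
  proof (rule integrableI_bounded)
    show "(\<integral>\<^sup>+ s. ennreal (norm (indicator {0<..} s * exp (- r * cosh s))) \<partial>lborel) < \<infinity>"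
      using fin unfolding eq by simp
  qed (simp add: cosh_def)
  then show ?thesis
    unfolding eq K0_def set_lebesgue_integral_def
    by (subst nn_integral_eq_integral) auto
qed

lemma Gk_nonneg [simp]: "0 \<le> Gk l x"
  unfolding Gk_def K0_def set_lebesgue_integral_def
  by (intro divide_nonneg_nonneg integral_nonneg_AE) auto

lemma Gk_minus [simp]: "Gk l (- x) = Gk l x"
  by (simp add: Gk_def)

lemma Gk_measurable [measurable (raw)]:
  "g \<in> borel_measurable M \<Longrightarrow> (\<lambda>z. Gk l (g z)) \<in> borel_measurable M"
proof -
  have "K0 \<in> borel_measurable borel"
    unfolding K0_def set_lebesgue_integral_def cosh_def
    by (rule lborel.borel_measurable_lebesgue_integral) simp
  then show "g \<in> borel_measurable M \<Longrightarrow> (\<lambda>z. Gk l (g z)) \<in> borel_measurable M"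
    unfolding Gk_def by simp
qed

text \<open>With \<open>s = c * exp u\<close> the exponents \<open>l * s\<close> and
  \<open>(norm x)^2 / (4 * s)\<close> become mirror images with sum \<open>r * cosh u\<close>, while
  the prefactor \<open>1 / (4 pi s)\<close> cancels the Jacobian. The integrand is even in
  \<open>u\<close>, and its two halves turn \<open>1 / (4 pi)\<close> into the
  \<open>1 / (2 pi)\<close> of \<open>Gk\<close>.\<close>

lemma Gk_laplace:
  assumes l: "0 < l" and x: "x \<noteq> 0"
  shows "(\<integral>\<^sup>+ s. ennreal (exp (- l * s) * hk s x) \<partial>lborel) = ennreal (Gk l x)"
proof -
  define r where "r = sqrt l * norm x"
  have r: "0 < r" using l x by (simp add: r_def)
  \<comment> \<open>The time at which both exponents are equal:
    \<open>l * c = (norm x)^2 / (4 * c) = r / 2\<close>.\<close>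
  define c where "c = norm x / (2 * sqrt l)"
  have c: "0 < c" using l x by (simp add: c_def)
  have "(\<integral>\<^sup>+ s. ennreal (exp (- l * s) * hk s x) \<partial>lborel) = (\<integral>\<^sup>+ s. ennreal (exp (- l * s) * hk s x) * indicator {0<..} s \<partial>lborel)"
    by (intro nn_integral_cong) (auto split: split_indicator)
  also have "\<dots> = (\<integral>\<^sup>+ s. ennreal (exp (- l * (c * exp s)) * hk (c * exp s) x * (c * exp s)) \<partial>lborel)"
    by (rule nn_integral_exp_substitution[OF _ c]) simp
  also have "\<dots> = (\<integral>\<^sup>+ s. ennreal (1 / (4 * pi)) * ennreal (exp (- r * cosh s)) \<partial>lborel)"
  proof (intro nn_integral_cong)
    fix s :: real
    have lc: "l * c = r / 2" using l real_sqrt_mult_self[of l] by (simp add: c_def r_def field_simps)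
    have xc: "(norm x)\<^sup>2 / (4 * c) = r / 2" using l x by (simp add: c_def r_def field_simps power2_eq_square)
    have "- l * (c * exp s) + - (norm x)\<^sup>2 / (4 * (c * exp s)) = - (l * c) * exp s - ((norm x)\<^sup>2 / (4 * c)) * exp (- s)"
      by (simp add: exp_minus field_simps)
    also have "\<dots> = - r * cosh s" unfolding lc xc by (simp add: cosh_def field_simps)
    finally have "exp (- l * (c * exp s)) * exp (- (norm x)\<^sup>2 / (4 * (c * exp s))) = exp (- r * cosh s)"
      unfolding exp_add[symmetric] by (rule arg_cong)
    then have "exp (- l * (c * exp s)) * hk (c * exp s) x * (c * exp s) = 1 / (4 * pi) * exp (- r * cosh s)"
      using c by (simp add: hk_def)
    then show "ennreal (exp (- l * (c * exp s)) * hk (c * exp s) x * (c * exp s)) = ennreal (1 / (4 * pi)) * ennreal (exp (- r * cosh s))"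
      by (simp add: ennreal_mult'[symmetric])
  qed
  also have "\<dots> = ennreal (1 / (4 * pi)) * (\<integral>\<^sup>+ s. ennreal (exp (- r * cosh s)) \<partial>lborel)"
    by (intro nn_integral_cmult) (simp add: cosh_def)
  also have "(\<integral>\<^sup>+ s. ennreal (exp (- r * cosh s)) \<partial>lborel)
     = (\<integral>\<^sup>+ s. ennreal (exp (- r * cosh s)) * indicator {0<..} s + ennreal (exp (- r * cosh (0 - s))) * indicator {0<..} (0 - s) \<partial>lborel)"
    by (rule nn_integral_cong_AE, rule AE_mp[OF AE_lborel_singleton[of 0]], rule AE_I2)
      (auto split: split_indicator)
  also have "\<dots> = (\<integral>\<^sup>+ s. ennreal (exp (- r * cosh s)) * indicator {0<..} s \<partial>lborel) + (\<integral>\<^sup>+ s. ennreal (exp (- r * cosh (0 - s))) * indicator {0<..} (0 - s) \<partial>lborel)"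
    by (intro nn_integral_add) (simp_all add: cosh_def)
  also have "(\<integral>\<^sup>+ s. ennreal (exp (- r * cosh (0 - s))) * indicator {0<..} (0 - s) \<partial>lborel) = (\<integral>\<^sup>+ s. ennreal (exp (- r * cosh s)) * indicator {0<..} s \<partial>lborel)"
    by (rule nn_integral_lborel_reflect[of "\<lambda>s. ennreal (exp (- r * cosh s)) * indicator {0<..} s" 0]) (simp add: cosh_def)
  also have "(\<integral>\<^sup>+ s. ennreal (exp (- r * cosh s)) * indicator {0<..} s \<partial>lborel) = ennreal (K0 r)"
    by (rule K0_nn_integral[OF r])
  finally have eq: "(\<integral>\<^sup>+ s. ennreal (exp (- l * s) * hk s x) \<partial>lborel) = ennreal (1 / (4 * pi)) * (ennreal (K0 r) + ennreal (K0 r))" .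
  have "0 \<le> K0 r"
    unfolding K0_def set_lebesgue_integral_def by (intro integral_nonneg_AE) auto
  then show ?thesis unfolding eq
    by (simp add: Gk_def r_def ennreal_mult'[symmetric] ennreal_plus[symmetric] del: ennreal_plus)
qed

section \<open>Laplace transforms on the half-line\<close>

lemma norm_integral_le_nn_integral:
  fixes f :: "'a \<Rightarrow> 'b::{banach, second_countable_topology}"
  shows "ennreal (norm (integral\<^sup>L M f)) \<le> (\<integral>\<^sup>+ x. ennreal (norm (f x)) \<partial>M)"
  by (cases "integrable M f") (auto simp: not_integrable_integral_eq intro: integral_norm_bound_ennreal)

text \<open>Scaling \<open>t = a * s\<close> in the Gamma integral. Every time weight of the form
  power times exponential is evaluated by it, with \<open>z > 0\<close> as the condition at
  0.\<close>

lemma nn_integral_Gamma: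
  assumes z: "0 < (z::real)" and a: "0 < a"
  shows "(\<integral>\<^sup>+ s. ennreal (s powr (z - 1) * exp (- a * s)) * indicator {0<..} s \<partial>lborel) = ennreal (Gamma z / a powr z)"
proof -
  have "(\<integral>\<^sup>+ t. ennreal (t powr (z - 1) / exp t) * indicator {0..} t \<partial>lborel) = ennreal (Gamma z)"
    by (rule nn_integral_has_integral_lebesgue'[OF _ Gamma_integral_real[OF z]]) auto
  also have "(\<integral>\<^sup>+ t. ennreal (t powr (z - 1) / exp t) * indicator {0..} t \<partial>lborel)
     = (\<integral>\<^sup>+ t. ennreal (t powr (z - 1) * exp (- t)) * indicator {0<..} t \<partial>lborel)"
    by (intro nn_integral_cong) (auto split: split_indicator simp: exp_minus field_simps)
  also have "\<dots> = \<bar>a\<bar> * (\<integral>\<^sup>+ t. ennreal ((0 + a * t) powr (z - 1) * exp (- (0 + a * t))) * indicator {0<..} (0 + a * t) \<partial>lborel)"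
    using a by (intro nn_integral_real_affine) auto
  also have "\<dots> = a * (\<integral>\<^sup>+ t. ennreal (a powr (z - 1)) * (ennreal (t powr (z - 1) * exp (- a * t)) * indicator {0<..} t) \<partial>lborel)"
  proof -
    have "ennreal ((0 + a * t) powr (z - 1) * exp (- (0 + a * t))) * indicator {0<..} (0 + a * t)
       = ennreal (a powr (z - 1)) * (ennreal (t powr (z - 1) * exp (- a * t)) * indicator {0<..} t)" for t
      using a by (cases "0 < t") (simp_all add: powr_mult ennreal_mult'[symmetric] zero_less_mult_iff mult_ac)
    then show ?thesis using a by simp
  qed
  also have "\<dots> = ennreal (a powr z) * (\<integral>\<^sup>+ s. ennreal (s powr (z - 1) * exp (- a * s)) * indicator {0<..} s \<partial>lborel)"
    using a by (subst nn_integral_cmult) (auto simp: mult.assoc[symmetric] ennreal_mult'[symmetric] powr_diff)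
  finally have eq: "ennreal (a powr z) * (\<integral>\<^sup>+ s. ennreal (s powr (z - 1) * exp (- a * s)) * indicator {0<..} s \<partial>lborel) = ennreal (Gamma z)" by simp
  have "(\<integral>\<^sup>+ s. ennreal (s powr (z - 1) * exp (- a * s)) * indicator {0<..} s \<partial>lborel)
     = ennreal (1 / a powr z) * (ennreal (a powr z) * (\<integral>\<^sup>+ s. ennreal (s powr (z - 1) * exp (- a * s)) * indicator {0<..} s \<partial>lborel))"
    using a by (simp add: mult.assoc[symmetric] ennreal_mult'[symmetric])
  then show ?thesis unfolding eq using a z by (simp add: ennreal_mult'[symmetric])
qed

text \<open>Convergence is required at every rate \<open>e > 0\<close>, which excludes exponential
  growth. The orbit of the eigenfunction, growing like \<open>exp (E * s)\<close>, is outside;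
  orbits of data orthogonal to it are inside.\<close>

definition laplace_class :: "(real \<Rightarrow> complex) \<Rightarrow> bool" where
  "laplace_class v \<longleftrightarrow> v \<in> borel_measurable borel \<and> (\<forall>s\<le>0. v s = 0) \<and>
     (\<forall>e>0. (\<integral>\<^sup>+ s. ennreal (exp (- e * s) * norm (v s)) \<partial>lborel) < \<infinity>)"

definition laplace :: "(real \<Rightarrow> complex) \<Rightarrow> real \<Rightarrow> complex" where
  "laplace v l = (\<integral>s. complex_of_real (exp (- l * s)) * v s \<partial>lborel)"

definition hconv :: "(real \<Rightarrow> complex) \<Rightarrow> (real \<Rightarrow> complex) \<Rightarrow> real \<Rightarrow> complex" where
  "hconv v w s = (\<integral>\<tau>. v (s - \<tau>) * w \<tau> \<partial>lborel)"

text \<open>The resolvent \<open>(m - d/ds)^(-1)\<close> of the left translation semigroup: an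
  average over future values. Cutting it off at \<open>s \<le> 0\<close> keeps it in
  \<open>laplace_class\<close>.\<close>

definition shift_resolvent :: "real \<Rightarrow> (real \<Rightarrow> complex) \<Rightarrow> real \<Rightarrow> complex" where
  "shift_resolvent m v s =
     (if 0 < s then \<integral>r. complex_of_real (indicator {0<..} r * exp (- m * r)) * v (s + r) \<partial>lborel else 0)"

lemma laplace_class_measurable: "laplace_class v \<Longrightarrow> v \<in> borel_measurable borel"
  by (simp add: laplace_class_def)

lemma laplace_class_integrable:
  assumes "laplace_class v" "0 < l"
  shows "integrable lborel (\<lambda>s. complex_of_real (exp (- l * s)) * v s)"
  using assms by (intro integrableI_bounded) (auto simp: laplace_class_def norm_mult)

lemma laplace_class_le:
  assumes "laplace_class v" "w \<in> borel_measurable borel" "\<And>s. s \<le> 0 \<Longrightarrow> w s = 0" "\<And>s. norm (w s) \<le> C * norm (v s)" "0 \<le> C"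
  shows "laplace_class w"
  unfolding laplace_class_def
proof (intro conjI allI impI)
  fix e :: real assume e: "0 < e"
  have "(\<integral>\<^sup>+ s. ennreal (exp (- e * s) * norm (w s)) \<partial>lborel) \<le> (\<integral>\<^sup>+ s. ennreal C * ennreal (exp (- e * s) * norm (v s)) \<partial>lborel)"
  proof (rule nn_integral_mono)
    fix s
    have "exp (- e * s) * norm (w s) \<le> exp (- e * s) * (C * norm (v s))" by (intro mult_left_mono assms) auto
    then show "ennreal (exp (- e * s) * norm (w s)) \<le> ennreal C * ennreal (exp (- e * s) * norm (v s))"
      using assms(5) by (simp add: ennreal_mult'[symmetric] mult_ac ennreal_leI)
  qed
  also have "\<dots> = ennreal C * (\<integral>\<^sup>+ s. ennreal (exp (- e * s) * norm (v s)) \<partial>lborel)"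
    using assms(1) by (intro nn_integral_cmult) (auto simp: laplace_class_def)
  also have "\<dots> < \<infinity>" using assms(1) e by (auto simp: laplace_class_def ennreal_mult_less_top)
  finally show "(\<integral>\<^sup>+ s. ennreal (exp (- e * s) * norm (w s)) \<partial>lborel) < \<infinity>" .
qed (use assms in auto)

lemma laplace_class_cmult: "laplace_class v \<Longrightarrow> laplace_class (\<lambda>s. c * v s)"
  by (rule laplace_class_le[where C = "norm c"]) (auto simp: laplace_class_def norm_mult)

lemma laplace_class_add:
  assumes "laplace_class v" "laplace_class w"
  shows "laplace_class (\<lambda>s. v s + w s)"
  unfolding laplace_class_def
proof (intro conjI allI impI)
  fix e :: real assume e: "0 < e"
  have "(\<integral>\<^sup>+ s. ennreal (exp (- e * s) * norm (v s + w s)) \<partial>lborel)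
     \<le> (\<integral>\<^sup>+ s. ennreal (exp (- e * s) * norm (v s)) + ennreal (exp (- e * s) * norm (w s)) \<partial>lborel)"
  proof (rule nn_integral_mono)
    fix s
    have "exp (- e * s) * norm (v s + w s) \<le> exp (- e * s) * (norm (v s) + norm (w s))"
      by (intro mult_left_mono norm_triangle_ineq) auto
    then show "ennreal (exp (- e * s) * norm (v s + w s)) \<le> ennreal (exp (- e * s) * norm (v s)) + ennreal (exp (- e * s) * norm (w s))"
      by (simp add: ennreal_plus[symmetric] distrib_left ennreal_leI del: ennreal_plus)
  qed
  also have "\<dots> = (\<integral>\<^sup>+ s. ennreal (exp (- e * s) * norm (v s)) \<partial>lborel) + (\<integral>\<^sup>+ s. ennreal (exp (- e * s) * norm (w s)) \<partial>lborel)"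
    using assms by (intro nn_integral_add) (auto simp: laplace_class_def)
  also have "\<dots> < \<infinity>" using assms e by (auto simp: laplace_class_def)
  finally show "(\<integral>\<^sup>+ s. ennreal (exp (- e * s) * norm (v s + w s)) \<partial>lborel) < \<infinity>" .
qed (use assms in \<open>auto simp: laplace_class_def\<close>)

lemma laplace_class_diff:
  assumes "laplace_class v" "laplace_class w"
  shows "laplace_class (\<lambda>s. v s - w s)"
  using laplace_class_add[OF assms(1) laplace_class_cmult[OF assms(2), of "-1"]] by simp

lemma laplace_cmult: "laplace (\<lambda>s. c * v s) l = c * laplace v l"
proof -
  have "laplace (\<lambda>s. c * v s) l = (\<integral>s. c * (complex_of_real (exp (- l * s)) * v s) \<partial>lborel)"
    unfolding laplace_def by (intro Bochner_Integration.integral_cong) (auto simp: mult_ac)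
  then show ?thesis by (simp add: laplace_def)
qed

lemma laplace_add:
  assumes "laplace_class v" "laplace_class w" "0 < l"
  shows "laplace (\<lambda>s. v s + w s) l = laplace v l + laplace w l"
  unfolding laplace_def distrib_left
  by (intro Bochner_Integration.integral_add laplace_class_integrable assms)

lemma laplace_diff:
  assumes "laplace_class v" "laplace_class w" "0 < l"
  shows "laplace (\<lambda>s. v s - w s) l = laplace v l - laplace w l"
  unfolding laplace_def right_diff_distrib
  by (intro Bochner_Integration.integral_diff laplace_class_integrable assms)

text \<open>The power bound has the transform \<open>Gamma (1 - b) / e powr (1 - b)\<close>, with
  \<open>b < 1\<close> for integrability at 0. The values of the heat flow at a point enter
  \<open>laplace_class\<close> this way.\<close>

lemma laplace_class_powr_bound:
  assumes "v \<in> borel_measurable borel" "\<And>s. s \<le> 0 \<Longrightarrow> v s = 0"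
    and b: "\<And>s. 0 < s \<Longrightarrow> norm (v s) \<le> A * s powr (- b)" and "b < 1"
  shows "laplace_class v"
  unfolding laplace_class_def
proof (intro conjI allI impI)
  fix e :: real assume e: "0 < e"
  have "0 \<le> A * 1 powr (-b)" using b[of 1] norm_ge_zero[of "v 1"] by linarith
  then have A: "0 \<le> A" by simp
  have "(\<integral>\<^sup>+ s. ennreal (exp (- e * s) * norm (v s)) \<partial>lborel)
     \<le> (\<integral>\<^sup>+ s. ennreal A * (ennreal (s powr ((1 - b) - 1) * exp (- e * s)) * indicator {0<..} s) \<partial>lborel)"
  proof (rule nn_integral_mono)
    fix s :: real
    show "ennreal (exp (- e * s) * norm (v s)) \<le> ennreal A * (ennreal (s powr ((1 - b) - 1) * exp (- e * s)) * indicator {0<..} s)"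
    proof (cases "0 < s")
      case True
      have "exp (- e * s) * norm (v s) \<le> exp (- e * s) * (A * s powr (-b))" by (intro mult_left_mono b True) auto
      then show ?thesis using True A by (simp add: ennreal_mult'[symmetric] mult_ac ennreal_leI)
    qed (use assms(2) in simp)
  qed
  also have "\<dots> = ennreal A * ennreal (Gamma (1 - b) / e powr (1 - b))"
    using assms by (subst nn_integral_cmult, simp, subst nn_integral_Gamma[OF _ e]) auto
  also have "\<dots> < \<infinity>" by (simp add: ennreal_mult_less_top)
  finally show "(\<integral>\<^sup>+ s. ennreal (exp (- e * s) * norm (v s)) \<partial>lborel) < \<infinity>" .
qed (use assms in auto)

lemma hconv_measurable:
  assumes [measurable]: "v \<in> borel_measurable borel" "w \<in> borel_measurable borel"
  shows "hconv v w \<in> borel_measurable borel"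
  unfolding hconv_def by (rule lborel.borel_measurable_lebesgue_integral) simp

text \<open>The weight factors as \<open>exp (- l * (s - \<tau>)) * exp (- l * \<tau>)\<close>, so
  after Tonelli the double integral of the norms is a product. The same computation at every rate
  gives membership.\<close>

lemma
  assumes v: "laplace_class v" and w: "laplace_class w"
  shows laplace_class_hconv: "laplace_class (hconv v w)"
    and laplace_hconv: "0 < l \<Longrightarrow> laplace (hconv v w) l = laplace v l * laplace w l"
proof -
  have [measurable]: "v \<in> borel_measurable borel" "w \<in> borel_measurable borel"
    using v w by (auto simp: laplace_class_measurable)
  define f where "f e s \<tau> = complex_of_real (exp (- e * s)) * (v (s - \<tau>) * w \<tau>)" for e s \<tau> :: real
  have [measurable]: "case_prod (f e) \<in> borel_measurable (lborel \<Otimes>\<^sub>M lborel)" for e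
    unfolding f_def by measurable
  have split: "norm (f e s \<tau>) = (exp (- e * (- \<tau> + s)) * norm (v (- \<tau> + s))) * (exp (- e * \<tau>) * norm (w \<tau>))" for e s \<tau>
    by (simp add: f_def norm_mult exp_add[symmetric] algebra_simps)
  have fin: "(\<integral>\<^sup>+ s. \<integral>\<^sup>+ \<tau>. ennreal (norm (f e s \<tau>)) \<partial>lborel \<partial>lborel) < \<infinity>" if "0 < e" for e
  proof -
    have "(\<integral>\<^sup>+ s. \<integral>\<^sup>+ \<tau>. ennreal (norm (f e s \<tau>)) \<partial>lborel \<partial>lborel)
        = (\<integral>\<^sup>+ \<tau>. \<integral>\<^sup>+ s. ennreal (norm (f e s \<tau>)) \<partial>lborel \<partial>lborel)"
      by (rule lborel_Tonelli) measurable
    also have "\<dots> = (\<integral>\<^sup>+ \<tau>. ennreal (exp (- e * \<tau>) * norm (w \<tau>)) * (\<integral>\<^sup>+ s. ennreal (exp (- e * s) * norm (v s)) \<partial>lborel) \<partial>lborel)"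
    proof (intro nn_integral_cong)
      fix \<tau> :: real
      have "(\<integral>\<^sup>+ s. ennreal (norm (f e s \<tau>)) \<partial>lborel)
          = (\<integral>\<^sup>+ s. ennreal (exp (- e * \<tau>) * norm (w \<tau>)) * ennreal (exp (- e * (- \<tau> + s)) * norm (v (- \<tau> + s))) \<partial>lborel)"
        unfolding split by (intro nn_integral_cong) (simp add: ennreal_mult'[symmetric] mult_ac)
      also have "\<dots> = ennreal (exp (- e * \<tau>) * norm (w \<tau>)) * (\<integral>\<^sup>+ s. ennreal (exp (- e * (- \<tau> + s)) * norm (v (- \<tau> + s))) \<partial>lborel)"
        by (intro nn_integral_cmult) simp
      also have "(\<integral>\<^sup>+ s. ennreal (exp (- e * (- \<tau> + s)) * norm (v (- \<tau> + s))) \<partial>lborel) = (\<integral>\<^sup>+ s. ennreal (exp (- e * s) * norm (v s)) \<partial>lborel)"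
        by (rule nn_integral_lborel_shift[of "\<lambda>s. ennreal (exp (- e * s) * norm (v s))"]) simp
      finally show "(\<integral>\<^sup>+ s. ennreal (norm (f e s \<tau>)) \<partial>lborel) = ennreal (exp (- e * \<tau>) * norm (w \<tau>)) * (\<integral>\<^sup>+ s. ennreal (exp (- e * s) * norm (v s)) \<partial>lborel)" .
    qed
    also have "\<dots> = (\<integral>\<^sup>+ \<tau>. ennreal (exp (- e * \<tau>) * norm (w \<tau>)) \<partial>lborel) * (\<integral>\<^sup>+ s. ennreal (exp (- e * s) * norm (v s)) \<partial>lborel)"
      by (intro nn_integral_multc) simp
    also have "\<dots> < \<infinity>" using v w that by (auto simp: laplace_class_def ennreal_mult_less_top)
    finally show ?thesis .
  qed
  have conv: "complex_of_real (exp (- e * s)) * hconv v w s = (\<integral>\<tau>. f e s \<tau> \<partial>lborel)" for e s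
    by (simp add: hconv_def f_def)
  show "laplace_class (hconv v w)"
    unfolding laplace_class_def
  proof (intro conjI allI impI hconv_measurable)
    fix s :: real assume "s \<le> 0"
    then have "v (s - \<tau>) * w \<tau> = 0" for \<tau>
      using v w by (cases "\<tau> \<le> 0") (auto simp: laplace_class_def)
    then show "hconv v w s = 0" unfolding hconv_def by (simp only: integral_zero)
  next
    fix e :: real assume e: "0 < e"
    have "(\<integral>\<^sup>+ s. ennreal (exp (- e * s) * norm (hconv v w s)) \<partial>lborel) = (\<integral>\<^sup>+ s. ennreal (norm (\<integral>\<tau>. f e s \<tau> \<partial>lborel)) \<partial>lborel)"
      unfolding conv[symmetric] by (simp add: norm_mult)
    also have "\<dots> \<le> (\<integral>\<^sup>+ s. \<integral>\<^sup>+ \<tau>. ennreal (norm (f e s \<tau>)) \<partial>lborel \<partial>lborel)"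
      by (intro nn_integral_mono norm_integral_le_nn_integral)
    also have "\<dots> < \<infinity>" by (rule fin[OF e])
    finally show "(\<integral>\<^sup>+ s. ennreal (exp (- e * s) * norm (hconv v w s)) \<partial>lborel) < \<infinity>" .
  qed auto
  assume l: "0 < l"
  have "laplace (hconv v w) l = (\<integral>s. \<integral>\<tau>. f l s \<tau> \<partial>lborel \<partial>lborel)"
    unfolding laplace_def conv ..
  also have "\<dots> = (\<integral>\<tau>. \<integral>s. f l s \<tau> \<partial>lborel \<partial>lborel)"
    by (rule lborel_Fubini(1)[OF _ fin[OF l]]) simp
  also have "\<dots> = (\<integral>\<tau>. laplace v l * (complex_of_real (exp (- l * \<tau>)) * w \<tau>) \<partial>lborel)"
  proof (intro Bochner_Integration.integral_cong refl)
    fix \<tau> :: real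
    have "(\<integral>s. f l s \<tau> \<partial>lborel) = (\<integral>s. complex_of_real (exp (- l * (- \<tau> + s))) * v (- \<tau> + s) * (complex_of_real (exp (- l * \<tau>)) * w \<tau>) \<partial>lborel)"
      by (intro Bochner_Integration.integral_cong refl)
        (simp add: f_def of_real_mult[symmetric] exp_add[symmetric] algebra_simps del: of_real_mult)
    also have "\<dots> = (\<integral>s. complex_of_real (exp (- l * (- \<tau> + s))) * v (- \<tau> + s) \<partial>lborel) * (complex_of_real (exp (- l * \<tau>)) * w \<tau>)"
      by (rule integral_mult_left_zero)
    also have "(\<integral>s. complex_of_real (exp (- l * (- \<tau> + s))) * v (- \<tau> + s) \<partial>lborel) = laplace v l"
      unfolding laplace_def by (rule integral_lborel_shift[of "\<lambda>s. complex_of_real (exp (- l * s)) * v s"]) simp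
    finally show "(\<integral>s. f l s \<tau> \<partial>lborel) = laplace v l * (complex_of_real (exp (- l * \<tau>)) * w \<tau>)" .
  qed
  also have "\<dots> = laplace v l * laplace w l"
    unfolding laplace_def by (rule integral_mult_right_zero)
  finally show "laplace (hconv v w) l = laplace v l * laplace w l" .
qed

text \<open>The shift is moved from \<open>v\<close> to the weights: averaging forward shifts with
  \<open>G\<close> and pairing with \<open>F\<close> amounts to pairing with the convolution
  \<open>K\<close> of \<open>F\<close> and \<open>G\<close>. It serves for exponentials (transform
  of \<open>shift_resolvent\<close>), for Erlang densities (raising the order) and for the
  convolution of two Green functions.\<close>

lemma
  fixes F G :: "real \<Rightarrow> real" and v :: "real \<Rightarrow> complex"
  assumes [measurable]: "F \<in> borel_measurable borel" "G \<in> borel_measurable borel" "v \<in> borel_measurable borel"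
    and nn: "\<And>s. 0 \<le> F s" "\<And>s. 0 \<le> G s"
    and K: "\<And>x. (\<integral>\<^sup>+ s. ennreal (F s * G (x - s)) \<partial>lborel) = ennreal (K x)" and Kn: "\<And>x. 0 \<le> K x"
    and fin: "(\<integral>\<^sup>+ x. ennreal (K x * norm (v x)) \<partial>lborel) < \<infinity>"
  shows shift_pairing_nn: "(\<integral>\<^sup>+ s. ennreal (F s) * (\<integral>\<^sup>+ r. ennreal (G r * norm (v (s + r))) \<partial>lborel) \<partial>lborel)
      = (\<integral>\<^sup>+ x. ennreal (K x * norm (v x)) \<partial>lborel)"
    and shift_pairing: "(\<integral>s. complex_of_real (F s) * (\<integral>r. complex_of_real (G r) * v (s + r) \<partial>lborel) \<partial>lborel)
      = (\<integral>x. complex_of_real (K x) * v x \<partial>lborel)"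
proof -
  define f where "f s x = complex_of_real (F s * G (x - s)) * v x" for s x :: real
  have [measurable]: "case_prod f \<in> borel_measurable (lborel \<Otimes>\<^sub>M lborel)" unfolding f_def by measurable
  have eq1: "ennreal (F s) * (\<integral>\<^sup>+ r. ennreal (G r * norm (v (s + r))) \<partial>lborel) = (\<integral>\<^sup>+ x. ennreal (norm (f s x)) \<partial>lborel)" for s
  proof -
    have "(\<integral>\<^sup>+ x. ennreal (norm (f s x)) \<partial>lborel) = (\<integral>\<^sup>+ x. ennreal (norm (f s (s + x))) \<partial>lborel)"
      by (rule nn_integral_lborel_shift[symmetric]) (simp add: f_def)
    also have "\<dots> = (\<integral>\<^sup>+ r. ennreal (F s) * ennreal (G r * norm (v (s + r))) \<partial>lborel)"
      using nn by (intro nn_integral_cong) (simp add: f_def norm_mult ennreal_mult'[symmetric] mult_ac)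
    also have "\<dots> = ennreal (F s) * (\<integral>\<^sup>+ r. ennreal (G r * norm (v (s + r))) \<partial>lborel)"
      by (intro nn_integral_cmult) simp
    finally show ?thesis by simp
  qed
  have eq2: "(\<integral>\<^sup>+ s. ennreal (norm (f s x)) \<partial>lborel) = ennreal (K x * norm (v x))" for x
  proof -
    have "(\<integral>\<^sup>+ s. ennreal (norm (f s x)) \<partial>lborel) = (\<integral>\<^sup>+ s. ennreal (F s * G (x - s)) * ennreal (norm (v x)) \<partial>lborel)"
      using nn by (intro nn_integral_cong) (simp add: f_def norm_mult ennreal_mult'[symmetric] mult_ac)
    also have "\<dots> = ennreal (K x) * ennreal (norm (v x))" by (subst nn_integral_multc) (simp_all add: K)
    finally show ?thesis using Kn by (simp add: ennreal_mult'[symmetric])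
  qed
  have "(\<integral>\<^sup>+ s. \<integral>\<^sup>+ x. ennreal (norm (f s x)) \<partial>lborel \<partial>lborel) = (\<integral>\<^sup>+ x. \<integral>\<^sup>+ s. ennreal (norm (f s x)) \<partial>lborel \<partial>lborel)"
    by (rule lborel_Tonelli) measurable
  then have nneq: "(\<integral>\<^sup>+ s. \<integral>\<^sup>+ x. ennreal (norm (f s x)) \<partial>lborel \<partial>lborel) = (\<integral>\<^sup>+ x. ennreal (K x * norm (v x)) \<partial>lborel)"
    unfolding eq2 .
  then show "(\<integral>\<^sup>+ s. ennreal (F s) * (\<integral>\<^sup>+ r. ennreal (G r * norm (v (s + r))) \<partial>lborel) \<partial>lborel) = (\<integral>\<^sup>+ x. ennreal (K x * norm (v x)) \<partial>lborel)"
    unfolding eq1 .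
  have "(\<integral>s. complex_of_real (F s) * (\<integral>r. complex_of_real (G r) * v (s + r) \<partial>lborel) \<partial>lborel) = (\<integral>s. \<integral>x. f s x \<partial>lborel \<partial>lborel)"
  proof (intro Bochner_Integration.integral_cong refl)
    fix s :: real
    have "(\<integral>x. f s x \<partial>lborel) = (\<integral>x. f s (s + x) \<partial>lborel)"
      by (rule integral_lborel_shift[symmetric]) (simp add: f_def)
    also have "\<dots> = (\<integral>r. complex_of_real (F s) * (complex_of_real (G r) * v (s + r)) \<partial>lborel)"
      by (intro Bochner_Integration.integral_cong) (simp_all add: f_def)
    finally show "complex_of_real (F s) * (\<integral>r. complex_of_real (G r) * v (s + r) \<partial>lborel) = (\<integral>x. f s x \<partial>lborel)"
      by simp
  qed
  also have "\<dots> = (\<integral>x. \<integral>s. f s x \<partial>lborel \<partial>lborel)"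
    using fin nneq by (intro lborel_Fubini(1)) auto
  also have "\<dots> = (\<integral>x. complex_of_real (K x) * v x \<partial>lborel)"
  proof (intro Bochner_Integration.integral_cong refl)
    fix x :: real
    have "integrable lborel (\<lambda>s. F s * G (x - s))"
      using nn K[of x] by (intro integrableI_nonneg) auto
    then have "(\<integral>s. F s * G (x - s) \<partial>lborel) = K x"
      using nn K[of x] Kn by (subst integral_eq_nn_integral) auto
    then show "(\<integral>s. f s x \<partial>lborel) = complex_of_real (K x) * v x"
      unfolding f_def by (subst integral_mult_left_zero) (simp add: integral_complex_of_real[symmetric] del: of_real_mult)
  qed
  finally show "(\<integral>s. complex_of_real (F s) * (\<integral>r. complex_of_real (G r) * v (s + r) \<partial>lborel) \<partial>lborel) = (\<integral>x. complex_of_real (K x) * v x \<partial>lborel)" .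
qed

text \<open>For \<open>l \<noteq> m\<close> the convolution of \<open>exp (- l * x)\<close> and
  \<open>exp (- m * x)\<close> on the half-line, as a divided difference; it is nonnegative for
  either order of \<open>l\<close> and \<open>m\<close>.\<close>

definition exp_diff_kernel :: "real \<Rightarrow> real \<Rightarrow> real \<Rightarrow> real" where
  "exp_diff_kernel l m x = (if 0 < x then (exp (- l * x) - exp (- m * x)) / (m - l) else 0)"

lemma exp_diff_kernel_measurable [measurable]: "exp_diff_kernel l m \<in> borel_measurable borel"
  unfolding exp_diff_kernel_def by measurable

lemma exp_diff_kernel_nonneg: "0 \<le> exp_diff_kernel l m x"
  by (cases "l \<le> m") (auto simp: exp_diff_kernel_def zero_le_divide_iff mult_right_mono)

lemma nn_integral_exp_conv:
  assumes "l \<noteq> m"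
  shows "(\<integral>\<^sup>+ s. ennreal ((indicator {0<..} s * exp (- l * s)) * (indicator {0<..} (x - s) * exp (- m * (x - s)))) \<partial>lborel)
     = ennreal (exp_diff_kernel l m x)"
proof (cases "0 < x")
  case True
  have "(\<integral>\<^sup>+ s. ennreal ((indicator {0<..} s * exp (- l * s)) * (indicator {0<..} (x - s) * exp (- m * (x - s)))) \<partial>lborel)
      = (\<integral>\<^sup>+ s. ennreal (exp (- m * x) * exp ((m - l) * s)) * indicator {0..x} s \<partial>lborel)"
    by (rule nn_integral_cong_AE, rule AE_mp[OF AE_lborel_singleton[of 0]], rule AE_mp[OF AE_lborel_singleton[of x]], rule AE_I2)
      (auto split: split_indicator simp: exp_add[symmetric] algebra_simps)
  also have "\<dots> = ennreal (exp (- m * x) * exp ((m - l) * x) / (m - l) - exp (- m * x) * exp ((m - l) * 0) / (m - l))"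
    using True assms by (intro nn_integral_FTC_Icc) (auto intro!: derivative_eq_intros)
  also have "exp (- m * x) * exp ((m - l) * x) / (m - l) - exp (- m * x) * exp ((m - l) * 0) / (m - l) = exp_diff_kernel l m x"
    using True by (simp add: exp_diff_kernel_def exp_add[symmetric] diff_divide_distrib[symmetric] algebra_simps)
  finally show ?thesis .
next
  case False
  then have "indicator {0<..} s * indicator {0<..} (x - s) = (0::real)" for s
    by (auto split: split_indicator)
  then have "(indicator {0<..} s * exp (- l * s)) * (indicator {0<..} (x - s) * exp (- m * (x - s))) = 0" for s
    by (metis mult.assoc mult.left_commute mult_zero_left)
  then show ?thesis using False unfolding exp_diff_kernel_def by (simp only: if_False ennreal_0 nn_integral_const mult_zero_left)
qed

text \<open>The difference of two decaying exponentials is at most the slower one. This puts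
  pairings with the kernel within reach of \<open>laplace_class\<close>.\<close>

lemma exp_diff_kernel_le:
  assumes "l \<noteq> m"
  shows "exp_diff_kernel l m x \<le> exp (- min l m * x) / \<bar>m - l\<bar>"
proof (cases "0 < x")
  case True
  then have "\<bar>exp (- l * x) - exp (- m * x)\<bar> \<le> exp (- min l m * x)"
    by (auto simp: min_def abs_if)
  then have "\<bar>exp (- l * x) - exp (- m * x)\<bar> / \<bar>m - l\<bar> \<le> exp (- min l m * x) / \<bar>m - l\<bar>"
    by (intro divide_right_mono) auto
  moreover have "exp_diff_kernel l m x \<le> \<bar>exp (- l * x) - exp (- m * x)\<bar> / \<bar>m - l\<bar>"
    using True by (simp add: exp_diff_kernel_def abs_divide[symmetric] del: abs_divide)
  ultimately show ?thesis by linarith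
qed (simp add: exp_diff_kernel_def)

lemma laplace_class_exp_diff_kernel:
  assumes v: "laplace_class v" and lm: "0 < l" "0 < m" "l \<noteq> m"
  shows "(\<integral>\<^sup>+ x. ennreal (exp_diff_kernel l m x * norm (v x)) \<partial>lborel) < \<infinity>"
proof -
  have [measurable]: "v \<in> borel_measurable borel" by (rule laplace_class_measurable[OF v])
  have "(\<integral>\<^sup>+ x. ennreal (exp_diff_kernel l m x * norm (v x)) \<partial>lborel)
     \<le> (\<integral>\<^sup>+ x. ennreal (1 / \<bar>m - l\<bar>) * ennreal (exp (- min l m * x) * norm (v x)) \<partial>lborel)"
  proof (rule nn_integral_mono)
    fix x
    have "exp_diff_kernel l m x * norm (v x) \<le> exp (- min l m * x) / \<bar>m - l\<bar> * norm (v x)"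
      by (intro mult_right_mono exp_diff_kernel_le lm) auto
    then show "ennreal (exp_diff_kernel l m x * norm (v x)) \<le> ennreal (1 / \<bar>m - l\<bar>) * ennreal (exp (- min l m * x) * norm (v x))"
      by (simp add: ennreal_mult'[symmetric] ennreal_leI)
  qed
  also have "\<dots> = ennreal (1 / \<bar>m - l\<bar>) * (\<integral>\<^sup>+ x. ennreal (exp (- min l m * x) * norm (v x)) \<partial>lborel)"
    by (intro nn_integral_cmult) simp
  also have "\<dots> < \<infinity>" using v lm by (auto simp: laplace_class_def ennreal_mult_less_top)
  finally show ?thesis .
qed

lemma shift_resolvent_measurable:
  assumes [measurable]: "v \<in> borel_measurable borel"
  shows "shift_resolvent m v \<in> borel_measurable borel"
proof -
  have [measurable]: "(\<lambda>s. \<integral>r. complex_of_real (indicator {0<..} r * exp (- m * r)) * v (s + r) \<partial>lborel) \<in> borel_measurable borel"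
    by (rule lborel.borel_measurable_lebesgue_integral) simp
  show ?thesis unfolding shift_resolvent_def by measurable
qed

text \<open>Pairing with \<open>exp (- l * s)\<close> turns the transform into an integral of
  \<open>v\<close> against \<open>exp_diff_kernel l m\<close>, hence into a divided difference of
  transforms. This is the first resolvent identity for translations, evaluated at time 0.\<close>

lemma
  assumes v: "laplace_class v" and m: "0 < m"
  shows laplace_class_shift_resolvent: "laplace_class (shift_resolvent m v)"
    and laplace_shift_resolvent: "0 < l \<Longrightarrow> l \<noteq> m \<Longrightarrow> laplace (shift_resolvent m v) l = (laplace v l - laplace v m) / complex_of_real (m - l)"
proof -
  have [measurable]: "v \<in> borel_measurable borel" by (rule laplace_class_measurable[OF v])
  define F where "F l s = indicator {0<..} s * exp (- l * s)" for l s :: real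
  have [measurable]: "F l \<in> borel_measurable borel" for l unfolding F_def by measurable
  have Fn: "0 \<le> F l s" for l s by (simp add: F_def)
  have FK: "(\<integral>\<^sup>+ s. ennreal (F l s * F m (x - s)) \<partial>lborel) = ennreal (exp_diff_kernel l m x)" if "l \<noteq> m" for l x
    unfolding F_def using nn_integral_exp_conv[OF that] by simp
  have S: "complex_of_real (exp (- l * s)) * shift_resolvent m v s = complex_of_real (F l s) * (\<integral>r. complex_of_real (F m r) * v (s + r) \<partial>lborel)" for l s
    by (simp add: shift_resolvent_def F_def)
  show "laplace_class (shift_resolvent m v)"
    unfolding laplace_class_def
  proof (intro conjI allI impI shift_resolvent_measurable)
    fix e :: real assume e: "0 < e"
    \<comment> \<open>The kernel needs a rate different from \<open>m\<close>. Half the minimum is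
      also below \<open>e\<close>, so passing from \<open>e\<close> to \<open>l\<close> only
      enlarges the integrand.\<close>
    define l where "l = min e m / 2"
    have l: "0 < l" "l < e" "l \<noteq> m" using e m by (auto simp: l_def min_def)
    have "(\<integral>\<^sup>+ s. ennreal (exp (- e * s) * norm (shift_resolvent m v s)) \<partial>lborel)
       \<le> (\<integral>\<^sup>+ s. ennreal (F l s) * (\<integral>\<^sup>+ r. ennreal (F m r * norm (v (s + r))) \<partial>lborel) \<partial>lborel)"
    proof (rule nn_integral_mono)
      fix s :: real
      have "ennreal (exp (- e * s) * norm (shift_resolvent m v s)) \<le> ennreal (exp (- l * s) * norm (shift_resolvent m v s))"
        using l by (cases "0 < s") (auto simp: shift_resolvent_def intro!: ennreal_leI mult_right_mono)
      also have "\<dots> = ennreal (norm (complex_of_real (F l s) * (\<integral>r. complex_of_real (F m r) * v (s + r) \<partial>lborel)))"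
        unfolding S[symmetric] by (simp add: norm_mult)
      also have "\<dots> = ennreal (F l s) * ennreal (norm (\<integral>r. complex_of_real (F m r) * v (s + r) \<partial>lborel))"
        using Fn by (simp add: norm_mult ennreal_mult')
      also have "\<dots> \<le> ennreal (F l s) * (\<integral>\<^sup>+ r. ennreal (norm (complex_of_real (F m r) * v (s + r))) \<partial>lborel)"
        by (intro mult_left_mono norm_integral_le_nn_integral) simp
      finally show "ennreal (exp (- e * s) * norm (shift_resolvent m v s)) \<le> ennreal (F l s) * (\<integral>\<^sup>+ r. ennreal (F m r * norm (v (s + r))) \<partial>lborel)"
        using Fn by (simp add: norm_mult)
    qed
    also have "\<dots> = (\<integral>\<^sup>+ x. ennreal (exp_diff_kernel l m x * norm (v x)) \<partial>lborel)"
      by (rule shift_pairing_nn) (use Fn FK l m v exp_diff_kernel_nonneg laplace_class_exp_diff_kernel in auto)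
    also have "\<dots> < \<infinity>" using laplace_class_exp_diff_kernel[OF v l(1) m l(3)] .
    finally show "(\<integral>\<^sup>+ s. ennreal (exp (- e * s) * norm (shift_resolvent m v s)) \<partial>lborel) < \<infinity>" .
  qed (auto simp: shift_resolvent_def)
  assume l: "0 < l" "l \<noteq> m"
  have "laplace (shift_resolvent m v) l = (\<integral>x. complex_of_real (exp_diff_kernel l m x) * v x \<partial>lborel)"
    unfolding laplace_def S
    by (rule shift_pairing) (use Fn FK l m v exp_diff_kernel_nonneg laplace_class_exp_diff_kernel in auto)
  also have "\<dots> = (\<integral>x. (complex_of_real (exp (- l * x)) * v x - complex_of_real (exp (- m * x)) * v x) / complex_of_real (m - l) \<partial>lborel)"
    using v by (intro Bochner_Integration.integral_cong refl)
      (auto simp: exp_diff_kernel_def laplace_class_def left_diff_distrib diff_divide_distrib)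
  also have "\<dots> = (laplace v l - laplace v m) / complex_of_real (m - l)"
    unfolding laplace_def using laplace_class_integrable[OF v l(1)] laplace_class_integrable[OF v m]
    by (simp add: integral_diff)
  finally show "laplace (shift_resolvent m v) l = (laplace v l - laplace v m) / complex_of_real (m - l)" .
qed

section \<open>Erlang averages and powers of the translation resolvent\<close>

lemma erlang_density_le:
  assumes m: "0 < m"
  shows "erlang_density k m s \<le> m ^ Suc k * (2 / m) ^ k * exp (- (m / 2) * s)"
proof (cases "s < 0")
  case False
  \<comment> \<open>Half of the exponential rate is spent on the power, through
    \<open>y ^ k / fact k \<le> exp y\<close>.\<close>
  define y where "y = m * s / 2"
  have y: "0 \<le> y" using False m by (simp add: y_def)
  have "y ^ k / fact k \<le> exp y"
  proof -
    have "y ^ k / fact k = (\<Sum>n\<in>{k}. y ^ n / fact n)" by simp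
    also have "\<dots> \<le> (\<Sum>n. y ^ n / fact n)"
      using y summable_exp[of y] by (intro sum_le_suminf) (auto simp: field_simps)
    also have "\<dots> = exp y" by (simp add: exp_def field_simps)
    finally show ?thesis .
  qed
  then have "(2 / m) ^ k * (y ^ k / fact k) * exp (- m * s) \<le> (2 / m) ^ k * exp y * exp (- m * s)"
    using m by (intro mult_right_mono mult_left_mono) auto
  moreover have "(2 / m) ^ k * y ^ k = s ^ k" using m by (simp add: y_def power_mult_distrib[symmetric])
  moreover have "exp y * exp (- m * s) = exp (- (m / 2) * s)" by (simp add: exp_add[symmetric] y_def)
  ultimately have "s ^ k / fact k * exp (- m * s) \<le> (2 / m) ^ k * exp (- (m / 2) * s)"
    by (metis mult.assoc times_divide_eq_right)
  then have "m ^ Suc k * (s ^ k / fact k * exp (- m * s)) \<le> m ^ Suc k * ((2 / m) ^ k * exp (- (m / 2) * s))"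
    using m by (intro mult_left_mono) auto
  then show ?thesis using False by (simp add: erlang_density_def mult_ac)
qed (use m in \<open>auto simp: erlang_density_def\<close>)

lemma erlang_nn_integral_finite:
  assumes v: "laplace_class v" and m: "0 < m"
  shows "(\<integral>\<^sup>+ s. ennreal (erlang_density k m s * norm (v s)) \<partial>lborel) < \<infinity>"
proof -
  define C where "C = m ^ Suc k * (2 / m) ^ k"
  have C: "0 \<le> C" using m by (simp add: C_def)
  have [measurable]: "v \<in> borel_measurable borel" by (rule laplace_class_measurable[OF v])
  have "(\<integral>\<^sup>+ s. ennreal (erlang_density k m s * norm (v s)) \<partial>lborel) \<le> (\<integral>\<^sup>+ s. ennreal C * ennreal (exp (- (m / 2) * s) * norm (v s)) \<partial>lborel)"
  proof (rule nn_integral_mono)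
    fix s
    have "erlang_density k m s * norm (v s) \<le> C * exp (- (m / 2) * s) * norm (v s)"
      unfolding C_def by (intro mult_right_mono erlang_density_le m) auto
    then show "ennreal (erlang_density k m s * norm (v s)) \<le> ennreal C * ennreal (exp (- (m / 2) * s) * norm (v s))"
      using C by (simp add: ennreal_mult'[symmetric] ennreal_leI mult.assoc)
  qed
  also have "\<dots> = ennreal C * (\<integral>\<^sup>+ s. ennreal (exp (- (m / 2) * s) * norm (v s)) \<partial>lborel)"
    by (intro nn_integral_cmult) simp
  also have "\<dots> < \<infinity>"
  proof -
    have "(\<integral>\<^sup>+ s. ennreal (exp (- (m / 2) * s) * norm (v s)) \<partial>lborel) < \<infinity>"
      using v m unfolding laplace_class_def by (metis half_gt_zero)
    then show ?thesis by (auto simp: ennreal_mult_less_top)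
  qed
  finally show ?thesis .
qed

text \<open>The Erlang density of order \<open>k + 1\<close> is the convolution of the one of order
  \<open>k\<close> with the exponential density \<open>m * exp (- m * r)\<close>. Each factor
  \<open>m * shift_resolvent m\<close> thus raises the order by one, which is the mechanism of the
  Post--Widder formula.\<close>

lemma erlang_shift_resolvent:
  assumes v: "laplace_class v" and m: "0 < m"
  shows "complex_of_real m * (\<integral>s. complex_of_real (erlang_density k m s) * shift_resolvent m v s \<partial>lborel)
     = (\<integral>s. complex_of_real (erlang_density (Suc k) m s) * v s \<partial>lborel)"
proof -
  have [measurable]: "v \<in> borel_measurable borel" by (rule laplace_class_measurable[OF v])
  define G where "G r = indicator {0<..} r * exp (- m * r)" for r :: real
  have [measurable]: "G \<in> borel_measurable borel" unfolding G_def by measurable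
  have en: "0 \<le> erlang_density k m s" for k s using m by (simp add: erlang_density_def)
  define F where "F s = indicator {0<..} s * erlang_density k m s" for s
  have [measurable]: "F \<in> borel_measurable borel" unfolding F_def by measurable
  have K: "(\<integral>\<^sup>+ s. ennreal (F s * G (x - s)) \<partial>lborel) = ennreal (erlang_density (Suc k) m x / m)" for x
  proof (cases "0 < x")
    case True
    have "(\<integral>\<^sup>+ s. ennreal (F s * G (x - s)) \<partial>lborel) = (\<integral>\<^sup>+ s. ennreal (m ^ Suc k * exp (- m * x) / fact k * s ^ k) * indicator {0..x} s \<partial>lborel)"
      by (rule nn_integral_cong_AE, rule AE_mp[OF AE_lborel_singleton[of 0]], rule AE_mp[OF AE_lborel_singleton[of x]], rule AE_I2)
        (auto split: split_indicator simp: F_def G_def erlang_density_def exp_add[symmetric] algebra_simps)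
    also have "\<dots> = ennreal (m ^ Suc k * exp (- m * x) / fact k * (x ^ Suc k / real (Suc k)) - m ^ Suc k * exp (- m * x) / fact k * (0 ^ Suc k / real (Suc k)))"
      using True m by (intro nn_integral_FTC_Icc)
        (auto intro!: derivative_eq_intros simp: field_simps simp del: of_nat_Suc power_Suc)
    also have "m ^ Suc k * exp (- m * x) / fact k * (x ^ Suc k / real (Suc k)) - m ^ Suc k * exp (- m * x) / fact k * (0 ^ Suc k / real (Suc k)) = erlang_density (Suc k) m x / m"
    proof -
      have "erlang_density (Suc k) m x / m = (m * m ^ Suc k * x ^ Suc k * exp (- m * x) / (real (Suc k) * fact k)) / m"
        using True by (simp add: erlang_density_def)
      also have "\<dots> = m ^ Suc k * x ^ Suc k * exp (- m * x) / (real (Suc k) * fact k)" using m by simp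
      finally show ?thesis by (simp add: mult_ac)
    qed
    finally show ?thesis .
  next
    case False
    then have "F s * G (x - s) = 0" for s by (auto simp: F_def G_def split: split_indicator)
    then have "(\<integral>\<^sup>+ s. ennreal (F s * G (x - s)) \<partial>lborel) = 0"
      by (simp only: ennreal_0 nn_integral_const mult_zero_left)
    then show ?thesis using False by (auto simp: erlang_density_def)
  qed
  have fin: "(\<integral>\<^sup>+ x. ennreal (erlang_density (Suc k) m x / m * norm (v x)) \<partial>lborel) < \<infinity>"
  proof -
    have "(\<integral>\<^sup>+ x. ennreal (erlang_density (Suc k) m x / m * norm (v x)) \<partial>lborel) = (\<integral>\<^sup>+ x. ennreal (1 / m) * ennreal (erlang_density (Suc k) m x * norm (v x)) \<partial>lborel)"
      using m en by (simp add: ennreal_mult'[symmetric])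
    also have "\<dots> = ennreal (1 / m) * (\<integral>\<^sup>+ x. ennreal (erlang_density (Suc k) m x * norm (v x)) \<partial>lborel)"
      by (intro nn_integral_cmult) simp
    also have "\<dots> < \<infinity>" using erlang_nn_integral_finite[OF v m] by (auto simp: ennreal_mult_less_top)
    finally show ?thesis .
  qed
  have "(\<integral>s. complex_of_real (erlang_density k m s) * shift_resolvent m v s \<partial>lborel)
     = (\<integral>s. complex_of_real (F s) * (\<integral>r. complex_of_real (G r) * v (s + r) \<partial>lborel) \<partial>lborel)"
    by (intro Bochner_Integration.integral_cong refl) (simp add: shift_resolvent_def F_def G_def)
  also have "\<dots> = (\<integral>x. complex_of_real (erlang_density (Suc k) m x / m) * v x \<partial>lborel)"
    by (rule shift_pairing[OF _ _ _ _ _ K _ fin]) (use en m in \<open>auto simp: F_def G_def\<close>)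
  also have "\<dots> = (\<integral>x. complex_of_real (erlang_density (Suc k) m x) * v x \<partial>lborel) / complex_of_real m"
    unfolding integral_divide_zero[symmetric] by (intro Bochner_Integration.integral_cong) auto
  finally show ?thesis using m by simp
qed

section \<open>Vanishing Laplace transforms\<close>

lemma laplace_class_mult_id:
  assumes v: "laplace_class v"
  shows "laplace_class (\<lambda>s. complex_of_real s * v s)"
  unfolding laplace_class_def
proof (intro conjI allI impI)
  have [measurable]: "v \<in> borel_measurable borel" by (rule laplace_class_measurable[OF v])
  show "(\<lambda>s. complex_of_real s * v s) \<in> borel_measurable borel" by simp
  fix e :: real assume e: "0 < e"
  have "(\<integral>\<^sup>+ s. ennreal (exp (- e * s) * norm (complex_of_real s * v s)) \<partial>lborel)
     \<le> (\<integral>\<^sup>+ s. ennreal (2 / e) * ennreal (exp (- (e / 2) * s) * norm (v s)) \<partial>lborel)"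
  proof (rule nn_integral_mono)
    fix s :: real
    show "ennreal (exp (- e * s) * norm (complex_of_real s * v s)) \<le> ennreal (2 / e) * ennreal (exp (- (e / 2) * s) * norm (v s))"
    proof (cases "0 < s")
      case True
      \<comment> \<open>The factor \<open>s\<close> is paid for with half of the rate
        \<open>e\<close>.\<close>
      have "(e / 2) * s \<le> exp ((e / 2) * s)" using exp_ge_add_one_self[of "(e / 2) * s"] by linarith
      then have "s \<le> 2 / e * exp ((e / 2) * s)" using e by (simp add: field_simps)
      then have "exp (- e * s) * s \<le> exp (- e * s) * (2 / e * exp ((e / 2) * s))" by (intro mult_left_mono) auto
      also have "\<dots> = 2 / e * (exp (- e * s) * exp ((e / 2) * s))" by simp
      also have "exp (- e * s) * exp ((e / 2) * s) = exp (- (e / 2) * s)" by (simp add: exp_add[symmetric])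
      finally have "exp (- e * s) * s * norm (v s) \<le> 2 / e * exp (- (e / 2) * s) * norm (v s)"
        by (intro mult_right_mono) auto
      then show ?thesis using True e by (simp add: norm_mult ennreal_mult'[symmetric] ennreal_leI mult.assoc)
    qed (use v in \<open>auto simp: laplace_class_def\<close>)
  qed
  also have "\<dots> = ennreal (2 / e) * (\<integral>\<^sup>+ s. ennreal (exp (- (e / 2) * s) * norm (v s)) \<partial>lborel)"
    by (intro nn_integral_cmult) simp
  also have "\<dots> < \<infinity>"
  proof -
    have "(\<integral>\<^sup>+ s. ennreal (exp (- (e / 2) * s) * norm (v s)) \<partial>lborel) < \<infinity>"
      using v e unfolding laplace_class_def by (metis half_gt_zero)
    then show ?thesis by (auto simp: ennreal_mult_less_top)
  qed
  finally show "(\<integral>\<^sup>+ s. ennreal (exp (- e * s) * norm (complex_of_real s * v s)) \<partial>lborel) < \<infinity>" .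
qed (use v in \<open>auto simp: laplace_class_def\<close>)

text \<open>For right limits the integrand at \<open>l\<close> itself dominates. They carry an
  identity across the finitely many values of \<open>l\<close> at which a formula for the transform
  breaks down.\<close>

lemma laplace_tendsto_right:
  assumes v: "laplace_class v" and l: "0 < l"
  shows "(\<lambda>i. laplace v (l + inverse (real (Suc i)))) \<longlonglongrightarrow> laplace v l"
  unfolding laplace_def
proof (rule integral_dominated_convergence)
  have [measurable]: "v \<in> borel_measurable borel" by (rule laplace_class_measurable[OF v])
  show "integrable lborel (\<lambda>s. exp (- l * s) * norm (v s))"
    using integrable_norm[OF laplace_class_integrable[OF v l]] by (simp add: norm_mult)
  show "AE s in lborel. (\<lambda>i. complex_of_real (exp (- (l + inverse (real (Suc i))) * s)) * v s) \<longlonglongrightarrow> complex_of_real (exp (- l * s)) * v s"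
  proof (rule AE_I2)
    fix s :: real
    have "(\<lambda>i. complex_of_real (exp (- (l + inverse (real (Suc i))) * s)) * v s) \<longlonglongrightarrow> complex_of_real (exp (- (l + 0) * s)) * v s"
      by (intro tendsto_intros LIMSEQ_inverse_real_of_nat)
    then show "(\<lambda>i. complex_of_real (exp (- (l + inverse (real (Suc i))) * s)) * v s) \<longlonglongrightarrow> complex_of_real (exp (- l * s)) * v s" by simp
  qed
  show "AE s in lborel. norm (complex_of_real (exp (- (l + inverse (real (Suc i))) * s)) * v s) \<le> exp (- l * s) * norm (v s)" for i
  proof (rule AE_I2)
    fix s :: real
    show "norm (complex_of_real (exp (- (l + inverse (real (Suc i))) * s)) * v s) \<le> exp (- l * s) * norm (v s)"
    proof (cases "0 < s")
      case True
      have "- (l + inverse (real (Suc i))) * s \<le> - l * s" using True by (intro mult_right_mono) auto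
      then have "exp (- (l + inverse (real (Suc i))) * s) \<le> exp (- l * s)" by (simp only: exp_le_cancel_iff)
      then show ?thesis unfolding norm_mult norm_of_real by (intro mult_right_mono) auto
    qed (use v in \<open>auto simp: laplace_class_def\<close>)
  qed
qed (use laplace_class_measurable[OF v] in simp_all)

text \<open>The transform of \<open>s * v s\<close> is minus the derivative of the transform of
  \<open>v\<close>, taken here as a limit of right difference quotients, each of which is 0. The
  inequality \<open>1 - h * s \<le> exp (- h * s)\<close> bounds the quotients in the integrand by
  \<open>s\<close>.\<close>

lemma laplace_mult_id_eq_0:
  assumes v: "laplace_class v" and z: "\<And>l. 0 < l \<Longrightarrow> laplace v l = 0" and l: "0 < l"
  shows "laplace (\<lambda>s. complex_of_real s * v s) l = 0"
proof -
  have [measurable]: "v \<in> borel_measurable borel" by (rule laplace_class_measurable[OF v])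
  define q where "q i s = complex_of_real ((exp (- inverse (real (Suc i)) * s) - 1) / inverse (real (Suc i))) * (complex_of_real (exp (- l * s)) * v s)" for i s
  have "(\<lambda>i. \<integral>s. q i s \<partial>lborel) \<longlonglongrightarrow> (\<integral>s. - (complex_of_real (exp (- l * s)) * (complex_of_real s * v s)) \<partial>lborel)"
  proof (rule integral_dominated_convergence)
    show "integrable lborel (\<lambda>s. exp (- l * s) * norm (complex_of_real s * v s))"
      using integrable_norm[OF laplace_class_integrable[OF laplace_class_mult_id[OF v] l]] by (simp add: norm_mult)
    show "AE s in lborel. (\<lambda>i. q i s) \<longlonglongrightarrow> - (complex_of_real (exp (- l * s)) * (complex_of_real s * v s))"
    proof (rule AE_I2)
      fix s :: real
      have "((\<lambda>h. exp (- h * s)) has_field_derivative - s) (at 0)"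
        by (auto intro!: derivative_eq_intros)
      then have "((\<lambda>h. (exp (- h * s) - 1) / h) \<longlongrightarrow> - s) (at 0)"
        by (simp add: has_field_derivative_iff)
      moreover have "filterlim (\<lambda>i. inverse (real (Suc i))) (at 0) sequentially"
        using LIMSEQ_inverse_real_of_nat by (auto simp: filterlim_at)
      ultimately have "(\<lambda>i. (exp (- inverse (real (Suc i)) * s) - 1) / inverse (real (Suc i))) \<longlonglongrightarrow> - s"
        by (rule filterlim_compose)
      then have "(\<lambda>i. q i s) \<longlonglongrightarrow> complex_of_real (- s) * (complex_of_real (exp (- l * s)) * v s)"
        unfolding q_def by (intro tendsto_intros)
      then show "(\<lambda>i. q i s) \<longlonglongrightarrow> - (complex_of_real (exp (- l * s)) * (complex_of_real s * v s))" by (simp add: mult_ac)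
    qed
    show "AE s in lborel. norm (q i s) \<le> exp (- l * s) * norm (complex_of_real s * v s)" for i
    proof (rule AE_I2)
      fix s :: real
      show "norm (q i s) \<le> exp (- l * s) * norm (complex_of_real s * v s)"
      proof (cases "0 < s")
        case True
        define h where "h = inverse (real (Suc i))"
        have h: "0 < h" by (simp add: h_def)
        have "1 - h * s \<le> exp (- h * s)" using exp_ge_add_one_self[of "- h * s"] by simp
        moreover have "exp (- h * s) \<le> 1" using h True by simp
        ultimately have "\<bar>(exp (- h * s) - 1) / h\<bar> \<le> s" using h by (simp add: abs_divide divide_le_eq mult.commute)
        then have "\<bar>(exp (- h * s) - 1) / h\<bar> * (exp (- l * s) * norm (v s)) \<le> s * (exp (- l * s) * norm (v s))"
          by (intro mult_right_mono) auto
        moreover have "norm (q i s) = \<bar>(exp (- h * s) - 1) / h\<bar> * (exp (- l * s) * norm (v s))"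
          unfolding q_def h_def norm_mult norm_of_real by simp
        ultimately show ?thesis using True by (simp add: norm_mult mult_ac)
      qed (use v in \<open>auto simp: q_def laplace_class_def\<close>)
    qed
  qed (simp_all add: q_def)
  moreover have "(\<integral>s. q i s \<partial>lborel) = 0" for i
  proof -
    define h where "h = inverse (real (Suc i))"
    have h: "0 < h" by (simp add: h_def)
    have "(\<integral>s. q i s \<partial>lborel) = (\<integral>s. (complex_of_real (exp (- (l + h) * s)) * v s - complex_of_real (exp (- l * s)) * v s) / complex_of_real h \<partial>lborel)"
    proof (intro Bochner_Integration.integral_cong refl)
      fix s
      have "exp (- (l + h) * s) = exp (- h * s) * exp (- l * s)" by (simp add: exp_add[symmetric] algebra_simps)
      then show "q i s = (complex_of_real (exp (- (l + h) * s)) * v s - complex_of_real (exp (- l * s)) * v s) / complex_of_real h"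
        unfolding q_def h_def[symmetric] by (simp add: field_simps)
    qed
    also have "\<dots> = (laplace v (l + h) - laplace v l) / complex_of_real h"
      unfolding laplace_def using laplace_class_integrable[OF v l] laplace_class_integrable[OF v, of "l + h"] l h
      by (simp add: integral_diff)
    also have "\<dots> = 0" using z l h by simp
    finally show ?thesis .
  qed
  ultimately have "(\<integral>s. - (complex_of_real (exp (- l * s)) * (complex_of_real s * v s)) \<partial>lborel) = 0"
    by (simp add: LIMSEQ_const_iff)
  then show ?thesis by (simp add: laplace_def)
qed

text \<open>Stands in for the uniqueness theorem of the Laplace transform: vanishing extends over
  the finite set by right continuity, and differentiating \<open>k\<close> times gives the pairings
  with \<open>s ^ k * exp (- l * s)\<close>. Erlang densities are of exactly this form on the
  half-line.\<close>

lemma laplace_vanishing_moments: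
  assumes v: "laplace_class v" and X: "finite X" and z: "\<And>l. 0 < l \<Longrightarrow> l \<notin> X \<Longrightarrow> laplace v l = 0" and l: "0 < l"
  shows "(\<integral>s. complex_of_real (s ^ k * exp (- l * s)) * v s \<partial>lborel) = 0"
proof -
  \<comment> \<open>Every \<open>l > 0\<close> is a right limit of points off the finite
    set.\<close>
  have z0: "laplace v l = 0" if "0 < l" for l
  proof -
    have "eventually (\<lambda>i. \<forall>x\<in>X. l + inverse (real (Suc i)) \<noteq> x) sequentially"
    proof (intro eventually_ball_finite X ballI)
      fix x assume "x \<in> X"
      show "eventually (\<lambda>i. l + inverse (real (Suc i)) \<noteq> x) sequentially"
      proof (cases "x = l")
        case False
        have "(\<lambda>i. l + inverse (real (Suc i))) \<longlonglongrightarrow> l + 0" by (intro tendsto_intros LIMSEQ_inverse_real_of_nat)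
        then show ?thesis using False by (intro tendsto_imp_eventually_ne) auto
      qed simp
    qed
    then have "eventually (\<lambda>i. laplace v (l + inverse (real (Suc i))) = 0) sequentially"
    proof (rule eventually_mono)
      fix i assume "\<forall>x\<in>X. l + inverse (real (Suc i)) \<noteq> x"
      then show "laplace v (l + inverse (real (Suc i))) = 0" using that by (intro z) (auto intro: add_pos_pos)
    qed
    then have "(\<lambda>i. laplace v (l + inverse (real (Suc i)))) \<longlonglongrightarrow> 0" by (rule tendsto_eventually)
    with laplace_tendsto_right[OF v that] show ?thesis by (rule LIMSEQ_unique)
  qed
  have "laplace_class (\<lambda>s. complex_of_real (s ^ k) * v s) \<and> (\<forall>l>0. laplace (\<lambda>s. complex_of_real (s ^ k) * v s) l = 0)"
  proof (induction k)
    case 0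
    then show ?case using v z0 by simp
  next
    case (Suc k)
    have eq: "(\<lambda>s. complex_of_real (s ^ Suc k) * v s) = (\<lambda>s. complex_of_real s * (complex_of_real (s ^ k) * v s))" by auto
    show ?case unfolding eq using Suc laplace_class_mult_id laplace_mult_id_eq_0 by blast
  qed
  then have "laplace (\<lambda>s. complex_of_real (s ^ k) * v s) l = 0" using l by blast
  then show ?thesis unfolding laplace_def by (simp add: mult_ac)
qed

section \<open>The Stieltjes representation of the inverse logarithm\<close>

lemma Gamma_reflection_real:
  fixes s :: real
  shows "Gamma s * Gamma (1 - s) = pi / sin (pi * s)"
proof -
  have "complex_of_real (Gamma s * Gamma (1 - s)) = complex_of_real (pi / sin (pi * s))"
    using Gamma_reflection_complex[of "complex_of_real s"]
    by (simp add: Gamma_complex_of_real[symmetric] sin_of_real[symmetric])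
  then show ?thesis by (simp only: of_real_eq_iff)
qed

text \<open>Writing \<open>1 / (l + r)\<close> as the integral of \<open>exp (- (l + r) * v)\<close>
  and swapping produces \<open>Gamma (1 - s) * Gamma s\<close>, hence the sine by
  reflection.\<close>

lemma nn_integral_powr_div_add:
  assumes l: "0 < l" and s: "0 < s" "s < (1::real)"
  shows "(\<integral>\<^sup>+ r. ennreal (r powr (- s) / (l + r)) * indicator {0<..} r \<partial>lborel) = ennreal (pi / sin (pi * s) * l powr (- s))"
proof -
  have "(\<integral>\<^sup>+ r. ennreal (r powr (- s) / (l + r)) * indicator {0<..} r \<partial>lborel)
     = (\<integral>\<^sup>+ r. \<integral>\<^sup>+ v. ennreal (r powr (- s) * exp (- (l + r) * v)) * indicator {0<..} v * indicator {0<..} r \<partial>lborel \<partial>lborel)"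
  proof (intro nn_integral_cong)
    fix r :: real
    show "ennreal (r powr (- s) / (l + r)) * indicator {0<..} r = (\<integral>\<^sup>+ v. ennreal (r powr (- s) * exp (- (l + r) * v)) * indicator {0<..} v * indicator {0<..} r \<partial>lborel)"
    proof (cases "0 < r")
      case True
      have "(\<integral>\<^sup>+ v. ennreal (r powr (- s) * exp (- (l + r) * v)) * indicator {0<..} v * indicator {0<..} r \<partial>lborel)
         = (\<integral>\<^sup>+ v. ennreal (r powr (- s)) * (ennreal (exp (- (l + r) * v)) * indicator {0<..} v) \<partial>lborel)"
        using True by (intro nn_integral_cong) (simp add: ennreal_mult' mult.assoc)
      also have "\<dots> = ennreal (r powr (- s)) * ennreal (1 / (l + r))"
        using l True by (subst nn_integral_cmult, simp, subst nn_integral_exp_decay) auto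
      finally show ?thesis using True l by (simp add: ennreal_mult'[symmetric])
    qed simp
  qed
  also have "\<dots> = (\<integral>\<^sup>+ v. \<integral>\<^sup>+ r. ennreal (r powr (- s) * exp (- (l + r) * v)) * indicator {0<..} v * indicator {0<..} r \<partial>lborel \<partial>lborel)"
    by (rule lborel_Tonelli) simp
  also have "\<dots> = (\<integral>\<^sup>+ v. ennreal (Gamma (1 - s)) * (ennreal (v powr (s - 1) * exp (- l * v)) * indicator {0<..} v) \<partial>lborel)"
  proof (intro nn_integral_cong)
    fix v :: real
    show "(\<integral>\<^sup>+ r. ennreal (r powr (- s) * exp (- (l + r) * v)) * indicator {0<..} v * indicator {0<..} r \<partial>lborel)
       = ennreal (Gamma (1 - s)) * (ennreal (v powr (s - 1) * exp (- l * v)) * indicator {0<..} v)"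
    proof (cases "0 < v")
      case True
      have "(\<integral>\<^sup>+ r. ennreal (r powr (- s) * exp (- (l + r) * v)) * indicator {0<..} v * indicator {0<..} r \<partial>lborel)
         = (\<integral>\<^sup>+ r. ennreal (exp (- l * v)) * (ennreal (r powr ((1 - s) - 1) * exp (- v * r)) * indicator {0<..} r) \<partial>lborel)"
      proof (intro nn_integral_cong)
        fix r :: real
        have "r powr (- s) * exp (- (l + r) * v) = exp (- l * v) * (r powr ((1 - s) - 1) * exp (- v * r))"
          by (simp add: exp_add[symmetric] exp_diff[symmetric] algebra_simps exp_minus_inverse)
        then show "ennreal (r powr (- s) * exp (- (l + r) * v)) * indicator {0<..} v * indicator {0<..} r = ennreal (exp (- l * v)) * (ennreal (r powr ((1 - s) - 1) * exp (- v * r)) * indicator {0<..} r)"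
          using True by (simp only: ennreal_mult' exp_ge_zero mult.assoc) simp
      qed
      also have "\<dots> = ennreal (exp (- l * v)) * ennreal (Gamma (1 - s) / v powr (1 - s))"
        using True s by (subst nn_integral_cmult, simp, subst nn_integral_Gamma) auto
      also have "\<dots> = ennreal (Gamma (1 - s)) * (ennreal (v powr (s - 1) * exp (- l * v)) * indicator {0<..} v)"
      proof -
        have "v powr (s - 1) = 1 / v powr (1 - s)" using True powr_minus_divide[of v "1 - s"] by simp
        then show ?thesis using True s by (simp add: ennreal_mult'[symmetric] mult_ac)
      qed
      finally show ?thesis .
    qed simp
  qed
  also have "\<dots> = ennreal (Gamma (1 - s)) * ennreal (Gamma s / l powr s)"
    using l s by (subst nn_integral_cmult, simp, subst nn_integral_Gamma) auto
  also have "\<dots> = ennreal (pi / sin (pi * s) * l powr (- s))"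
    unfolding Gamma_reflection_real[symmetric] using s l
    by (simp add: ennreal_mult'[symmetric] powr_minus_divide mult_ac)
  finally show ?thesis .
qed

text \<open>The place where the logarithm enters a denominator: averaging a power over its exponent
  divides by \<open>ln l\<close>.\<close>

lemma nn_integral_powr_exponent:
  assumes l: "0 < l" "l \<noteq> (1::real)"
  shows "(\<integral>\<^sup>+ s. ennreal (l powr (- s)) * indicator {0<..<1} s \<partial>lborel) = ennreal ((l - 1) / (l * ln l))"
proof -
  have ln: "ln l \<noteq> 0" using l by simp
  have "(\<integral>\<^sup>+ s. ennreal (l powr (- s)) * indicator {0<..<1} s \<partial>lborel) = (\<integral>\<^sup>+ s. ennreal (exp (- ln l * s)) * indicator {0..1} s \<partial>lborel)"
    by (rule nn_integral_cong_AE, rule AE_mp[OF AE_lborel_singleton[of 0]], rule AE_mp[OF AE_lborel_singleton[of 1]], rule AE_I2)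
      (use l in \<open>auto split: split_indicator simp: powr_def mult_ac\<close>)
  also have "\<dots> = ennreal (- exp (- ln l * 1) / ln l - (- exp (- ln l * 0) / ln l))"
    using ln by (intro nn_integral_FTC_Icc) (auto intro!: derivative_eq_intros)
  also have "- exp (- ln l * 1) / ln l - (- exp (- ln l * 0) / ln l) = (l - 1) / (l * ln l)"
    using l ln by (simp add: exp_minus field_simps)
  finally show ?thesis .
qed

lemma nn_integral_sin_powr:
  assumes r: "0 < r"
  shows "(\<integral>\<^sup>+ s. ennreal (sin (pi * s) / pi * r powr (- s)) * indicator {0<..<1} s \<partial>lborel)
     = ennreal ((1 + 1 / r) / (pi\<^sup>2 + (ln r)\<^sup>2))"
proof -
  define L where "L = ln r"
  define Q where "Q = L\<^sup>2 + pi\<^sup>2"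
  have Q: "0 < Q" by (simp add: Q_def add_nonneg_pos)
  have "(\<integral>\<^sup>+ s. ennreal (sin (pi * s) / pi * r powr (- s)) * indicator {0<..<1} s \<partial>lborel)
     = (\<integral>\<^sup>+ s. ennreal (sin (pi * s) / pi * exp (- L * s)) * indicator {0..1} s \<partial>lborel)"
    by (rule nn_integral_cong_AE, rule AE_mp[OF AE_lborel_singleton[of 0]], rule AE_mp[OF AE_lborel_singleton[of 1]], rule AE_I2)
      (use r in \<open>auto split: split_indicator simp: powr_def L_def mult_ac\<close>)
  also have "\<dots> = ennreal (- (exp (- L * 1) * (L * sin (pi * 1) + pi * cos (pi * 1))) / (Q * pi) - (- (exp (- L * 0) * (L * sin (pi * 0) + pi * cos (pi * 0))) / (Q * pi)))"
  \<comment> \<open>An explicit primitive of the damped sine. At \<open>s = 1\<close> the sign of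
    \<open>cos pi\<close> makes the two boundary terms add, which yields
    \<open>1 + 1 / r\<close>.\<close>
  proof (rule nn_integral_FTC_Icc[where F = "\<lambda>s. - (exp (- L * s) * (L * sin (pi * s) + pi * cos (pi * s))) / (Q * pi)"])
    fix s :: real
    have "((\<lambda>s. - (exp (- L * s) * (L * sin (pi * s) + pi * cos (pi * s))) / (Q * pi)) has_field_derivative
       - (- L * exp (- L * s) * (L * sin (pi * s) + pi * cos (pi * s)) + exp (- L * s) * (L * pi * cos (pi * s) - pi * pi * sin (pi * s))) / (Q * pi)) (at s)"
      by (rule DERIV_cdivide) (auto intro!: derivative_eq_intros simp: algebra_simps)
    moreover have "- (- L * exp (- L * s) * (L * sin (pi * s) + pi * cos (pi * s)) + exp (- L * s) * (L * pi * cos (pi * s) - pi * pi * sin (pi * s))) / (Q * pi)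
       = sin (pi * s) / pi * exp (- L * s)"
    proof -
      have "- (- L * exp (- L * s) * (L * sin (pi * s) + pi * cos (pi * s)) + exp (- L * s) * (L * pi * cos (pi * s) - pi * pi * sin (pi * s))) = Q * (exp (- L * s) * sin (pi * s))"
        by (simp add: Q_def algebra_simps power2_eq_square)
      then show ?thesis using Q by simp
    qed
    ultimately show "((\<lambda>s. - (exp (- L * s) * (L * sin (pi * s) + pi * cos (pi * s))) / (Q * pi)) has_field_derivative sin (pi * s) / pi * exp (- L * s)) (at s)"
      by simp
  next
    fix s :: real assume "s \<in> {0..1}"
    then show "0 \<le> sin (pi * s) / pi * exp (- L * s)"
      by (intro mult_nonneg_nonneg divide_nonneg_nonneg sin_ge_zero) auto
  qed auto
  also have "- (exp (- L * 1) * (L * sin (pi * 1) + pi * cos (pi * 1))) / (Q * pi) - (- (exp (- L * 0) * (L * sin (pi * 0) + pi * cos (pi * 0))) / (Q * pi)) = (exp (- L) + 1) / Q"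
    using Q by (simp add: field_simps)
  also have "\<dots> = (1 + 1 / r) / (pi\<^sup>2 + (ln r)\<^sup>2)"
    using r by (simp add: L_def Q_def exp_minus field_simps)
  finally show ?thesis .
qed

text \<open>The Stieltjes formula for \<open>l powr (- s)\<close>, multiplied by
  \<open>sin (pi * s) / pi\<close> and averaged over \<open>0 < s < 1\<close>:
  \<open>nn_integral_sin_powr\<close> gives the density on the left,
  \<open>nn_integral_powr_exponent\<close> the value on the right.\<close>

lemma nn_integral_log_density:
  assumes l: "0 < l" "l \<noteq> (1::real)"
  shows "(\<integral>\<^sup>+ r. ennreal ((1 + 1 / r) / ((pi\<^sup>2 + (ln r)\<^sup>2) * (l + r))) * indicator {0<..} r \<partial>lborel) = ennreal ((l - 1) / (l * ln l))"
proof -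
  have "(\<integral>\<^sup>+ r. ennreal ((1 + 1 / r) / ((pi\<^sup>2 + (ln r)\<^sup>2) * (l + r))) * indicator {0<..} r \<partial>lborel)
     = (\<integral>\<^sup>+ r. \<integral>\<^sup>+ s. ennreal (sin (pi * s) / pi * r powr (- s) / (l + r)) * indicator {0<..<1} s * indicator {0<..} r \<partial>lborel \<partial>lborel)"
  proof (intro nn_integral_cong)
    fix r :: real
    show "ennreal ((1 + 1 / r) / ((pi\<^sup>2 + (ln r)\<^sup>2) * (l + r))) * indicator {0<..} r
       = (\<integral>\<^sup>+ s. ennreal (sin (pi * s) / pi * r powr (- s) / (l + r)) * indicator {0<..<1} s * indicator {0<..} r \<partial>lborel)"
    proof (cases "0 < r")
      case True
      have "(\<integral>\<^sup>+ s. ennreal (sin (pi * s) / pi * r powr (- s) / (l + r)) * indicator {0<..<1} s * indicator {0<..} r \<partial>lborel)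
         = (\<integral>\<^sup>+ s. ennreal (1 / (l + r)) * (ennreal (sin (pi * s) / pi * r powr (- s)) * indicator {0<..<1} s) \<partial>lborel)"
      proof (intro nn_integral_cong)
        fix s :: real
        show "ennreal (sin (pi * s) / pi * r powr (- s) / (l + r)) * indicator {0<..<1} s * indicator {0<..} r
          = ennreal (1 / (l + r)) * (ennreal (sin (pi * s) / pi * r powr (- s)) * indicator {0<..<1} s)"
          using True l by (cases "s \<in> {0<..<1}") (simp_all add: ennreal_mult'[symmetric] mult.commute)
      qed
      also have "\<dots> = ennreal (1 / (l + r)) * ennreal ((1 + 1 / r) / (pi\<^sup>2 + (ln r)\<^sup>2))"
        using True by (subst nn_integral_cmult, simp, subst nn_integral_sin_powr) auto
      finally show ?thesis using True l by (simp add: ennreal_mult'[symmetric] mult_ac)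
    qed simp
  qed
  also have "\<dots> = (\<integral>\<^sup>+ s. \<integral>\<^sup>+ r. ennreal (sin (pi * s) / pi * r powr (- s) / (l + r)) * indicator {0<..<1} s * indicator {0<..} r \<partial>lborel \<partial>lborel)"
    by (rule lborel_Tonelli) simp
  also have "\<dots> = (\<integral>\<^sup>+ s. ennreal (l powr (- s)) * indicator {0<..<1} s \<partial>lborel)"
  proof (intro nn_integral_cong)
    fix s :: real
    show "(\<integral>\<^sup>+ r. ennreal (sin (pi * s) / pi * r powr (- s) / (l + r)) * indicator {0<..<1} s * indicator {0<..} r \<partial>lborel) = ennreal (l powr (- s)) * indicator {0<..<1} s"
    proof (cases "s \<in> {0<..<1}")
      case True
      have sp: "0 < sin (pi * s)" using True by (intro sin_gt_zero) auto
      have "(\<integral>\<^sup>+ r. ennreal (sin (pi * s) / pi * r powr (- s) / (l + r)) * indicator {0<..<1} s * indicator {0<..} r \<partial>lborel)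
         = (\<integral>\<^sup>+ r. ennreal (sin (pi * s) / pi) * (ennreal (r powr (- s) / (l + r)) * indicator {0<..} r) \<partial>lborel)"
        using True sp l by (intro nn_integral_cong) (auto simp: ennreal_mult'[symmetric] mult.assoc split: split_indicator)
      also have "\<dots> = ennreal (sin (pi * s) / pi) * ennreal (pi / sin (pi * s) * l powr (- s))"
        using True l by (subst nn_integral_cmult, simp, subst nn_integral_powr_div_add) auto
      also have "\<dots> = ennreal (l powr (- s))" using sp by (simp add: ennreal_mult'[symmetric])
      finally show ?thesis using True by simp
    qed simp
  qed
  also have "\<dots> = ennreal ((l - 1) / (l * ln l))" by (rule nn_integral_powr_exponent[OF l])
  finally show ?thesis .
qed

text \<open>In the variable \<open>ln r\<close> this is the Cauchy density of scale
  \<open>pi\<close>, with primitive \<open>arctan (ln r / pi) / pi\<close>.\<close>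

lemma nn_integral_Cauchy_log:
  "(\<integral>\<^sup>+ r. ennreal (1 / (r * (pi\<^sup>2 + (ln r)\<^sup>2))) * indicator {0<..} r \<partial>lborel) = 1"
proof -
  define F where "F = (\<lambda>r. arctan (ln r / pi) / pi)"
  define f where "f = (\<lambda>r. 1 / (r * (pi\<^sup>2 + (ln r)\<^sup>2)))"
  have pos: "0 < pi\<^sup>2 + (ln r)\<^sup>2" for r :: real by (simp add: add_pos_nonneg)
  have D: "DERIV F r :> f r" if "0 < r" for r
  proof -
    have "DERIV F r :> inverse (1 + (ln r / pi)\<^sup>2) * (1 / r / pi) / pi"
      unfolding F_def using that by (auto intro!: derivative_eq_intros)
    moreover have "inverse (1 + (ln r / pi)\<^sup>2) * (1 / r / pi) / pi = f r"
    proof -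
      have "1 + (ln r / pi)\<^sup>2 = (pi\<^sup>2 + (ln r)\<^sup>2) / pi\<^sup>2" by (simp add: power_divide add_divide_distrib)
      then show ?thesis using that pos[of r] unfolding f_def by (simp add: power2_eq_square)
    qed
    ultimately show ?thesis by simp
  qed
  have fc: "isCont f r" if "0 < r" for r
    unfolding f_def using that pos[of r] by (intro continuous_intros) auto
  have e0: "einterval (ereal 0) \<infinity> = {0<..}" by (auto simp: einterval_def)
  have l0: "((F \<circ> real_of_ereal) \<longlongrightarrow> - (1 / 2)) (at_right (ereal 0))"
  proof -
    have "(F \<longlongrightarrow> - (pi / 2) / pi) (at_right 0)"
      unfolding F_def
    proof (intro tendsto_intros)
      have "filterlim (\<lambda>r. ln r / pi) at_bot (at_right 0)"
        using filterlim_tendsto_pos_mult_at_bot[OF tendsto_const[of "1/pi"] _ ln_at_0] by simp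
      then show "((\<lambda>r. arctan (ln r / pi)) \<longlongrightarrow> - (pi / 2)) (at_right 0)"
        using filterlim_compose[OF tendsto_arctan_at_bot] by blast
    qed simp
    then show ?thesis by (simp add: ereal_tendsto_simps)
  qed
  have l1: "((F \<circ> real_of_ereal) \<longlongrightarrow> 1 / 2) (at_left \<infinity>)"
  proof -
    have "(F \<longlongrightarrow> (pi / 2) / pi) at_top"
      unfolding F_def
    proof (intro tendsto_intros)
      have "filterlim (\<lambda>r. ln r / pi) at_top at_top"
        using filterlim_tendsto_pos_mult_at_top[OF tendsto_const[of "1/pi"] _ ln_at_top] by simp
      then show "((\<lambda>r. arctan (ln r / pi)) \<longlongrightarrow> pi / 2) at_top"
        using filterlim_compose[OF tendsto_arctan_at_top] by blast
    qed simp
    then show ?thesis by (simp add: ereal_tendsto_simps)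
  qed
  have i: "set_integrable lborel (einterval (ereal 0) \<infinity>) f" and v: "(LBINT x=ereal 0..\<infinity>. f x) = 1 / 2 - - (1 / 2)"
    by (rule interval_integral_FTC_nonneg[OF _ D fc _ l0 l1]; use pos in \<open>auto simp: f_def intro!: AE_I2 mult_nonneg_nonneg less_imp_le[OF pos]\<close>)+
  have "(\<integral>\<^sup>+ r. ennreal (f r) * indicator {0<..} r \<partial>lborel) = (\<integral>\<^sup>+ r. ennreal (indicator {0<..} r * f r) \<partial>lborel)"
    by (intro nn_integral_cong) (auto split: split_indicator)
  also have "\<dots> = ennreal (\<integral>r. indicator {0<..} r * f r \<partial>lborel)"
    using i unfolding e0 set_integrable_def
    by (intro nn_integral_eq_integral) (auto split: split_indicator simp: f_def intro!: mult_nonneg_nonneg less_imp_le[OF pos])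
  also have "(\<integral>r. indicator {0<..} r * f r \<partial>lborel) = 1"
    using v by (simp add: interval_lebesgue_integral_def e0 set_lebesgue_integral_def)
  finally show ?thesis by (simp add: f_def)
qed

text \<open>The subtracted term \<open>1 / (l - 1)\<close> is the pole of \<open>1 / ln l\<close> at
  1, and what remains is a Stieltjes transform with positive density. The weight
  \<open>1 + 1 / r\<close> in \<open>nn_integral_log_density\<close> is removed by subtracting the
  Cauchy integral, whose value is 1.\<close>

lemma log_Stieltjes:
  assumes l: "0 < l" "l \<noteq> (1::real)"
  shows "(\<integral>\<^sup>+ r. ennreal (1 / ((l + r) * (pi\<^sup>2 + (ln r)\<^sup>2))) * indicator {0<..} r \<partial>lborel) = ennreal (1 / ln l - 1 / (l - 1))"
    "0 \<le> 1 / ln l - 1 / (l - 1)"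
proof -
  define R where "R r = pi\<^sup>2 + (ln r)\<^sup>2" for r :: real
  have R: "0 < R r" for r by (simp add: add_pos_nonneg R_def)
  define a where "a r = indicator {0<..} r * ((1 + 1 / r) / (R r * (l + r)))" for r
  define b where "b r = indicator {0<..} r * (1 / (r * R r))" for r
  define c where "c r = indicator {0<..} r * (1 / ((l + r) * R r))" for r
  have [measurable]: "R \<in> borel_measurable borel" unfolding R_def by measurable
  have [measurable]: "a \<in> borel_measurable borel" "b \<in> borel_measurable borel" "c \<in> borel_measurable borel"
    unfolding a_def b_def c_def by measurable
  have nn: "0 \<le> a r" "0 \<le> b r" "0 \<le> c r" for r
    using l R[of r] by (auto simp: a_def b_def c_def split: split_indicator)
  have "0 \<le> (l - 1) / (l * ln l)"
    using l by (cases "1 < l") (auto simp: zero_le_divide_iff mult_le_0_iff zero_le_mult_iff)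
  moreover have A: "(\<integral>\<^sup>+ r. ennreal (a r) \<partial>lborel) = ennreal ((l - 1) / (l * ln l))"
    unfolding nn_integral_log_density[OF l, symmetric]
    by (intro nn_integral_cong) (auto simp: a_def R_def split: split_indicator)
  ultimately have a: "integrable lborel a" "integral\<^sup>L lborel a = (l - 1) / (l * ln l)"
    using nn by (auto intro!: integrableI_nonneg simp: integral_eq_nn_integral)
  have B: "(\<integral>\<^sup>+ r. ennreal (b r) \<partial>lborel) = 1"
    unfolding nn_integral_Cauchy_log[symmetric]
    by (intro nn_integral_cong) (auto simp: b_def R_def split: split_indicator)
  then have b: "integrable lborel b" "integral\<^sup>L lborel b = 1"
    using nn by (auto intro!: integrableI_nonneg simp: integral_eq_nn_integral)
  \<comment> \<open>Partial fractions:
    \<open>l * (1 + 1 / r) / (l + r) - 1 / r = (l - 1) / (l + r)\<close>.\<close>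
  have c: "c r = (l * a r - b r) / (l - 1)" for r
  proof (cases "0 < r")
    case True
    have "l * (1 + 1 / r) / (R r * (l + r)) - 1 / (r * R r) = (l - 1) / ((l + r) * R r)"
    proof -
      have "l + r \<noteq> 0" "r \<noteq> 0" "R r \<noteq> 0" using l True R[of r] by auto
      then show ?thesis by (simp add: divide_simps) (simp add: algebra_simps)
    qed
    then show ?thesis using True l unfolding a_def b_def c_def by simp
  qed (simp add: a_def b_def c_def)
  have ci: "integrable lborel c" unfolding c using a b by simp
  have "integral\<^sup>L lborel c = (l * ((l - 1) / (l * ln l)) - 1) / (l - 1)"
    unfolding c using a b by simp
  also have "l * ((l - 1) / (l * ln l)) = (l - 1) * (1 / ln l)" using l by simp
  also have "((l - 1) * (1 / ln l) - 1) / (l - 1) = 1 / ln l - 1 / (l - 1)"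
    unfolding diff_divide_distrib using l by simp
  finally have cv: "integral\<^sup>L lborel c = 1 / ln l - 1 / (l - 1)" .
  show "(\<integral>\<^sup>+ r. ennreal (1 / ((l + r) * (pi\<^sup>2 + (ln r)\<^sup>2))) * indicator {0<..} r \<partial>lborel) = ennreal (1 / ln l - 1 / (l - 1))"
  proof -
    have "(\<integral>\<^sup>+ r. ennreal (1 / ((l + r) * (pi\<^sup>2 + (ln r)\<^sup>2))) * indicator {0<..} r \<partial>lborel) = (\<integral>\<^sup>+ r. ennreal (c r) \<partial>lborel)"
      by (intro nn_integral_cong) (auto simp: c_def R_def split: split_indicator)
    also have "\<dots> = ennreal (integral\<^sup>L lborel c)" using nn by (intro nn_integral_eq_integral ci) auto
    finally show ?thesis unfolding cv .
  qed
  show "0 \<le> 1 / ln l - 1 / (l - 1)" unfolding cv[symmetric] using nn by (intro integral_nonneg_AE) auto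
qed

section \<open>The memory kernel and convolutions of Green functions\<close>

text \<open>The majorant is asked for only between \<open>t / 2\<close> and \<open>2 * t\<close>:
  the kernels to which this is applied are singular at time 0, and this is the window of
  \<open>hk_le_dilated\<close>.\<close>

lemma isCont_integral_dominated:
  fixes f :: "real \<Rightarrow> 'a \<Rightarrow> 'b::{banach, second_countable_topology}"
  assumes t: "0 < t" and meas: "\<And>s. f s \<in> borel_measurable M" and w: "integrable M w"
    and cont: "AE x in M. isCont (\<lambda>s. f s x) t"
    and bd: "\<And>s. t / 2 \<le> s \<Longrightarrow> s \<le> 2 * t \<Longrightarrow> AE x in M. norm (f s x) \<le> w x"
  shows "isCont (\<lambda>s. \<integral>x. f s x \<partial>M) t"
  unfolding continuous_at_sequentially
proof (intro allI impI)
  fix X :: "nat \<Rightarrow> real" assume X: "X \<longlonglongrightarrow> t"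
  have "t / 2 < t" "t < 2 * t" using t by auto
  then have "eventually (\<lambda>n. t / 2 < X n \<and> X n < 2 * t) sequentially"
    using order_tendstoD(1)[OF X, of "t / 2"] order_tendstoD(2)[OF X, of "2 * t"] by (intro eventually_conj) blast+
  then obtain N where N: "\<And>n. N \<le> n \<Longrightarrow> t / 2 < X n \<and> X n < 2 * t"
    unfolding eventually_sequentially by blast
  have "(\<lambda>n. \<integral>x. f (X (n + N)) x \<partial>M) \<longlonglongrightarrow> (\<integral>x. f t x \<partial>M)"
  proof (rule integral_dominated_convergence[OF _ _ w])
    show "AE x in M. (\<lambda>n. f (X (n + N)) x) \<longlonglongrightarrow> f t x"
      using cont
    proof eventually_elim
      case (elim x)
      have "(\<lambda>n. X (n + N)) \<longlonglongrightarrow> t" using X by (rule LIMSEQ_ignore_initial_segment)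
      with elim show ?case by (rule isCont_tendsto_compose)
    qed
    show "AE x in M. norm (f (X (n + N)) x) \<le> w x" for n
      using N[of "n + N"] by (intro bd) auto
  qed (use meas in auto)
  then show "((\<lambda>s. \<integral>x. f s x \<partial>M) \<circ> X) \<longlonglongrightarrow> (\<integral>x. f t x \<partial>M)"
    unfolding comp_def by (rule LIMSEQ_offset)
qed

text \<open>What is left of the inverse transform of \<open>4 pi / ln (l / E)\<close> once the pole
  is taken out: a superposition of decaying exponentials, hence decreasing for \<open>t > 0\<close>.
  The value 0 for \<open>t \<le> 0\<close> makes convolutions causal.\<close>

definition memory_kernel :: "real \<Rightarrow> real \<Rightarrow> real" where
  "memory_kernel E t = (if 0 < t then
     4 * pi * (\<integral>s. indicator {0<..} s * (exp (- t * s) / (pi\<^sup>2 + (ln (s / E))\<^sup>2)) \<partial>lborel) else 0)"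

lemma log_density_pos: "0 < pi\<^sup>2 + (ln r)\<^sup>2" for r :: real
  by (simp add: add_pos_nonneg)

lemma log_density_le: "1 / (pi\<^sup>2 + (ln r)\<^sup>2) \<le> 1 / pi\<^sup>2" for r :: real
  by (intro divide_left_mono) (auto simp: log_density_pos)

lemma memory_kernel_bound:
  "indicator {0<..} s * (exp (- t * s) / (pi\<^sup>2 + (ln (s / E))\<^sup>2)) \<le> 1 / pi\<^sup>2 * (indicator {0<..} s * exp (- t * s))" for s t :: real
proof -
  have "exp (- t * s) * (1 / (pi\<^sup>2 + (ln (s / E))\<^sup>2)) \<le> exp (- t * s) * (1 / pi\<^sup>2)"
    by (intro mult_left_mono log_density_le) auto
  then show ?thesis by (auto split: split_indicator)
qed

lemma memory_kernel_integrand_nonneg: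
  "0 \<le> indicator {0<..} s * (exp (- t * s) / (pi\<^sup>2 + (ln (s / E))\<^sup>2))" for s t :: real
  using log_density_pos[of "s / E"] by (auto split: split_indicator intro!: divide_nonneg_pos)

lemma has_bochner_integral_exp_decay:
  assumes "0 < (t::real)"
  shows "has_bochner_integral lborel (\<lambda>s. indicator {0<..} s * exp (- t * s)) (1 / t)"
proof (rule has_bochner_integral_nn_integral)
  show "(\<integral>\<^sup>+ s. ennreal (indicator {0<..} s * exp (- t * s)) \<partial>lborel) = ennreal (1 / t)"
    unfolding nn_integral_exp_decay[OF assms, symmetric]
    by (intro nn_integral_cong) (auto split: split_indicator)
qed (use assms in auto)

lemma memory_kernel_integrable:
  assumes "0 < (t::real)"
  shows "integrable lborel (\<lambda>s. indicator {0<..} s * (exp (- t * s) / (pi\<^sup>2 + (ln (s / E))\<^sup>2)))"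
proof (rule Bochner_Integration.integrable_bound)
  show "integrable lborel (\<lambda>s. 1 / pi\<^sup>2 * (indicator {0<..} s * exp (- t * s)))"
    using has_bochner_integral_exp_decay[OF assms] by (intro integrable_mult_right) (auto simp: has_bochner_integral_iff)
  show "AE s in lborel. norm (indicator {0<..} s * (exp (- t * s) / (pi\<^sup>2 + (ln (s / E))\<^sup>2))) \<le> norm (1 / pi\<^sup>2 * (indicator {0<..} s * exp (- t * s)))"
    using memory_kernel_bound[of _ t E] memory_kernel_integrand_nonneg[of _ t E] unfolding real_norm_def
    by (intro AE_I2) (auto intro: order_trans)
qed simp

lemma memory_kernel_nonneg [simp]: "0 \<le> memory_kernel E t"
  unfolding memory_kernel_def using memory_kernel_integrand_nonneg
  by (auto intro!: mult_nonneg_nonneg integral_nonneg_AE)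

lemma memory_kernel_nonpos [simp]: "t \<le> 0 \<Longrightarrow> memory_kernel E t = 0"
  by (simp add: memory_kernel_def)

lemma memory_kernel_measurable [measurable]: "memory_kernel E \<in> borel_measurable borel"
proof -
  have [measurable]: "(\<lambda>t. \<integral>s. indicator {0<..} s * (exp (- t * s) / (pi\<^sup>2 + (ln (s / E))\<^sup>2)) \<partial>lborel) \<in> borel_measurable borel"
    by (rule lborel.borel_measurable_lebesgue_integral) simp
  show ?thesis unfolding memory_kernel_def by measurable
qed

text \<open>Dropping the squared logarithm from the denominator leaves
  \<open>exp (- t * s) / pi^2\<close>, in which no trace of \<open>E\<close> remains.\<close>

lemma memory_kernel_le:
  assumes "0 < t"
  shows "memory_kernel E t \<le> 4 / (pi * t)"
proof -
  have "(\<integral>s. indicator {0<..} s * (exp (- t * s) / (pi\<^sup>2 + (ln (s / E))\<^sup>2)) \<partial>lborel) \<le> (\<integral>s. 1 / pi\<^sup>2 * (indicator {0<..} s * exp (- t * s)) \<partial>lborel)"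
    using has_bochner_integral_exp_decay[OF assms] memory_kernel_bound
    by (intro integral_mono memory_kernel_integrable assms integrable_mult_right) (auto simp: has_bochner_integral_iff)
  also have "\<dots> = 1 / pi\<^sup>2 * (1 / t)"
    using has_bochner_integral_integral_eq[OF has_bochner_integral_exp_decay[OF assms]]
    by (subst integral_mult_right_zero) simp
  finally have "memory_kernel E t \<le> 4 * pi * (1 / pi\<^sup>2 * (1 / t))"
    using assms unfolding memory_kernel_def by (simp only: if_True) (intro mult_left_mono, auto)
  also have "\<dots> = 4 / (pi * t)" by (simp add: power2_eq_square)
  finally show ?thesis .
qed

text \<open>Monotonicity supplies the dominating function once the memory convolution is scaled to
  the unit interval.\<close>

lemma memory_kernel_antimono:
  assumes "0 < s" "s \<le> t"
  shows "memory_kernel E t \<le> memory_kernel E s"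
proof -
  have "(\<integral>r. indicator {0<..} r * (exp (- t * r) / (pi\<^sup>2 + (ln (r / E))\<^sup>2)) \<partial>lborel) \<le> (\<integral>r. indicator {0<..} r * (exp (- s * r) / (pi\<^sup>2 + (ln (r / E))\<^sup>2)) \<partial>lborel)"
  proof (intro integral_mono memory_kernel_integrable)
    fix r :: real
    show "indicator {0<..} r * (exp (- t * r) / (pi\<^sup>2 + (ln (r / E))\<^sup>2)) \<le> indicator {0<..} r * (exp (- s * r) / (pi\<^sup>2 + (ln (r / E))\<^sup>2))"
      using assms less_imp_le[OF log_density_pos[of "r / E"]] by (auto split: split_indicator intro!: divide_right_mono)
  qed (use assms in auto)
  then show ?thesis using assms by (simp add: memory_kernel_def)
qed

lemma memory_kernel_isCont:
  assumes "0 < t"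
  shows "isCont (memory_kernel E) t"
proof -
  let ?I = "\<lambda>t. \<integral>s. indicator {0<..} s * (exp (- t * s) / (pi\<^sup>2 + (ln (s / E))\<^sup>2)) \<partial>lborel"
  have "isCont ?I t"
  proof (rule isCont_integral_dominated[OF assms _ memory_kernel_integrable[of "t / 2" E]])
    show "AE x in lborel. isCont (\<lambda>s. indicator {0<..} x * (exp (- s * x) / (pi\<^sup>2 + (ln (x / E))\<^sup>2))) t"
    proof (rule AE_I2)
      fix x :: real
      show "isCont (\<lambda>s. indicator {0<..} x * (exp (- s * x) / (pi\<^sup>2 + (ln (x / E))\<^sup>2))) t"
        using log_density_pos[of "x / E"] by (intro continuous_intros) auto
    qed
    fix s assume s: "t / 2 \<le> s"
    show "AE x in lborel. norm (indicator {0<..} x * (exp (- s * x) / (pi\<^sup>2 + (ln (x / E))\<^sup>2))) \<le> indicator {0<..} x * (exp (- (t / 2) * x) / (pi\<^sup>2 + (ln (x / E))\<^sup>2))"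
    proof (rule AE_I2)
      fix x :: real
      have "exp (- s * x) \<le> exp (- (t / 2) * x)" if "0 < x" using s that by simp
      then show "norm (indicator {0<..} x * (exp (- s * x) / (pi\<^sup>2 + (ln (x / E))\<^sup>2))) \<le> indicator {0<..} x * (exp (- (t / 2) * x) / (pi\<^sup>2 + (ln (x / E))\<^sup>2))"
        using less_imp_le[OF log_density_pos[of "x / E"]] by (auto split: split_indicator intro!: divide_right_mono)
    qed
  qed (use assms in auto)
  then have "isCont (\<lambda>t. 4 * pi * ?I t) t" by (intro continuous_intros)
  moreover have "eventually (\<lambda>s. memory_kernel E s = 4 * pi * ?I s) (nhds t)"
    by (rule eventually_mono[OF eventually_nhds_in_open[of "{0<..}" t]]) (use assms in \<open>auto simp: memory_kernel_def\<close>)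
  ultimately show ?thesis by (simp add: isCont_cong)
qed

lemma memory_kernel_nn:
  assumes "0 < t"
  shows "ennreal (memory_kernel E t) = (\<integral>\<^sup>+ s. ennreal (4 * pi) * (ennreal (exp (- t * s) / (pi\<^sup>2 + (ln (s / E))\<^sup>2)) * indicator {0<..} s) \<partial>lborel)"
proof -
  have "(\<integral>\<^sup>+ s. ennreal (exp (- t * s) / (pi\<^sup>2 + (ln (s / E))\<^sup>2)) * indicator {0<..} s \<partial>lborel)
     = (\<integral>\<^sup>+ s. ennreal (indicator {0<..} s * (exp (- t * s) / (pi\<^sup>2 + (ln (s / E))\<^sup>2))) \<partial>lborel)"
    by (intro nn_integral_cong) (auto split: split_indicator)
  also have "\<dots> = ennreal (\<integral>s. indicator {0<..} s * (exp (- t * s) / (pi\<^sup>2 + (ln (s / E))\<^sup>2)) \<partial>lborel)"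
    by (intro nn_integral_eq_integral memory_kernel_integrable assms AE_I2 memory_kernel_integrand_nonneg)
  finally show ?thesis using assms by (simp add: nn_integral_cmult memory_kernel_def ennreal_mult')
qed

text \<open>The rate \<open>l = 0\<close> is included because the total mass is read off from it.
  The substitution \<open>s = E * r\<close> moves the pole to 1, the normalisation of
  \<open>log_Stieltjes\<close>.\<close>

lemma memory_kernel_nn_laplace:
  assumes E: "0 < E" and l: "0 \<le> l"
  shows "(\<integral>\<^sup>+ t. ennreal (exp (- l * t) * memory_kernel E t) \<partial>lborel)
     = ennreal (4 * pi) * (\<integral>\<^sup>+ r. ennreal (1 / ((l / E + r) * (pi\<^sup>2 + (ln r)\<^sup>2))) * indicator {0<..} r \<partial>lborel)"
proof -
  have "(\<integral>\<^sup>+ t. ennreal (exp (- l * t) * memory_kernel E t) \<partial>lborel)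
     = (\<integral>\<^sup>+ t. \<integral>\<^sup>+ s. ennreal (4 * pi) * (ennreal (exp (- l * t) * (exp (- t * s) / (pi\<^sup>2 + (ln (s / E))\<^sup>2))) * indicator {0<..} s * indicator {0<..} t) \<partial>lborel \<partial>lborel)"
  proof (intro nn_integral_cong)
    fix t :: real
    show "ennreal (exp (- l * t) * memory_kernel E t) = (\<integral>\<^sup>+ s. ennreal (4 * pi) * (ennreal (exp (- l * t) * (exp (- t * s) / (pi\<^sup>2 + (ln (s / E))\<^sup>2))) * indicator {0<..} s * indicator {0<..} t) \<partial>lborel)"
    proof (cases "0 < t")
      case True
      have "ennreal (exp (- l * t) * memory_kernel E t) = ennreal (exp (- l * t)) * (\<integral>\<^sup>+ s. ennreal (4 * pi) * (ennreal (exp (- t * s) / (pi\<^sup>2 + (ln (s / E))\<^sup>2)) * indicator {0<..} s) \<partial>lborel)"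
        unfolding memory_kernel_nn[OF True, symmetric] by (simp add: ennreal_mult')
      also have "\<dots> = (\<integral>\<^sup>+ s. ennreal (exp (- l * t)) * (ennreal (4 * pi) * (ennreal (exp (- t * s) / (pi\<^sup>2 + (ln (s / E))\<^sup>2)) * indicator {0<..} s)) \<partial>lborel)"
        by (intro nn_integral_cmult[symmetric]) simp
      also have "\<dots> = (\<integral>\<^sup>+ s. ennreal (4 * pi) * (ennreal (exp (- l * t) * (exp (- t * s) / (pi\<^sup>2 + (ln (s / E))\<^sup>2))) * indicator {0<..} s * indicator {0<..} t) \<partial>lborel)"
      proof (intro nn_integral_cong)
        fix s :: real
        have "ennreal (exp (- l * t) * (exp (- t * s) / (pi\<^sup>2 + (ln (s / E))\<^sup>2))) = ennreal (exp (- l * t)) * ennreal (exp (- t * s) / (pi\<^sup>2 + (ln (s / E))\<^sup>2))"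
          by (rule ennreal_mult') simp
        then show "ennreal (exp (- l * t)) * (ennreal (4 * pi) * (ennreal (exp (- t * s) / (pi\<^sup>2 + (ln (s / E))\<^sup>2)) * indicator {0<..} s))
          = ennreal (4 * pi) * (ennreal (exp (- l * t) * (exp (- t * s) / (pi\<^sup>2 + (ln (s / E))\<^sup>2))) * indicator {0<..} s * indicator {0<..} t)"
          using True by (simp only: mult_ac) simp
      qed
      finally show ?thesis .
    qed simp
  qed
  also have "\<dots> = (\<integral>\<^sup>+ s. \<integral>\<^sup>+ t. ennreal (4 * pi) * (ennreal (exp (- l * t) * (exp (- t * s) / (pi\<^sup>2 + (ln (s / E))\<^sup>2))) * indicator {0<..} s * indicator {0<..} t) \<partial>lborel \<partial>lborel)"
    by (rule lborel_Tonelli) simp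
  also have "\<dots> = (\<integral>\<^sup>+ s. ennreal (4 * pi) * (ennreal (1 / ((l + s) * (pi\<^sup>2 + (ln (s / E))\<^sup>2))) * indicator {0<..} s) \<partial>lborel)"
  proof (intro nn_integral_cong)
    fix s :: real
    show "(\<integral>\<^sup>+ t. ennreal (4 * pi) * (ennreal (exp (- l * t) * (exp (- t * s) / (pi\<^sup>2 + (ln (s / E))\<^sup>2))) * indicator {0<..} s * indicator {0<..} t) \<partial>lborel)
       = ennreal (4 * pi) * (ennreal (1 / ((l + s) * (pi\<^sup>2 + (ln (s / E))\<^sup>2))) * indicator {0<..} s)"
    proof (cases "0 < s")
      case True
      have "ennreal (exp (- l * t) * (exp (- t * s) / (pi\<^sup>2 + (ln (s / E))\<^sup>2))) = ennreal (1 / (pi\<^sup>2 + (ln (s / E))\<^sup>2)) * ennreal (exp (- (l + s) * t))" for t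
        by (simp add: ennreal_mult'[symmetric] exp_add[symmetric] algebra_simps)
      then have "(\<integral>\<^sup>+ t. ennreal (4 * pi) * (ennreal (exp (- l * t) * (exp (- t * s) / (pi\<^sup>2 + (ln (s / E))\<^sup>2))) * indicator {0<..} s * indicator {0<..} t) \<partial>lborel)
         = (\<integral>\<^sup>+ t. ennreal (4 * pi) * ennreal (1 / (pi\<^sup>2 + (ln (s / E))\<^sup>2)) * (ennreal (exp (- (l + s) * t)) * indicator {0<..} t) \<partial>lborel)"
        using True by (intro nn_integral_cong) (simp add: mult.assoc)
      also have "\<dots> = ennreal (4 * pi) * ennreal (1 / (pi\<^sup>2 + (ln (s / E))\<^sup>2)) * ennreal (1 / (l + s))"
        using True l by (subst nn_integral_cmult, simp, subst nn_integral_exp_decay) auto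
      finally show ?thesis using True l log_density_pos[of "s / E"] by (simp add: ennreal_mult'[symmetric] mult_ac)
    qed simp
  qed
  also have "\<dots> = ennreal (4 * pi) * (\<integral>\<^sup>+ s. ennreal (1 / ((l + s) * (pi\<^sup>2 + (ln (s / E))\<^sup>2))) * indicator {0<..} s \<partial>lborel)"
    by (intro nn_integral_cmult) simp
  also have "(\<integral>\<^sup>+ s. ennreal (1 / ((l + s) * (pi\<^sup>2 + (ln (s / E))\<^sup>2))) * indicator {0<..} s \<partial>lborel)
     = \<bar>E\<bar> * (\<integral>\<^sup>+ r. ennreal (1 / ((l + (0 + E * r)) * (pi\<^sup>2 + (ln ((0 + E * r) / E))\<^sup>2))) * indicator {0<..} (0 + E * r) \<partial>lborel)"
    using E by (intro nn_integral_real_affine) auto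
  also have "\<dots> = (\<integral>\<^sup>+ r. ennreal \<bar>E\<bar> * (ennreal (1 / ((l + (0 + E * r)) * (pi\<^sup>2 + (ln ((0 + E * r) / E))\<^sup>2))) * indicator {0<..} (0 + E * r)) \<partial>lborel)"
    by (intro nn_integral_cmult[symmetric]) simp
  also have "\<dots> = (\<integral>\<^sup>+ r. ennreal (1 / ((l / E + r) * (pi\<^sup>2 + (ln r)\<^sup>2))) * indicator {0<..} r \<partial>lborel)"
  proof (intro nn_integral_cong)
    fix r :: real
    have "E * (1 / ((l + E * r) * (pi\<^sup>2 + (ln r)\<^sup>2))) = 1 / ((l / E + r) * (pi\<^sup>2 + (ln r)\<^sup>2))" if "0 < r"
    proof -
      have "l / E + r = (l + E * r) / E" using E by (simp add: field_simps)
      then show ?thesis by simp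
    qed
    then show "ennreal \<bar>E\<bar> * (ennreal (1 / ((l + (0 + E * r)) * (pi\<^sup>2 + (ln ((0 + E * r) / E))\<^sup>2))) * indicator {0<..} (0 + E * r)) = ennreal (1 / ((l / E + r) * (pi\<^sup>2 + (ln r)\<^sup>2))) * indicator {0<..} r"
      using E by (cases "0 < r") (simp_all add: ennreal_mult'[symmetric] zero_less_mult_iff)
  qed
  finally show ?thesis .
qed

text \<open>The factor \<open>4 * pi\<close> times the Cauchy integral, the same for every
  \<open>E\<close>. Together with the bound \<open>4 / (pi * t)\<close> it makes the convolution
  with this kernel preserve power decay.\<close>

lemma memory_kernel_mass:
  assumes "0 < E"
  shows "(\<integral>\<^sup>+ t. ennreal (memory_kernel E t) \<partial>lborel) = ennreal (4 * pi)"
  using memory_kernel_nn_laplace[OF assms, of 0] nn_integral_Cauchy_log by simp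

text \<open>An instance of \<open>log_Stieltjes\<close> at \<open>l / E\<close>, whose pole term
  \<open>1 / (l / E - 1)\<close> is \<open>E / (l - E)\<close>.\<close>

lemma
  assumes E: "0 < E"
  shows laplace_class_memory_kernel: "laplace_class (\<lambda>t. complex_of_real (memory_kernel E t))"
    and laplace_memory_kernel: "0 < l \<Longrightarrow> l \<noteq> E \<Longrightarrow> laplace (\<lambda>t. complex_of_real (memory_kernel E t)) l = complex_of_real (4 * pi * (1 / ln (l / E) - E / (l - E)))"
proof -
  show "laplace_class (\<lambda>t. complex_of_real (memory_kernel E t))"
    unfolding laplace_class_def
  proof (intro conjI allI impI)
    fix e :: real assume e: "0 < e"
    have "(\<integral>\<^sup>+ s. ennreal (exp (- e * s) * norm (complex_of_real (memory_kernel E s))) \<partial>lborel) \<le> (\<integral>\<^sup>+ s. ennreal (memory_kernel E s) \<partial>lborel)"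
    proof (intro nn_integral_mono ennreal_leI)
      fix s show "exp (- e * s) * norm (complex_of_real (memory_kernel E s)) \<le> memory_kernel E s"
        using e by (cases "0 < s") (auto intro!: mult_left_le_one_le)
    qed
    also have "\<dots> < \<infinity>" using memory_kernel_mass[OF E] by simp
    finally show "(\<integral>\<^sup>+ s. ennreal (exp (- e * s) * norm (complex_of_real (memory_kernel E s))) \<partial>lborel) < \<infinity>" .
  qed auto
  assume l: "0 < l" "l \<noteq> E"
  have le: "0 < l / E" "l / E \<noteq> 1" using l E by auto
  have eq: "(\<integral>\<^sup>+ t. ennreal (exp (- l * t) * memory_kernel E t) \<partial>lborel) = ennreal (4 * pi * (1 / ln (l / E) - 1 / (l / E - 1)))"
    using memory_kernel_nn_laplace[OF E, of l] log_Stieltjes[OF le] l by (simp add: ennreal_mult')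
  have "(\<integral>t. exp (- l * t) * memory_kernel E t \<partial>lborel) = 4 * pi * (1 / ln (l / E) - 1 / (l / E - 1))"
    using log_Stieltjes(2)[OF le] by (subst integral_eq_nn_integral) (auto simp: eq[simplified])
  moreover have "1 / (l / E - 1) = E / (l - E)"
  proof -
    have "l / E - 1 = (l - E) / E" using E by (simp add: field_simps)
    then show ?thesis by simp
  qed
  ultimately show "laplace (\<lambda>t. complex_of_real (memory_kernel E t)) l = complex_of_real (4 * pi * (1 / ln (l / E) - E / (l - E)))"
    unfolding laplace_def of_real_mult[symmetric] by (simp only: integral_complex_of_real)
qed

section \<open>Laplace transforms and convolutions of Green functions\<close>

lemma
  assumes x: "x \<noteq> 0"
  shows laplace_class_hk: "laplace_class (\<lambda>s. complex_of_real (hk s x))"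
    and laplace_hk: "0 < l \<Longrightarrow> laplace (\<lambda>s. complex_of_real (hk s x)) l = complex_of_real (Gk l x)"
proof -
  show "laplace_class (\<lambda>s. complex_of_real (hk s x))"
    unfolding laplace_class_def using Gk_laplace[OF _ x] by auto
  assume l: "0 < l"
  have "(\<integral>t. exp (- l * t) * hk t x \<partial>lborel) = Gk l x"
    using Gk_laplace[OF l x] by (subst integral_eq_nn_integral) auto
  then show "laplace (\<lambda>s. complex_of_real (hk s x)) l = complex_of_real (Gk l x)"
    unfolding laplace_def of_real_mult[symmetric] by (simp only: integral_complex_of_real)
qed

text \<open>The sign is recorded separately because later passages between \<open>ennreal\<close>
  and real values use that the divided difference is nonnegative for either order of
  \<open>l\<close> and \<open>m\<close>.\<close>

lemma nn_integral_exp_diff_hk: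
  assumes lm: "0 < l" "0 < m" "l \<noteq> m" and x: "x \<noteq> 0"
  shows "(\<integral>\<^sup>+ v. ennreal (exp_diff_kernel l m v * hk v x) \<partial>lborel) = ennreal ((Gk l x - Gk m x) / (m - l))"
    "0 \<le> (Gk l x - Gk m x) / (m - l)"
proof -
  have i: "integrable lborel (\<lambda>t. exp (- l * t) * hk t x)" "integrable lborel (\<lambda>t. exp (- m * t) * hk t x)"
    using Gk_laplace[OF _ x] lm by (auto intro!: integrableI_nonneg)
  have v: "(\<integral>t. exp (- l * t) * hk t x \<partial>lborel) = Gk l x" if "0 < l" for l
    using Gk_laplace[OF that x] by (subst integral_eq_nn_integral) auto
  have eq: "exp_diff_kernel l m v * hk v x = (exp (- l * v) * hk v x - exp (- m * v) * hk v x) / (m - l)" for v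
    by (auto simp: exp_diff_kernel_def left_diff_distrib)
  have "integrable lborel (\<lambda>v. exp_diff_kernel l m v * hk v x)"
    unfolding eq using i by auto
  moreover have I: "(\<integral>v. exp_diff_kernel l m v * hk v x \<partial>lborel) = (Gk l x - Gk m x) / (m - l)"
    unfolding eq using i v[OF lm(1)] v[OF lm(2)] by simp
  ultimately show "(\<integral>\<^sup>+ v. ennreal (exp_diff_kernel l m v * hk v x) \<partial>lborel) = ennreal ((Gk l x - Gk m x) / (m - l))"
    by (subst nn_integral_eq_integral) (auto intro!: mult_nonneg_nonneg exp_diff_kernel_nonneg)
  show "0 \<le> (Gk l x - Gk m x) / (m - l)"
    unfolding I[symmetric] by (intro integral_nonneg_AE AE_I2 mult_nonneg_nonneg exp_diff_kernel_nonneg) auto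
qed

lemma exp_diff_kernel_commute: "exp_diff_kernel l m = exp_diff_kernel m l"
proof
  fix x
  have "(a - b) / (m - l) = (b - a) / (l - m)" for a b :: real
    by (metis minus_diff_eq minus_divide_divide)
  then show "exp_diff_kernel l m x = exp_diff_kernel m l x"
    by (simp add: exp_diff_kernel_def)
qed

text \<open>At the origin the two Laplace transforms diverge separately and only their difference
  survives: the integral of \<open>(exp (- l * v) - exp (- m * v)) / v\<close> is
  \<open>ln m - ln l\<close>, which with the factor \<open>1 / (4 pi)\<close> is
  \<open>cc m - cc l\<close>. Here \<open>- cc l\<close> is the value of \<open>Gk l\<close> at 0
  after removal of its logarithmic singularity.\<close>

lemma Frullani:
  assumes lm: "0 < l" "l < m"
  shows "(\<integral>\<^sup>+ v. ennreal (exp_diff_kernel l m v * hk v 0) \<partial>lborel) = ennreal ((cc m - cc l) / (m - l))"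
proof -
  have "(\<integral>\<^sup>+ v. ennreal (exp_diff_kernel l m v * hk v 0) \<partial>lborel)
     = (\<integral>\<^sup>+ v. \<integral>\<^sup>+ r. ennreal (1 / (4 * pi * (m - l))) * (ennreal (exp (- r * v)) * indicator {l..m} r * indicator {0<..} v) \<partial>lborel \<partial>lborel)"
  proof (intro nn_integral_cong)
    fix v :: real
    show "ennreal (exp_diff_kernel l m v * hk v 0) = (\<integral>\<^sup>+ r. ennreal (1 / (4 * pi * (m - l))) * (ennreal (exp (- r * v)) * indicator {l..m} r * indicator {0<..} v) \<partial>lborel)"
    proof (cases "0 < v")
      case True
      have "(\<integral>\<^sup>+ r. ennreal (exp (- r * v)) * indicator {l..m} r \<partial>lborel) = ennreal (- exp (- m * v) / v - (- exp (- l * v) / v))"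
        using True lm by (intro nn_integral_FTC_Icc) (auto intro!: derivative_eq_intros)
      then have "(\<integral>\<^sup>+ r. ennreal (1 / (4 * pi * (m - l))) * (ennreal (exp (- r * v)) * indicator {l..m} r * indicator {0<..} v) \<partial>lborel)
          = ennreal (1 / (4 * pi * (m - l))) * ennreal (- exp (- m * v) / v - (- exp (- l * v) / v))"
        using True by (subst nn_integral_cmult) auto
      also have "\<dots> = ennreal (1 / (4 * pi * (m - l)) * (- exp (- m * v) / v - (- exp (- l * v) / v)))"
        using lm by (intro ennreal_mult'[symmetric]) auto
      also have "1 / (4 * pi * (m - l)) * (- exp (- m * v) / v - (- exp (- l * v) / v)) = exp_diff_kernel l m v * hk v 0"
        using True lm by (simp add: exp_diff_kernel_def hk_def divide_simps)
      finally show ?thesis by simp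
    qed (simp add: exp_diff_kernel_def)
  qed
  also have "\<dots> = (\<integral>\<^sup>+ r. \<integral>\<^sup>+ v. ennreal (1 / (4 * pi * (m - l))) * (ennreal (exp (- r * v)) * indicator {l..m} r * indicator {0<..} v) \<partial>lborel \<partial>lborel)"
    by (rule lborel_Tonelli) simp
  also have "\<dots> = (\<integral>\<^sup>+ r. ennreal (1 / (4 * pi * (m - l))) * (ennreal (1 / r) * indicator {l..m} r) \<partial>lborel)"
  proof (intro nn_integral_cong)
    fix r :: real
    show "(\<integral>\<^sup>+ v. ennreal (1 / (4 * pi * (m - l))) * (ennreal (exp (- r * v)) * indicator {l..m} r * indicator {0<..} v) \<partial>lborel) = ennreal (1 / (4 * pi * (m - l))) * (ennreal (1 / r) * indicator {l..m} r)"
    proof (cases "r \<in> {l..m}")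
      case True
      then show ?thesis using lm nn_integral_exp_decay[of r] by (subst nn_integral_cmult) auto
    qed simp
  qed
  also have "\<dots> = ennreal (1 / (4 * pi * (m - l))) * (\<integral>\<^sup>+ r. ennreal (1 / r) * indicator {l..m} r \<partial>lborel)"
    by (intro nn_integral_cmult) simp
  also have "(\<integral>\<^sup>+ r. ennreal (1 / r) * indicator {l..m} r \<partial>lborel) = ennreal (ln m - ln l)"
    using lm by (intro nn_integral_FTC_Icc) (auto intro!: derivative_eq_intros)
  also have "ennreal (1 / (4 * pi * (m - l))) * ennreal (ln m - ln l) = ennreal ((cc m - cc l) / (m - l))"
    using lm by (simp add: ennreal_mult'[symmetric] cc_def ln_sqrt field_simps)
  finally show ?thesis .
qed

lemma nn_integral_exp_diff_hk_0:
  assumes "0 < l" "0 < m" "l \<noteq> m"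
  shows "(\<integral>\<^sup>+ v. ennreal (exp_diff_kernel l m v * hk v 0) \<partial>lborel) = ennreal ((cc m - cc l) / (m - l))"
proof (cases "l < m")
  case True
  then show ?thesis using assms by (intro Frullani)
next
  case False
  then have "(\<integral>\<^sup>+ v. ennreal (exp_diff_kernel m l v * hk v 0) \<partial>lborel) = ennreal ((cc l - cc m) / (l - m))"
    using assms by (intro Frullani) auto
  moreover have "(cc l - cc m) / (l - m) = (cc m - cc l) / (m - l)" by (metis minus_diff_eq minus_divide_divide)
  ultimately show ?thesis by (simp add: exp_diff_kernel_commute)
qed

lemma AE_neq: "AE y in lborel. y \<noteq> (c :: 'a :: euclidean_space)"
  using AE_lborel_singleton by fast

text \<open>Both Green functions are expanded in heat kernels; integrating in \<open>y\<close>
  leaves \<open>hk (s + r) z\<close>, and the double time integral collapses to the convolution of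
  exponentials. The right side is kept as a time integral so as to cover \<open>z = 0\<close>, where
  the Green functions are singular.\<close>

lemma nn_integral_Gk_conv:
  assumes lm: "0 < l" "0 < m" "l \<noteq> m"
  shows "(\<integral>\<^sup>+ y. ennreal (Gk m (z - y) * Gk l y) \<partial>lborel) = (\<integral>\<^sup>+ v. ennreal (exp_diff_kernel l m v * hk v z) \<partial>lborel)"
proof -
  define F where "F l s = indicator {0<..} s * exp (- l * s)" for l s :: real
  have [measurable]: "F l \<in> borel_measurable borel" for l unfolding F_def by measurable
  have Fn: "0 \<le> F l s" for l s by (simp add: F_def)
  have FK: "(\<integral>\<^sup>+ s. ennreal (F l s * F m (x - s)) \<partial>lborel) = ennreal (exp_diff_kernel l m x)" for x
    unfolding F_def using nn_integral_exp_conv[OF lm(3)] by simp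
  have GF: "ennreal (Gk l x) = (\<integral>\<^sup>+ s. ennreal (F l s * hk s x) \<partial>lborel)" if "0 < l" "x \<noteq> 0" for l x
    unfolding Gk_laplace[OF that, symmetric] by (intro nn_integral_cong) (auto simp: F_def split: split_indicator)
  have "(\<integral>\<^sup>+ y. ennreal (Gk m (z - y) * Gk l y) \<partial>lborel)
     = (\<integral>\<^sup>+ y. \<integral>\<^sup>+ s. ennreal (F l s * hk s y) * (\<integral>\<^sup>+ r. ennreal (F m r * hk r (z - y)) \<partial>lborel) \<partial>lborel \<partial>lborel)"
  proof (rule nn_integral_cong_AE)
    show "AE y in lborel. ennreal (Gk m (z - y) * Gk l y) = (\<integral>\<^sup>+ s. ennreal (F l s * hk s y) * (\<integral>\<^sup>+ r. ennreal (F m r * hk r (z - y)) \<partial>lborel) \<partial>lborel)"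
      using AE_neq[of 0] AE_neq[of z]
    proof eventually_elim
      case (elim y)
      have "(\<integral>\<^sup>+ s. ennreal (F l s * hk s y) * (\<integral>\<^sup>+ r. ennreal (F m r * hk r (z - y)) \<partial>lborel) \<partial>lborel)
        = (\<integral>\<^sup>+ s. ennreal (F l s * hk s y) \<partial>lborel) * (\<integral>\<^sup>+ r. ennreal (F m r * hk r (z - y)) \<partial>lborel)"
        by (intro nn_integral_multc) simp
      then show ?case using GF[OF lm(1), of y] GF[OF lm(2), of "z - y"] elim
        by (simp add: ennreal_mult' mult.commute)
    qed
  qed
  also have "\<dots> = (\<integral>\<^sup>+ s. \<integral>\<^sup>+ y. ennreal (F l s * hk s y) * (\<integral>\<^sup>+ r. ennreal (F m r * hk r (z - y)) \<partial>lborel) \<partial>lborel \<partial>lborel)"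
    by (rule lborel_Tonelli) measurable
  also have "\<dots> = (\<integral>\<^sup>+ s. \<integral>\<^sup>+ y. \<integral>\<^sup>+ r. ennreal (F l s * F m r) * (ennreal (hk r (z - y)) * ennreal (hk s y)) \<partial>lborel \<partial>lborel \<partial>lborel)"
  proof (intro nn_integral_cong)
    fix s y
    have "ennreal (F l s * hk s y) * (\<integral>\<^sup>+ r. ennreal (F m r * hk r (z - y)) \<partial>lborel) = (\<integral>\<^sup>+ r. ennreal (F l s * hk s y) * ennreal (F m r * hk r (z - y)) \<partial>lborel)"
      by (intro nn_integral_cmult[symmetric]) simp
    then show "ennreal (F l s * hk s y) * (\<integral>\<^sup>+ r. ennreal (F m r * hk r (z - y)) \<partial>lborel) = (\<integral>\<^sup>+ r. ennreal (F l s * F m r) * (ennreal (hk r (z - y)) * ennreal (hk s y)) \<partial>lborel)"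
      using Fn by (simp add: ennreal_mult' mult_ac)
  qed
  also have "\<dots> = (\<integral>\<^sup>+ s. \<integral>\<^sup>+ r. \<integral>\<^sup>+ y. ennreal (F l s * F m r) * (ennreal (hk r (z - y)) * ennreal (hk s y)) \<partial>lborel \<partial>lborel \<partial>lborel)"
    by (intro nn_integral_cong lborel_Tonelli) measurable
  also have "\<dots> = (\<integral>\<^sup>+ s. ennreal (F l s) * (\<integral>\<^sup>+ r. ennreal (F m r * norm (complex_of_real (hk (s + r) z))) \<partial>lborel) \<partial>lborel)"
  proof (intro nn_integral_cong)
    fix s :: real
    have "(\<integral>\<^sup>+ y. ennreal (F l s * F m r) * (ennreal (hk r (z - y)) * ennreal (hk s y)) \<partial>lborel) = ennreal (F l s) * ennreal (F m r * hk (s + r) z)" for r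
    proof (cases "0 < s \<and> 0 < r")
      case True
      then have "(\<integral>\<^sup>+ y. ennreal (F l s * F m r) * (ennreal (hk r (z - y)) * ennreal (hk s y)) \<partial>lborel) = ennreal (F l s * F m r) * ennreal (hk (r + s) z)"
        by (subst nn_integral_cmult) (auto simp: nn_integral_hk_mult)
      then show ?thesis using Fn by (simp add: ennreal_mult' mult_ac add.commute)
    next
      case False
      then have "F l s = 0 \<or> F m r = 0" by (auto simp: F_def split: split_indicator)
      then show ?thesis by auto
    qed
    then show "(\<integral>\<^sup>+ r. \<integral>\<^sup>+ y. ennreal (F l s * F m r) * (ennreal (hk r (z - y)) * ennreal (hk s y)) \<partial>lborel \<partial>lborel) = ennreal (F l s) * (\<integral>\<^sup>+ r. ennreal (F m r * norm (complex_of_real (hk (s + r) z))) \<partial>lborel)"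
      by (simp add: nn_integral_cmult)
  qed
  also have "\<dots> = (\<integral>\<^sup>+ v. ennreal (exp_diff_kernel l m v * norm (complex_of_real (hk v z))) \<partial>lborel)"
  proof (rule shift_pairing_nn[OF _ _ _ _ _ FK])
    show "(\<integral>\<^sup>+ x. ennreal (exp_diff_kernel l m x * norm (complex_of_real (hk x z))) \<partial>lborel) < \<infinity>"
      using nn_integral_exp_diff_hk[OF lm, of z] nn_integral_exp_diff_hk_0[OF lm] by (cases "z = 0") auto
  qed (use Fn exp_diff_kernel_nonneg in auto)
  finally show ?thesis by simp
qed

section \<open>Heat flow estimates\<close>

lemma Lp_norm_nonneg [simp]: "0 \<le> Lp_norm p f"
  by (simp add: Lp_norm_def)

lemma Lp_memD_measurable: "Lp_mem p f \<Longrightarrow> f \<in> borel_measurable borel"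
  by (simp add: Lp_mem_def)

lemma nn_integral_Lp_norm:
  assumes "Lp_mem p f" "0 < p"
  shows "(\<integral>\<^sup>+ x. ennreal (norm (f x) powr p) \<partial>lborel) = ennreal (Lp_norm p f powr p)"
  using assms unfolding Lp_mem_def Lp_norm_def
  by (simp add: powr_powr top.not_eq_extremum)

lemma Lp_norm_le:
  assumes "(\<integral>\<^sup>+ x. ennreal (norm (f x) powr p) \<partial>lborel) \<le> ennreal (B powr p)" "0 \<le> B" "0 < p"
  shows "Lp_norm p f \<le> B"
proof -
  have "enn2real (\<integral>\<^sup>+ x. ennreal (norm (f x) powr p) \<partial>lborel) \<le> B powr p"
    using assms by (intro enn2real_leI) auto
  then have "Lp_norm p f \<le> (B powr p) powr (1 / p)"
    unfolding Lp_norm_def using assms by (intro powr_mono2) auto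
  then show ?thesis using assms by (simp add: powr_powr)
qed

text \<open>Jensen for the probability density \<open>hk s (x - y)\<close>, then its supremum
  \<open>1 / (4 pi s)\<close>. The constant \<open>(4 * pi) powr (- 1 / p)\<close> is below 1 and is
  dropped.\<close>

lemma hk_nn_integral_bound:
  fixes f :: "R2 \<Rightarrow> complex"
  assumes f: "Lp_mem p f" and p: "1 < p" and s: "0 < s"
  shows "(\<integral>\<^sup>+ y. ennreal (hk s (x - y) * norm (f y)) \<partial>lborel) \<le> ennreal (s powr (- (1 / p)) * Lp_norm p f)"
proof -
  have [measurable]: "f \<in> borel_measurable borel" by (rule Lp_memD_measurable[OF f])
  define N where "N = Lp_norm p f"
  have "(\<integral>\<^sup>+ y. ennreal (hk s (x - y) * norm (f y) powr p) \<partial>lborel) \<le> (\<integral>\<^sup>+ y. ennreal (1 / (4 * pi * s)) * ennreal (norm (f y) powr p) \<partial>lborel)"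
    using s by (intro nn_integral_mono) (auto simp: ennreal_mult'[symmetric] intro!: ennreal_leI mult_right_mono hk_le[simplified] simp del: times_divide_eq_left times_divide_eq_right)
  also have "\<dots> = ennreal (1 / (4 * pi * s) * N powr p)"
    using p s by (subst nn_integral_cmult) (auto simp: nn_integral_Lp_norm[OF f] ennreal_mult'[symmetric] N_def)
  finally have B: "(\<integral>\<^sup>+ y. ennreal (hk s (x - y) * norm (f y) powr p) \<partial>lborel) \<le> ennreal (1 / (4 * pi * s) * N powr p)" .
  have "(\<integral>\<^sup>+ y. ennreal (hk s (x - y) * norm (f y)) \<partial>lborel) \<le> ennreal (1 powr (1 - 1 / p) * (1 / (4 * pi * s) * N powr p) powr (1 / p))"
    by (rule nn_integral_Jensen_powr[OF _ _ _ _ p _ _ _ B]) (use s nn_integral_hk_shift in auto)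
  also have "\<dots> \<le> ennreal (s powr (- (1 / p)) * N)"
  proof (rule ennreal_leI)
    have "1 / (4 * pi * s) \<le> 1 / s" using s pi_gt3 by (intro divide_left_mono) auto
    then have "(1 / (4 * pi * s)) powr (1 / p) \<le> (1 / s) powr (1 / p)" using s p by (intro powr_mono2) auto
    then have "(1 / (4 * pi * s)) powr (1 / p) * N \<le> (1 / s) powr (1 / p) * N" by (intro mult_right_mono) (auto simp: N_def)
    moreover have "(1 / (4 * pi * s) * N powr p) powr (1 / p) = (1 / (4 * pi * s)) powr (1 / p) * N"
      using s p by (subst powr_mult) (auto simp: powr_powr N_def)
    moreover have "(1 / s) powr (1 / p) = s powr (- (1 / p))" using s by (simp add: powr_divide powr_minus_divide)
    ultimately show "1 powr (1 - 1 / p) * (1 / (4 * pi * s) * N powr p) powr (1 / p) \<le> s powr (- (1 / p)) * N" by simp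
  qed
  finally show ?thesis by (simp add: N_def)
qed

section \<open>The heat flow and its Laplace transform\<close>

definition heat :: "(R2 \<Rightarrow> complex) \<Rightarrow> real \<Rightarrow> R2 \<Rightarrow> complex" where
  "heat f s x = (\<integral>y. complex_of_real (hk s (x - y)) * f y \<partial>lborel)"

lemma heat_nonpos: "s \<le> 0 \<Longrightarrow> heat f s x = 0"
  by (simp add: heat_def)

lemma heat_measurable [measurable (raw)]:
  assumes [measurable]: "f \<in> borel_measurable borel" "g \<in> borel_measurable M" "h \<in> borel_measurable M"
  shows "(\<lambda>z. heat f (g z) (h z)) \<in> borel_measurable M"
  unfolding heat_def by (rule lborel.borel_measurable_lebesgue_integral) simp

lemma heat_integrable:
  assumes f: "Lp_mem p f" and p: "1 < p" and s: "0 < s"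
  shows "integrable lborel (\<lambda>y. complex_of_real (hk s (x - y)) * f y)"
proof (rule integrableI_bounded)
  have [measurable]: "f \<in> borel_measurable borel" by (rule Lp_memD_measurable[OF f])
  show "(\<lambda>y. complex_of_real (hk s (x - y)) * f y) \<in> borel_measurable lborel" by measurable
  have "(\<integral>\<^sup>+ y. ennreal (norm (complex_of_real (hk s (x - y)) * f y)) \<partial>lborel) \<le> ennreal (s powr (- (1 / p)) * Lp_norm p f)"
    using hk_nn_integral_bound[OF f p s, of x] by (simp add: norm_mult)
  also have "\<dots> < \<infinity>" by simp
  finally show "(\<integral>\<^sup>+ y. ennreal (norm (complex_of_real (hk s (x - y)) * f y)) \<partial>lborel) < \<infinity>" .
qed

lemma heat_bound:
  assumes f: "Lp_mem p f" and p: "1 < p" and s: "0 < s"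
  shows "norm (heat f s x) \<le> Lp_norm p f * s powr (- (1 / p))"
proof -
  have "ennreal (norm (heat f s x)) \<le> (\<integral>\<^sup>+ y. ennreal (norm (complex_of_real (hk s (x - y)) * f y)) \<partial>lborel)"
    unfolding heat_def by (rule norm_integral_le_nn_integral)
  also have "\<dots> \<le> ennreal (s powr (- (1 / p)) * Lp_norm p f)"
    using hk_nn_integral_bound[OF f p s, of x] by (simp add: norm_mult)
  finally show ?thesis by (simp add: mult.commute)
qed

text \<open>Jensen in \<open>y\<close> for the probability density, then Tonelli, where the mass in
  \<open>x\<close> is 1 again.\<close>

lemma heat_Lp:
  assumes f: "Lp_mem p f" and p: "1 < p" and s: "0 < s"
  shows "(\<integral>\<^sup>+ x. ennreal (norm (heat f s x) powr p) \<partial>lborel) \<le> ennreal (Lp_norm p f powr p)"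
proof -
  have [measurable]: "f \<in> borel_measurable borel" by (rule Lp_memD_measurable[OF f])
  have "(\<integral>\<^sup>+ x. ennreal (norm (heat f s x) powr p) \<partial>lborel) \<le> (\<integral>\<^sup>+ x. ennreal (1 powr (p - 1)) * (\<integral>\<^sup>+ y. ennreal (hk s (x - y) * norm (f y) powr p) \<partial>lborel) \<partial>lborel)"
    unfolding heat_def
    by (intro nn_integral_mono integral_Jensen_powr) (use p s in \<open>auto simp: norm_mult nn_integral_hk_shift\<close>)
  also have "\<dots> = (\<integral>\<^sup>+ y. \<integral>\<^sup>+ x. ennreal (hk s (x - y) * norm (f y) powr p) \<partial>lborel \<partial>lborel)"
    by (simp, rule lborel_Tonelli) measurable
  also have "\<dots> = (\<integral>\<^sup>+ y. ennreal (norm (f y) powr p) \<partial>lborel)"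
  proof (intro nn_integral_cong)
    fix y
    have "(\<integral>\<^sup>+ x. ennreal (hk s (x - y) * norm (f y) powr p) \<partial>lborel) = (\<integral>\<^sup>+ x. ennreal (norm (f y) powr p) * ennreal (hk s (x - y)) \<partial>lborel)"
      by (simp add: ennreal_mult'[symmetric] mult.commute)
    then show "(\<integral>\<^sup>+ x. ennreal (hk s (x - y) * norm (f y) powr p) \<partial>lborel) = ennreal (norm (f y) powr p)"
      using s by (simp add: nn_integral_cmult nn_integral_hk_shift)
  qed
  also have "\<dots> = ennreal (Lp_norm p f powr p)" using p by (intro nn_integral_Lp_norm[OF f]) auto
  finally show ?thesis .
qed

lemma laplace_class_heat:
  assumes f: "Lp_mem p f" and p: "1 < p"
  shows "laplace_class (\<lambda>s. heat f s x)"
proof (rule laplace_class_powr_bound[where A = "Lp_norm p f" and b = "1 / p"])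
  show "(\<lambda>s. heat f s x) \<in> borel_measurable borel"
    using Lp_memD_measurable[OF f] by measurable
qed (use p heat_bound[OF f p] in \<open>auto simp: heat_nonpos\<close>)

text \<open>The bound \<open>s powr (- 1 / p)\<close> for the flow is integrable at 0 because
  \<open>p > 1\<close>; this justifies exchanging the time integral with the space integral.\<close>

lemma
  assumes f: "Lp_mem p f" and p: "1 < p" and l: "0 < l"
  shows Gk_integrable: "integrable lborel (\<lambda>y. complex_of_real (Gk l (x - y)) * f y)"
    and laplace_heat: "laplace (\<lambda>s. heat f s x) l = (\<integral>y. complex_of_real (Gk l (x - y)) * f y \<partial>lborel)"
proof -
  have [measurable]: "f \<in> borel_measurable borel" by (rule Lp_memD_measurable[OF f])
  define g where "g s y = complex_of_real (exp (- l * s)) * (complex_of_real (hk s (x - y)) * f y)" for s y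
  have [measurable]: "case_prod g \<in> borel_measurable (lborel \<Otimes>\<^sub>M lborel)" unfolding g_def by measurable
  have fin: "(\<integral>\<^sup>+ s. \<integral>\<^sup>+ y. ennreal (norm (g s y)) \<partial>lborel \<partial>lborel) < \<infinity>"
  proof -
    have "(\<integral>\<^sup>+ s. \<integral>\<^sup>+ y. ennreal (norm (g s y)) \<partial>lborel \<partial>lborel)
       \<le> (\<integral>\<^sup>+ s. ennreal (Lp_norm p f) * (ennreal (s powr ((1 - 1 / p) - 1) * exp (- l * s)) * indicator {0<..} s) \<partial>lborel)"
    proof (rule nn_integral_mono)
      fix s :: real
      show "(\<integral>\<^sup>+ y. ennreal (norm (g s y)) \<partial>lborel) \<le> ennreal (Lp_norm p f) * (ennreal (s powr ((1 - 1 / p) - 1) * exp (- l * s)) * indicator {0<..} s)"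
      proof (cases "0 < s")
        case True
        have "(\<integral>\<^sup>+ y. ennreal (norm (g s y)) \<partial>lborel) = (\<integral>\<^sup>+ y. ennreal (exp (- l * s)) * ennreal (hk s (x - y) * norm (f y)) \<partial>lborel)"
          by (intro nn_integral_cong) (simp add: g_def norm_mult ennreal_mult'[symmetric])
        also have "\<dots> = ennreal (exp (- l * s)) * (\<integral>\<^sup>+ y. ennreal (hk s (x - y) * norm (f y)) \<partial>lborel)"
          by (intro nn_integral_cmult) simp
        also have "\<dots> \<le> ennreal (exp (- l * s)) * ennreal (s powr (- (1 / p)) * Lp_norm p f)"
          by (intro mult_left_mono hk_nn_integral_bound[OF f p True]) simp
        finally show ?thesis using True by (simp add: ennreal_mult'[symmetric] mult_ac)
      qed (simp add: g_def)
    qed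
    also have "\<dots> = ennreal (Lp_norm p f) * ennreal (Gamma (1 - 1 / p) / l powr (1 - 1 / p))"
      using p l by (subst nn_integral_cmult, simp, subst nn_integral_Gamma) auto
    also have "\<dots> < \<infinity>" by (simp add: ennreal_mult_less_top)
    finally show ?thesis .
  qed
  have ae: "AE y in lborel. (\<integral>s. g s y \<partial>lborel) = complex_of_real (Gk l (x - y)) * f y"
    using AE_neq[of x]
  proof eventually_elim
    case (elim y)
    have "(\<integral>s. g s y \<partial>lborel) = (\<integral>s. complex_of_real (exp (- l * s)) * complex_of_real (hk s (x - y)) * f y \<partial>lborel)"
      by (simp add: g_def mult.assoc)
    also have "\<dots> = laplace (\<lambda>s. complex_of_real (hk s (x - y))) l * f y"
      unfolding laplace_def by (rule integral_mult_left_zero)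
    finally show ?case using elim l by (subst (asm) laplace_hk) auto
  qed
  have "integrable lborel (\<lambda>y. \<integral>s. g s y \<partial>lborel)" using fin by (intro lborel_Fubini(3)) auto
  then show "integrable lborel (\<lambda>y. complex_of_real (Gk l (x - y)) * f y)"
    by (rule integrable_cong_AE_imp) (use ae in auto)
  have "laplace (\<lambda>s. heat f s x) l = (\<integral>s. \<integral>y. g s y \<partial>lborel \<partial>lborel)"
    by (simp add: laplace_def heat_def g_def)
  also have "\<dots> = (\<integral>y. \<integral>s. g s y \<partial>lborel \<partial>lborel)" using fin by (intro lborel_Fubini(1)) auto
  also have "\<dots> = (\<integral>y. complex_of_real (Gk l (x - y)) * f y \<partial>lborel)"
    by (rule integral_cong_AE) (use ae in \<open>auto simp: g_def\<close>)
  finally show "laplace (\<lambda>s. heat f s x) l = (\<integral>y. complex_of_real (Gk l (x - y)) * f y \<partial>lborel)" .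
qed

section \<open>Singular time integrals\<close>

lemma nn_integral_powr_Ioo:
  assumes "b < 1" "0 < s"
  shows "(\<integral>\<^sup>+ x. ennreal (indicator {0<..<s} x * x powr (- b)) \<partial>lborel) = ennreal (s powr (1 - b) / (1 - b))"
proof -
  have "(\<integral>\<^sup>+ x. ennreal (indicator {0<..<s} x * x powr (- b)) \<partial>lborel) = (\<integral>\<^sup>+ x. ennreal (x powr (- b)) * indicator {0..s} x \<partial>lborel)"
    by (rule nn_integral_cong_AE, rule AE_mp[OF AE_lborel_singleton[of 0]], rule AE_mp[OF AE_lborel_singleton[of s]], rule AE_I2)
      (auto split: split_indicator)
  also have "\<dots> = ennreal (s powr (- b + 1) / (- b + 1))"
    using assms by (intro nn_integral_has_integral_lebesgue' has_integral_powr_from_0) auto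
  finally show ?thesis by simp
qed

lemma powr_half_le:
  fixes b s x :: real
  assumes "0 \<le> b" "b \<le> 1" "0 < s" "s / 2 \<le> x"
  shows "x powr (- b) \<le> 2 * s powr (- b)"
proof -
  have "x powr (- b) \<le> (s / 2) powr (- b)" using assms by (intro powr_mono2') auto
  also have "\<dots> = 2 powr b * s powr (- b)" using assms by (simp add: powr_divide powr_minus_divide)
  also have "\<dots> \<le> 2 powr 1 * s powr (- b)" using assms by (intro mult_right_mono powr_mono) auto
  finally show ?thesis by simp
qed

text \<open>On each half of \<open>(0, t)\<close> one of the two powers is at most twice its value
  at \<open>t\<close> and can be pulled out. The resulting explicit constant takes the place of the
  Beta function.\<close>

lemma nn_integral_Beta_bound:
  assumes "0 \<le> a" "a < 1" "0 \<le> b" "b < 1" "0 < t"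
  shows "(\<integral>\<^sup>+ x. ennreal (indicator {0<..<t} x * (x powr (- b) * (t - x) powr (- a))) \<partial>lborel)
     \<le> ennreal ((2 / (1 - b) + 2 / (1 - a)) * t powr (1 - a - b))"
proof -
  let ?f = "\<lambda>b x. indicator {0<..<t} x * x powr (- b)"
  have "(\<integral>\<^sup>+ x. ennreal (indicator {0<..<t} x * (x powr (- b) * (t - x) powr (- a))) \<partial>lborel)
     \<le> (\<integral>\<^sup>+ x. ennreal (2 * t powr (- a)) * ennreal (?f b x) + ennreal (2 * t powr (- b)) * ennreal (?f a (t - x)) \<partial>lborel)"
  proof (rule nn_integral_mono)
    fix x :: real
    have "indicator {0<..<t} x * (x powr (- b) * (t - x) powr (- a)) \<le> 2 * t powr (- a) * ?f b x + 2 * t powr (- b) * ?f a (t - x)"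
    proof (cases "x \<in> {0<..<t}")
      case True
      show ?thesis
      proof (cases "x \<le> t / 2")
        case True': True
        have "(t - x) powr (- a) \<le> 2 * t powr (- a)" using assms True' by (intro powr_half_le) auto
        then have "x powr (- b) * (t - x) powr (- a) \<le> x powr (- b) * (2 * t powr (- a))" by (intro mult_left_mono) auto
        also have "\<dots> \<le> 2 * t powr (- a) * ?f b x + 2 * t powr (- b) * ?f a (t - x)" using True by simp
        finally show ?thesis using True by simp
      next
        case False
        have "x powr (- b) \<le> 2 * t powr (- b)" using assms False by (intro powr_half_le) auto
        then have "x powr (- b) * (t - x) powr (- a) \<le> 2 * t powr (- b) * (t - x) powr (- a)" by (intro mult_right_mono) auto
        also have "\<dots> \<le> 2 * t powr (- a) * ?f b x + 2 * t powr (- b) * ?f a (t - x)" using True by simp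
        finally show ?thesis using True by simp
      qed
    qed simp
    then have "ennreal (indicator {0<..<t} x * (x powr (- b) * (t - x) powr (- a))) \<le> ennreal (2 * t powr (- a) * ?f b x + 2 * t powr (- b) * ?f a (t - x))"
      by (rule ennreal_leI)
    also have "\<dots> = ennreal (2 * t powr (- a) * ?f b x) + ennreal (2 * t powr (- b) * ?f a (t - x))"
      by (rule ennreal_plus) simp_all
    also have "ennreal (2 * t powr (- a) * ?f b x) = ennreal (2 * t powr (- a)) * ennreal (?f b x)"
      by (rule ennreal_mult') simp
    also have "ennreal (2 * t powr (- b) * ?f a (t - x)) = ennreal (2 * t powr (- b)) * ennreal (?f a (t - x))"
      by (rule ennreal_mult') simp
    finally show "ennreal (indicator {0<..<t} x * (x powr (- b) * (t - x) powr (- a))) \<le> ennreal (2 * t powr (- a)) * ennreal (?f b x) + ennreal (2 * t powr (- b)) * ennreal (?f a (t - x))" .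
  qed
  also have "\<dots> = ennreal (2 * t powr (- a)) * (\<integral>\<^sup>+ x. ennreal (?f b x) \<partial>lborel) + ennreal (2 * t powr (- b)) * (\<integral>\<^sup>+ x. ennreal (?f a (t - x)) \<partial>lborel)"
    by (subst nn_integral_add) (simp_all add: nn_integral_cmult)
  also have "(\<integral>\<^sup>+ x. ennreal (?f a (t - x)) \<partial>lborel) = (\<integral>\<^sup>+ x. ennreal (?f a x) \<partial>lborel)"
    by (rule nn_integral_lborel_reflect[of "\<lambda>x. ennreal (?f a x)"]) simp
  also have "ennreal (2 * t powr (- a)) * (\<integral>\<^sup>+ x. ennreal (?f b x) \<partial>lborel) + ennreal (2 * t powr (- b)) * (\<integral>\<^sup>+ x. ennreal (?f a x) \<partial>lborel)
     = ennreal (2 * t powr (- a) * (t powr (1 - b) / (1 - b)) + 2 * t powr (- b) * (t powr (1 - a) / (1 - a)))"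
    using assms by (simp add: nn_integral_powr_Ioo ennreal_mult'[symmetric] ennreal_plus[symmetric] del: ennreal_plus)
  also have "2 * t powr (- a) * (t powr (1 - b) / (1 - b)) + 2 * t powr (- b) * (t powr (1 - a) / (1 - a)) = (2 / (1 - b) + 2 / (1 - a)) * t powr (1 - a - b)"
  proof -
    have "t powr (- a) * t powr (1 - b) = t powr (1 - a - b)" "t powr (- b) * t powr (1 - a) = t powr (1 - a - b)"
      using assms by (simp_all add: powr_add[symmetric] algebra_simps)
    then show ?thesis by (simp add: distrib_right mult.assoc)
  qed
  finally show ?thesis .
qed

text \<open>The Jensen weight \<open>\<tau>\<^sup>-\<^sup>b (t - \<tau>)\<^sup>-\<^sup>a\<close> with \<open>a\<close> slightly below 1 replaces Minkowski's integral inequality.\<close>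
lemma hk_hconv_Lp_bound:
  assumes p: "1 < p" and k: "0 \<le> k" "p * k < 1" and b: "0 \<le> b" "b < 1" and c: "0 < c"
  obtains C where "0 \<le> C" "\<And>t M (g :: real \<Rightarrow> R2 \<Rightarrow> complex). 0 < t \<Longrightarrow> 0 \<le> M \<Longrightarrow>
     (\<And>\<tau> x. norm (g \<tau> x) \<le> indicator {0<..<t} \<tau> * (M * ((t - \<tau>) powr (- k) * hk (c * (t - \<tau>)) x * \<tau> powr (- b)))) \<Longrightarrow>
     (\<integral>\<^sup>+ x. ennreal (norm (\<integral>\<tau>. g \<tau> x \<partial>lborel) powr p) \<partial>lborel) \<le> ennreal (C * M powr p * t powr (1 - p * b - p * k))"
proof -
  \<comment> \<open>The room left by \<open>p * k < 1\<close>, shared out so that the exponent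
    \<open>e\<close> below comes out equal to \<open>a = 1 - d\<close>.\<close>
  define d where "d = (1 - p * k) / p"
  have "0 \<le> p * k" using p k by simp
  with p have "1 - p * k < p" by linarith
  then have d: "0 < d" "d < 1" using p k by (auto simp: d_def)
  define a where "a = 1 - d"
  have a: "0 \<le> a" "a < 1" using d by (auto simp: a_def)
  \<comment> \<open>\<open>- e\<close> is the power of \<open>t - \<tau>\<close> left after Jensen:
    \<open>- a\<close> from the weight, \<open>(a - k) * p\<close> from \<open>F\<close>, and
    \<open>1 - p\<close> from the space integral of the \<open>p\<close>-th power of the
    kernel.\<close>
  define e where "e = p * k + d * (p - 1)"
  have e: "0 \<le> e" using p k d by (simp add: e_def)
  have e1: "e < 1"
  proof -
    have "d * (p - 1) < d * p" using d by simp
    also have "d * p = 1 - p * k" using p by (simp add: d_def)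
    finally show ?thesis by (simp add: e_def)
  qed
  define W where "W = 2 / (1 - b) + 2 / (1 - a)"
  define V where "V = 2 / (1 - b) + 2 / (1 - e)"
  have W: "0 < W" "0 < V" using a b e e1 by (auto simp: W_def V_def intro!: add_pos_pos)
  define C where "C = W powr (p - 1) * ((4 * pi * c) powr (1 - p) / p) * V"
  have C: "0 \<le> C" using W p by (simp add: C_def)
  show thesis
  proof (rule that[OF C])
    fix t M :: real and g :: "real \<Rightarrow> R2 \<Rightarrow> complex"
    assume t: "0 < t" and M: "0 \<le> M"
      and g: "\<And>\<tau> x. norm (g \<tau> x) \<le> indicator {0<..<t} \<tau> * (M * ((t - \<tau>) powr (- k) * hk (c * (t - \<tau>)) x * \<tau> powr (- b)))"
    define w where "w \<tau> = indicator {0<..<t} \<tau> * (\<tau> powr (- b) * (t - \<tau>) powr (- a))" for \<tau>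
    define F where "F x \<tau> = M * ((t - \<tau>) powr (a - k) * hk (c * (t - \<tau>)) x)" for x \<tau>
    have [measurable]: "w \<in> borel_measurable borel" unfolding w_def by measurable
    have [measurable]: "(\<lambda>z. F (fst z) (snd z)) \<in> borel_measurable (borel \<Otimes>\<^sub>M borel)" unfolding F_def by measurable
    have [measurable]: "F x \<in> borel_measurable borel" for x unfolding F_def by measurable
    have wn: "0 \<le> w \<tau>" for \<tau> by (simp add: w_def)
    have Fn: "0 \<le> F x \<tau>" for x \<tau> using M by (simp add: F_def)
    have "(\<integral>\<^sup>+ x. ennreal (norm (\<integral>\<tau>. g \<tau> x \<partial>lborel) powr p) \<partial>lborel)
       \<le> (\<integral>\<^sup>+ x. ennreal ((W * t powr (1 - a - b)) powr (p - 1)) * (\<integral>\<^sup>+ \<tau>. ennreal (w \<tau> * F x \<tau> powr p) \<partial>lborel) \<partial>lborel)"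
    proof (intro nn_integral_mono integral_Jensen_powr)
      fix x \<tau>
      show "(\<integral>\<^sup>+ \<tau>. ennreal (w \<tau>) \<partial>lborel) \<le> ennreal (W * t powr (1 - a - b))"
        unfolding w_def W_def by (rule nn_integral_Beta_bound) (use a b t in auto)
      show "norm (g \<tau> x) \<le> w \<tau> * F x \<tau>"
      proof (cases "\<tau> \<in> {0<..<t}")
        case True
        then have "(t - \<tau>) powr (- a) * (t - \<tau>) powr (a - k) = (t - \<tau>) powr (- k)" by (simp add: powr_add[symmetric])
        then have "w \<tau> * F x \<tau> = M * ((t - \<tau>) powr (- k) * hk (c * (t - \<tau>)) x * \<tau> powr (- b))"
          using True by (simp add: w_def F_def mult_ac)
        then show ?thesis using g[of \<tau> x] True by simp
      qed (use g[of \<tau> x] in \<open>simp add: w_def\<close>)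
    qed (use W t p wn Fn in auto)
    also have "\<dots> = ennreal ((W * t powr (1 - a - b)) powr (p - 1)) * (\<integral>\<^sup>+ \<tau>. \<integral>\<^sup>+ x. ennreal (w \<tau> * F x \<tau> powr p) \<partial>lborel \<partial>lborel)"
      by (subst nn_integral_cmult, simp, subst lborel_Tonelli) auto
    also have "(\<integral>\<^sup>+ \<tau>. \<integral>\<^sup>+ x. ennreal (w \<tau> * F x \<tau> powr p) \<partial>lborel \<partial>lborel)
       = (\<integral>\<^sup>+ \<tau>. ennreal (M powr p * ((4 * pi * c) powr (1 - p) / p)) * ennreal (indicator {0<..<t} \<tau> * (\<tau> powr (- b) * (t - \<tau>) powr (- e))) \<partial>lborel)"
    proof (intro nn_integral_cong)
      fix \<tau> :: real
      show "(\<integral>\<^sup>+ x. ennreal (w \<tau> * F x \<tau> powr p) \<partial>lborel) = ennreal (M powr p * ((4 * pi * c) powr (1 - p) / p)) * ennreal (indicator {0<..<t} \<tau> * (\<tau> powr (- b) * (t - \<tau>) powr (- e)))"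
      proof (cases "\<tau> \<in> {0<..<t}")
        case True
        have "w \<tau> * F x \<tau> powr p = \<tau> powr (- b) * (t - \<tau>) powr (- a) * (M powr p * (t - \<tau>) powr ((a - k) * p)) * hk (c * (t - \<tau>)) x powr p" for x
          using True M by (simp add: w_def F_def powr_mult powr_powr mult_ac)
        then have "(\<integral>\<^sup>+ x. ennreal (w \<tau> * F x \<tau> powr p) \<partial>lborel)
          = (\<integral>\<^sup>+ x. ennreal (\<tau> powr (- b) * (t - \<tau>) powr (- a) * (M powr p * (t - \<tau>) powr ((a - k) * p))) * ennreal (hk (c * (t - \<tau>)) x powr p) \<partial>lborel)"
          by (simp add: ennreal_mult'[symmetric])
        also have "\<dots> = ennreal (\<tau> powr (- b) * (t - \<tau>) powr (- a) * (M powr p * (t - \<tau>) powr ((a - k) * p))) * ennreal ((4 * pi * (c * (t - \<tau>))) powr (1 - p) / p)"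
          using True c p by (subst nn_integral_cmult, simp, subst nn_integral_hk_powr) auto
        also have "\<dots> = ennreal (\<tau> powr (- b) * (t - \<tau>) powr (- a) * (M powr p * (t - \<tau>) powr ((a - k) * p)) * ((4 * pi * (c * (t - \<tau>))) powr (1 - p) / p))"
          using True c p by (intro ennreal_mult'[symmetric]) auto
        also have "\<tau> powr (- b) * (t - \<tau>) powr (- a) * (M powr p * (t - \<tau>) powr ((a - k) * p)) * ((4 * pi * (c * (t - \<tau>))) powr (1 - p) / p)
           = M powr p * ((4 * pi * c) powr (1 - p) / p) * (\<tau> powr (- b) * ((t - \<tau>) powr (- a) * (t - \<tau>) powr ((a - k) * p) * (t - \<tau>) powr (1 - p)))"
        proof -
          have "(4 * pi * (c * (t - \<tau>))) powr (1 - p) = (4 * pi * c) powr (1 - p) * (t - \<tau>) powr (1 - p)"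
            using True c by (subst powr_mult[symmetric]) (auto simp: mult_ac)
          then show ?thesis by (simp add: mult_ac)
        qed
        also have "(t - \<tau>) powr (- a) * (t - \<tau>) powr ((a - k) * p) * (t - \<tau>) powr (1 - p) = (t - \<tau>) powr (- e)"
        proof -
          have "- a + (a - k) * p + (1 - p) = - e" by (simp add: a_def e_def algebra_simps)
          then show ?thesis using True by (simp add: powr_add[symmetric])
        qed
        finally show ?thesis using True p by (simp add: ennreal_mult'[symmetric])
      qed (simp add: w_def)
    qed
    also have "\<dots> \<le> ennreal (M powr p * ((4 * pi * c) powr (1 - p) / p)) * ennreal (V * t powr (1 - e - b))"
      unfolding V_def using e e1 b t by (subst nn_integral_cmult, simp) (intro mult_left_mono nn_integral_Beta_bound, auto)
    also have "ennreal ((W * t powr (1 - a - b)) powr (p - 1)) * (ennreal (M powr p * ((4 * pi * c) powr (1 - p) / p)) * ennreal (V * t powr (1 - e - b)))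
       = ennreal (C * M powr p * t powr (1 - p * b - p * k))"
    proof -
      have "(W * t powr (1 - a - b)) powr (p - 1) = W powr (p - 1) * t powr ((1 - a - b) * (p - 1))"
        using W t by (simp add: powr_mult powr_powr)
      moreover have "t powr ((1 - a - b) * (p - 1)) * t powr (1 - e - b) = t powr (1 - p * b - p * k)"
      proof -
        have "(1 - a - b) * (p - 1) + (1 - e - b) = 1 - p * b - p * k" by (simp add: a_def e_def algebra_simps)
        then show ?thesis unfolding powr_add[symmetric] by (simp only:)
      qed
      ultimately have "(W * t powr (1 - a - b)) powr (p - 1) * ((M powr p * ((4 * pi * c) powr (1 - p) / p)) * (V * t powr (1 - e - b))) = C * M powr p * t powr (1 - p * b - p * k)"
        by (simp add: C_def mult_ac)
      then show ?thesis using W p by (simp add: ennreal_mult'[symmetric])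
    qed
    finally show "(\<integral>\<^sup>+ x. ennreal (norm (\<integral>\<tau>. g \<tau> x \<partial>lborel) powr p) \<partial>lborel) \<le> ennreal (C * M powr p * t powr (1 - p * b - p * k))"
      by (auto simp: mult_left_mono)
  qed
qed

section \<open>The point-interaction evolution\<close>

text \<open>The strength of a source at the origin, driven by the values \<open>a s\<close> of the
  free flow there; in the theory of point interactions it is called the charge. The first summand
  inverts the pole, the second the rest of the Krein factor.\<close>

definition charge :: "real \<Rightarrow> (real \<Rightarrow> complex) \<Rightarrow> real \<Rightarrow> complex" where
  "charge E a s = complex_of_real (- (4 * pi * E)) * shift_resolvent E a s
     + hconv (\<lambda>t. complex_of_real (memory_kernel E t)) a s"

lemma charge_measurable:
  assumes [measurable]: "a \<in> borel_measurable borel"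
  shows "charge E a \<in> borel_measurable borel"
proof -
  have [measurable]: "shift_resolvent E a \<in> borel_measurable borel" by (rule shift_resolvent_measurable) simp
  have [measurable]: "hconv (\<lambda>t. complex_of_real (memory_kernel E t)) a \<in> borel_measurable borel"
    by (rule hconv_measurable) simp_all
  show ?thesis unfolding charge_def by measurable
qed

lemma laplace_class_charge:
  assumes "laplace_class a" "0 < E"
  shows "laplace_class (charge E a)"
  unfolding charge_def using assms
  by (intro laplace_class_add laplace_class_cmult laplace_class_shift_resolvent laplace_class_hconv laplace_class_memory_kernel)

text \<open>Since \<open>laplace a E = 0\<close>, one term of the divided difference for
  \<open>shift_resolvent\<close> disappears. The pole then cancels against the one subtracted in the
  memory kernel, and only \<open>4 pi / ln (l / E)\<close> remains.\<close>

lemma laplace_charge: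
  assumes a: "laplace_class a" and E: "0 < E" and aE: "laplace a E = 0" and l: "0 < l" "l \<noteq> E"
  shows "laplace (charge E a) l = laplace a l / complex_of_real (ln (l / E) / (4 * pi))"
proof -
  have "laplace (charge E a) l = complex_of_real (- (4 * pi * E)) * laplace (shift_resolvent E a) l
     + laplace (hconv (\<lambda>t. complex_of_real (memory_kernel E t)) a) l"
    unfolding charge_def using a E l
    by (subst laplace_add) (auto intro!: laplace_class_cmult laplace_class_shift_resolvent laplace_class_hconv laplace_class_memory_kernel simp: laplace_cmult simp del: of_real_minus of_real_mult)
  also have "laplace (shift_resolvent E a) l = laplace a l / complex_of_real (E - l)"
    using laplace_shift_resolvent[OF a E l] aE by simp
  also have "laplace (hconv (\<lambda>t. complex_of_real (memory_kernel E t)) a) l = complex_of_real (4 * pi * (1 / ln (l / E) - E / (l - E))) * laplace a l"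
    using laplace_hconv[OF laplace_class_memory_kernel[OF E] a l(1)] laplace_memory_kernel[OF E l] by simp
  also have "complex_of_real (- (4 * pi * E)) * (laplace a l / complex_of_real (E - l)) = complex_of_real (- (4 * pi * E) / (E - l)) * laplace a l"
    by simp
  also have "complex_of_real (- (4 * pi * E) / (E - l)) * laplace a l + complex_of_real (4 * pi * (1 / ln (l / E) - E / (l - E))) * laplace a l
    = complex_of_real (- (4 * pi * E) / (E - l) + 4 * pi * (1 / ln (l / E) - E / (l - E))) * laplace a l"
    by (simp only: of_real_add distrib_right)
  also have "- (4 * pi * E) / (E - l) + 4 * pi * (1 / ln (l / E) - E / (l - E)) = 1 / (ln (l / E) / (4 * pi))"
  proof -
    have "- (4 * pi * E) / (E - l) = 4 * pi * E / (l - E)" by (metis minus_diff_eq minus_divide_divide minus_minus)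
    then show ?thesis by (simp add: algebra_simps)
  qed
  finally show ?thesis by simp
qed

text \<open>Only values \<open>a (s + r)\<close> with \<open>r > 0\<close> occur, where the
  decreasing power bound is at most its value at \<open>s\<close>. The weight has mass
  \<open>1 / E\<close>, which cancels the prefactor \<open>E\<close> of the charge.\<close>

lemma shift_resolvent_bound:
  assumes E: "0 < E" and b: "0 \<le> b" and A: "0 \<le> A" and s: "0 < s"
    and bd: "\<And>s. 0 < s \<Longrightarrow> norm (a s) \<le> A * s powr (- b)"
  shows "norm (shift_resolvent E a s) \<le> A * s powr (- b) / E"
proof -
  have "ennreal (norm (shift_resolvent E a s)) \<le> (\<integral>\<^sup>+ r. ennreal (norm (complex_of_real (indicator {0<..} r * exp (- E * r)) * a (s + r))) \<partial>lborel)"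
    using s norm_integral_le_nn_integral by (simp add: shift_resolvent_def)
  also have "\<dots> \<le> (\<integral>\<^sup>+ r. ennreal (A * s powr (- b)) * (ennreal (exp (- E * r)) * indicator {0<..} r) \<partial>lborel)"
  proof (rule nn_integral_mono)
    fix r :: real
    show "ennreal (norm (complex_of_real (indicator {0<..} r * exp (- E * r)) * a (s + r))) \<le> ennreal (A * s powr (- b)) * (ennreal (exp (- E * r)) * indicator {0<..} r)"
    proof (cases "0 < r")
      case True
      have "norm (a (s + r)) \<le> A * (s + r) powr (- b)" using s True by (intro bd) auto
      also have "\<dots> \<le> A * s powr (- b)" using s True b A by (intro mult_left_mono powr_mono2') auto
      finally have "norm (a (s + r)) * exp (- E * r) \<le> A * s powr (- b) * exp (- E * r)" by (intro mult_right_mono) auto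
      then show ?thesis using True A by (simp add: norm_mult ennreal_mult'[symmetric] mult.commute ennreal_leI)
    qed simp
  qed
  also have "\<dots> = ennreal (A * s powr (- b)) * ennreal (1 / E)"
    by (subst nn_integral_cmult, simp, subst nn_integral_exp_decay[OF E]) simp
  also have "\<dots> = ennreal (A * s powr (- b) / E)" using A E by (simp add: ennreal_mult'[symmetric])
  finally show ?thesis using A E s by simp
qed

text \<open>The integral is split at \<open>s / 2\<close>. For small \<open>r\<close> the kernel is
  at most \<open>8 / (pi * s)\<close> and the power is integrated; for larger \<open>r\<close> the
  power is at most twice its value at \<open>s\<close> and the kernel is integrated to
  \<open>4 * pi\<close>.\<close>

lemma memory_hconv_nn_bound:
  assumes E: "0 < E" and b: "0 \<le> b" "b < 1" and A: "0 \<le> A" and s: "0 < s"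
    and bd: "\<And>s. 0 < s \<Longrightarrow> norm (a s) \<le> A * s powr (- b)" and z: "\<And>s. s \<le> 0 \<Longrightarrow> a s = (0::complex)"
  shows "(\<integral>\<^sup>+ r. ennreal (memory_kernel E (s - r) * norm (a r)) \<partial>lborel) \<le> ennreal ((8 / (pi * (1 - b)) + 8 * pi) * A * s powr (- b))"
proof -
  have "(\<integral>\<^sup>+ r. ennreal (memory_kernel E (s - r) * norm (a r)) \<partial>lborel)
     \<le> (\<integral>\<^sup>+ r. ennreal (8 / (pi * s) * A) * ennreal (indicator {0<..<s} r * r powr (- b)) + ennreal (2 * A * s powr (- b)) * ennreal (memory_kernel E (s - r)) \<partial>lborel)"
  proof (rule nn_integral_mono)
    fix r :: real
    let ?R = "8 / (pi * s) * A * (indicator {0<..<s} r * r powr (- b)) + 2 * A * s powr (- b) * memory_kernel E (s - r)"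
    have "memory_kernel E (s - r) * norm (a r) \<le> ?R"
    proof (cases "r \<in> {0<..<s}")
      case True
      have ar: "norm (a r) \<le> A * r powr (- b)" using True by (intro bd) auto
      show ?thesis
      proof (cases "r \<le> s / 2")
        case True': True
        have "memory_kernel E (s - r) \<le> 4 / (pi * (s - r))" using True by (intro memory_kernel_le) auto
        also have "\<dots> \<le> 4 / (pi * (s / 2))" using True True' s by (intro divide_left_mono mult_left_mono) auto
        finally have "memory_kernel E (s - r) \<le> 8 / (pi * s)" by simp
        then have "memory_kernel E (s - r) * norm (a r) \<le> 8 / (pi * s) * (A * r powr (- b))"
          using ar s by (intro mult_mono) auto
        also have "\<dots> \<le> ?R" using True A by (simp add: mult.assoc)
        finally show ?thesis .
      next
        case False
        have "r powr (- b) \<le> 2 * s powr (- b)" using b s False by (intro powr_half_le) auto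
        then have "A * r powr (- b) \<le> A * (2 * s powr (- b))" using A by (intro mult_left_mono)
        with ar have "norm (a r) \<le> A * (2 * s powr (- b))" by linarith
        then have "memory_kernel E (s - r) * norm (a r) \<le> memory_kernel E (s - r) * (A * (2 * s powr (- b)))" by (intro mult_left_mono) auto
        also have "\<dots> \<le> ?R" using True A s by (simp add: mult_ac)
        finally show ?thesis .
      qed
    next
      case False
      then have 0: "memory_kernel E (s - r) * norm (a r) = 0" using z[of r] by (auto simp: not_less)
      show ?thesis unfolding 0 using A s by simp
    qed
    then have "ennreal (memory_kernel E (s - r) * norm (a r)) \<le> ennreal ?R" by (rule ennreal_leI)
    also have "ennreal ?R = ennreal (8 / (pi * s) * A * (indicator {0<..<s} r * r powr (- b))) + ennreal (2 * A * s powr (- b) * memory_kernel E (s - r))"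
      using A s by (intro ennreal_plus) auto
    also have "ennreal (8 / (pi * s) * A * (indicator {0<..<s} r * r powr (- b))) = ennreal (8 / (pi * s) * A) * ennreal (indicator {0<..<s} r * r powr (- b))"
      using A s by (intro ennreal_mult') auto
    also have "ennreal (2 * A * s powr (- b) * memory_kernel E (s - r)) = ennreal (2 * A * s powr (- b)) * ennreal (memory_kernel E (s - r))"
      using A s by (intro ennreal_mult') auto
    finally show "ennreal (memory_kernel E (s - r) * norm (a r)) \<le> ennreal (8 / (pi * s) * A) * ennreal (indicator {0<..<s} r * r powr (- b)) + ennreal (2 * A * s powr (- b)) * ennreal (memory_kernel E (s - r))" .
  qed
  also have "\<dots> = ennreal (8 / (pi * s) * A) * (\<integral>\<^sup>+ r. ennreal (indicator {0<..<s} r * r powr (- b)) \<partial>lborel) + ennreal (2 * A * s powr (- b)) * (\<integral>\<^sup>+ r. ennreal (memory_kernel E (s - r)) \<partial>lborel)"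
    by (subst nn_integral_add) (simp_all add: nn_integral_cmult)
  also have "(\<integral>\<^sup>+ r. ennreal (memory_kernel E (s - r)) \<partial>lborel) = ennreal (4 * pi)"
    using nn_integral_lborel_reflect[of "\<lambda>r. ennreal (memory_kernel E r)" s] memory_kernel_mass[OF E] by simp
  also have "ennreal (8 / (pi * s) * A) * (\<integral>\<^sup>+ r. ennreal (indicator {0<..<s} r * r powr (- b)) \<partial>lborel) + ennreal (2 * A * s powr (- b)) * ennreal (4 * pi)
     = ennreal (8 / (pi * s) * A * (s powr (1 - b) / (1 - b)) + 2 * A * s powr (- b) * (4 * pi))"
    unfolding nn_integral_powr_Ioo[OF b(2) s] using A s b
    by (subst ennreal_plus) (auto simp: ennreal_mult'[symmetric])
  also have "8 / (pi * s) * A * (s powr (1 - b) / (1 - b)) + 2 * A * s powr (- b) * (4 * pi) = (8 / (pi * (1 - b)) + 8 * pi) * A * s powr (- b)"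
  proof -
    have b': "s powr (- b) = s powr (1 - b) / s" using s by (simp add: powr_diff powr_minus_divide)
    have "8 / (pi * s) * A * (s powr (1 - b) / (1 - b)) = 8 / (pi * (1 - b)) * A * s powr (- b)"
      unfolding b' by (simp add: mult_ac)
    then show ?thesis by (simp add: algebra_simps)
  qed
  finally show ?thesis .
qed

text \<open>The constant collects \<open>4 * pi\<close> from the future average and
  \<open>8 * pi + 8 / (pi * (1 - b))\<close> from the memory term. It depends on \<open>b\<close>
  alone, neither on \<open>E\<close> nor on time.\<close>

lemma charge_bound:
  assumes E: "0 < E" and b: "0 \<le> b" "b < 1" and A: "0 \<le> A" and s: "0 < s"
    and bd: "\<And>s. 0 < s \<Longrightarrow> norm (a s) \<le> A * s powr (- b)" and z: "\<And>s. s \<le> 0 \<Longrightarrow> a s = (0::complex)"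
  shows "norm (charge E a s) \<le> (12 * pi + 8 / (pi * (1 - b))) * A * s powr (- b)"
proof -
  have "norm (shift_resolvent E a s) \<le> A * s powr (- b) / E" by (rule shift_resolvent_bound[OF E b(1) A s bd])
  then have "4 * pi * E * norm (shift_resolvent E a s) \<le> 4 * pi * E * (A * s powr (- b) / E)" using E by (intro mult_left_mono) auto
  then have 1: "norm (complex_of_real (- (4 * pi * E)) * shift_resolvent E a s) \<le> 4 * pi * A * s powr (- b)"
    using E unfolding norm_mult norm_of_real by simp
  have "ennreal (norm (hconv (\<lambda>t. complex_of_real (memory_kernel E t)) a s)) \<le> (\<integral>\<^sup>+ r. ennreal (norm (complex_of_real (memory_kernel E (s - r)) * a r)) \<partial>lborel)"
    unfolding hconv_def by (rule norm_integral_le_nn_integral)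
  also have "\<dots> \<le> ennreal ((8 / (pi * (1 - b)) + 8 * pi) * A * s powr (- b))"
    using memory_hconv_nn_bound[OF E b A s bd z] by (simp add: norm_mult)
  finally have 2: "norm (hconv (\<lambda>t. complex_of_real (memory_kernel E t)) a s) \<le> (8 / (pi * (1 - b)) + 8 * pi) * A * s powr (- b)"
    using A b by (subst (asm) ennreal_le_iff) auto
  have "norm (charge E a s) \<le> 4 * pi * A * s powr (- b) + (8 / (pi * (1 - b)) + 8 * pi) * A * s powr (- b)"
    unfolding charge_def by (rule order_trans[OF norm_triangle_ineq]) (intro add_mono 1 2)
  then show ?thesis by (simp add: algebra_simps)
qed

definition evol :: "real \<Rightarrow> (R2 \<Rightarrow> complex) \<Rightarrow> real \<Rightarrow> R2 \<Rightarrow> complex" where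
  "evol E f s x = heat f s x + hconv (\<lambda>r. complex_of_real (hk r x)) (charge E (\<lambda>s. heat f s 0)) s"

lemma charge_heat_measurable:
  "f \<in> borel_measurable borel \<Longrightarrow> charge E (\<lambda>s. heat f s 0) \<in> borel_measurable borel"
  by (intro charge_measurable) simp

lemma charge_heat_nonpos:
  assumes "s \<le> 0"
  shows "charge E (\<lambda>s. heat f s 0) s = 0"
proof -
  have "complex_of_real (memory_kernel E (s - r)) * heat f r 0 = 0" for r
    using assms by (cases "r \<le> 0") (auto simp: heat_nonpos)
  then show ?thesis using assms unfolding charge_def shift_resolvent_def hconv_def by (simp only: Bochner_Integration.integral_zero) simp
qed

lemma evol_nonpos: "s \<le> 0 \<Longrightarrow> evol E f s x = 0"
proof -
  assume s: "s \<le> 0"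
  have "complex_of_real (hk (s - r) x) * charge E (\<lambda>s. heat f s 0) r = 0" for r
    using s by (cases "r \<le> 0") (auto simp: charge_heat_nonpos)
  then show ?thesis using s unfolding evol_def hconv_def by (simp only: Bochner_Integration.integral_zero heat_nonpos) simp
qed

lemma evol_measurable [measurable (raw)]:
  assumes [measurable]: "f \<in> borel_measurable borel" "g \<in> borel_measurable M" "h \<in> borel_measurable M"
  shows "(\<lambda>z. evol E f (g z) (h z)) \<in> borel_measurable M"
proof -
  have [measurable]: "charge E (\<lambda>s. heat f s 0) \<in> borel_measurable borel" by (rule charge_heat_measurable) simp
  have [measurable]: "(\<lambda>z. \<integral>r. complex_of_real (hk (g z - r) (h z)) * charge E (\<lambda>s. heat f s 0) r \<partial>lborel) \<in> borel_measurable M"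
    by (rule lborel.borel_measurable_lebesgue_integral) simp
  show ?thesis unfolding evol_def hconv_def by measurable
qed

section \<open>A square-integral bound for the evolution, uniform in time\<close>

lemma powr_add_le:
  assumes "0 \<le> (x::real)" "0 \<le> y" "0 \<le> p"
  shows "(x + y) powr p \<le> 2 powr p * (x powr p + y powr p)"
proof -
  have "(x + y) powr p \<le> (2 * max x y) powr p" using assms by (intro powr_mono2) auto
  also have "\<dots> = 2 powr p * max x y powr p" using assms by (simp add: powr_mult)
  also have "max x y powr p \<le> x powr p + y powr p" by (auto simp: max_def)
  finally show ?thesis by (simp add: mult_left_mono)
qed

text \<open>A quasi-triangle inequality in place of Minkowski's; the factor \<open>2 powr p\<close>
  is harmless where only some constant is claimed.\<close>

lemma nn_integral_add_powr_le:
  fixes f g :: "R2 \<Rightarrow> 'b::real_normed_vector"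
  assumes [measurable]: "f \<in> borel_measurable borel" "g \<in> borel_measurable borel" and p: "0 \<le> p"
    and h: "\<And>x. norm (h x) \<le> norm (f x) + norm (g x)"
  shows "(\<integral>\<^sup>+ x. ennreal (norm (h x) powr p) \<partial>lborel)
     \<le> ennreal (2 powr p) * ((\<integral>\<^sup>+ x. ennreal (norm (f x) powr p) \<partial>lborel) + (\<integral>\<^sup>+ x. ennreal (norm (g x) powr p) \<partial>lborel))"
proof -
  have "(\<integral>\<^sup>+ x. ennreal (norm (h x) powr p) \<partial>lborel) \<le> (\<integral>\<^sup>+ x. ennreal (2 powr p) * (ennreal (norm (f x) powr p) + ennreal (norm (g x) powr p)) \<partial>lborel)"
  proof (rule nn_integral_mono)
    fix x
    have "norm (h x) powr p \<le> (norm (f x) + norm (g x)) powr p" using h p by (intro powr_mono2) auto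
    also have "\<dots> \<le> 2 powr p * (norm (f x) powr p + norm (g x) powr p)" using p by (intro powr_add_le) auto
    finally show "ennreal (norm (h x) powr p) \<le> ennreal (2 powr p) * (ennreal (norm (f x) powr p) + ennreal (norm (g x) powr p))"
      by (simp add: ennreal_plus[symmetric] ennreal_mult'[symmetric] ennreal_leI del: ennreal_plus)
  qed
  also have "\<dots> = ennreal (2 powr p) * ((\<integral>\<^sup>+ x. ennreal (norm (f x) powr p) \<partial>lborel) + (\<integral>\<^sup>+ x. ennreal (norm (g x) powr p) \<partial>lborel))"
    by (simp add: nn_integral_cmult nn_integral_add)
  finally show ?thesis .
qed

lemma charge_heat_bound:
  assumes f: "Lp_mem p f" and p: "1 < p" and E: "0 < E" and s: "0 < s"
  shows "norm (charge E (\<lambda>s. heat f s 0) s) \<le> (12 * pi + 8 / (pi * (1 - 1 / p))) * Lp_norm p f * s powr (- (1 / p))"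
  by (rule charge_bound[OF E]) (use p s heat_bound[OF f p] in \<open>auto simp: heat_nonpos\<close>)

lemma hk_charge_le:
  assumes f: "Lp_mem p f" and p: "1 < p" and E: "0 < E"
  defines "M \<equiv> (12 * pi + 8 / (pi * (1 - 1 / p))) * Lp_norm p f"
  shows "hk (t - r) x * norm (charge E (\<lambda>s. heat f s 0) r) \<le> indicator {0<..<t} r * (M * (hk (t - r) x * r powr (- (1 / p))))"
proof (cases "r \<in> {0<..<t}")
  case True
  have "hk (t - r) x * norm (charge E (\<lambda>s. heat f s 0) r) \<le> hk (t - r) x * (M * r powr (- (1 / p)))"
    unfolding M_def using True by (intro mult_left_mono charge_heat_bound[OF f p E]) auto
  then show ?thesis using True by (simp add: mult_ac)
next
  case False
  then have 0: "hk (t - r) x * norm (charge E (\<lambda>s. heat f s 0) r) = 0" by (auto simp: charge_heat_nonpos not_less)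
  show ?thesis unfolding 0 using False by simp
qed

text \<open>At exponent 2 the charge is bounded by a multiple of \<open>s powr (- 1 / 2)\<close>,
  and the exponent \<open>1 - p * b - p * k\<close> of \<open>hk_hconv_Lp_bound\<close> becomes
  \<open>1 - 2 * (1 / 2) - 0 = 0\<close>. The singular part is therefore bounded uniformly in
  time.\<close>

lemma evol_L2_bound:
  assumes f: "Lp_mem 2 f" and E: "0 < E"
  obtains B where "0 \<le> B" "\<And>s. 0 < s \<Longrightarrow> (\<integral>\<^sup>+ x. ennreal (norm (evol E f s x) powr 2) \<partial>lborel) \<le> ennreal B"
proof -
  have [measurable]: "f \<in> borel_measurable borel" by (rule Lp_memD_measurable[OF f])
  have [measurable]: "charge E (\<lambda>s. heat f s 0) \<in> borel_measurable borel" by (rule charge_heat_measurable) simp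
  define M where "M = (12 * pi + 8 / (pi * (1 - 1 / 2))) * Lp_norm 2 f"
  have M: "0 \<le> M" by (simp add: M_def)
  obtain C where C: "0 \<le> C" "\<And>t M (g :: real \<Rightarrow> R2 \<Rightarrow> complex). 0 < t \<Longrightarrow> 0 \<le> M \<Longrightarrow>
     (\<And>\<tau> x. norm (g \<tau> x) \<le> indicator {0<..<t} \<tau> * (M * ((t - \<tau>) powr (- 0) * hk (1 * (t - \<tau>)) x * \<tau> powr (- (1/2))))) \<Longrightarrow>
     (\<integral>\<^sup>+ x. ennreal (norm (\<integral>\<tau>. g \<tau> x \<partial>lborel) powr 2) \<partial>lborel) \<le> ennreal (C * M powr 2 * t powr (1 - 2 * (1/2) - 2 * 0))"
    by (rule hk_hconv_Lp_bound[of 2 0 "1/2" 1]) auto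
  define V where "V s x = hconv (\<lambda>r. complex_of_real (hk r x)) (charge E (\<lambda>s. heat f s 0)) s" for s x
  have [measurable]: "V s \<in> borel_measurable borel" for s
    unfolding V_def hconv_def by (rule lborel.borel_measurable_lebesgue_integral) simp
  have V: "(\<integral>\<^sup>+ x. ennreal (norm (V s x) powr 2) \<partial>lborel) \<le> ennreal (C * M powr 2)" if s: "0 < s" for s
  proof -
    have "(\<integral>\<^sup>+ x. ennreal (norm (V s x) powr 2) \<partial>lborel) \<le> ennreal (C * M powr 2 * s powr (1 - 2 * (1/2) - 2 * 0))"
      unfolding V_def hconv_def
    proof (rule C(2)[OF s M])
      fix \<tau> x
      show "norm (complex_of_real (hk (s - \<tau>) x) * charge E (\<lambda>s. heat f s 0) \<tau>) \<le> indicator {0<..<s} \<tau> * (M * ((s - \<tau>) powr (- 0) * hk (1 * (s - \<tau>)) x * \<tau> powr (- (1/2))))"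
        using hk_charge_le[OF f _ E, of s \<tau> x] unfolding M_def by (cases "\<tau> \<in> {0<..<s}") (auto simp: norm_mult)
    qed
    then show ?thesis using s by simp
  qed
  show thesis
  proof
    show "0 \<le> 2 powr 2 * (Lp_norm 2 f powr 2 + C * M powr 2)" using C by auto
    fix s :: real assume s: "0 < s"
    have "(\<integral>\<^sup>+ x. ennreal (norm (evol E f s x) powr 2) \<partial>lborel)
       \<le> ennreal (2 powr 2) * ((\<integral>\<^sup>+ x. ennreal (norm (heat f s x) powr 2) \<partial>lborel) + (\<integral>\<^sup>+ x. ennreal (norm (V s x) powr 2) \<partial>lborel))"
      by (rule nn_integral_add_powr_le) (auto simp: evol_def V_def[symmetric] norm_triangle_ineq)
    also have "\<dots> \<le> ennreal (2 powr 2) * (ennreal (Lp_norm 2 f powr 2) + ennreal (C * M powr 2))"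
      using s by (intro mult_left_mono add_mono V heat_Lp[OF f]) auto
    also have "\<dots> = ennreal (2 powr 2 * (Lp_norm 2 f powr 2 + C * M powr 2))"
    proof -
      have "ennreal (Lp_norm 2 f powr 2) + ennreal (C * M powr 2) = ennreal (Lp_norm 2 f powr 2 + C * M powr 2)"
        using C(1) by (intro ennreal_plus[symmetric]) (auto simp del: powr_numeral)
      then show ?thesis by (simp only: ennreal_mult'[symmetric] powr_ge_zero)
    qed
    finally show "(\<integral>\<^sup>+ x. ennreal (norm (evol E f s x) powr 2) \<partial>lborel) \<le> ennreal (2 powr 2 * (Lp_norm 2 f powr 2 + C * M powr 2))" .
  qed
qed

section \<open>The Krein factor and the Laplace transform of the evolution\<close>

lemma Ealpha_pos [simp]: "0 < Ealpha alpha"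
  by (simp add: Ealpha_def)

text \<open>\<open>Ealpha alpha\<close> is the zero of \<open>alpha + cc l\<close>, and the slope in
  \<open>ln l\<close> is \<open>1 / (4 pi)\<close> because \<open>cc\<close> contains the logarithm
  of a square root.\<close>

lemma alpha_cc:
  assumes l: "0 < l"
  shows "alpha + cc l = ln (l / Ealpha alpha) / (4 * pi)"
proof -
  have "ln (l / Ealpha alpha) = ln l - (ln 4 + (- 4 * pi * alpha - 2 * euler_mascheroni))"
    using l by (simp add: ln_div ln_mult Ealpha_def)
  also have "ln 4 = 2 * ln (2::real)" using ln_realpow[of 2 2] by simp
  finally show ?thesis using l by (simp add: cc_def ln_sqrt field_simps)
qed

lemma alpha_cc_nonzero:
  assumes "0 < l" "l \<noteq> Ealpha alpha"
  shows "alpha + cc l \<noteq> 0"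
  unfolding alpha_cc[OF assms(1)] using assms Ealpha_pos[of alpha] by (simp add: ln_eq_zero_iff[of "l / Ealpha alpha"])

lemma laplace_class_evol:
  assumes f: "Lp_mem p f" and p: "1 < p" and E: "0 < E" and x: "x \<noteq> 0"
  shows "laplace_class (\<lambda>s. evol E f s x)"
  unfolding evol_def
  by (intro laplace_class_add laplace_class_heat[OF f p] laplace_class_hconv laplace_class_hk[OF x] laplace_class_charge E)

text \<open>Transforms turn the heat flow into the Green potential, the kernel \<open>hk r x\<close>
  into \<open>Gk l x\<close> and the charge into the Krein coefficient. Orthogonality to the
  eigenfunction says exactly that the transform of \<open>heat f s 0\<close> vanishes at
  \<open>Ealpha alpha\<close>.\<close>

lemma laplace_evol:
  assumes f: "Lp_mem p f" and p: "1 < p" and x: "x \<noteq> 0"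
    and orth: "(\<integral>y. complex_of_real (Gk (Ealpha alpha) y) * f y \<partial>lborel) = 0"
    and l: "0 < l" "l \<noteq> Ealpha alpha"
  shows "laplace (\<lambda>s. evol (Ealpha alpha) f s x) l = resolv alpha l f x"
proof -
  have G0: "laplace (\<lambda>s. heat f s 0) l = (\<integral>y. complex_of_real (Gk l y) * f y \<partial>lborel)" if "0 < l" for l
    using laplace_heat[OF f p that, of 0] by simp
  have "laplace (\<lambda>s. evol (Ealpha alpha) f s x) l = laplace (\<lambda>s. heat f s x) l + laplace (\<lambda>r. complex_of_real (hk r x)) l * laplace (charge (Ealpha alpha) (\<lambda>s. heat f s 0)) l"
    unfolding evol_def using l laplace_hconv[OF laplace_class_hk[OF x] laplace_class_charge[OF laplace_class_heat[OF f p] Ealpha_pos] l(1)]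
    by (subst laplace_add) (auto intro!: laplace_class_heat[OF f p] laplace_class_hconv laplace_class_hk[OF x] laplace_class_charge)
  also have "laplace (charge (Ealpha alpha) (\<lambda>s. heat f s 0)) l = (\<integral>y. complex_of_real (Gk l y) * f y \<partial>lborel) / complex_of_real (alpha + cc l)"
    unfolding alpha_cc[OF l(1)] G0[OF l(1), symmetric]
    by (rule laplace_charge) (use l orth G0[of "Ealpha alpha"] laplace_class_heat[OF f p] in auto)
  finally show ?thesis
    using laplace_heat[OF f p l(1), of x] laplace_hk[OF x l(1)] by (simp add: resolv_def mult.commute)
qed

section \<open>Resolvents of the evolution\<close>

text \<open>In the Laplace representation \<open>hk s x\<close> is written as
  \<open>s powr (- 1 / 2)\<close> times \<open>s powr (1 / 2) * hk s x\<close> before Jensen.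
  Integrating the \<open>p\<close>-th power in space leaves \<open>s powr ((1 - p) / 2)\<close>,
  integrable at 0 for \<open>p < 3\<close>; this covers 2 and every exponent between 1 and
  2.\<close>

lemma Gk_Lp:
  assumes l: "0 < l" and p: "1 < p" "p < 3"
  shows "(\<integral>\<^sup>+ x. ennreal (Gk l x powr p) \<partial>lborel) < \<infinity>"
proof -
  define w where "w s = indicator {0<..} s * (s powr (1 / 2 - 1) * exp (- l * s))" for s
  define F where "F x s = s powr (1 / 2) * hk s x" for x s
  have [measurable]: "w \<in> borel_measurable borel" unfolding w_def by measurable
  have [measurable]: "(\<lambda>z. F (fst z) (snd z)) \<in> borel_measurable (borel \<Otimes>\<^sub>M borel)" unfolding F_def by measurable
  have [measurable]: "F x \<in> borel_measurable borel" for x unfolding F_def by measurable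
  define W where "W = Gamma (1 / 2) / l powr (1 / 2)"
  have W: "0 < W" using l by (simp add: W_def)
  have wW: "(\<integral>\<^sup>+ s. ennreal (w s) \<partial>lborel) \<le> ennreal W"
  proof -
    have "(\<integral>\<^sup>+ s. ennreal (w s) \<partial>lborel) = (\<integral>\<^sup>+ s. ennreal (s powr (1 / 2 - 1) * exp (- l * s)) * indicator {0<..} s \<partial>lborel)"
      by (intro nn_integral_cong) (auto simp: w_def split: split_indicator)
    also have "\<dots> = ennreal W" unfolding W_def using l by (intro nn_integral_Gamma) auto
    finally show ?thesis by simp
  qed
  have "(\<integral>\<^sup>+ x. ennreal (Gk l x powr p) \<partial>lborel) \<le> (\<integral>\<^sup>+ x. ennreal (W powr (p - 1)) * (\<integral>\<^sup>+ s. ennreal (w s * F x s powr p) \<partial>lborel) \<partial>lborel)"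
  proof (rule nn_integral_mono_AE)
    show "AE x in lborel. ennreal (Gk l x powr p) \<le> ennreal (W powr (p - 1)) * (\<integral>\<^sup>+ s. ennreal (w s * F x s powr p) \<partial>lborel)"
      using AE_neq[of 0]
    proof eventually_elim
      case (elim x)
      have g: "norm (exp (- l * s) * hk s x) \<le> w s * F x s" for s
      proof (cases "0 < s")
        case True
        have "s powr (1 / 2 - 1) * s powr (1 / 2) = s powr 0" using powr_add[of s "1/2 - 1" "1/2"] by simp
        then have "s powr (1 / 2 - 1) * s powr (1 / 2) = 1" using True by simp
        then have "w s * F x s = exp (- l * s) * hk s x" using True by (simp add: w_def F_def)
        then show ?thesis by simp
      qed (simp add: w_def)
      have "ennreal (norm (\<integral>s. exp (- l * s) * hk s x \<partial>lborel) powr p) \<le> ennreal (W powr (p - 1)) * (\<integral>\<^sup>+ s. ennreal (w s * F x s powr p) \<partial>lborel)"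
        by (rule integral_Jensen_powr[OF _ _ _ _ p(1) W wW g]) (auto simp: w_def F_def)
      moreover have "(\<integral>s. exp (- l * s) * hk s x \<partial>lborel) = Gk l x"
        using Gk_laplace[OF l elim] by (subst integral_eq_nn_integral) auto
      ultimately show ?case by simp
    qed
  qed
  also have "\<dots> = ennreal (W powr (p - 1)) * (\<integral>\<^sup>+ s. \<integral>\<^sup>+ x. ennreal (w s * F x s powr p) \<partial>lborel \<partial>lborel)"
    by (subst nn_integral_cmult, simp, subst lborel_Tonelli) auto
  also have "(\<integral>\<^sup>+ s. \<integral>\<^sup>+ x. ennreal (w s * F x s powr p) \<partial>lborel \<partial>lborel)
     = (\<integral>\<^sup>+ s. ennreal ((4 * pi) powr (1 - p) / p) * (ennreal (s powr ((3 - p) / 2 - 1) * exp (- l * s)) * indicator {0<..} s) \<partial>lborel)"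
  proof (intro nn_integral_cong)
    fix s :: real
    show "(\<integral>\<^sup>+ x. ennreal (w s * F x s powr p) \<partial>lborel) = ennreal ((4 * pi) powr (1 - p) / p) * (ennreal (s powr ((3 - p) / 2 - 1) * exp (- l * s)) * indicator {0<..} s)"
    proof (cases "0 < s")
      case True
      have "w s * F x s powr p = (s powr (1 / 2 - 1) * exp (- l * s) * s powr (1 / 2 * p)) * hk s x powr p" for x
        using True by (simp add: w_def F_def powr_mult powr_powr)
      then have "(\<integral>\<^sup>+ x. ennreal (w s * F x s powr p) \<partial>lborel) = (\<integral>\<^sup>+ x. ennreal (s powr (1 / 2 - 1) * exp (- l * s) * s powr (1 / 2 * p)) * ennreal (hk s x powr p) \<partial>lborel)"
        by (simp only: ennreal_mult'[symmetric] zero_le_mult_iff powr_ge_zero exp_ge_zero) (simp add: ennreal_mult'[symmetric])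
      also have "\<dots> = ennreal (s powr (1 / 2 - 1) * exp (- l * s) * s powr (1 / 2 * p)) * ennreal ((4 * pi * s) powr (1 - p) / p)"
        using True p by (subst nn_integral_cmult, simp, subst nn_integral_hk_powr) auto
      also have "\<dots> = ennreal (s powr (1 / 2 - 1) * exp (- l * s) * s powr (1 / 2 * p) * ((4 * pi * s) powr (1 - p) / p))"
        by (rule ennreal_mult'[symmetric]) auto
      also have "s powr (1 / 2 - 1) * exp (- l * s) * s powr (1 / 2 * p) * ((4 * pi * s) powr (1 - p) / p)
         = (4 * pi) powr (1 - p) / p * ((s powr (1 / 2 - 1) * s powr (1 / 2 * p) * s powr (1 - p)) * exp (- l * s))"
      proof -
        have "(4 * pi * s) powr (1 - p) = (4 * pi) powr (1 - p) * s powr (1 - p)"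
          using True by (subst powr_mult[symmetric]) (auto simp: mult_ac)
        then show ?thesis by (simp add: mult_ac)
      qed
      also have "s powr (1 / 2 - 1) * s powr (1 / 2 * p) * s powr (1 - p) = s powr ((3 - p) / 2 - 1)"
      proof -
        have "1 / 2 - 1 + 1 / 2 * p + (1 - p) = (3 - p) / 2 - 1" by (simp add: field_simps)
        then show ?thesis unfolding powr_add[symmetric] by (simp only:)
      qed
      finally show ?thesis using True p by (simp add: ennreal_mult'[symmetric])
    qed (simp add: w_def)
  qed
  also have "\<dots> = ennreal ((4 * pi) powr (1 - p) / p) * ennreal (Gamma ((3 - p) / 2) / l powr ((3 - p) / 2))"
    using p l by (subst nn_integral_cmult, simp, subst nn_integral_Gamma) auto
  also have "ennreal (W powr (p - 1)) * \<dots> < \<infinity>" by (simp add: ennreal_mult_less_top)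
  finally show ?thesis .
qed

text \<open>Where this is applied only finiteness is at stake, so the inequality between a product
  and the sum of squares takes the place of Cauchy--Schwarz.\<close>

lemma L2_mult_nn_bound:
  fixes g :: "R2 \<Rightarrow> real" and h :: "R2 \<Rightarrow> complex"
  assumes [measurable]: "g \<in> borel_measurable borel" "h \<in> borel_measurable borel" and g: "\<And>y. 0 \<le> g y"
  shows "(\<integral>\<^sup>+ y. ennreal (g y * norm (h y)) \<partial>lborel) \<le> (\<integral>\<^sup>+ y. ennreal (g y powr 2) \<partial>lborel) + (\<integral>\<^sup>+ y. ennreal (norm (h y) powr 2) \<partial>lborel)"
proof -
  have "(\<integral>\<^sup>+ y. ennreal (g y * norm (h y)) \<partial>lborel) \<le> (\<integral>\<^sup>+ y. ennreal (g y powr 2) + ennreal (norm (h y) powr 2) \<partial>lborel)"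
  proof (rule nn_integral_mono)
    fix y
    have "2 * (g y * norm (h y)) \<le> g y ^ 2 + norm (h y) ^ 2" using sum_squares_bound[of "g y" "norm (h y)"] by simp
    moreover have "0 \<le> g y * norm (h y)" using g by simp
    ultimately have "g y * norm (h y) \<le> g y ^ 2 + norm (h y) ^ 2" by linarith
    then have "g y * norm (h y) \<le> g y powr 2 + norm (h y) powr 2" using g by (simp add: powr_numeral)
    then show "ennreal (g y * norm (h y)) \<le> ennreal (g y powr 2) + ennreal (norm (h y) powr 2)"
      by (simp add: ennreal_plus[symmetric] ennreal_leI del: ennreal_plus powr_numeral)
  qed
  then show ?thesis by (simp add: nn_integral_add)
qed

lemma nn_integral_Gk_shift_L2: "(\<integral>\<^sup>+ y. ennreal (Gk l (x - y) powr 2) \<partial>lborel) = (\<integral>\<^sup>+ y. ennreal (Gk l y powr 2) \<partial>lborel)"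
  using nn_integral_lborel_reflect[of "\<lambda>y. ennreal (Gk l y powr 2)" x] by simp

text \<open>The bound of \<open>evol_L2_bound\<close> does not depend on \<open>s\<close>, so any
  finite nonnegative weight in time can be exchanged with the pairing against a square-integrable
  Green function.\<close>

lemma
  assumes f: "Lp_mem 2 f" and E: "0 < E" and m: "0 < m"
    and [measurable]: "\<omega> \<in> borel_measurable borel" and w: "\<And>s. 0 \<le> \<omega> s" "(\<integral>\<^sup>+ s. ennreal (\<omega> s) \<partial>lborel) < \<infinity>"
  shows Gk_time_average: "(\<integral>y. complex_of_real (Gk m (x - y)) * (\<integral>s. complex_of_real (\<omega> s) * evol E f s y \<partial>lborel) \<partial>lborel)
      = (\<integral>s. complex_of_real (\<omega> s) * (\<integral>y. complex_of_real (Gk m (x - y)) * evol E f s y \<partial>lborel) \<partial>lborel)"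
    and Gk_time_average_integrable: "integrable lborel (\<lambda>s. complex_of_real (\<omega> s) * (\<integral>y. complex_of_real (Gk m (x - y)) * evol E f s y \<partial>lborel))"
proof -
  have [measurable]: "f \<in> borel_measurable borel" by (rule Lp_memD_measurable[OF f])
  obtain B where B: "0 \<le> B" "\<And>s. 0 < s \<Longrightarrow> (\<integral>\<^sup>+ x. ennreal (norm (evol E f s x) powr 2) \<partial>lborel) \<le> ennreal B"
    using evol_L2_bound[OF f E] by blast
  define g where "g s y = complex_of_real (\<omega> s) * (complex_of_real (Gk m (x - y)) * evol E f s y)" for s y
  have [measurable]: "case_prod g \<in> borel_measurable (lborel \<Otimes>\<^sub>M lborel)" unfolding g_def by measurable
  define K where "K = (\<integral>\<^sup>+ y. ennreal (Gk m y powr 2) \<partial>lborel) + ennreal B"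
  have K: "K < \<infinity>" unfolding K_def using Gk_Lp[OF m, of 2] by simp
  have fin: "(\<integral>\<^sup>+ s. \<integral>\<^sup>+ y. ennreal (norm (g s y)) \<partial>lborel \<partial>lborel) < \<infinity>"
  proof -
    have "(\<integral>\<^sup>+ s. \<integral>\<^sup>+ y. ennreal (norm (g s y)) \<partial>lborel \<partial>lborel) \<le> (\<integral>\<^sup>+ s. ennreal (\<omega> s) * K \<partial>lborel)"
    proof (rule nn_integral_mono)
      fix s :: real
      have "(\<integral>\<^sup>+ y. ennreal (norm (g s y)) \<partial>lborel) = (\<integral>\<^sup>+ y. ennreal (\<omega> s) * ennreal (Gk m (x - y) * norm (evol E f s y)) \<partial>lborel)"
        using w(1) by (intro nn_integral_cong) (simp add: g_def norm_mult ennreal_mult'[symmetric])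
      also have "\<dots> = ennreal (\<omega> s) * (\<integral>\<^sup>+ y. ennreal (Gk m (x - y) * norm (evol E f s y)) \<partial>lborel)"
        by (intro nn_integral_cmult) simp
      also have "\<dots> \<le> ennreal (\<omega> s) * K"
      proof (intro mult_left_mono)
        have "(\<integral>\<^sup>+ y. ennreal (Gk m (x - y) * norm (evol E f s y)) \<partial>lborel) \<le> (\<integral>\<^sup>+ y. ennreal (Gk m (x - y) powr 2) \<partial>lborel) + (\<integral>\<^sup>+ y. ennreal (norm (evol E f s y) powr 2) \<partial>lborel)"
          by (rule L2_mult_nn_bound) auto
        also have "\<dots> \<le> K" unfolding K_def nn_integral_Gk_shift_L2
          using B by (intro add_left_mono) (cases "0 < s"; simp add: evol_nonpos)
        finally show "(\<integral>\<^sup>+ y. ennreal (Gk m (x - y) * norm (evol E f s y)) \<partial>lborel) \<le> K" .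
      qed simp
      finally show "(\<integral>\<^sup>+ y. ennreal (norm (g s y)) \<partial>lborel) \<le> ennreal (\<omega> s) * K" .
    qed
    also have "\<dots> = (\<integral>\<^sup>+ s. ennreal (\<omega> s) \<partial>lborel) * K" by (intro nn_integral_multc) simp
    also have "\<dots> < \<infinity>" using w K by (simp add: ennreal_mult_less_top)
    finally show ?thesis .
  qed
  have eq: "(\<integral>y. g s y \<partial>lborel) = complex_of_real (\<omega> s) * (\<integral>y. complex_of_real (Gk m (x - y)) * evol E f s y \<partial>lborel)" for s
    unfolding g_def by (rule integral_mult_right_zero)
  have eq2: "(\<integral>s. g s y \<partial>lborel) = complex_of_real (Gk m (x - y)) * (\<integral>s. complex_of_real (\<omega> s) * evol E f s y \<partial>lborel)" for y
  proof -
    have "(\<integral>s. g s y \<partial>lborel) = (\<integral>s. complex_of_real (Gk m (x - y)) * (complex_of_real (\<omega> s) * evol E f s y) \<partial>lborel)"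
      unfolding g_def by (intro Bochner_Integration.integral_cong) (simp_all add: mult_ac)
    then show ?thesis by simp
  qed
  show "(\<integral>y. complex_of_real (Gk m (x - y)) * (\<integral>s. complex_of_real (\<omega> s) * evol E f s y \<partial>lborel) \<partial>lborel)
      = (\<integral>s. complex_of_real (\<omega> s) * (\<integral>y. complex_of_real (Gk m (x - y)) * evol E f s y \<partial>lborel) \<partial>lborel)"
    unfolding eq[symmetric] eq2[symmetric] using fin by (intro lborel_Fubini(1)[symmetric]) auto
  show "integrable lborel (\<lambda>s. complex_of_real (\<omega> s) * (\<integral>y. complex_of_real (Gk m (x - y)) * evol E f s y \<partial>lborel))"
    unfolding eq[symmetric] using fin by (intro lborel_Fubini(2)) auto
qed

text \<open>Both integrals in Krein's formula, the potential at \<open>x\<close> and the one at 0,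
  are instances of \<open>Gk_time_average\<close>; the rest is linear.\<close>

lemma resolv_time_average:
  assumes f: "Lp_mem 2 f" and E: "0 < E" and m: "0 < m"
    and w: "\<omega> \<in> borel_measurable borel" "\<And>s. 0 \<le> \<omega> s" "(\<integral>\<^sup>+ s. ennreal (\<omega> s) \<partial>lborel) < \<infinity>"
  shows "resolv alpha m (\<lambda>y. \<integral>s. complex_of_real (\<omega> s) * evol E f s y \<partial>lborel) x
     = (\<integral>s. complex_of_real (\<omega> s) * resolv alpha m (evol E f s) x \<partial>lborel)" (is "?L = ?R")
    and "integrable lborel (\<lambda>s. complex_of_real (\<omega> s) * resolv alpha m (evol E f s) x)"
proof -
  define J where "J x s = complex_of_real (\<omega> s) * (\<integral>y. complex_of_real (Gk m (x - y)) * evol E f s y \<partial>lborel)" for x s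
  define D where "D = complex_of_real (alpha + cc m)"
  have Ji: "integrable lborel (J x)" for x unfolding J_def by (rule Gk_time_average_integrable[OF f E m w])
  have Jx: "(\<integral>y. complex_of_real (Gk m (x - y)) * (\<integral>s. complex_of_real (\<omega> s) * evol E f s y \<partial>lborel) \<partial>lborel) = integral\<^sup>L lborel (J x)" for x
    unfolding J_def by (rule Gk_time_average[OF f E m w])
  have res: "complex_of_real (\<omega> s) * resolv alpha m (evol E f s) x = J x s + J 0 s / D * complex_of_real (Gk m x)" for s
    unfolding resolv_def J_def D_def by (simp add: distrib_left)
  show "integrable lborel (\<lambda>s. complex_of_real (\<omega> s) * resolv alpha m (evol E f s) x)"
    unfolding res using Ji by (intro Bochner_Integration.integrable_add) auto
  have "?R = integral\<^sup>L lborel (J x) + integral\<^sup>L lborel (J 0) / D * complex_of_real (Gk m x)"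
    unfolding res using Ji by (subst Bochner_Integration.integral_add) auto
  also have "\<dots> = ?L" unfolding resolv_def D_def[symmetric] using Jx[of x] Jx[of 0] by simp
  finally show "?L = ?R" by simp
qed

section \<open>The resolvent identity for Krein's formula\<close>

lemma
  assumes f: "Lp_mem 2 f" and lm: "0 < l" "0 < m" "l \<noteq> m"
  shows Gk_Gk_conv: "(\<integral>y. complex_of_real (Gk m (x - y)) * (\<integral>z. complex_of_real (Gk l (y - z)) * f z \<partial>lborel) \<partial>lborel)
      = ((\<integral>z. complex_of_real (Gk l (x - z)) * f z \<partial>lborel) - (\<integral>z. complex_of_real (Gk m (x - z)) * f z \<partial>lborel)) / complex_of_real (m - l)"
    and Gk_Gk_conv_integrable: "integrable lborel (\<lambda>y. complex_of_real (Gk m (x - y)) * (\<integral>z. complex_of_real (Gk l (y - z)) * f z \<partial>lborel))"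
proof -
  have [measurable]: "f \<in> borel_measurable borel" by (rule Lp_memD_measurable[OF f])
  define g where "g y z = complex_of_real (Gk m (x - y) * Gk l (y - z)) * f z" for y z
  have [measurable]: "case_prod g \<in> borel_measurable (lborel \<Otimes>\<^sub>M lborel)" unfolding g_def by measurable
  have G: "(\<integral>\<^sup>+ y. ennreal (Gk m (x - y) * Gk l (y - z)) \<partial>lborel) = ennreal ((Gk l (x - z) - Gk m (x - z)) / (m - l))" if "z \<noteq> x" for z
  proof -
    have "(\<integral>\<^sup>+ y. ennreal (Gk m (x - y) * Gk l (y - z)) \<partial>lborel) = (\<integral>\<^sup>+ y. ennreal (Gk m (x - (z + y)) * Gk l (z + y - z)) \<partial>lborel)"
      by (rule nn_integral_lborel_shift[symmetric]) simp
    also have "\<dots> = (\<integral>\<^sup>+ y. ennreal (Gk m ((x - z) - y) * Gk l y) \<partial>lborel)" by (simp add: algebra_simps)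
    also have "\<dots> = ennreal ((Gk l (x - z) - Gk m (x - z)) / (m - l))"
      using that by (simp add: nn_integral_Gk_conv[OF lm] nn_integral_exp_diff_hk[OF lm])
    finally show ?thesis .
  qed
  have Gnn: "0 \<le> (Gk l (x - z) - Gk m (x - z)) / (m - l)" if "z \<noteq> x" for z
    using that by (intro nn_integral_exp_diff_hk(2)[OF lm]) auto
  have i: "integrable lborel (\<lambda>z. complex_of_real (Gk l (x - z)) * f z)" "integrable lborel (\<lambda>z. complex_of_real (Gk m (x - z)) * f z)"
    using Gk_integrable[OF f] lm by auto
  define H where "H z = (complex_of_real (Gk l (x - z)) * f z - complex_of_real (Gk m (x - z)) * f z) / complex_of_real (m - l)" for z
  have H: "integrable lborel H" unfolding H_def using i by auto
  \<comment> \<open>The divided difference of Green functions is nonnegative, so the double integral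
    of the norms equals the integral of \<open>norm (H z)\<close>, already known to be
    finite.\<close>
  have fin: "(\<integral>\<^sup>+ y. \<integral>\<^sup>+ z. ennreal (norm (g y z)) \<partial>lborel \<partial>lborel) < \<infinity>"
  proof -
    have "(\<integral>\<^sup>+ y. \<integral>\<^sup>+ z. ennreal (norm (g y z)) \<partial>lborel \<partial>lborel) = (\<integral>\<^sup>+ z. \<integral>\<^sup>+ y. ennreal (norm (g y z)) \<partial>lborel \<partial>lborel)"
      by (rule lborel_Tonelli) measurable
    also have "\<dots> = (\<integral>\<^sup>+ z. ennreal (norm (H z)) \<partial>lborel)"
    proof (rule nn_integral_cong_AE)
      show "AE z in lborel. (\<integral>\<^sup>+ y. ennreal (norm (g y z)) \<partial>lborel) = ennreal (norm (H z))"
        using AE_neq[of x]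
      proof eventually_elim
        case (elim z)
        have "(\<integral>\<^sup>+ y. ennreal (norm (g y z)) \<partial>lborel) = (\<integral>\<^sup>+ y. ennreal (Gk m (x - y) * Gk l (y - z)) * ennreal (norm (f z)) \<partial>lborel)"
          by (intro nn_integral_cong) (simp add: g_def norm_mult ennreal_mult'[symmetric])
        also have "\<dots> = ennreal ((Gk l (x - z) - Gk m (x - z)) / (m - l)) * ennreal (norm (f z))"
          using G[OF elim] by (subst nn_integral_multc) auto
        also have "\<dots> = ennreal (((Gk l (x - z) - Gk m (x - z)) / (m - l)) * norm (f z))"
          using Gnn[OF elim] by (intro ennreal_mult'[symmetric])
        also have "((Gk l (x - z) - Gk m (x - z)) / (m - l)) * norm (f z) = norm (H z)"
        proof -
          have "H z = complex_of_real ((Gk l (x - z) - Gk m (x - z)) / (m - l)) * f z"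
            by (simp add: H_def left_diff_distrib)
          then show ?thesis using Gnn[OF elim] by (simp only: norm_mult norm_of_real abs_of_nonneg)
        qed
        finally show ?case .
      qed
    qed
    also have "\<dots> < \<infinity>" using H by (simp add: integrable_iff_bounded)
    finally show ?thesis .
  qed
  have eq: "(\<integral>z. g y z \<partial>lborel) = complex_of_real (Gk m (x - y)) * (\<integral>z. complex_of_real (Gk l (y - z)) * f z \<partial>lborel)" for y
    unfolding g_def of_real_mult mult.assoc by (rule integral_mult_right_zero)
  show "integrable lborel (\<lambda>y. complex_of_real (Gk m (x - y)) * (\<integral>z. complex_of_real (Gk l (y - z)) * f z \<partial>lborel))"
    unfolding eq[symmetric] using fin by (intro lborel_Fubini(2)) auto
  have "(\<integral>y. complex_of_real (Gk m (x - y)) * (\<integral>z. complex_of_real (Gk l (y - z)) * f z \<partial>lborel) \<partial>lborel) = (\<integral>y. \<integral>z. g y z \<partial>lborel \<partial>lborel)"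
    unfolding eq ..
  also have "\<dots> = (\<integral>z. \<integral>y. g y z \<partial>lborel \<partial>lborel)" using fin by (intro lborel_Fubini(1)) auto
  also have "\<dots> = (\<integral>z. H z \<partial>lborel)"
  proof (rule integral_cong_AE)
    show "AE z in lborel. (\<integral>y. g y z \<partial>lborel) = H z"
      using AE_neq[of x]
    proof eventually_elim
      case (elim z)
      have "(\<integral>y. g y z \<partial>lborel) = (\<integral>y. complex_of_real (Gk m (x - y) * Gk l (y - z)) \<partial>lborel) * f z"
        unfolding g_def by (rule integral_mult_left_zero)
      also have "(\<integral>y. complex_of_real (Gk m (x - y) * Gk l (y - z)) \<partial>lborel) = complex_of_real ((Gk l (x - z) - Gk m (x - z)) / (m - l))"
        unfolding integral_complex_of_real using G[OF elim] Gnn[OF elim] by (subst integral_eq_nn_integral) auto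
      finally show ?case by (simp add: H_def left_diff_distrib)
    qed
  qed (auto simp: H_def g_def)
  also have "\<dots> = ((\<integral>z. complex_of_real (Gk l (x - z)) * f z \<partial>lborel) - (\<integral>z. complex_of_real (Gk m (x - z)) * f z \<partial>lborel)) / complex_of_real (m - l)"
    unfolding H_def using i by simp
  finally show "(\<integral>y. complex_of_real (Gk m (x - y)) * (\<integral>z. complex_of_real (Gk l (y - z)) * f z \<partial>lborel) \<partial>lborel)
      = ((\<integral>z. complex_of_real (Gk l (x - z)) * f z \<partial>lborel) - (\<integral>z. complex_of_real (Gk m (x - z)) * f z \<partial>lborel)) / complex_of_real (m - l)" .
qed

lemma
  assumes lm: "0 < l" "0 < m" "l \<noteq> m"
  shows Gk_conv: "x \<noteq> 0 \<Longrightarrow> (\<integral>y. complex_of_real (Gk m (x - y)) * complex_of_real (Gk l y) \<partial>lborel) = complex_of_real ((Gk l x - Gk m x) / (m - l))"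
    and Gk_conv_0: "(\<integral>y. complex_of_real (Gk m (0 - y)) * complex_of_real (Gk l y) \<partial>lborel) = complex_of_real ((cc m - cc l) / (m - l))"
    and Gk_conv_integrable: "integrable lborel (\<lambda>y. complex_of_real (Gk m (x - y)) * complex_of_real (Gk l y))"
proof -
  have i: "integrable lborel (\<lambda>y. Gk m (x - y) * Gk l y)" for x
    using nn_integral_Gk_conv[OF lm, of x] nn_integral_exp_diff_hk[OF lm, of x] nn_integral_exp_diff_hk_0[OF lm]
    by (intro integrableI_nonneg) (auto, cases "x = 0", auto)
  then show "integrable lborel (\<lambda>y. complex_of_real (Gk m (x - y)) * complex_of_real (Gk l y))"
    unfolding of_real_mult[symmetric] by (intro integrable_of_real)
  show "(\<integral>y. complex_of_real (Gk m (x - y)) * complex_of_real (Gk l y) \<partial>lborel) = complex_of_real ((Gk l x - Gk m x) / (m - l))" if "x \<noteq> 0"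
    unfolding of_real_mult[symmetric] integral_complex_of_real
    using nn_integral_Gk_conv[OF lm, of x] nn_integral_exp_diff_hk[OF lm that] by (subst integral_eq_nn_integral) auto
  have "0 \<le> (cc m - cc l) / (m - l)"
  proof -
    have "0 \<le> (ln m - ln l) / (m - l)" using lm by (cases "l < m") (auto simp: zero_le_divide_iff)
    then have "0 \<le> (ln m - ln l) / (m - l) / (4 * pi)" by (rule divide_nonneg_nonneg) simp
    moreover have "(cc m - cc l) / (m - l) = (ln m - ln l) / (m - l) / (4 * pi)"
      using lm by (simp add: cc_def ln_sqrt field_simps)
    ultimately show ?thesis by simp
  qed
  then show "(\<integral>y. complex_of_real (Gk m (0 - y)) * complex_of_real (Gk l y) \<partial>lborel) = complex_of_real ((cc m - cc l) / (m - l))"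
    unfolding of_real_mult[symmetric] integral_complex_of_real
    using nn_integral_Gk_conv[OF lm, of 0] nn_integral_exp_diff_hk_0[OF lm] by (subst integral_eq_nn_integral) auto
qed

text \<open>The free part obeys the identity by \<open>Gk_Gk_conv\<close>. The rank-one terms close
  up because the convolution of \<open>Gk m\<close> and \<open>Gk l\<close> at the origin is
  \<open>(cc m - cc l) / (m - l)\<close>, the difference quotient of the Krein denominators.\<close>

lemma resolvent_identity:
  assumes f: "Lp_mem 2 f" and lm: "0 < l" "0 < m" "l \<noteq> m" and D: "alpha + cc l \<noteq> 0" "alpha + cc m \<noteq> 0" and x: "x \<noteq> 0"
  shows "resolv alpha m (resolv alpha l f) x = (resolv alpha l f x - resolv alpha m f x) / complex_of_real (m - l)"
proof -
  define P where "P l x = (\<integral>z. complex_of_real (Gk l (x - z)) * f z \<partial>lborel)" for l x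
  define d where "d = complex_of_real (m - l)"
  define Dl where "Dl = complex_of_real (alpha + cc l)"
  define Dm where "Dm = complex_of_real (alpha + cc m)"
  have nz: "d \<noteq> 0" "Dl \<noteq> 0" "Dm \<noteq> 0" using lm D by (auto simp: d_def Dl_def Dm_def simp del: of_real_diff of_real_add)
  have P0: "(\<integral>z. complex_of_real (Gk l z) * f z \<partial>lborel) = P l 0" for l by (simp add: P_def)
  have r: "resolv alpha l f x = P l x + P l 0 / complex_of_real (alpha + cc l) * complex_of_real (Gk l x)" for l x
    unfolding resolv_def P0 by (simp add: P_def)
  have int: "(\<integral>y. complex_of_real (Gk m (x - y)) * resolv alpha l f y \<partial>lborel)
     = (P l x - P m x) / d + P l 0 / Dl * (\<integral>y. complex_of_real (Gk m (x - y)) * complex_of_real (Gk l y) \<partial>lborel)" for x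
  proof -
    have "(\<integral>y. complex_of_real (Gk m (x - y)) * resolv alpha l f y \<partial>lborel)
       = (\<integral>y. complex_of_real (Gk m (x - y)) * P l y + P l 0 / Dl * (complex_of_real (Gk m (x - y)) * complex_of_real (Gk l y)) \<partial>lborel)"
      unfolding r Dl_def by (intro Bochner_Integration.integral_cong) (simp_all add: distrib_left mult_ac)
    also have "\<dots> = (\<integral>y. complex_of_real (Gk m (x - y)) * P l y \<partial>lborel) + P l 0 / Dl * (\<integral>y. complex_of_real (Gk m (x - y)) * complex_of_real (Gk l y) \<partial>lborel)"
      using Gk_Gk_conv_integrable[OF f lm, of x] Gk_conv_integrable[OF lm, of x] unfolding P_def
      by (subst Bochner_Integration.integral_add) auto
    finally show ?thesis using Gk_Gk_conv[OF f lm, of x] by (simp add: P_def d_def)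
  qed
  have "(\<integral>y. complex_of_real (Gk m y) * resolv alpha l f y \<partial>lborel) = (P l 0 - P m 0) / d + P l 0 / Dl * ((Dm - Dl) / d)"
    using int[of 0] Gk_conv_0[OF lm] by (simp add: Dm_def Dl_def d_def)
  then have "resolv alpha m (resolv alpha l f) x = (P l x - P m x) / d + P l 0 / Dl * ((complex_of_real (Gk l x) - complex_of_real (Gk m x)) / d)
     + ((P l 0 - P m 0) / d + P l 0 / Dl * ((Dm - Dl) / d)) / Dm * complex_of_real (Gk m x)"
    unfolding resolv_def[of alpha m "resolv alpha l f" x] int Gk_conv[OF lm x] Dm_def[symmetric] by (simp add: d_def)
  also have "\<dots> = (P l x + P l 0 / Dl * complex_of_real (Gk l x) - (P m x + P m 0 / Dm * complex_of_real (Gk m x))) / d"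
    using nz by (simp add: divide_simps) (simp add: algebra_simps)
  finally show ?thesis unfolding r Dl_def Dm_def d_def .
qed

text \<open>Iterates and time averages are compared only off the origin, so the resolvent must not
  see null sets.\<close>

lemma resolv_cong_AE:
  assumes "AE y in lborel. f y = g y" "f \<in> borel_measurable borel" "g \<in> borel_measurable borel"
  shows "resolv alpha l f x = resolv alpha l g x"
proof -
  have "(\<integral>y. complex_of_real (Gk l (x - y)) * f y \<partial>lborel) = (\<integral>y. complex_of_real (Gk l (x - y)) * g y \<partial>lborel)" for x
    using assms by (intro integral_cong_AE) auto
  from this[of x] this[of 0] show ?thesis by (simp add: resolv_def)
qed

lemma resolv_measurable [measurable]:
  assumes [measurable]: "f \<in> borel_measurable borel"
  shows "resolv alpha l f \<in> borel_measurable borel"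
proof -
  have [measurable]: "(\<lambda>x. \<integral>y. complex_of_real (Gk l (x - y)) * f y \<partial>lborel) \<in> borel_measurable borel"
    by (rule lborel.borel_measurable_lebesgue_integral) simp
  show ?thesis unfolding resolv_def[abs_def] by measurable
qed

lemma erlang_nonneg: "0 < m \<Longrightarrow> 0 \<le> erlang_density k m s"
  by (simp add: erlang_density_def)

lemma nn_integral_erlang: "0 < m \<Longrightarrow> (\<integral>\<^sup>+ s. ennreal (erlang_density k m s) \<partial>lborel) = 1"
  using nn_integral_erlang_ith_moment[of m k 0] by simp

text \<open>The identity \<open>resolv m (evol s) = shift_resolvent m evol s\<close> is only needed against Erlang densities,
  where it follows from equality of Laplace transforms in \<open>s\<close>, which is the resolvent identity.\<close>
lemma resolv_erlang_step:
  assumes f: "Lp_mem 2 f" and orth: "(\<integral>y. complex_of_real (Gk (Ealpha alpha) y) * f y \<partial>lborel) = 0"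
    and m: "0 < m" "m \<noteq> Ealpha alpha" and x: "x \<noteq> 0"
  defines "E \<equiv> Ealpha alpha"
  shows "complex_of_real m * resolv alpha m (\<lambda>y. \<integral>s. complex_of_real (erlang_density k m s) * evol E f s y \<partial>lborel) x
     = (\<integral>s. complex_of_real (erlang_density (Suc k) m s) * evol E f s x \<partial>lborel)"
proof -
  have [measurable]: "f \<in> borel_measurable borel" by (rule Lp_memD_measurable[OF f])
  have E: "0 < E" by (simp add: E_def)
  define A where "A s = resolv alpha m (evol E f s) x" for s
  \<comment> \<open>What \<open>A\<close> ought to be: on an orbit of the evolution the resolvent
    should act as the resolvent of time translation.\<close>
  define S where "S = shift_resolvent m (\<lambda>s. evol E f s x)"
  have cl: "laplace_class (\<lambda>s. evol E f s y)" if "y \<noteq> 0" for y by (rule laplace_class_evol[OF f _ E that]) simp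
  have Scl: "laplace_class S" unfolding S_def by (rule laplace_class_shift_resolvent[OF cl[OF x] m(1)])
  have A0: "A s = 0" if "s \<le> 0" for s using that by (simp add: A_def resolv_def evol_nonpos)
  \<comment> \<open>The exponential cut off at 0, of finite mass as
    \<open>resolv_time_average\<close> requires. Against functions vanishing for
    \<open>s \<le> 0\<close> it acts like \<open>exp (- l * s)\<close>.\<close>
  define w where "w l s = indicator {0<..} s * exp (- l * s)" for l s :: real
  have wm: "w l \<in> borel_measurable borel" for l unfolding w_def by measurable
  have wn: "0 \<le> w l s" for l s by (simp add: w_def)
  have wi: "(\<integral>\<^sup>+ s. ennreal (w l s) \<partial>lborel) < \<infinity>" if "0 < l" for l
  proof -
    have "(\<integral>\<^sup>+ s. ennreal (w l s) \<partial>lborel) = (\<integral>\<^sup>+ s. ennreal (exp (- l * s)) * indicator {0<..} s \<partial>lborel)"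
      by (intro nn_integral_cong) (auto simp: w_def split: split_indicator)
    then show ?thesis using nn_integral_exp_decay[OF that] by simp
  qed
  have wv: "complex_of_real (w l s) * v = complex_of_real (exp (- l * s)) * v" if "s \<le> 0 \<Longrightarrow> v = 0" for l s v
    using that by (cases "0 < s") (auto simp: w_def)
  have Am: "A \<in> borel_measurable borel"
  proof -
    have [measurable]: "(\<lambda>s. \<integral>y. complex_of_real (Gk m (x - y)) * evol E f s y \<partial>lborel) \<in> borel_measurable borel" for x
      by (rule lborel.borel_measurable_lebesgue_integral) simp
    have [measurable]: "(\<lambda>s. \<integral>y. complex_of_real (Gk m y) * evol E f s y \<partial>lborel) \<in> borel_measurable borel"
      by (rule lborel.borel_measurable_lebesgue_integral) simp
    show ?thesis unfolding A_def resolv_def by measurable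
  qed
  have Acl: "laplace_class A"
    unfolding laplace_class_def
  proof (intro conjI allI impI Am A0)
    fix e :: real assume e: "0 < e"
    have "integrable lborel (\<lambda>s. complex_of_real (w e s) * A s)"
      unfolding A_def by (rule resolv_time_average(2)[OF f E m(1) wm wn wi[OF e]])
    then have "(\<integral>\<^sup>+ s. ennreal (norm (complex_of_real (exp (- e * s)) * A s)) \<partial>lborel) < \<infinity>"
      using A0 by (simp add: wv integrable_iff_bounded)
    then show "(\<integral>\<^sup>+ s. ennreal (exp (- e * s) * norm (A s)) \<partial>lborel) < \<infinity>" by (simp add: norm_mult)
  qed
  \<comment> \<open>Excluded are \<open>l = m\<close>, where the divided differences degenerate, and
    \<open>l = E\<close>, where the Krein denominator vanishes.\<close>
  have lapA: "laplace A l = laplace S l" if l: "0 < l" "l \<notin> {m, E}" for l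
  proof -
    have ev: "(\<integral>s. complex_of_real (w l s) * evol E f s y \<partial>lborel) = resolv alpha l f y" if "y \<noteq> 0" for y
    proof -
      have "(\<integral>s. complex_of_real (w l s) * evol E f s y \<partial>lborel) = laplace (\<lambda>s. evol E f s y) l"
        unfolding laplace_def by (simp add: wv evol_nonpos)
      then show ?thesis unfolding E_def using laplace_evol[OF f _ that orth] l by (simp add: E_def)
    qed
    have "laplace A l = (\<integral>s. complex_of_real (w l s) * A s \<partial>lborel)" by (simp add: laplace_def wv A0)
    also have "\<dots> = resolv alpha m (\<lambda>y. \<integral>s. complex_of_real (w l s) * evol E f s y \<partial>lborel) x"
      unfolding A_def by (rule resolv_time_average(1)[OF f E m(1) wm wn wi[OF l(1)], symmetric])
    also have "\<dots> = resolv alpha m (resolv alpha l f) x"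
    proof (rule resolv_cong_AE)
      show "AE y in lborel. (\<integral>s. complex_of_real (w l s) * evol E f s y \<partial>lborel) = resolv alpha l f y"
        using AE_neq[of 0] by eventually_elim (rule ev)
      show "(\<lambda>y. \<integral>s. complex_of_real (w l s) * evol E f s y \<partial>lborel) \<in> borel_measurable borel"
        using wm[measurable] by (intro lborel.borel_measurable_lebesgue_integral) simp
    qed simp
    also have "\<dots> = (resolv alpha l f x - resolv alpha m f x) / complex_of_real (m - l)"
      by (rule resolvent_identity[OF f]) (use l m x alpha_cc_nonzero in \<open>auto simp: E_def\<close>)
    also have "\<dots> = laplace S l"
      unfolding S_def using laplace_shift_resolvent[OF cl[OF x] m(1) l(1)] l
        laplace_evol[OF f _ x orth l(1)] laplace_evol[OF f _ x orth m] by (simp add: E_def)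
    finally show ?thesis .
  qed
  \<comment> \<open>Equality of transforms off two points becomes equality of moments. These
    suffice, because for \<open>s \<ge> 0\<close> an Erlang density is a constant times
    \<open>s ^ k * exp (- m * s)\<close>.\<close>
  have zero: "(\<integral>s. complex_of_real (s ^ k * exp (- m * s)) * (A s - S s) \<partial>lborel) = 0"
    by (rule laplace_vanishing_moments[where X = "{m, E}"])
      (use Acl Scl lapA m in \<open>auto simp: laplace_diff intro!: laplace_class_diff\<close>)
  have Ai: "integrable lborel (\<lambda>s. complex_of_real (erlang_density k m s) * A s)"
    unfolding A_def by (rule resolv_time_average(2)[OF f E m(1)]) (use m in \<open>auto simp: erlang_nonneg nn_integral_erlang\<close>)
  have Si: "integrable lborel (\<lambda>s. complex_of_real (erlang_density k m s) * S s)"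
    using erlang_nn_integral_finite[OF Scl m(1), of k] laplace_class_measurable[OF Scl] m
    by (intro integrableI_bounded) (auto simp: norm_mult erlang_nonneg)
  have "(\<integral>s. complex_of_real (erlang_density k m s) * A s \<partial>lborel) - (\<integral>s. complex_of_real (erlang_density k m s) * S s \<partial>lborel)
     = (\<integral>s. complex_of_real (m ^ Suc k / fact k) * (complex_of_real (s ^ k * exp (- m * s)) * (A s - S s)) \<partial>lborel)"
    unfolding Bochner_Integration.integral_diff[OF Ai Si, symmetric]
  proof (intro Bochner_Integration.integral_cong refl)
    fix s
    show "complex_of_real (erlang_density k m s) * A s - complex_of_real (erlang_density k m s) * S s = complex_of_real (m ^ Suc k / fact k) * (complex_of_real (s ^ k * exp (- m * s)) * (A s - S s))"
    proof (cases "s < 0")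
      case True
      then show ?thesis using A0 by (simp add: S_def shift_resolvent_def)
    next
      case False
      then have "erlang_density k m s = m ^ Suc k / fact k * (s ^ k * exp (- m * s))" by (simp add: erlang_density_def)
      then show ?thesis by (simp only: of_real_mult right_diff_distrib mult.assoc)
    qed
  qed
  also have "\<dots> = complex_of_real (m ^ Suc k / fact k) * (\<integral>s. complex_of_real (s ^ k * exp (- m * s)) * (A s - S s) \<partial>lborel)"
    by (rule integral_mult_right_zero)
  also have "\<dots> = 0" unfolding zero by simp
  finally have AS: "(\<integral>s. complex_of_real (erlang_density k m s) * A s \<partial>lborel) = (\<integral>s. complex_of_real (erlang_density k m s) * S s \<partial>lborel)" by simp
  have "resolv alpha m (\<lambda>y. \<integral>s. complex_of_real (erlang_density k m s) * evol E f s y \<partial>lborel) x = (\<integral>s. complex_of_real (erlang_density k m s) * A s \<partial>lborel)"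
    unfolding A_def by (rule resolv_time_average(1)[OF f E m(1)]) (use m in \<open>auto simp: erlang_nonneg nn_integral_erlang\<close>)
  then show ?thesis unfolding AS S_def using erlang_shift_resolvent[OF cl[OF x] m(1), of k] by simp
qed

section \<open>Convergence of the exponential formula\<close>

lemma resolv_iterate_measurable:
  assumes "f \<in> borel_measurable borel"
  shows "((\<lambda>g y. c * resolv alpha m g y) ^^ n) f \<in> borel_measurable borel"
  by (induction n) (use assms in \<open>auto intro!: borel_measurable_times resolv_measurable\<close>)

text \<open>\<open>Suc k\<close> factors go with the Erlang density of order \<open>k\<close>, since
  order 0 is already the exponential density \<open>m * exp (- m * s)\<close>. The identity is
  available off the origin only, so the induction step passes through
  \<open>resolv_cong_AE\<close>.\<close>

lemma resolv_iterate:
  assumes f: "Lp_mem 2 f" and orth: "(\<integral>y. complex_of_real (Gk (Ealpha alpha) y) * f y \<partial>lborel) = 0"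
    and m: "0 < m" "m \<noteq> Ealpha alpha" and x: "x \<noteq> 0"
  shows "((\<lambda>g y. complex_of_real m * resolv alpha m g y) ^^ Suc k) f x
     = (\<integral>s. complex_of_real (erlang_density k m s) * evol (Ealpha alpha) f s x \<partial>lborel)"
  using x
proof (induction k arbitrary: x)
  case 0
  have "(\<integral>s. complex_of_real (erlang_density 0 m s) * evol (Ealpha alpha) f s x \<partial>lborel)
     = (\<integral>s. complex_of_real m * (complex_of_real (exp (- m * s)) * evol (Ealpha alpha) f s x) \<partial>lborel)"
    by (intro Bochner_Integration.integral_cong refl) (auto simp: erlang_density_def evol_nonpos)
  also have "\<dots> = complex_of_real m * laplace (\<lambda>s. evol (Ealpha alpha) f s x) m"
    unfolding laplace_def by (rule integral_mult_right_zero)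
  finally show ?case using laplace_evol[OF f _ \<open>x \<noteq> 0\<close> orth m] by simp
next
  case (Suc k)
  have [measurable]: "f \<in> borel_measurable borel" by (rule Lp_memD_measurable[OF f])
  let ?F = "\<lambda>g y. complex_of_real m * resolv alpha m g y"
  have "(?F ^^ Suc (Suc k)) f x = complex_of_real m * resolv alpha m ((?F ^^ Suc k) f) x" by simp
  also have "resolv alpha m ((?F ^^ Suc k) f) x = resolv alpha m (\<lambda>y. \<integral>s. complex_of_real (erlang_density k m s) * evol (Ealpha alpha) f s y \<partial>lborel) x"
  proof (rule resolv_cong_AE)
    show "AE y in lborel. (?F ^^ Suc k) f y = (\<integral>s. complex_of_real (erlang_density k m s) * evol (Ealpha alpha) f s y \<partial>lborel)"
      using AE_neq[of 0] by eventually_elim (rule Suc.IH)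
    show "(?F ^^ Suc k) f \<in> borel_measurable borel" by (rule resolv_iterate_measurable) simp
    show "(\<lambda>y. \<integral>s. complex_of_real (erlang_density k m s) * evol (Ealpha alpha) f s y \<partial>lborel) \<in> borel_measurable borel"
      by (rule lborel.borel_measurable_lebesgue_integral) simp
  qed
  also have "complex_of_real m * \<dots> = (\<integral>s. complex_of_real (erlang_density (Suc k) m s) * evol (Ealpha alpha) f s x \<partial>lborel)"
    by (rule resolv_erlang_step[OF f orth m Suc.prems])
  finally show ?case .
qed

section \<open>Continuity of the evolution in time\<close>

lemma heat_isCont:
  assumes f: "Lp_mem p f" and p: "1 < p" and t: "0 < t"
  shows "isCont (\<lambda>s. heat f s x) t"
  unfolding heat_def
proof (rule isCont_integral_dominated[OF t])
  have [measurable]: "f \<in> borel_measurable borel" by (rule Lp_memD_measurable[OF f])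
  show "(\<lambda>y. complex_of_real (hk s (x - y)) * f y) \<in> borel_measurable lborel" for s by measurable
  show "integrable lborel (\<lambda>y. 4 * norm (complex_of_real (hk (2 * t) (x - y)) * f y))"
    using heat_integrable[OF f p, of "2 * t" x] t by auto
  show "AE y in lborel. isCont (\<lambda>s. complex_of_real (hk s (x - y)) * f y) t"
    using hk_isCont[OF t] by (intro AE_I2 continuous_intros) auto
  fix s assume s: "t / 2 \<le> s" "s \<le> 2 * t"
  show "AE y in lborel. norm (complex_of_real (hk s (x - y)) * f y) \<le> 4 * norm (complex_of_real (hk (2 * t) (x - y)) * f y)"
  proof (rule AE_I2)
    fix y
    have "hk s (x - y) * norm (f y) \<le> 4 * hk (2 * t) (x - y) * norm (f y)" by (intro mult_right_mono hk_le_dilated t s) auto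
    then show "norm (complex_of_real (hk s (x - y)) * f y) \<le> 4 * norm (complex_of_real (hk (2 * t) (x - y)) * f y)"
      by (simp add: norm_mult)
  qed
qed

lemma shift_resolvent_isCont:
  assumes E: "0 < E" and b: "0 \<le> b" and A: "0 \<le> A" and t: "0 < t"
    and bd: "\<And>s. 0 < s \<Longrightarrow> norm (a s) \<le> A * s powr (- b)" and [measurable]: "a \<in> borel_measurable borel"
    and cont: "\<And>s. 0 < s \<Longrightarrow> isCont a s"
  shows "isCont (shift_resolvent E a) t"
proof -
  let ?I = "\<lambda>s. \<integral>r. complex_of_real (indicator {0<..} r * exp (- E * r)) * a (s + r) \<partial>lborel"
  have "isCont ?I t"
  proof (rule isCont_integral_dominated[OF t])
    show "integrable lborel (\<lambda>r. A * (t / 2) powr (- b) * (indicator {0<..} r * exp (- E * r)))"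
      using has_bochner_integral_exp_decay[OF E] by (intro integrable_mult_right) (auto simp: has_bochner_integral_iff)
    show "AE r in lborel. isCont (\<lambda>s. complex_of_real (indicator {0<..} r * exp (- E * r)) * a (s + r)) t"
    proof (rule AE_I2)
      fix r :: real
      show "isCont (\<lambda>s. complex_of_real (indicator {0<..} r * exp (- E * r)) * a (s + r)) t"
      proof (cases "0 < r")
        case True
        have "isCont (\<lambda>s. a (s + r)) t"
          using cont[of "t + r"] t True by (intro isCont_o2[of t "\<lambda>s. s + r" a]) (auto intro!: continuous_intros)
        then show ?thesis by (intro continuous_intros)
      qed simp
    qed
    fix s assume s: "t / 2 \<le> s" "s \<le> 2 * t"
    show "AE r in lborel. norm (complex_of_real (indicator {0<..} r * exp (- E * r)) * a (s + r)) \<le> A * (t / 2) powr (- b) * (indicator {0<..} r * exp (- E * r))"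
    proof (rule AE_I2)
      fix r :: real
      show "norm (complex_of_real (indicator {0<..} r * exp (- E * r)) * a (s + r)) \<le> A * (t / 2) powr (- b) * (indicator {0<..} r * exp (- E * r))"
      proof (cases "0 < r")
        case True
        have "norm (a (s + r)) \<le> A * (s + r) powr (- b)" using s t True by (intro bd) auto
        also have "\<dots> \<le> A * (t / 2) powr (- b)" using s t True b A by (intro mult_left_mono powr_mono2') auto
        finally have "norm (a (s + r)) * exp (- E * r) \<le> A * (t / 2) powr (- b) * exp (- E * r)" by (intro mult_right_mono) auto
        then show ?thesis using True by (simp add: norm_mult mult.commute)
      qed simp
    qed
  qed simp
  moreover have "eventually (\<lambda>s. shift_resolvent E a s = ?I s) (nhds t)"
    by (rule eventually_mono[OF eventually_nhds_in_open[of "{0<..}" t]]) (use t in \<open>auto simp: shift_resolvent_def\<close>)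
  ultimately show ?thesis by (simp add: isCont_cong)
qed

text \<open>Rescaling to the unit interval fixes the domain of integration and the places of both
  endpoint singularities, so that continuity in \<open>s\<close> becomes a matter of dominated
  convergence.\<close>

lemma hconv_scaled:
  assumes s: "0 < s" and zv: "\<And>s. s \<le> 0 \<Longrightarrow> v s = 0" and zw: "\<And>s. s \<le> 0 \<Longrightarrow> w s = 0"
  shows "hconv v w s = complex_of_real s * (\<integral>\<theta>. indicator {0<..<1} \<theta> *\<^sub>R (v (s * (1 - \<theta>)) * w (s * \<theta>)) \<partial>lborel)"
proof -
  have "hconv v w s = \<bar>s\<bar> *\<^sub>R (\<integral>\<theta>. v (s - (0 + s * \<theta>)) * w (0 + s * \<theta>) \<partial>lborel)"
    unfolding hconv_def by (rule lborel_integral_real_affine) (use s in auto)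
  also have "(\<integral>\<theta>. v (s - (0 + s * \<theta>)) * w (0 + s * \<theta>) \<partial>lborel) = (\<integral>\<theta>. indicator {0<..<1} \<theta> *\<^sub>R (v (s * (1 - \<theta>)) * w (s * \<theta>)) \<partial>lborel)"
  proof (intro Bochner_Integration.integral_cong refl)
    fix \<theta> :: real
    show "v (s - (0 + s * \<theta>)) * w (0 + s * \<theta>) = indicator {0<..<1} \<theta> *\<^sub>R (v (s * (1 - \<theta>)) * w (s * \<theta>))"
    proof (cases "\<theta> \<in> {0<..<1}")
      case True
      then show ?thesis by (simp add: algebra_simps)
    next
      case False
      then have "s * \<theta> \<le> 0 \<or> s - s * \<theta> \<le> 0" using s by (auto simp: mult_le_0_iff)
      then show ?thesis using zv zw False by auto
    qed
  qed
  finally show ?thesis using s by (simp add: scaleR_conv_of_real)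
qed

lemma hconv_isCont:
  assumes t: "0 < t" and [measurable]: "v \<in> borel_measurable borel" "w \<in> borel_measurable borel"
    and zv: "\<And>s. s \<le> 0 \<Longrightarrow> v s = 0" and zw: "\<And>s. s \<le> 0 \<Longrightarrow> w s = 0"
    and cv: "\<And>s. 0 < s \<Longrightarrow> isCont v s" and cw: "\<And>s. 0 < s \<Longrightarrow> isCont w s"
    and d: "integrable lborel d"
    and bd: "\<And>s \<theta>. t / 2 \<le> s \<Longrightarrow> s \<le> 2 * t \<Longrightarrow> norm (indicator {0<..<1} \<theta> *\<^sub>R (v (s * (1 - \<theta>)) * w (s * \<theta>))) \<le> d \<theta>"
  shows "isCont (hconv v w) t"
proof -
  let ?I = "\<lambda>s. complex_of_real s * (\<integral>\<theta>. indicator {0<..<1} \<theta> *\<^sub>R (v (s * (1 - \<theta>)) * w (s * \<theta>)) \<partial>lborel)"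
  have "isCont (\<lambda>s. \<integral>\<theta>. indicator {0<..<1} \<theta> *\<^sub>R (v (s * (1 - \<theta>)) * w (s * \<theta>)) \<partial>lborel) t"
  proof (rule isCont_integral_dominated[OF t _ d])
    show "AE \<theta> in lborel. isCont (\<lambda>s. indicator {0<..<1} \<theta> *\<^sub>R (v (s * (1 - \<theta>)) * w (s * \<theta>))) t"
    proof (rule AE_I2)
      fix \<theta> :: real
      show "isCont (\<lambda>s. indicator {0<..<1} \<theta> *\<^sub>R (v (s * (1 - \<theta>)) * w (s * \<theta>))) t"
      proof (cases "\<theta> \<in> {0<..<1}")
        case True
        have "isCont (\<lambda>s. v (s * (1 - \<theta>))) t"
          using cv[of "t * (1 - \<theta>)"] t True by (intro isCont_o2[of t "\<lambda>s. s * (1 - \<theta>)" v]) (auto intro!: continuous_intros)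
        moreover have "isCont (\<lambda>s. w (s * \<theta>)) t"
          using cw[of "t * \<theta>"] t True by (intro isCont_o2[of t "\<lambda>s. s * \<theta>" w]) (auto intro!: continuous_intros)
        ultimately show ?thesis by (intro continuous_intros)
      qed simp
    qed
    show "AE \<theta> in lborel. norm (indicator {0<..<1} \<theta> *\<^sub>R (v (s * (1 - \<theta>)) * w (s * \<theta>))) \<le> d \<theta>" if "t / 2 \<le> s" "s \<le> 2 * t" for s
      using bd[OF that] by simp
  qed simp
  then have "isCont ?I t" by (intro continuous_intros)
  moreover have "eventually (\<lambda>s. hconv v w s = ?I s) (nhds t)"
    by (rule eventually_mono[OF eventually_nhds_in_open[of "{0<..}" t]]) (use t hconv_scaled[OF _ zv zw] in auto)
  ultimately show ?thesis by (simp add: isCont_cong)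
qed

lemma charge_isCont:
  assumes E: "0 < E" and b: "0 \<le> b" "b < 1" and A: "0 \<le> A" and t: "0 < t"
    and bd: "\<And>s. 0 < s \<Longrightarrow> norm (a s) \<le> A * s powr (- b)" and z: "\<And>s. s \<le> 0 \<Longrightarrow> a s = 0"
    and [measurable]: "a \<in> borel_measurable borel"
    and cont: "\<And>s. 0 < s \<Longrightarrow> isCont a s"
  shows "isCont (charge E a) t"
proof -
  \<comment> \<open>The earliest time of the window. Memory kernel and power bound both decrease in
    time, so the scaled bound at \<open>\<sigma>\<close> dominates those at all later times.\<close>
  define \<sigma> where "\<sigma> = t / 2"
  have \<sigma>: "0 < \<sigma>" using t by (simp add: \<sigma>_def)
  define a0 where "a0 r = complex_of_real (indicator {0<..} r * r powr (- b))" for r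
  have [measurable]: "a0 \<in> borel_measurable borel" unfolding a0_def by measurable
  define d where "d \<theta> = A * (memory_kernel E (\<sigma> - (0 + \<sigma> * \<theta>)) * norm (a0 (0 + \<sigma> * \<theta>)))" for \<theta>
  have "(\<integral>\<^sup>+ r. ennreal (memory_kernel E (\<sigma> - r) * norm (a0 r)) \<partial>lborel) \<le> ennreal ((8 / (pi * (1 - b)) + 8 * pi) * 1 * \<sigma> powr (- b))"
    by (rule memory_hconv_nn_bound[OF E b _ \<sigma>]) (auto simp: a0_def)
  also have "\<dots> < \<infinity>" by simp
  finally have "integrable lborel (\<lambda>r. memory_kernel E (\<sigma> - r) * norm (a0 r))"
    by (intro integrableI_nonneg) auto
  then have d: "integrable lborel d" unfolding d_def
    using \<sigma> by (intro integrable_mult_right lborel_integrable_real_affine) auto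
  have "isCont (hconv (\<lambda>t. complex_of_real (memory_kernel E t)) a) t"
  proof (rule hconv_isCont[OF t _ _ _ z _ cont d])
    show "isCont (\<lambda>s. complex_of_real (memory_kernel E s)) s" if "0 < s" for s
      using memory_kernel_isCont[OF that] by (intro continuous_intros)
    fix s \<theta> assume s: "t / 2 \<le> s" "s \<le> 2 * t"
    show "norm (indicator {0<..<1} \<theta> *\<^sub>R (complex_of_real (memory_kernel E (s * (1 - \<theta>))) * a (s * \<theta>))) \<le> d \<theta>"
    proof (cases "\<theta> \<in> {0<..<1}")
      case True
      have "memory_kernel E (s * (1 - \<theta>)) \<le> memory_kernel E (\<sigma> * (1 - \<theta>))"
        using True s \<sigma> by (intro memory_kernel_antimono mult_right_mono) (auto simp: \<sigma>_def)
      moreover have "norm (a (s * \<theta>)) \<le> A * (\<sigma> * \<theta>) powr (- b)"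
      proof -
        have "norm (a (s * \<theta>)) \<le> A * (s * \<theta>) powr (- b)" using True s t by (intro bd) auto
        also have "\<dots> \<le> A * (\<sigma> * \<theta>) powr (- b)"
          using True s t b A \<sigma> by (intro mult_left_mono powr_mono2' mult_right_mono) (auto simp: \<sigma>_def)
        finally show ?thesis .
      qed
      ultimately have "memory_kernel E (s * (1 - \<theta>)) * norm (a (s * \<theta>)) \<le> memory_kernel E (\<sigma> * (1 - \<theta>)) * (A * (\<sigma> * \<theta>) powr (- b))"
        by (intro mult_mono) auto
      also have "\<dots> = d \<theta>" using True \<sigma> by (simp add: d_def a0_def right_diff_distrib)
      finally show ?thesis using True by (simp add: norm_mult)
    next
      case False
      then show ?thesis using A by (simp add: d_def)
    qed
  qed auto
  then show ?thesis unfolding charge_def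
    using shift_resolvent_isCont[OF E b(1) A t bd _ cont] by (intro continuous_intros) auto
qed

lemma charge_heat_isCont:
  assumes f: "Lp_mem p f" and p: "1 < p" and E: "0 < E" and t: "0 < t"
  shows "isCont (charge E (\<lambda>s. heat f s 0)) t"
proof (rule charge_isCont[OF E _ _ _ t, where b = "1 / p" and A = "Lp_norm p f"])
  show "(\<lambda>s. heat f s 0) \<in> borel_measurable borel" using Lp_memD_measurable[OF f] by measurable
qed (use p heat_bound[OF f p] heat_isCont[OF f p] in \<open>auto simp: heat_nonpos\<close>)

lemma integrable_powr_Ioo:
  fixes b s :: real
  assumes "b < 1" "0 < s"
  shows "integrable lborel (\<lambda>x. indicator {0<..<s} x * x powr (- b))"
  using nn_integral_powr_Ioo[OF assms] by (intro integrableI_nonneg) auto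

text \<open>For \<open>x \<noteq> 0\<close> the kernel is bounded uniformly in time by
  \<open>hk_le_norm\<close>, so only the integrable singularity of the charge at time 0
  remains.\<close>

lemma evol_isCont:
  assumes f: "Lp_mem p f" and p: "1 < p" and E: "0 < E" and t: "0 < t" and x: "x \<noteq> 0"
  shows "isCont (\<lambda>s. evol E f s x) t"
proof -
  have [measurable]: "f \<in> borel_measurable borel" by (rule Lp_memD_measurable[OF f])
  define M where "M = (12 * pi + 8 / (pi * (1 - 1 / p))) * Lp_norm p f"
  have M: "0 \<le> M" using p by (simp add: M_def)
  define d where "d \<theta> = 1 / (pi * (norm x)\<^sup>2) * M * (t / 2) powr (- (1 / p)) * (indicator {0<..<1} \<theta> * \<theta> powr (- (1 / p)))" for \<theta> :: real
  have d: "integrable lborel d" unfolding d_def using p by (intro integrable_mult_right integrable_powr_Ioo) auto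
  have "isCont (hconv (\<lambda>r. complex_of_real (hk r x)) (charge E (\<lambda>s. heat f s 0))) t"
  proof (rule hconv_isCont[OF t _ _ _ charge_heat_nonpos _ charge_heat_isCont[OF f p E] d])
    show "isCont (\<lambda>r. complex_of_real (hk r x)) s" if "0 < s" for s
      using hk_isCont[OF that] by (intro continuous_intros)
    fix s \<theta> assume s: "t / 2 \<le> s" "s \<le> 2 * t"
    show "norm (indicator {0<..<1} \<theta> *\<^sub>R (complex_of_real (hk (s * (1 - \<theta>)) x) * charge E (\<lambda>s. heat f s 0) (s * \<theta>))) \<le> d \<theta>"
    proof (cases "\<theta> \<in> {0<..<1}")
      case True
      have "norm (charge E (\<lambda>s. heat f s 0) (s * \<theta>)) \<le> M * (s * \<theta>) powr (- (1 / p))"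
        unfolding M_def using True s t by (intro charge_heat_bound[OF f p E]) auto
      also have "\<dots> \<le> M * ((t / 2) * \<theta>) powr (- (1 / p))"
        using True s t M p by (intro mult_left_mono powr_mono2' mult_right_mono) auto
      also have "((t / 2) * \<theta>) powr (- (1 / p)) = (t / 2) powr (- (1 / p)) * \<theta> powr (- (1 / p))"
        using True t by (intro powr_mult)
      finally have "hk (s * (1 - \<theta>)) x * norm (charge E (\<lambda>s. heat f s 0) (s * \<theta>)) \<le> 1 / (pi * (norm x)\<^sup>2) * (M * ((t / 2) powr (- (1 / p)) * \<theta> powr (- (1 / p))))"
        by (intro mult_mono hk_le_norm x) auto
      then show ?thesis using True by (simp add: norm_mult d_def mult.assoc)
    qed (simp add: d_def)
  qed (auto intro!: charge_heat_measurable)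
  then show ?thesis unfolding evol_def using heat_isCont[OF f p t, of x] by (intro continuous_intros)
qed

lemma norm_integral_le:
  fixes f :: "'a \<Rightarrow> 'b::{banach, second_countable_topology}" and g :: "'a \<Rightarrow> real"
  assumes g: "integrable M g" and le: "\<And>x. norm (f x) \<le> g x"
  shows "norm (integral\<^sup>L M f) \<le> integral\<^sup>L M g"
proof (cases "integrable M f")
  case True
  have "norm (integral\<^sup>L M f) \<le> (\<integral>x. norm (f x) \<partial>M)" by (rule integral_norm_bound)
  also have "\<dots> \<le> integral\<^sup>L M g" using True g le by (intro integral_mono) auto
  finally show ?thesis .
next
  case False
  moreover have "0 \<le> integral\<^sup>L M g" by (intro integral_nonneg_AE AE_I2 order_trans[OF norm_ge_zero le])
  ultimately show ?thesis by (simp add: not_integrable_integral_eq)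
qed

text \<open>The free part is dominated by the flow of \<open>norm (f y)\<close> at time
  \<open>2 * t\<close>. The singular part, after rescaling to the unit interval, is dominated by the
  same convolution at time \<open>2 * t\<close> with the charge replaced by its power bound.\<close>

lemma evol_dominated:
  assumes f: "Lp_mem 2 f" and E: "0 < E" and t: "0 < t"
  obtains D where "D \<in> borel_measurable borel" "integrable lborel (\<lambda>x. (D x)\<^sup>2)"
    "\<And>s x. t / 2 \<le> s \<Longrightarrow> s \<le> 2 * t \<Longrightarrow> x \<noteq> 0 \<Longrightarrow> norm (evol E f s x) \<le> D x"
proof -
  have [measurable]: "f \<in> borel_measurable borel" by (rule Lp_memD_measurable[OF f])
  define F where "F y = complex_of_real (norm (f y))" for y
  have F: "Lp_mem 2 F" using f unfolding F_def Lp_mem_def by auto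
  have [measurable]: "F \<in> borel_measurable borel" by (rule Lp_memD_measurable[OF F])
  define H where "H = heat F (2 * t)"
  have [measurable]: "H \<in> borel_measurable borel" unfolding H_def by measurable
  have Hb: "norm (heat f s x) \<le> 4 * norm (H x)" if s: "t / 2 \<le> s" "s \<le> 2 * t" for s x
  proof -
    have hi: "integrable lborel (\<lambda>y. hk (2 * t) (x - y) * norm (f y))"
      using integrable_norm[OF heat_integrable[OF f, of "2 * t" x]] t by (simp add: norm_mult)
    have "norm (heat f s x) \<le> (\<integral>y. 4 * (hk (2 * t) (x - y) * norm (f y)) \<partial>lborel)"
      unfolding heat_def
    proof (rule norm_integral_le)
      fix y
      have "hk s (x - y) * norm (f y) \<le> 4 * hk (2 * t) (x - y) * norm (f y)" by (intro mult_right_mono hk_le_dilated t s) auto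
      then show "norm (complex_of_real (hk s (x - y)) * f y) \<le> 4 * (hk (2 * t) (x - y) * norm (f y))" by (simp add: norm_mult)
    qed (use hi in simp)
    also have "\<dots> = 4 * (\<integral>y. hk (2 * t) (x - y) * norm (f y) \<partial>lborel)" by simp
    also have "(\<integral>y. hk (2 * t) (x - y) * norm (f y) \<partial>lborel) \<le> norm (H x)"
      unfolding H_def heat_def F_def of_real_mult[symmetric] integral_complex_of_real norm_of_real by simp
    finally show ?thesis by simp
  qed
  define M where "M = (12 * pi + 8 / (pi * (1 - 1 / 2))) * Lp_norm 2 f"
  have M: "0 \<le> M" by (simp add: M_def)
  define q where "q x r = indicator {0<..<2 * t} r * (hk (2 * t - r) x * r powr (- (1 / 2)))" for x r
  have [measurable]: "(\<lambda>z. q (fst z) (snd z)) \<in> borel_measurable (borel \<Otimes>\<^sub>M borel)" unfolding q_def by measurable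
  have [measurable]: "q x \<in> borel_measurable borel" for x unfolding q_def by measurable
  have qn: "0 \<le> q x r" for x r by (simp add: q_def)
  \<comment> \<open>Complex-valued, so that the bound from \<open>hk_hconv_Lp_bound\<close> applies;
    by positivity its norm is the real integral.\<close>
  define Q where "Q x = (\<integral>r. complex_of_real (q x r) \<partial>lborel)" for x
  have [measurable]: "Q \<in> borel_measurable borel"
    unfolding Q_def by (rule lborel.borel_measurable_lebesgue_integral) (simp add: q_def)
  have qi: "integrable lborel (q x)" if "x \<noteq> 0" for x
  proof (rule Bochner_Integration.integrable_bound)
    show "integrable lborel (\<lambda>r. 1 / (pi * (norm x)\<^sup>2) * (indicator {0<..<2 * t} r * r powr (- (1 / 2))))"
      using t by (intro integrable_mult_right integrable_powr_Ioo) auto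
    show "AE r in lborel. norm (q x r) \<le> norm (1 / (pi * (norm x)\<^sup>2) * (indicator {0<..<2 * t} r * r powr (- (1 / 2))))"
    proof (rule AE_I2)
      fix r
      have "hk (2 * t - r) x * r powr (- (1 / 2)) \<le> 1 / (pi * (norm x)\<^sup>2) * r powr (- (1 / 2))"
        by (intro mult_right_mono hk_le_norm that) auto
      then show "norm (q x r) \<le> norm (1 / (pi * (norm x)\<^sup>2) * (indicator {0<..<2 * t} r * r powr (- (1 / 2))))"
        by (auto simp: q_def split: split_indicator)
    qed
  qed simp
  have Qn: "norm (Q x) = (\<integral>r. q x r \<partial>lborel)" for x
    unfolding Q_def integral_complex_of_real norm_of_real using qn by (intro abs_of_nonneg integral_nonneg_AE AE_I2) auto
  have Vb: "norm (hconv (\<lambda>r. complex_of_real (hk r x)) (charge E (\<lambda>s. heat f s 0)) s) \<le> 8 * M * norm (Q x)"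
    if s: "t / 2 \<le> s" "s \<le> 2 * t" and x: "x \<noteq> 0" for s x
  proof -
    have s0: "0 < s" using s t by simp
    \<comment> \<open>The factor 8 is 4 from \<open>hk_le_dilated\<close> times 2 from
      \<open>(1 / 4) powr (- (1 / 2))\<close>, as \<open>s * \<theta>\<close> is at least a quarter
      of \<open>2 * t * \<theta>\<close>.\<close>
    have di: "integrable lborel (\<lambda>\<theta>. 8 * M * q x (0 + 2 * t * \<theta>))"
      using t by (intro integrable_mult_right lborel_integrable_real_affine qi x) auto
    let ?I = "\<integral>\<theta>. indicator {0<..<1} \<theta> *\<^sub>R (complex_of_real (hk (s * (1 - \<theta>)) x) * charge E (\<lambda>s. heat f s 0) (s * \<theta>)) \<partial>lborel"
    have I: "norm ?I \<le> (\<integral>\<theta>. 8 * M * q x (0 + 2 * t * \<theta>) \<partial>lborel)"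
    proof (rule norm_integral_le[OF di])
      fix \<theta> :: real
      show "norm (indicator {0<..<1} \<theta> *\<^sub>R (complex_of_real (hk (s * (1 - \<theta>)) x) * charge E (\<lambda>s. heat f s 0) (s * \<theta>))) \<le> 8 * M * q x (0 + 2 * t * \<theta>)"
      proof (cases "\<theta> \<in> {0<..<1}")
        case True
        have "norm (charge E (\<lambda>s. heat f s 0) (s * \<theta>)) \<le> M * (s * \<theta>) powr (- (1 / 2))"
          unfolding M_def using True s0 by (intro charge_heat_bound[OF f _ E]) auto
        also have "\<dots> \<le> M * ((1 / 4) * (2 * t * \<theta>)) powr (- (1 / 2))"
          using True s t M by (intro mult_left_mono powr_mono2') (auto simp: mult_right_mono)
        also have "((1 / 4) * (2 * t * \<theta>)) powr (- (1 / 2)) = (1 / 4) powr (- (1 / 2)) * (2 * t * \<theta>) powr (- (1 / 2))"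
          using True t by (intro powr_mult)
        also have "(1 / 4 :: real) powr (- (1 / 2)) = 2" by (simp add: powr_minus powr_half_sqrt real_sqrt_divide)
        finally have c: "norm (charge E (\<lambda>s. heat f s 0) (s * \<theta>)) \<le> M * (2 * (2 * t * \<theta>) powr (- (1 / 2)))" .
        have "hk (s * (1 - \<theta>)) x \<le> 4 * hk (2 * (t * (1 - \<theta>))) x"
        proof (rule hk_le_dilated)
          have "t / 2 * (1 - \<theta>) \<le> s * (1 - \<theta>)" using True s by (intro mult_right_mono) auto
          then show "t * (1 - \<theta>) / 2 \<le> s * (1 - \<theta>)" by simp
          have "s * (1 - \<theta>) \<le> 2 * t * (1 - \<theta>)" using True s by (intro mult_right_mono) auto
          then show "s * (1 - \<theta>) \<le> 2 * (t * (1 - \<theta>))" by simp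
        qed (use True t in auto)
        then have "hk (s * (1 - \<theta>)) x * norm (charge E (\<lambda>s. heat f s 0) (s * \<theta>)) \<le> 4 * hk (2 * (t * (1 - \<theta>))) x * (M * (2 * (2 * t * \<theta>) powr (- (1 / 2))))"
          using c by (intro mult_mono) auto
        moreover have "q x (0 + 2 * t * \<theta>) = hk (2 * (t * (1 - \<theta>))) x * (2 * t * \<theta>) powr (- (1 / 2))"
          using True t by (simp add: q_def algebra_simps)
        ultimately show ?thesis using True by (simp add: norm_mult mult_ac)
      qed (use M qn in simp)
    qed
    have "norm (hconv (\<lambda>r. complex_of_real (hk r x)) (charge E (\<lambda>s. heat f s 0)) s) = s * norm ?I"
      by (subst hconv_scaled[OF s0]) (use s0 in \<open>auto simp: charge_heat_nonpos norm_mult\<close>)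
    also have "\<dots> \<le> (2 * t) * (\<integral>\<theta>. 8 * M * q x (0 + 2 * t * \<theta>) \<partial>lborel)" using I s s0 by (intro mult_mono) auto
    also have "\<dots> = 8 * M * ((2 * t) * (\<integral>\<theta>. q x (0 + 2 * t * \<theta>) \<partial>lborel))" by simp
    also have "(2 * t) * (\<integral>\<theta>. q x (0 + 2 * t * \<theta>) \<partial>lborel) = (\<integral>r. q x r \<partial>lborel)"
      using lborel_integral_real_affine[of "2 * t" "q x" 0] t by simp
    finally show ?thesis by (simp add: Qn)
  qed
  obtain C where C: "0 \<le> C" "\<And>t M (g :: real \<Rightarrow> R2 \<Rightarrow> complex). 0 < t \<Longrightarrow> 0 \<le> M \<Longrightarrow>
     (\<And>\<tau> x. norm (g \<tau> x) \<le> indicator {0<..<t} \<tau> * (M * ((t - \<tau>) powr (- 0) * hk (1 * (t - \<tau>)) x * \<tau> powr (- (1/2))))) \<Longrightarrow>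
     (\<integral>\<^sup>+ x. ennreal (norm (\<integral>\<tau>. g \<tau> x \<partial>lborel) powr 2) \<partial>lborel) \<le> ennreal (C * M powr 2 * t powr (1 - 2 * (1/2) - 2 * 0))"
    by (rule hk_hconv_Lp_bound[of 2 0 "1/2" 1]) auto
  have Q2: "(\<integral>\<^sup>+ x. ennreal (norm (Q x) powr 2) \<partial>lborel) < \<infinity>"
  proof -
    have "(\<integral>\<^sup>+ x. ennreal (norm (Q x) powr 2) \<partial>lborel) \<le> ennreal (C * 1 powr 2 * (2 * t) powr (1 - 2 * (1/2) - 2 * 0))"
      unfolding Q_def
    proof (rule C(2))
      fix \<tau> x
      show "norm (complex_of_real (q x \<tau>)) \<le> indicator {0<..<2 * t} \<tau> * (1 * ((2 * t - \<tau>) powr (- 0) * hk (1 * (2 * t - \<tau>)) x * \<tau> powr (- (1/2))))"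
        by (cases "\<tau> \<in> {0<..<2 * t}") (auto simp: q_def norm_mult)
    qed (use t in auto)
    also have "\<dots> < \<infinity>" by simp
    finally show ?thesis .
  qed
  have H2: "(\<integral>\<^sup>+ x. ennreal (norm (H x) powr 2) \<partial>lborel) < \<infinity>"
    using heat_Lp[OF F, of "2 * t"] t unfolding H_def by (auto intro: le_less_trans)
  define D where "D x = 4 * norm (H x) + 8 * M * norm (Q x)" for x
  show thesis
  proof
    show [measurable]: "D \<in> borel_measurable borel" unfolding D_def by measurable
    have D0: "0 \<le> D x" for x using M by (simp add: D_def)
    have sc: "ennreal (norm (c * r) powr 2) = ennreal (c powr 2) * ennreal (norm r powr 2)" if "0 \<le> c" for c r :: real
      using that by (subst ennreal_mult'[symmetric]) (simp_all add: power_mult_distrib)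
    have "(\<integral>\<^sup>+ x. ennreal (norm (D x) powr 2) \<partial>lborel)
       \<le> ennreal (2 powr 2) * ((\<integral>\<^sup>+ x. ennreal (norm (4 * norm (H x)) powr 2) \<partial>lborel) + (\<integral>\<^sup>+ x. ennreal (norm (8 * M * norm (Q x)) powr 2) \<partial>lborel))"
      by (rule nn_integral_add_powr_le) (use M in \<open>auto simp: D_def\<close>)
    also have "(\<integral>\<^sup>+ x. ennreal (norm (4 * norm (H x)) powr 2) \<partial>lborel) = (\<integral>\<^sup>+ x. ennreal (4 powr 2) * ennreal (norm (norm (H x)) powr 2) \<partial>lborel)"
      by (simp only: sc zero_le_numeral)
    also have "\<dots> = ennreal (4 powr 2) * (\<integral>\<^sup>+ x. ennreal (norm (H x) powr 2) \<partial>lborel)" by (simp add: nn_integral_cmult del: powr_numeral)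
    also have "(\<integral>\<^sup>+ x. ennreal (norm (8 * M * norm (Q x)) powr 2) \<partial>lborel) = (\<integral>\<^sup>+ x. ennreal ((8 * M) powr 2) * ennreal (norm (norm (Q x)) powr 2) \<partial>lborel)"
      using M by (simp only: sc zero_le_numeral mult_nonneg_nonneg)
    also have "\<dots> = ennreal ((8 * M) powr 2) * (\<integral>\<^sup>+ x. ennreal (norm (Q x) powr 2) \<partial>lborel)" by (simp add: nn_integral_cmult del: powr_numeral)
    also have "ennreal (2 powr 2) * (ennreal (4 powr 2) * (\<integral>\<^sup>+ x. ennreal (norm (H x) powr 2) \<partial>lborel) + ennreal ((8 * M) powr 2) * (\<integral>\<^sup>+ x. ennreal (norm (Q x) powr 2) \<partial>lborel)) < \<infinity>"
      using H2 Q2 by (simp add: ennreal_mult_less_top del: powr_numeral)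
    finally have "(\<integral>\<^sup>+ x. ennreal (norm (D x) powr 2) \<partial>lborel) < \<infinity>" .
    then show "integrable lborel (\<lambda>x. (D x)\<^sup>2)"
      using D0 by (intro integrableI_nonneg) auto
    show "norm (evol E f s x) \<le> D x" if "t / 2 \<le> s" "s \<le> 2 * t" "x \<noteq> 0" for s x
      unfolding evol_def D_def using that by (intro order_trans[OF norm_triangle_ineq] add_mono Hb Vb) auto
  qed
qed

text \<open>Dominated convergence for the squared difference, with majorant
  \<open>4 * (D x)^2\<close> from \<open>evol_dominated\<close>; the pointwise limit off the origin
  is \<open>evol_isCont\<close>.\<close>

lemma evol_L2_continuous:
  assumes f: "Lp_mem 2 f" and E: "0 < E" and t: "0 < t" and e: "0 < e"
  obtains d where "0 < d" "\<And>s. \<bar>s - t\<bar> < d \<Longrightarrow> (\<integral>\<^sup>+ x. ennreal (norm (evol E f s x - evol E f t x) powr 2) \<partial>lborel) \<le> ennreal e"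
proof -
  have [measurable]: "f \<in> borel_measurable borel" by (rule Lp_memD_measurable[OF f])
  obtain D where [measurable]: "D \<in> borel_measurable borel" and D2: "integrable lborel (\<lambda>x. (D x)\<^sup>2)"
    and D: "\<And>s x. t / 2 \<le> s \<Longrightarrow> s \<le> 2 * t \<Longrightarrow> x \<noteq> 0 \<Longrightarrow> norm (evol E f s x) \<le> D x"
    using evol_dominated[OF f E t] by metis
  let ?g = "\<lambda>s x. (norm (evol E f s x - evol E f t x))\<^sup>2"
  have le: "?g s x \<le> 4 * (D x)\<^sup>2" if "t / 2 \<le> s" "s \<le> 2 * t" "x \<noteq> 0" for s x
  proof -
    have "norm (evol E f s x - evol E f t x) \<le> D x + D x"
      using t by (intro order_trans[OF norm_triangle_ineq4] add_mono D that) auto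
    then have "?g s x \<le> (2 * D x)\<^sup>2" by (intro power_mono) auto
    then show ?thesis by (simp add: power_mult_distrib)
  qed
  have "isCont (\<lambda>s. \<integral>x. ?g s x \<partial>lborel) t"
  proof (rule isCont_integral_dominated[OF t])
    show "integrable lborel (\<lambda>x. 4 * (D x)\<^sup>2)" using D2 by simp
    show "AE x in lborel. isCont (\<lambda>s. ?g s x) t"
      using AE_neq[of 0]
    proof eventually_elim
      case (elim x)
      show ?case using evol_isCont[OF f _ E t elim] by (intro continuous_intros) auto
    qed
    show "AE x in lborel. norm (?g s x) \<le> 4 * (D x)\<^sup>2" if "t / 2 \<le> s" "s \<le> 2 * t" for s
      using AE_neq[of 0] by eventually_elim (use le[OF that] in simp)
  qed simp
  then obtain d where d: "0 < d" "\<And>s. \<bar>s - t\<bar> < d \<Longrightarrow> \<bar>(\<integral>x. ?g s x \<partial>lborel) - (\<integral>x. ?g t x \<partial>lborel)\<bar> < e"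
    using e unfolding continuous_at_eps_delta dist_real_def by blast
  show thesis
  proof
    show "0 < min d (t / 2)" using d t by simp
    fix s assume s: "\<bar>s - t\<bar> < min d (t / 2)"
    then have s': "t / 2 \<le> s" "s \<le> 2 * t" by linarith+
    have i: "integrable lborel (?g s)"
      by (rule Bochner_Integration.integrable_bound[of _ "\<lambda>x. 4 * (D x)\<^sup>2"])
        (use D2 le[OF s'] AE_neq[of 0] in \<open>auto elim!: eventually_mono\<close>)
    have "(\<integral>\<^sup>+ x. ennreal (norm (evol E f s x - evol E f t x) powr 2) \<partial>lborel) = ennreal (\<integral>x. ?g s x \<partial>lborel)"
      using i by (subst nn_integral_eq_integral[symmetric]) auto
    also have "\<dots> \<le> ennreal e" using d(2)[of s] s by (intro ennreal_leI) auto
    finally show "(\<integral>\<^sup>+ x. ennreal (norm (evol E f s x - evol E f t x) powr 2) \<partial>lborel) \<le> ennreal e" .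
  qed
qed

section \<open>Concentration of the Erlang densities\<close>

lemma erlang_moment:
  assumes m: "0 < m"
  shows "has_bochner_integral lborel (\<lambda>s. erlang_density k m s * s ^ i) (fact (k + i) / (fact k * m ^ i))"
proof (rule has_bochner_integral_nn_integral)
  show "(\<integral>\<^sup>+ s. ennreal (erlang_density k m s * s ^ i) \<partial>lborel) = ennreal (fact (k + i) / (fact k * m ^ i))"
    by (rule nn_integral_erlang_ith_moment[OF m])
  show "AE s in lborel. 0 \<le> erlang_density k m s * s ^ i"
    using m by (intro AE_I2) (auto simp: erlang_density_def)
qed (use m in auto)

text \<open>The rate is tuned so that the mean \<open>(k + 1) / m\<close> is exactly
  \<open>t\<close>; the shrinking variance is the concentration behind the Post--Widder
  limit.\<close>

lemma erlang_variance:
  fixes k :: nat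
  assumes t: "0 < t"
  defines "m \<equiv> real (Suc k) / t"
  shows "(\<integral>\<^sup>+ s. ennreal (erlang_density k m s * (s - t)\<^sup>2) \<partial>lborel) = ennreal (t\<^sup>2 / real (Suc k))"
proof -
  have m: "0 < m" using t by (simp add: m_def)
  define n where "n = real (Suc k)"
  have n: "0 < n" by (simp add: n_def)
  have tm: "t = n / m" using t n by (simp add: m_def n_def)
  have f1: "fact (k + 1) / (fact k * m ^ 1) = n / m" by (simp add: n_def)
  have f2: "fact (k + 2) / (fact k * m ^ 2) = (n + 1) * n / m\<^sup>2"
  proof -
    have "fact (k + 2) = (n + 1) * n * fact k" by (simp add: n_def numeral_2_eq_2 algebra_simps)
    then show ?thesis by simp
  qed
  have "has_bochner_integral lborel (\<lambda>s. erlang_density k m s * s ^ 2 - 2 * t * (erlang_density k m s * s ^ 1) + t\<^sup>2 * (erlang_density k m s * s ^ 0))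
     ((n + 1) * n / m\<^sup>2 - 2 * t * (n / m) + t\<^sup>2 * 1)"
    using erlang_moment[OF m, of k 2] erlang_moment[OF m, of k 1] erlang_moment[OF m, of k 0] unfolding f1 f2
    by (intro has_bochner_integral_add has_bochner_integral_diff has_bochner_integral_mult_right) simp_all
  moreover have "erlang_density k m s * s ^ 2 - 2 * t * (erlang_density k m s * s ^ 1) + t\<^sup>2 * (erlang_density k m s * s ^ 0) = erlang_density k m s * (s - t)\<^sup>2" for s
    by (simp add: power2_eq_square algebra_simps)
  moreover have "(n + 1) * n / m\<^sup>2 - 2 * t * (n / m) + t\<^sup>2 * 1 = t\<^sup>2 / n"
    unfolding tm using n m by (simp add: field_simps power2_eq_square)
  ultimately have b: "has_bochner_integral lborel (\<lambda>s. erlang_density k m s * (s - t)\<^sup>2) (t\<^sup>2 / n)" by simp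
  have "(\<integral>\<^sup>+ s. ennreal (erlang_density k m s * (s - t)\<^sup>2) \<partial>lborel) = ennreal (\<integral>s. erlang_density k m s * (s - t)\<^sup>2 \<partial>lborel)"
    using b m by (intro nn_integral_eq_integral) (auto simp: has_bochner_integral_iff erlang_nonneg)
  then show ?thesis using has_bochner_integral_integral_eq[OF b] by (simp add: n_def)
qed

text \<open>Chebyshev's argument: near \<open>t\<close> the evolution is close to its value at
  \<open>t\<close> by continuity, and away from \<open>t\<close> the uniform bound is dominated by a
  multiple of \<open>(s - t)^2\<close>, whose Erlang average is the variance. Jensen transfers the
  estimate to the averaged evolution.\<close>

lemma erlang_average_L2_bound:
  assumes f: "Lp_mem 2 f" and E: "0 < E" and t: "0 < t" and e: "0 < e"
  obtains K where "0 \<le> K" "\<And>k. (\<integral>\<^sup>+ x. ennreal (norm ((\<integral>s. complex_of_real (erlang_density k (real (Suc k) / t) s) * evol E f s x \<partial>lborel) - evol E f t x) powr 2) \<partial>lborel)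
      \<le> ennreal (e + K / real (Suc k))"
proof -
  have [measurable]: "f \<in> borel_measurable borel" by (rule Lp_memD_measurable[OF f])
  obtain B where B: "0 \<le> B" "\<And>s. 0 < s \<Longrightarrow> (\<integral>\<^sup>+ x. ennreal (norm (evol E f s x) powr 2) \<partial>lborel) \<le> ennreal B"
    using evol_L2_bound[OF f E] by blast
  obtain d where d: "0 < d" "\<And>s. \<bar>s - t\<bar> < d \<Longrightarrow> (\<integral>\<^sup>+ x. ennreal (norm (evol E f s x - evol E f t x) powr 2) \<partial>lborel) \<le> ennreal e"
    using evol_L2_continuous[OF f E t e] by blast
  \<comment> \<open>8 is \<open>2 powr 2\<close> from the quasi-triangle inequality times the two
    copies of \<open>B\<close>. Dividing by the square of \<open>d\<close> makes
    \<open>L * (s - t)^2\<close> exceed \<open>8 * B\<close> as soon as \<open>s\<close> is at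
    distance at least \<open>d\<close> from \<open>t\<close>.\<close>
  define L where "L = 8 * B / d\<^sup>2"
  have L: "0 \<le> L" using B by (simp add: L_def)
  have dist: "(\<integral>\<^sup>+ x. ennreal (norm (evol E f s x - evol E f t x) powr 2) \<partial>lborel) \<le> ennreal (e + L * (s - t)\<^sup>2)" if s: "0 < s" for s
  proof (cases "\<bar>s - t\<bar> < d")
    case True
    then show ?thesis using d(2)[OF True] L by (elim order_trans) (auto intro!: ennreal_leI)
  next
    case False
    then have "1 \<le> (s - t)\<^sup>2 / d\<^sup>2" using d(1) by (simp add: power2_le_iff_abs_le abs_le_square_iff[symmetric])
    then have "8 * B * 1 \<le> 8 * B * ((s - t)\<^sup>2 / d\<^sup>2)" using B by (intro mult_left_mono) auto
    then have "8 * B \<le> L * (s - t)\<^sup>2" by (simp add: L_def)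
    then have le: "8 * B \<le> e + L * (s - t)\<^sup>2" using e by simp
    have "(\<integral>\<^sup>+ x. ennreal (norm (evol E f s x - evol E f t x) powr 2) \<partial>lborel)
       \<le> ennreal (2 powr 2) * ((\<integral>\<^sup>+ x. ennreal (norm (evol E f s x) powr 2) \<partial>lborel) + (\<integral>\<^sup>+ x. ennreal (norm (evol E f t x) powr 2) \<partial>lborel))"
      by (rule nn_integral_add_powr_le) (auto simp: norm_triangle_ineq4)
    also have "\<dots> \<le> ennreal (2 powr 2) * (ennreal B + ennreal B)"
      using s t B by (intro mult_left_mono add_mono) auto
    also have "\<dots> = ennreal (8 * B)" using B by (simp add: ennreal_plus[symmetric] ennreal_mult'[symmetric] del: ennreal_plus) (simp add: ennreal_mult')
    also have "\<dots> \<le> ennreal (e + L * (s - t)\<^sup>2)" by (rule ennreal_leI[OF le])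
    finally show ?thesis .
  qed
  show thesis
  proof
    show "0 \<le> L * t\<^sup>2" using L by simp
    fix k
    define m where "m = real (Suc k) / t"
    have m: "0 < m" using t by (simp add: m_def)
    have en: "0 \<le> erlang_density k m s" for s by (rule erlang_nonneg[OF m])
    define F where "F x s = norm (evol E f s x - evol E f t x)" for x s
    have [measurable]: "(\<lambda>z. F (fst z) (snd z)) \<in> borel_measurable (borel \<Otimes>\<^sub>M borel)" unfolding F_def by measurable
    have [measurable]: "F x \<in> borel_measurable borel" for x unfolding F_def by measurable
    have "(\<integral>\<^sup>+ x. ennreal (norm ((\<integral>s. complex_of_real (erlang_density k m s) * evol E f s x \<partial>lborel) - evol E f t x) powr 2) \<partial>lborel)
       \<le> (\<integral>\<^sup>+ x. ennreal (1 powr (2 - 1)) * (\<integral>\<^sup>+ s. ennreal (erlang_density k m s * F x s powr 2) \<partial>lborel) \<partial>lborel)"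
    proof (rule nn_integral_mono_AE)
      show "AE x in lborel. ennreal (norm ((\<integral>s. complex_of_real (erlang_density k m s) * evol E f s x \<partial>lborel) - evol E f t x) powr 2)
          \<le> ennreal (1 powr (2 - 1)) * (\<integral>\<^sup>+ s. ennreal (erlang_density k m s * F x s powr 2) \<partial>lborel)"
        using AE_neq[of 0]
      proof eventually_elim
        case (elim x)
        have cl: "laplace_class (\<lambda>s. evol E f s x)" by (rule laplace_class_evol[OF f _ E elim]) simp
        have i1: "integrable lborel (\<lambda>s. complex_of_real (erlang_density k m s) * evol E f s x)"
          using erlang_nn_integral_finite[OF cl m, of k] en by (intro integrableI_bounded) (auto simp: norm_mult)
        have ei: "has_bochner_integral lborel (erlang_density k m) 1"
          using erlang_moment[OF m, of k 0] by simp
        then have i2: "integrable lborel (\<lambda>s. complex_of_real (erlang_density k m s) * evol E f t x)"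
          by (intro integrable_mult_left integrable_of_real) (auto simp: has_bochner_integral_iff)
        have "(\<integral>s. complex_of_real (erlang_density k m s) * evol E f t x \<partial>lborel) = evol E f t x"
          using has_bochner_integral_integral_eq[OF ei] by (subst integral_mult_left_zero) (simp add: integral_complex_of_real)
        then have eq: "(\<integral>s. complex_of_real (erlang_density k m s) * evol E f s x \<partial>lborel) - evol E f t x
           = (\<integral>s. complex_of_real (erlang_density k m s) * (evol E f s x - evol E f t x) \<partial>lborel)"
          unfolding right_diff_distrib Bochner_Integration.integral_diff[OF i1 i2] by simp
        show ?case unfolding eq
          by (rule integral_Jensen_powr) (use en m in \<open>auto simp: F_def norm_mult nn_integral_erlang\<close>)
      qed
    qed
    also have "\<dots> = (\<integral>\<^sup>+ s. \<integral>\<^sup>+ x. ennreal (erlang_density k m s * F x s powr 2) \<partial>lborel \<partial>lborel)"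
      by (subst lborel_Tonelli[symmetric]) (auto simp del: powr_numeral)
    also have "\<dots> \<le> (\<integral>\<^sup>+ s. ennreal e * ennreal (erlang_density k m s) + ennreal L * ennreal (erlang_density k m s * (s - t)\<^sup>2) \<partial>lborel)"
    proof (rule nn_integral_mono_AE)
      show "AE s in lborel. (\<integral>\<^sup>+ x. ennreal (erlang_density k m s * F x s powr 2) \<partial>lborel) \<le> ennreal e * ennreal (erlang_density k m s) + ennreal L * ennreal (erlang_density k m s * (s - t)\<^sup>2)"
        using AE_neq[of 0]
      proof eventually_elim
        case (elim s)
        show ?case
        proof (cases "0 < s")
          case True
          have "(\<integral>\<^sup>+ x. ennreal (erlang_density k m s * F x s powr 2) \<partial>lborel) = (\<integral>\<^sup>+ x. ennreal (erlang_density k m s) * ennreal (norm (evol E f s x - evol E f t x) powr 2) \<partial>lborel)"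
            using en by (intro nn_integral_cong) (simp add: ennreal_mult'[symmetric] F_def)
          also have "\<dots> = ennreal (erlang_density k m s) * (\<integral>\<^sup>+ x. ennreal (norm (evol E f s x - evol E f t x) powr 2) \<partial>lborel)"
            by (intro nn_integral_cmult) simp
          also have "\<dots> \<le> ennreal (erlang_density k m s) * ennreal (e + L * (s - t)\<^sup>2)"
            by (intro mult_left_mono dist True) simp
          also have "\<dots> = ennreal (e * erlang_density k m s + L * (erlang_density k m s * (s - t)\<^sup>2))"
            using en by (simp add: ennreal_mult'[symmetric] algebra_simps)
          also have "\<dots> = ennreal (e * erlang_density k m s) + ennreal (L * (erlang_density k m s * (s - t)\<^sup>2))"
            using en e L by (intro ennreal_plus) auto
          finally show ?thesis using e L by (simp add: ennreal_mult')
        next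
          case False
          then have "erlang_density k m s = 0" using elim by (simp add: erlang_density_def)
          then show ?thesis by simp
        qed
      qed
    qed
    also have "\<dots> = ennreal e * (\<integral>\<^sup>+ s. ennreal (erlang_density k m s) \<partial>lborel) + ennreal L * (\<integral>\<^sup>+ s. ennreal (erlang_density k m s * (s - t)\<^sup>2) \<partial>lborel)"
      by (subst nn_integral_add) (auto simp: nn_integral_cmult)
    also have "\<dots> = ennreal e * 1 + ennreal L * ennreal (t\<^sup>2 / real (Suc k))"
      using nn_integral_erlang[OF m] erlang_variance[OF t, of k] by (simp add: m_def)
    also have "\<dots> = ennreal (e + L * t\<^sup>2 / real (Suc k))"
      using e L by (subst ennreal_plus) (auto simp: ennreal_mult'[symmetric] simp del: of_nat_Suc)
    finally show "(\<integral>\<^sup>+ x. ennreal (norm ((\<integral>s. complex_of_real (erlang_density k (real (Suc k) / t) s) * evol E f s x \<partial>lborel) - evol E f t x) powr 2) \<partial>lborel)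
      \<le> ennreal (e + L * t\<^sup>2 / real (Suc k))" by (simp add: m_def)
  qed
qed

lemma evol_Lp_mem:
  assumes f: "Lp_mem 2 f" and E: "0 < E" and t: "0 < t"
  shows "Lp_mem 2 (evol E f t)"
proof -
  have [measurable]: "f \<in> borel_measurable borel" by (rule Lp_memD_measurable[OF f])
  obtain B where B: "0 \<le> B" "\<And>s. 0 < s \<Longrightarrow> (\<integral>\<^sup>+ x. ennreal (norm (evol E f s x) powr 2) \<partial>lborel) \<le> ennreal B"
    using evol_L2_bound[OF f E] by blast
  have "(\<integral>\<^sup>+ x. ennreal (norm (evol E f t x) powr 2) \<partial>lborel) < \<infinity>"
    using B(2)[OF t] by (rule le_less_trans) simp
  moreover have "evol E f t \<in> borel_measurable borel" by measurable
  ultimately show ?thesis unfolding Lp_mem_def by simp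
qed

text \<open>Stated through the integral and not through \<open>Lp_norm\<close>, whose value for an
  infinite integral is 0 and would carry no information.\<close>

lemma resolv_iterate_eventually_close:
  assumes f: "Lp_mem 2 f" and orth: "(\<integral>y. complex_of_real (Gk (Ealpha alpha) y) * f y \<partial>lborel) = 0" and t: "0 < t" and e: "0 < e"
  shows "eventually (\<lambda>n. (\<integral>\<^sup>+ x. ennreal (norm (((\<lambda>g y. complex_of_real (real n / t) * resolv alpha (real n / t) g y) ^^ n) f x - evol (Ealpha alpha) f t x) powr 2) \<partial>lborel) \<le> ennreal e) sequentially"
proof -
  obtain K where K: "0 \<le> K" "\<And>k. (\<integral>\<^sup>+ x. ennreal (norm ((\<integral>s. complex_of_real (erlang_density k (real (Suc k) / t) s) * evol (Ealpha alpha) f s x \<partial>lborel) - evol (Ealpha alpha) f t x) powr 2) \<partial>lborel)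
      \<le> ennreal (e / 2 + K / real (Suc k))"
    using erlang_average_L2_bound[OF f Ealpha_pos t, of "e / 2"] e by auto
  \<comment> \<open>Beyond \<open>Ealpha alpha * t\<close> the rate \<open>n / t\<close> avoids the
    eigenvalue, where the Krein denominator vanishes; beyond \<open>2 * K / e\<close> the variance
    term is at most \<open>e / 2\<close>.\<close>
  obtain N :: nat where N: "max (Ealpha alpha * t) (2 * K / e) < real N" using reals_Archimedean2 by blast
  show ?thesis
  proof (rule eventually_sequentiallyI[of "Suc N"])
    fix n assume n: "Suc N \<le> n"
    then obtain k where k: "n = Suc k" by (cases n) auto
    have nN: "Ealpha alpha * t < real n" "2 * K / e < real n" using N n by auto
    define m where "m = real (Suc k) / t"
    have m: "0 < m" "m \<noteq> Ealpha alpha" using nN t by (auto simp: m_def k field_simps)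
    have "(\<integral>\<^sup>+ x. ennreal (norm (((\<lambda>g y. complex_of_real (real n / t) * resolv alpha (real n / t) g y) ^^ n) f x - evol (Ealpha alpha) f t x) powr 2) \<partial>lborel)
       = (\<integral>\<^sup>+ x. ennreal (norm ((\<integral>s. complex_of_real (erlang_density k (real (Suc k) / t) s) * evol (Ealpha alpha) f s x \<partial>lborel) - evol (Ealpha alpha) f t x) powr 2) \<partial>lborel)"
    proof (rule nn_integral_cong_AE)
      show "AE x in lborel. ennreal (norm (((\<lambda>g y. complex_of_real (real n / t) * resolv alpha (real n / t) g y) ^^ n) f x - evol (Ealpha alpha) f t x) powr 2)
         = ennreal (norm ((\<integral>s. complex_of_real (erlang_density k (real (Suc k) / t) s) * evol (Ealpha alpha) f s x \<partial>lborel) - evol (Ealpha alpha) f t x) powr 2)"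
        using AE_neq[of 0]
      proof eventually_elim
        case (elim x)
        show ?case unfolding k m_def[symmetric] resolv_iterate[OF f orth m elim] ..
      qed
    qed
    also have "\<dots> \<le> ennreal (e / 2 + K / real (Suc k))" by (rule K(2))
    also have "\<dots> \<le> ennreal e"
    proof (rule ennreal_leI)
      have "2 * K < e * real n" using nN(2) e by (simp add: field_simps)
      then have "K / real n \<le> e / 2" using n by (simp add: field_simps)
      then show "e / 2 + K / real (Suc k) \<le> e" unfolding k by linarith
    qed
    finally show "(\<integral>\<^sup>+ x. ennreal (norm (((\<lambda>g y. complex_of_real (real n / t) * resolv alpha (real n / t) g y) ^^ n) f x - evol (Ealpha alpha) f t x) powr 2) \<partial>lborel) \<le> ennreal e" .
  qed
qed

lemma heat_sg_evol:
  assumes f: "Lp_mem 2 f" and orth: "(\<integral>y. complex_of_real (Gk (Ealpha alpha) y) * f y \<partial>lborel) = 0" and t: "0 < t"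
  shows "heat_sg alpha t f (evol (Ealpha alpha) f t)"
  unfolding heat_sg_def
proof (intro conjI evol_Lp_mem[OF f _ t] LIMSEQ_I)
  fix r :: real assume r: "0 < r"
  have "0 < (r / 2) powr 2" using r by simp
  from resolv_iterate_eventually_close[OF f orth t this]
  obtain N where N: "\<And>n. N \<le> n \<Longrightarrow> (\<integral>\<^sup>+ x. ennreal (norm (((\<lambda>g y. complex_of_real (real n / t) * resolv alpha (real n / t) g y) ^^ n) f x - evol (Ealpha alpha) f t x) powr 2) \<partial>lborel) \<le> ennreal ((r / 2) powr 2)"
    unfolding eventually_sequentially by blast
  show "\<exists>N. \<forall>n\<ge>N. norm (Lp_norm 2 (\<lambda>x. ((\<lambda>g y. complex_of_real (real n / t) * resolv alpha (real n / t) g y) ^^ n) f x - evol (Ealpha alpha) f t x) - 0) < r"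
  proof (intro exI allI impI)
    fix n assume "N \<le> n"
    then have "Lp_norm 2 (\<lambda>x. ((\<lambda>g y. complex_of_real (real n / t) * resolv alpha (real n / t) g y) ^^ n) f x - evol (Ealpha alpha) f t x) \<le> r / 2"
      using r by (intro Lp_norm_le N) auto
    then show "norm (Lp_norm 2 (\<lambda>x. ((\<lambda>g y. complex_of_real (real n / t) * resolv alpha (real n / t) g y) ^^ n) f x - evol (Ealpha alpha) f t x) - 0) < r"
      using r by simp
  qed
qed simp

text \<open>Both \<open>u\<close> and the evolution are mean-square limits of the same iterates, so
  their difference has arbitrarily small square integral.\<close>

lemma heat_sg_unique:
  assumes f: "Lp_mem 2 f" and orth: "(\<integral>y. complex_of_real (Gk (Ealpha alpha) y) * f y \<partial>lborel) = 0" and t: "0 < t"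
    and u: "heat_sg alpha t f u"
  shows "AE x in lborel. u x = evol (Ealpha alpha) f t x"
proof -
  have [measurable]: "f \<in> borel_measurable borel" by (rule Lp_memD_measurable[OF f])
  have um: "Lp_mem 2 u" using u by (simp add: heat_sg_def)
  have [measurable]: "u \<in> borel_measurable borel" by (rule Lp_memD_measurable[OF um])
  define a where "a n = ((\<lambda>g y. complex_of_real (real n / t) * resolv alpha (real n / t) g y) ^^ n) f" for n
  have [measurable]: "a n \<in> borel_measurable borel" for n unfolding a_def by (rule resolv_iterate_measurable) simp
  define v where "v = evol (Ealpha alpha) f t"
  have vm: "Lp_mem 2 v" unfolding v_def by (rule evol_Lp_mem[OF f _ t]) simp
  have [measurable]: "v \<in> borel_measurable borel" by (rule Lp_memD_measurable[OF vm])
  have lim: "(\<lambda>n. Lp_norm 2 (\<lambda>x. a n x - u x)) \<longlonglongrightarrow> 0" using u unfolding heat_sg_def a_def by blast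
  let ?I = "\<lambda>h. \<integral>\<^sup>+ x. ennreal (norm (h x) powr 2) \<partial>lborel"
  have small: "?I (\<lambda>x. u x - v x) \<le> ennreal e" if e: "0 < e" for e
  proof -
    \<comment> \<open>Two errors of size \<open>e / 8\<close> and the quasi-triangle factor
      \<open>2 powr 2\<close> add up to \<open>e\<close>.\<close>
    define r where "r = sqrt (e / 8)"
    have r: "0 < r" "r powr 2 = e / 8" using e by (auto simp: r_def)
    have "eventually (\<lambda>n. ?I (\<lambda>x. a n x - v x) \<le> ennreal (e / 8)) sequentially"
      unfolding a_def v_def using e by (intro resolv_iterate_eventually_close[OF f orth t]) auto
    moreover have "eventually (\<lambda>n. Lp_norm 2 (\<lambda>x. a n x - u x) < r) sequentially"
      using order_tendstoD(2)[OF lim r(1)] .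
    ultimately have "eventually (\<lambda>n. ?I (\<lambda>x. a n x - v x) \<le> ennreal (e / 8) \<and> Lp_norm 2 (\<lambda>x. a n x - u x) < r) sequentially"
      by (rule eventually_conj)
    then obtain n where n: "?I (\<lambda>x. a n x - v x) \<le> ennreal (e / 8)" "Lp_norm 2 (\<lambda>x. a n x - u x) < r"
      unfolding eventually_sequentially by blast
    \<comment> \<open>Required before the norm can be used: \<open>Lp_norm\<close> is 0 when the
      integral is infinite, so its smallness alone does not control the integral. Membership comes
      from the closeness of the iterate to the evolution.\<close>
    have "Lp_mem 2 (\<lambda>x. a n x - u x)"
    proof -
      have "?I (\<lambda>x. v x - u x) \<le> ennreal (2 powr 2) * (?I v + ?I u)"
        by (rule nn_integral_add_powr_le) (auto simp: norm_triangle_ineq4)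
      also have "\<dots> < \<infinity>" using vm um unfolding Lp_mem_def by (simp add: ennreal_mult_less_top)
      finally have vu: "?I (\<lambda>x. v x - u x) < \<infinity>" .
      have "?I (\<lambda>x. a n x - u x) \<le> ennreal (2 powr 2) * (?I (\<lambda>x. a n x - v x) + ?I (\<lambda>x. v x - u x))"
      proof (rule nn_integral_add_powr_le)
        show "norm (a n x - u x) \<le> norm (a n x - v x) + norm (v x - u x)" for x
          using norm_triangle_ineq[of "a n x - v x" "v x - u x"] by simp
      qed auto
      also have "\<dots> < \<infinity>"
      proof -
        have "?I (\<lambda>x. a n x - v x) < \<infinity>" using n(1) by (rule le_less_trans) simp
        then show ?thesis using vu by (simp add: ennreal_mult_less_top)
      qed
      finally show ?thesis unfolding Lp_mem_def by simp
    qed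
    then have "?I (\<lambda>x. a n x - u x) = ennreal (Lp_norm 2 (\<lambda>x. a n x - u x) powr 2)" by (rule nn_integral_Lp_norm) simp
    also have "\<dots> \<le> ennreal (r powr 2)" using n(2) by (intro ennreal_leI powr_mono2) auto
    finally have nu: "?I (\<lambda>x. a n x - u x) \<le> ennreal (e / 8)" unfolding r(2) .
    have "?I (\<lambda>x. u x - v x) \<le> ennreal (2 powr 2) * (?I (\<lambda>x. a n x - u x) + ?I (\<lambda>x. a n x - v x))"
    proof (rule nn_integral_add_powr_le)
      show "norm (u x - v x) \<le> norm (a n x - u x) + norm (a n x - v x)" for x
        using norm_triangle_ineq4[of "a n x - v x" "a n x - u x"] by simp
    qed auto
    also have "\<dots> \<le> ennreal (2 powr 2) * (ennreal (e / 8) + ennreal (e / 8))"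
      using n(1) nu by (intro mult_left_mono add_mono) auto
    also have "\<dots> = ennreal (2 powr 2 * (e / 8 + e / 8))"
    proof -
      have "ennreal (e / 8) + ennreal (e / 8) = ennreal (e / 8 + e / 8)" using e by (intro ennreal_plus[symmetric]) auto
      then show ?thesis by (simp only: ennreal_mult'[symmetric] powr_ge_zero)
    qed
    also have "2 powr 2 * (e / 8 + e / 8) = e" by simp
    finally show ?thesis .
  qed
  have "?I (\<lambda>x. u x - v x) \<le> 0"
  proof (rule ennreal_le_epsilon)
    fix e :: real assume "0 < e"
    then show "?I (\<lambda>x. u x - v x) \<le> 0 + ennreal e" unfolding add_0 by (rule small)
  qed
  then have "?I (\<lambda>x. u x - v x) = 0" by (simp only: le_zero_eq)
  then have "AE x in lborel. ennreal (norm (u x - v x) powr 2) = 0"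
    by (subst (asm) nn_integral_0_iff_AE) auto
  then show ?thesis unfolding v_def by eventually_elim auto
qed

section \<open>Weak gradients\<close>

text \<open>The partial derivative of \<open>hk s\<close> in direction \<open>j\<close>, in closed
  form; like \<open>hk\<close> it vanishes for \<open>s \<le> 0\<close>.\<close>

definition dhk :: "2 \<Rightarrow> real \<Rightarrow> R2 \<Rightarrow> real" where
  "dhk j s z = - (z $ j) / (2 * s) * hk s z"

lemma dhk_measurable [measurable (raw)]:
  assumes [measurable]: "f \<in> borel_measurable M" "g \<in> borel_measurable M"
  shows "(\<lambda>z. dhk j (f z) (g z)) \<in> borel_measurable M"
proof -
  have [measurable]: "(\<lambda>z. g z $ j) \<in> borel_measurable M"
    by (rule borel_measurable_continuous_on[OF _ assms(2)]) (intro continuous_intros)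
  show ?thesis unfolding dhk_def by measurable
qed

lemma dhk_nonpos [simp]: "s \<le> 0 \<Longrightarrow> dhk j s z = 0"
  by (simp add: dhk_def)

text \<open>The factor \<open>norm z / sqrt s\<close> is absorbed by half of the Gaussian exponent,
  which doubles the time; a power \<open>s powr (- 1 / 2)\<close> remains. Gradient bounds thereby
  reduce to bounds for \<open>hk\<close>.\<close>

lemma dhk_le:
  assumes s: "0 < s"
  shows "\<bar>dhk j s z\<bar> \<le> 2 * s powr (- (1 / 2)) * hk (2 * s) z"
proof -
  define y where "y = norm z / sqrt s"
  have y: "0 \<le> y" "y\<^sup>2 = (norm z)\<^sup>2 / s" using s by (auto simp: y_def power_divide)
  have "2 * y \<le> 4 + y\<^sup>2 / 4"
    using sum_squares_bound[of 2 "y / 2"] by (simp add: power_divide)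
  then have "y \<le> 2 + y\<^sup>2 / 8" by simp
  also have "\<dots> \<le> 2 * (1 + y\<^sup>2 / 8)" by simp
  also have "\<dots> \<le> 2 * exp (y\<^sup>2 / 8)" using exp_ge_add_one_self[of "y\<^sup>2 / 8"] by (intro mult_left_mono) auto
  finally have "y * exp (- y\<^sup>2 / 8) \<le> 2 * exp (y\<^sup>2 / 8) * exp (- y\<^sup>2 / 8)" by (intro mult_right_mono) auto
  then have ye: "y * exp (- y\<^sup>2 / 8) \<le> 2" by (simp add: exp_add[symmetric] mult.assoc)
  have "\<bar>dhk j s z\<bar> = \<bar>z $ j\<bar> / (2 * s) * hk s z" using s by (simp add: dhk_def abs_mult)
  also have "\<dots> \<le> norm z / (2 * s) * hk s z"
    using s by (intro mult_right_mono divide_right_mono component_le_norm_cart) auto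
  also have "\<dots> = (1 / sqrt s) * (y * exp (- y\<^sup>2 / 8)) * (exp (- y\<^sup>2 / 8) / (8 * pi * s))"
  proof -
    have "norm z = y * sqrt s" using s by (simp add: y_def)
    moreover have "exp (- (norm z)\<^sup>2 / (4 * s)) = exp (- y\<^sup>2 / 8) * exp (- y\<^sup>2 / 8)"
      unfolding exp_add[symmetric] y(2) by simp
    moreover have "sqrt s / s = 1 / sqrt s" using s real_div_sqrt[of s] by (simp add: field_simps)
    ultimately show ?thesis using s by (simp add: hk_def field_simps)
  qed
  also have "\<dots> \<le> (1 / sqrt s) * 2 * (exp (- y\<^sup>2 / 8) / (8 * pi * s))"
    using ye s by (intro mult_right_mono mult_left_mono) auto
  also have "\<dots> = 2 * s powr (- (1 / 2)) * hk (2 * s) z"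
  proof -
    have "s powr (- (1 / 2)) = 1 / sqrt s" using s by (simp add: powr_minus powr_half_sqrt inverse_eq_divide)
    moreover have "hk (2 * s) z = exp (- y\<^sup>2 / 8) / (8 * pi * s)" using s unfolding hk_def y(2) by (simp add: mult_ac)
    ultimately show ?thesis by simp
  qed
  finally show ?thesis .
qed

lemma hk_directional_derivative:
  assumes s: "0 < s"
  shows "((\<lambda>h. hk s (z + h *\<^sub>R axis j 1)) has_real_derivative dhk j s (z + h *\<^sub>R axis j 1)) (at h)"
proof -
  have n: "(norm (z + h *\<^sub>R axis j 1))\<^sup>2 = (norm z)\<^sup>2 + 2 * h * (z $ j) + h\<^sup>2" for h
    unfolding power2_norm_eq_inner
    by (simp add: inner_add inner_commute[of "axis j 1" z] inner_axis inner_axis_axis power2_eq_square algebra_simps)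
  have c: "(z + h *\<^sub>R axis j 1) $ j = z $ j + h" for h by simp
  have "((\<lambda>h. - ((norm z)\<^sup>2 + 2 * h * (z $ j) + h\<^sup>2) / (4 * s)) has_real_derivative - (2 * (z $ j) + 2 * h) / (4 * s)) (at h)"
    by (rule DERIV_cdivide) (auto intro!: derivative_eq_intros)
  from DERIV_cdivide[OF DERIV_fun_exp[OF this], of "4 * pi * s"]
  have "((\<lambda>h. exp (- ((norm z)\<^sup>2 + 2 * h * (z $ j) + h\<^sup>2) / (4 * s)) / (4 * pi * s)) has_real_derivative
     exp (- ((norm z)\<^sup>2 + 2 * h * (z $ j) + h\<^sup>2) / (4 * s)) * (- (2 * (z $ j) + 2 * h) / (4 * s)) / (4 * pi * s)) (at h)"
    .
  then have "((\<lambda>h. exp (- ((norm z)\<^sup>2 + 2 * h * (z $ j) + h\<^sup>2) / (4 * s)) / (4 * pi * s)) has_real_derivative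
     - (z $ j + h) / (2 * s) * (exp (- ((norm z)\<^sup>2 + 2 * h * (z $ j) + h\<^sup>2) / (4 * s)) / (4 * pi * s))) (at h)"
    by (rule DERIV_cong) (use s in \<open>simp add: field_simps\<close>)
  then show ?thesis using s unfolding hk_def dhk_def n c by (simp only: if_True)
qed

lemma hk_increment_le:
  assumes s: "0 < s" and L: "\<And>z. \<bar>dhk j s z\<bar> \<le> L"
  shows "\<bar>hk s (z + h *\<^sub>R axis j 1) - hk s z\<bar> \<le> L * \<bar>h\<bar>"
proof -
  have "norm (hk s (z + h *\<^sub>R axis j 1) - hk s (z + 0 *\<^sub>R axis j 1)) \<le> L * norm (h - 0)"
    by (rule field_differentiable_bound[of UNIV "\<lambda>h. hk s (z + h *\<^sub>R axis j 1)" "\<lambda>h. dhk j s (z + h *\<^sub>R axis j 1)"])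
      (use hk_directional_derivative[OF s] L in auto)
  then show ?thesis by simp
qed

section \<open>Test functions and integration by parts\<close>

lemma test_fun_partial_continuous:
  assumes "test_fun \<phi>"
  shows "continuous_on UNIV \<phi>" "continuous_on UNIV (partial j \<phi>)"
proof -
  have "iter_partial [] \<phi> differentiable_on UNIV" "iter_partial [j] \<phi> differentiable_on UNIV"
    using assms unfolding test_fun_def by blast+
  then show "continuous_on UNIV \<phi>" "continuous_on UNIV (partial j \<phi>)"
    by (auto intro: differentiable_imp_continuous_on)
qed

lemma test_fun_measurable:
  assumes "test_fun \<phi>"
  shows "\<phi> \<in> borel_measurable borel" "partial j \<phi> \<in> borel_measurable borel"
  using test_fun_partial_continuous[OF assms] by (auto intro: borel_measurable_continuous_onI)

lemma test_fun_bounds: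
  assumes \<phi>: "test_fun \<phi>"
  obtains B R where "0 \<le> B" "\<And>x. \<bar>\<phi> x\<bar> \<le> B * indicator (cball 0 R) x" "\<And>x. \<bar>partial j \<phi> x\<bar> \<le> B * indicator (cball 0 R) x"
proof -
  obtain R where R: "{x. \<phi> x \<noteq> 0} \<subseteq> cball 0 R"
    using \<phi> unfolding test_fun_def bounded_iff by fastforce
  have z: "\<phi> x = 0" if "x \<notin> cball 0 R" for x using R that by auto
  \<comment> \<open>The complement of the ball is open, so \<open>\<phi>\<close> vanishes in a whole
    neighbourhood of such a point.\<close>
  have z': "partial j \<phi> x = 0" if "x \<notin> cball 0 R" for x
  proof -
    have "((\<lambda>_. 0) has_derivative (\<lambda>_. 0)) (at x)" by (rule has_derivative_const)
    then have "(\<phi> has_derivative (\<lambda>_. 0)) (at x)"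
      by (rule has_derivative_transform_within_open[of _ _ _ _ "- cball 0 R"]) (use that z in auto)
    then have "frechet_derivative \<phi> (at x) = (\<lambda>_. 0)" by (rule frechet_derivative_at[symmetric])
    then show ?thesis by (simp add: partial_def)
  qed
  have bd: "\<exists>B\<ge>0. \<forall>x\<in>cball 0 R. \<bar>g x\<bar> \<le> B" if "continuous_on UNIV g" for g :: "R2 \<Rightarrow> real"
  proof -
    have "bounded (g ` cball 0 R)"
      using that by (intro compact_imp_bounded compact_continuous_image) (auto intro: continuous_on_subset)
    then obtain B where "\<And>y. y \<in> g ` cball 0 R \<Longrightarrow> norm y \<le> B" unfolding bounded_iff by blast
    then show ?thesis by (intro exI[of _ "max 0 B"]) force
  qed
  obtain B1 where B1: "0 \<le> B1" "\<And>x. x \<in> cball 0 R \<Longrightarrow> \<bar>\<phi> x\<bar> \<le> B1" using bd[OF test_fun_partial_continuous(1)[OF \<phi>]] by blast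
  obtain B2 where B2: "0 \<le> B2" "\<And>x. x \<in> cball 0 R \<Longrightarrow> \<bar>partial j \<phi> x\<bar> \<le> B2" using bd[OF test_fun_partial_continuous(2)[OF \<phi>]] by blast
  show thesis
  proof
    show "0 \<le> max B1 B2" using B1 by simp
    fix x
    show "\<bar>\<phi> x\<bar> \<le> max B1 B2 * indicator (cball 0 R) x"
      using B1(2)[of x] z[of x] by (cases "x \<in> cball 0 R") (auto simp del: mem_cball)
    show "\<bar>partial j \<phi> x\<bar> \<le> max B1 B2 * indicator (cball 0 R) x"
      using B2(2)[of x] z'[of x] by (cases "x \<in> cball 0 R") (auto simp del: mem_cball)
  qed
qed

lemma nn_integral_cball_indicator:
  "(\<integral>\<^sup>+ x. ennreal (B * indicator (cball (0 :: R2) R) x) \<partial>lborel) < \<infinity>"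
proof -
  have "(\<integral>\<^sup>+ x. ennreal (B * indicator (cball (0 :: R2) R) x) \<partial>lborel) = (\<integral>\<^sup>+ x. ennreal B * indicator (cball (0 :: R2) R) x \<partial>lborel)"
    by (intro nn_integral_cong) (auto split: split_indicator)
  also have "\<dots> = ennreal B * emeasure lborel (cball (0 :: R2) R)" by (rule nn_integral_cmult_indicator) simp
  also have "\<dots> < \<infinity>" using emeasure_bounded_finite[of "cball (0 :: R2) R"] by (simp add: ennreal_mult_less_top)
  finally show ?thesis .
qed

lemma test_fun_integrable:
  assumes \<phi>: "test_fun \<phi>"
  shows "integrable lborel \<phi>"
proof (rule integrableI_bounded)
  obtain B R where B: "\<And>x. \<bar>\<phi> x\<bar> \<le> B * indicator (cball (0 :: R2) R) x" using test_fun_bounds[OF \<phi>] by metis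
  have "(\<integral>\<^sup>+ x. ennreal (norm (\<phi> x)) \<partial>lborel) \<le> (\<integral>\<^sup>+ x. ennreal (B * indicator (cball (0 :: R2) R) x) \<partial>lborel)"
    using B by (intro nn_integral_mono ennreal_leI) auto
  also have "\<dots> < \<infinity>" by (rule nn_integral_cball_indicator)
  finally show "(\<integral>\<^sup>+ x. ennreal (norm (\<phi> x)) \<partial>lborel) < \<infinity>" .
qed (use test_fun_measurable[OF \<phi>] in simp)

lemma test_fun_directional_derivative:
  assumes \<phi>: "test_fun \<phi>"
  shows "((\<lambda>h. \<phi> (x + h *\<^sub>R axis j 1)) has_real_derivative partial j \<phi> (x + h *\<^sub>R axis j 1)) (at h)"
proof -
  have "\<phi> differentiable_on UNIV" using \<phi> unfolding test_fun_def by (metis iter_partial.simps(1))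
  then have "\<phi> differentiable (at y)" for y by (simp add: differentiable_on_def)
  then have D: "(\<phi> has_derivative frechet_derivative \<phi> (at y)) (at y)" for y by (simp add: frechet_derivative_works)
  have "((\<lambda>h. x + h *\<^sub>R axis j 1) has_derivative (\<lambda>k. k *\<^sub>R axis j 1)) (at h)"
    by (auto intro!: derivative_eq_intros)
  from has_derivative_compose[OF this D]
  have "((\<lambda>h. \<phi> (x + h *\<^sub>R axis j 1)) has_derivative (\<lambda>k. frechet_derivative \<phi> (at (x + h *\<^sub>R axis j 1)) (k *\<^sub>R axis j 1))) (at h)" .
  moreover have "frechet_derivative \<phi> (at (x + h *\<^sub>R axis j 1)) (k *\<^sub>R axis j 1) = partial j \<phi> (x + h *\<^sub>R axis j 1) * k" for k
    using linear_scale[OF has_derivative_linear[OF D[of "x + h *\<^sub>R axis j 1"]], of k "axis j 1"] by (simp add: partial_def)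
  ultimately show ?thesis unfolding has_field_derivative_def by simp
qed

lemma test_fun_increment_le:
  assumes \<phi>: "test_fun \<phi>" and L: "\<And>z. \<bar>partial j \<phi> z\<bar> \<le> L"
  shows "\<bar>\<phi> (z + h *\<^sub>R axis j 1) - \<phi> z\<bar> \<le> L * \<bar>h\<bar>"
proof -
  have "norm (\<phi> (z + h *\<^sub>R axis j 1) - \<phi> (z + 0 *\<^sub>R axis j 1)) \<le> L * norm (h - 0)"
    by (rule field_differentiable_bound[of UNIV "\<lambda>h. \<phi> (z + h *\<^sub>R axis j 1)" "\<lambda>h. partial j \<phi> (z + h *\<^sub>R axis j 1)"])
      (use test_fun_directional_derivative[OF \<phi>] L in auto)
  then show ?thesis by simp
qed

lemma filterlim_inverse_Suc_at_0: "filterlim (\<lambda>i. inverse (real (Suc i))) (at 0) sequentially"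
  using LIMSEQ_inverse_real_of_nat by (auto simp: filterlim_at)

text \<open>Integration by parts as the limit of the translation invariance of difference quotients.\<close>
lemma hk_integration_by_parts:
  assumes \<phi>: "test_fun \<phi>"
  shows "(\<integral>x. hk s (x - y) * partial j \<phi> x \<partial>lborel) = - (\<integral>x. dhk j s (x - y) * \<phi> x \<partial>lborel)"
proof (cases "0 < s")
  case s: True
  have [measurable]: "\<phi> \<in> borel_measurable borel" "partial j \<phi> \<in> borel_measurable borel" by (rule test_fun_measurable[OF \<phi>])+
  obtain B R where B: "0 \<le> B" "\<And>x. \<bar>\<phi> x\<bar> \<le> B * indicator (cball 0 R) x" "\<And>x. \<bar>partial j \<phi> x\<bar> \<le> B * indicator (cball 0 R) x"
    using test_fun_bounds[OF \<phi>, of j] by blast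
  have B': "\<bar>\<phi> x\<bar> \<le> B" "\<bar>partial j \<phi> x\<bar> \<le> B" for x
    using B(1) order_trans[OF B(2)[of x], of B] order_trans[OF B(3)[of x], of B] by (auto split: split_indicator simp: mult_left_le)
  \<comment> \<open>A Lipschitz constant of \<open>hk s\<close> along the axis, from
    \<open>dhk_le\<close> and the supremum of \<open>hk (2 * s)\<close>. It gives the majorant for
    the difference quotients of the kernel.\<close>
  define L where "L = 2 * s powr (- (1 / 2)) * (1 / (4 * pi * (2 * s)))"
  have L: "\<bar>dhk j s z\<bar> \<le> L" for z
    unfolding L_def using s by (intro order_trans[OF dhk_le[OF s]] mult_left_mono hk_le) auto
  define h where "h i = inverse (real (Suc i))" for i
  have h0: "0 < h i" for i by (simp add: h_def)
  define e where "e = (axis j 1 :: R2)"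
  have hki: "integrable lborel (\<lambda>x. hk s (x - y))"
    using nn_integral_hk_shift[OF s] by (intro integrableI_nonneg) auto
  have i1: "integrable lborel (\<lambda>x. hk s (x - y) * \<phi> (x + c))" for c
    by (rule Bochner_Integration.integrable_bound[of _ "\<lambda>x. B * hk s (x - y)"])
      (use hki B' B(1) in \<open>auto simp: abs_mult mult.commute intro!: mult_right_mono\<close>)
  have shift: "(\<integral>x. hk s (x - y) * \<phi> (x + h i *\<^sub>R e) \<partial>lborel) = (\<integral>x. hk s (x - h i *\<^sub>R e - y) * \<phi> x \<partial>lborel)" for i
    using integral_lborel_shift[of "\<lambda>x. hk s (x - y) * \<phi> (x + h i *\<^sub>R e)" "- (h i *\<^sub>R e)"]
    by (simp add: algebra_simps)
  have i2: "integrable lborel (\<lambda>x. hk s (x - c) * \<phi> x)" for c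
  proof (rule Bochner_Integration.integrable_bound[of _ "\<lambda>x. 1 / (4 * pi * s) * \<phi> x"])
    show "integrable lborel (\<lambda>x. 1 / (4 * pi * s) * \<phi> x)" using test_fun_integrable[OF \<phi>] by simp
    show "AE x in lborel. norm (hk s (x - c) * \<phi> x) \<le> norm (1 / (4 * pi * s) * \<phi> x)"
    proof (rule AE_I2)
      fix x
      have "hk s (x - c) * \<bar>\<phi> x\<bar> \<le> 1 / (4 * pi * s) * \<bar>\<phi> x\<bar>" by (intro mult_right_mono hk_le s) auto
      then show "norm (hk s (x - c) * \<phi> x) \<le> norm (1 / (4 * pi * s) * \<phi> x)" using s by (simp add: abs_mult)
    qed
  qed simp
  have eq: "(\<integral>x. hk s (x - y) * ((\<phi> (x + h i *\<^sub>R e) - \<phi> x) / h i) \<partial>lborel) = (\<integral>x. (hk s (x - y + (- h i) *\<^sub>R e) - hk s (x - y)) / h i * \<phi> x \<partial>lborel)" for i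
  proof -
    have "(\<integral>x. hk s (x - y) * ((\<phi> (x + h i *\<^sub>R e) - \<phi> x) / h i) \<partial>lborel) = ((\<integral>x. hk s (x - y) * \<phi> (x + h i *\<^sub>R e) \<partial>lborel) - (\<integral>x. hk s (x - y) * \<phi> x \<partial>lborel)) / h i"
      using i1[of "h i *\<^sub>R e"] i1[of 0] by (simp add: right_diff_distrib)
    also have "\<dots> = ((\<integral>x. hk s (x - (h i *\<^sub>R e + y)) * \<phi> x \<partial>lborel) - (\<integral>x. hk s (x - y) * \<phi> x \<partial>lborel)) / h i"
      unfolding shift by (simp add: algebra_simps)
    also have "\<dots> = (\<integral>x. (hk s (x - (h i *\<^sub>R e + y)) * \<phi> x - hk s (x - y) * \<phi> x) / h i \<partial>lborel)"
      using i2 by simp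
    also have "\<dots> = (\<integral>x. (hk s (x - y + (- h i) *\<^sub>R e) - hk s (x - y)) / h i * \<phi> x \<partial>lborel)"
      by (intro Bochner_Integration.integral_cong refl) (simp add: algebra_simps diff_divide_distrib)
    finally show ?thesis .
  qed
  have quot: "(\<lambda>i. (F (h i) - F 0) / h i) \<longlonglongrightarrow> D" if "(F has_real_derivative D) (at 0)" for F D
  proof -
    have "((\<lambda>k. (F k - F 0) / k) \<longlongrightarrow> D) (at 0)" using that by (simp add: has_field_derivative_iff)
    then show ?thesis unfolding h_def by (rule filterlim_compose[OF _ filterlim_inverse_Suc_at_0])
  qed
  have lim1: "(\<lambda>i. \<integral>x. hk s (x - y) * ((\<phi> (x + h i *\<^sub>R e) - \<phi> x) / h i) \<partial>lborel) \<longlonglongrightarrow> (\<integral>x. hk s (x - y) * partial j \<phi> x \<partial>lborel)"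
  proof (rule integral_dominated_convergence)
    show "integrable lborel (\<lambda>x. B * hk s (x - y))" using hki by simp
    show "AE x in lborel. (\<lambda>i. hk s (x - y) * ((\<phi> (x + h i *\<^sub>R e) - \<phi> x) / h i)) \<longlonglongrightarrow> hk s (x - y) * partial j \<phi> x"
    proof (intro AE_I2 tendsto_mult tendsto_const)
      fix x
      show "(\<lambda>i. (\<phi> (x + h i *\<^sub>R e) - \<phi> x) / h i) \<longlonglongrightarrow> partial j \<phi> x"
        using quot[OF test_fun_directional_derivative[OF \<phi>, of x j 0]] by (simp add: e_def)
    qed
    fix i
    show "AE x in lborel. norm (hk s (x - y) * ((\<phi> (x + h i *\<^sub>R e) - \<phi> x) / h i)) \<le> B * hk s (x - y)"
    proof (rule AE_I2)
      fix x
      have "\<bar>\<phi> (x + h i *\<^sub>R e) - \<phi> x\<bar> \<le> B * \<bar>h i\<bar>" unfolding e_def by (rule test_fun_increment_le[OF \<phi> B'(2)])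
      then have "\<bar>(\<phi> (x + h i *\<^sub>R e) - \<phi> x) / h i\<bar> \<le> B" using h0[of i] by (simp add: abs_divide divide_le_eq)
      then have "hk s (x - y) * \<bar>(\<phi> (x + h i *\<^sub>R e) - \<phi> x) / h i\<bar> \<le> hk s (x - y) * B" by (intro mult_left_mono) auto
      then show "norm (hk s (x - y) * ((\<phi> (x + h i *\<^sub>R e) - \<phi> x) / h i)) \<le> B * hk s (x - y)" by (simp add: abs_mult mult.commute)
    qed
  qed auto
  have lim2: "(\<lambda>i. \<integral>x. (hk s (x - y + (- h i) *\<^sub>R e) - hk s (x - y)) / h i * \<phi> x \<partial>lborel) \<longlonglongrightarrow> (\<integral>x. - dhk j s (x - y) * \<phi> x \<partial>lborel)"
  proof (rule integral_dominated_convergence)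
    show "integrable lborel (\<lambda>x. L * \<bar>\<phi> x\<bar>)" using test_fun_integrable[OF \<phi>] by simp
    show "AE x in lborel. (\<lambda>i. (hk s (x - y + (- h i) *\<^sub>R e) - hk s (x - y)) / h i * \<phi> x) \<longlonglongrightarrow> - dhk j s (x - y) * \<phi> x"
    proof (intro AE_I2 tendsto_mult tendsto_const)
      fix x
      have "((\<lambda>k. hk s (x - y + (- k) *\<^sub>R axis j 1)) has_real_derivative dhk j s (x - y + (- 0) *\<^sub>R axis j 1) * (- 1)) (at 0)"
        by (rule DERIV_chain2[where f = "\<lambda>k. hk s (x - y + k *\<^sub>R axis j 1)" and g = "\<lambda>k. - k", OF hk_directional_derivative[OF s]])
          (auto intro!: derivative_eq_intros)
      from quot[OF this] show "(\<lambda>i. (hk s (x - y + (- h i) *\<^sub>R e) - hk s (x - y)) / h i) \<longlonglongrightarrow> - dhk j s (x - y)"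
        by (simp add: e_def)
    qed
    fix i
    show "AE x in lborel. norm ((hk s (x - y + (- h i) *\<^sub>R e) - hk s (x - y)) / h i * \<phi> x) \<le> L * \<bar>\<phi> x\<bar>"
    proof (rule AE_I2)
      fix x
      have "\<bar>hk s (x - y + (- h i) *\<^sub>R e) - hk s (x - y)\<bar> \<le> L * \<bar>- h i\<bar>" unfolding e_def by (rule hk_increment_le[OF s L])
      then have "\<bar>(hk s (x - y + (- h i) *\<^sub>R e) - hk s (x - y)) / h i\<bar> \<le> L" using h0[of i] by (simp add: abs_divide divide_le_eq)
      then show "norm ((hk s (x - y + (- h i) *\<^sub>R e) - hk s (x - y)) / h i * \<phi> x) \<le> L * \<bar>\<phi> x\<bar>"
        unfolding real_norm_def abs_mult by (intro mult_right_mono) auto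
    qed
  qed auto
  have "(\<integral>x. hk s (x - y) * partial j \<phi> x \<partial>lborel) = (\<integral>x. - dhk j s (x - y) * \<phi> x \<partial>lborel)"
    using lim1 lim2 unfolding eq by (rule LIMSEQ_unique)
  then show ?thesis by simp
qed simp

text \<open>Both parts of the evolution superpose translated heat kernels: the free part over
  \<open>y\<close> at fixed time, the singular part over the time \<open>r\<close> at the fixed
  centre 0. Integrating by parts under one general integral covers both.\<close>

lemma
  fixes c :: "'z::euclidean_space \<Rightarrow> complex" and \<sigma> :: "'z \<Rightarrow> real" and y :: "'z \<Rightarrow> R2"
  assumes \<phi>: "test_fun \<phi>"
    and [measurable]: "c \<in> borel_measurable borel" "\<sigma> \<in> borel_measurable borel" "y \<in> borel_measurable borel"
    and fin1: "(\<integral>\<^sup>+ x. \<integral>\<^sup>+ z. ennreal (norm (c z) * hk (\<sigma> z) (x - y z) * \<bar>partial j \<phi> x\<bar>) \<partial>lborel \<partial>lborel) < \<infinity>"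
    and fin2: "(\<integral>\<^sup>+ x. \<integral>\<^sup>+ z. ennreal (norm (c z) * \<bar>dhk j (\<sigma> z) (x - y z)\<bar> * \<bar>\<phi> x\<bar>) \<partial>lborel \<partial>lborel) < \<infinity>"
  defines "U \<equiv> \<lambda>x. \<integral>z. complex_of_real (hk (\<sigma> z) (x - y z)) * c z \<partial>lborel"
    and "V \<equiv> \<lambda>x. \<integral>z. complex_of_real (dhk j (\<sigma> z) (x - y z)) * c z \<partial>lborel"
  shows superposition_integrable: "integrable lborel (\<lambda>x. U x * complex_of_real (partial j \<phi> x))"
      "integrable lborel (\<lambda>x. V x * complex_of_real (\<phi> x))"
    and superposition_by_parts: "(\<integral>x. U x * complex_of_real (partial j \<phi> x) \<partial>lborel) = - (\<integral>x. V x * complex_of_real (\<phi> x) \<partial>lborel)"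
proof -
  have [measurable]: "\<phi> \<in> borel_measurable borel" "partial j \<phi> \<in> borel_measurable borel" by (rule test_fun_measurable[OF \<phi>])+
  define f where "f x z = c z * complex_of_real (hk (\<sigma> z) (x - y z) * partial j \<phi> x)" for x z
  define g where "g x z = c z * complex_of_real (dhk j (\<sigma> z) (x - y z) * \<phi> x)" for x z
  have [measurable]: "case_prod f \<in> borel_measurable (lborel \<Otimes>\<^sub>M lborel)" "case_prod g \<in> borel_measurable (lborel \<Otimes>\<^sub>M lborel)"
    unfolding f_def g_def by measurable
  have ff: "(\<integral>\<^sup>+ x. \<integral>\<^sup>+ z. ennreal (norm (f x z)) \<partial>lborel \<partial>lborel) < \<infinity>"
    using fin1 unfolding f_def by (simp add: norm_mult abs_mult mult.assoc del: of_real_mult)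
  have fg: "(\<integral>\<^sup>+ x. \<integral>\<^sup>+ z. ennreal (norm (g x z)) \<partial>lborel \<partial>lborel) < \<infinity>"
    using fin2 unfolding g_def by (simp add: norm_mult abs_mult mult.assoc del: of_real_mult)
  have U: "U x * complex_of_real (partial j \<phi> x) = (\<integral>z. f x z \<partial>lborel)" for x
    unfolding U_def integral_mult_left_zero[symmetric] f_def by (intro Bochner_Integration.integral_cong) (simp_all add: mult_ac)
  have V: "V x * complex_of_real (\<phi> x) = (\<integral>z. g x z \<partial>lborel)" for x
    unfolding V_def integral_mult_left_zero[symmetric] g_def by (intro Bochner_Integration.integral_cong) (simp_all add: mult_ac)
  show "integrable lborel (\<lambda>x. U x * complex_of_real (partial j \<phi> x))" unfolding U using ff by (intro lborel_Fubini(2)) auto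
  show "integrable lborel (\<lambda>x. V x * complex_of_real (\<phi> x))" unfolding V using fg by (intro lborel_Fubini(2)) auto
  have "(\<integral>x. U x * complex_of_real (partial j \<phi> x) \<partial>lborel) = (\<integral>z. \<integral>x. f x z \<partial>lborel \<partial>lborel)"
    unfolding U using ff by (intro lborel_Fubini(1)) auto
  also have "\<dots> = (\<integral>z. - (\<integral>x. g x z \<partial>lborel) \<partial>lborel)"
  proof (intro Bochner_Integration.integral_cong refl)
    fix z
    have "(\<integral>x. f x z \<partial>lborel) = c z * complex_of_real (\<integral>x. hk (\<sigma> z) (x - y z) * partial j \<phi> x \<partial>lborel)"
      unfolding f_def integral_mult_right_zero integral_complex_of_real ..
    moreover have "(\<integral>x. g x z \<partial>lborel) = c z * complex_of_real (\<integral>x. dhk j (\<sigma> z) (x - y z) * \<phi> x \<partial>lborel)"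
      unfolding g_def integral_mult_right_zero integral_complex_of_real ..
    ultimately show "(\<integral>x. f x z \<partial>lborel) = - (\<integral>x. g x z \<partial>lborel)"
      unfolding hk_integration_by_parts[OF \<phi>] by simp
  qed
  also have "\<dots> = - (\<integral>x. \<integral>z. g x z \<partial>lborel \<partial>lborel)"
    using lborel_Fubini(1)[OF _ fg] by simp
  finally show "(\<integral>x. U x * complex_of_real (partial j \<phi> x) \<partial>lborel) = - (\<integral>x. V x * complex_of_real (\<phi> x) \<partial>lborel)"
    unfolding V .
qed

section \<open>The gradient estimate\<close>

definition heat_grad :: "(R2 \<Rightarrow> complex) \<Rightarrow> real \<Rightarrow> 2 \<Rightarrow> R2 \<Rightarrow> complex" where
  "heat_grad f t j x = (\<integral>y. complex_of_real (dhk j t (x - y)) * f y \<partial>lborel)"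

definition charge_grad :: "real \<Rightarrow> (R2 \<Rightarrow> complex) \<Rightarrow> real \<Rightarrow> 2 \<Rightarrow> R2 \<Rightarrow> complex" where
  "charge_grad E f t j x = (\<integral>r. complex_of_real (dhk j (t - r) x) * charge E (\<lambda>s. heat f s 0) r \<partial>lborel)"

lemma heat_grad_measurable [measurable]:
  assumes [measurable]: "f \<in> borel_measurable borel"
  shows "heat_grad f t j \<in> borel_measurable borel"
  unfolding heat_grad_def by (rule lborel.borel_measurable_lebesgue_integral) simp

lemma charge_grad_measurable [measurable]:
  assumes [measurable]: "f \<in> borel_measurable borel"
  shows "charge_grad E f t j \<in> borel_measurable borel"
proof -
  have [measurable]: "charge E (\<lambda>s. heat f s 0) \<in> borel_measurable borel" by (rule charge_heat_measurable) simp
  show ?thesis unfolding charge_grad_def by (rule lborel.borel_measurable_lebesgue_integral) simp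
qed

lemma heat_weak_partial:
  assumes f: "Lp_mem 2 f" and t: "0 < t" and \<phi>: "test_fun \<phi>"
  shows "integrable lborel (\<lambda>x. heat f t x * complex_of_real (partial j \<phi> x))"
    "integrable lborel (\<lambda>x. heat_grad f t j x * complex_of_real (\<phi> x))"
    "(\<integral>x. heat f t x * complex_of_real (partial j \<phi> x) \<partial>lborel) = - (\<integral>x. heat_grad f t j x * complex_of_real (\<phi> x) \<partial>lborel)"
proof -
  have [measurable]: "f \<in> borel_measurable borel" by (rule Lp_memD_measurable[OF f])
  have [measurable]: "\<phi> \<in> borel_measurable borel" "partial j \<phi> \<in> borel_measurable borel" by (rule test_fun_measurable[OF \<phi>])+
  obtain B R where B: "0 \<le> B" "\<And>x. \<bar>\<phi> x\<bar> \<le> B * indicator (cball 0 R) x" "\<And>x. \<bar>partial j \<phi> x\<bar> \<le> B * indicator (cball 0 R) x"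
    using test_fun_bounds[OF \<phi>, of j] by blast
  \<comment> \<open>One estimate for the kernel and its derivative, both bounded by a multiple of
    some \<open>hk s\<close>: the flow of \<open>norm (f z)\<close> is bounded in space, and the
    test function has bounded support.\<close>
  have gen: "(\<integral>\<^sup>+ x. \<integral>\<^sup>+ z. ennreal (norm (f z) * k (x - z) * \<bar>\<psi> x\<bar>) \<partial>lborel \<partial>lborel) < \<infinity>"
    if k: "\<And>z. 0 \<le> k z" "\<And>z. k z \<le> M * hk s z" "0 \<le> M" "0 < s" and \<psi>: "\<And>x. \<bar>\<psi> x\<bar> \<le> B * indicator (cball 0 R) x"
    for k :: "R2 \<Rightarrow> real" and \<psi> :: "R2 \<Rightarrow> real" and M s :: real
  proof -
    define C where "C = s powr (- (1 / 2)) * Lp_norm 2 f"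
    have "(\<integral>\<^sup>+ x. \<integral>\<^sup>+ z. ennreal (norm (f z) * k (x - z) * \<bar>\<psi> x\<bar>) \<partial>lborel \<partial>lborel) \<le> (\<integral>\<^sup>+ x. ennreal (M * C) * ennreal (B * indicator (cball (0 :: R2) R) x) \<partial>lborel)"
    proof (rule nn_integral_mono)
      fix x
      have "(\<integral>\<^sup>+ z. ennreal (norm (f z) * k (x - z) * \<bar>\<psi> x\<bar>) \<partial>lborel) \<le> (\<integral>\<^sup>+ z. ennreal (M * (B * indicator (cball 0 R) x)) * ennreal (hk s (x - z) * norm (f z)) \<partial>lborel)"
      proof (rule nn_integral_mono)
        fix z
        have "norm (f z) * k (x - z) * \<bar>\<psi> x\<bar> \<le> norm (f z) * (M * hk s (x - z)) * (B * indicator (cball 0 R) x)"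
          using k B(1) \<psi> by (intro mult_mono mult_nonneg_nonneg) auto
        then have "ennreal (norm (f z) * k (x - z) * \<bar>\<psi> x\<bar>) \<le> ennreal (M * (B * indicator (cball 0 R) x) * (hk s (x - z) * norm (f z)))"
          by (intro ennreal_leI) (simp add: mult_ac)
        also have "\<dots> = ennreal (M * (B * indicator (cball 0 R) x)) * ennreal (hk s (x - z) * norm (f z))"
          using k B(1) by (intro ennreal_mult') auto
        finally show "ennreal (norm (f z) * k (x - z) * \<bar>\<psi> x\<bar>) \<le> ennreal (M * (B * indicator (cball 0 R) x)) * ennreal (hk s (x - z) * norm (f z))" .
      qed
      also have "\<dots> = ennreal (M * (B * indicator (cball 0 R) x)) * (\<integral>\<^sup>+ z. ennreal (hk s (x - z) * norm (f z)) \<partial>lborel)"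
        by (intro nn_integral_cmult) simp
      also have "\<dots> \<le> ennreal (M * (B * indicator (cball 0 R) x)) * ennreal C"
        unfolding C_def using k by (intro mult_left_mono hk_nn_integral_bound[OF f]) auto
      also have "\<dots> = ennreal (M * (B * indicator (cball 0 R) x) * C)" using k B(1) by (intro ennreal_mult'[symmetric]) auto
      also have "\<dots> = ennreal (M * C * (B * indicator (cball 0 R) x))" by (simp add: mult_ac)
      also have "\<dots> = ennreal (M * C) * ennreal (B * indicator (cball 0 R) x)" using k by (intro ennreal_mult') (auto simp: C_def)
      finally show "(\<integral>\<^sup>+ z. ennreal (norm (f z) * k (x - z) * \<bar>\<psi> x\<bar>) \<partial>lborel) \<le> ennreal (M * C) * ennreal (B * indicator (cball 0 R) x)" .
    qed
    also have "\<dots> = ennreal (M * C) * (\<integral>\<^sup>+ x. ennreal (B * indicator (cball (0 :: R2) R) x) \<partial>lborel)"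
    proof (rule nn_integral_cmult)
      have [measurable]: "cball (0 :: R2) R \<in> sets borel" by simp
      show "(\<lambda>x. ennreal (B * indicator (cball (0 :: R2) R) x)) \<in> borel_measurable lborel" by measurable
    qed
    also have "\<dots> < \<infinity>" using nn_integral_cball_indicator by (simp add: ennreal_mult_less_top)
    finally show ?thesis .
  qed
  have fin1: "(\<integral>\<^sup>+ x. \<integral>\<^sup>+ z. ennreal (norm (f z) * hk t (x - z) * \<bar>partial j \<phi> x\<bar>) \<partial>lborel \<partial>lborel) < \<infinity>"
    using t B by (intro gen[where M = 1 and s = t]) auto
  have fin2: "(\<integral>\<^sup>+ x. \<integral>\<^sup>+ z. ennreal (norm (f z) * \<bar>dhk j t (x - z)\<bar> * \<bar>\<phi> x\<bar>) \<partial>lborel \<partial>lborel) < \<infinity>"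
    using t B dhk_le[OF t] by (intro gen[where M = "2 * t powr (- (1 / 2))" and s = "2 * t"]) auto
  note S = superposition_integrable[where c = f and \<sigma> = "\<lambda>_. t" and y = "\<lambda>z. z", OF \<phi> _ _ _ fin1 fin2]
    superposition_by_parts[where c = f and \<sigma> = "\<lambda>_. t" and y = "\<lambda>z. z", OF \<phi> _ _ _ fin1 fin2]
  show "integrable lborel (\<lambda>x. heat f t x * complex_of_real (partial j \<phi> x))" unfolding heat_def by (rule S(1)) auto
  show "integrable lborel (\<lambda>x. heat_grad f t j x * complex_of_real (\<phi> x))" unfolding heat_grad_def by (rule S(2)) auto
  show "(\<integral>x. heat f t x * complex_of_real (partial j \<phi> x) \<partial>lborel) = - (\<integral>x. heat_grad f t j x * complex_of_real (\<phi> x) \<partial>lborel)"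
    unfolding heat_def heat_grad_def by (rule S(3)) auto
qed

lemma charge_weak_partial:
  assumes f: "Lp_mem 2 f" and E: "0 < E" and t: "0 < t" and \<phi>: "test_fun \<phi>"
  defines "V \<equiv> \<lambda>x. hconv (\<lambda>r. complex_of_real (hk r x)) (charge E (\<lambda>s. heat f s 0)) t"
  shows "integrable lborel (\<lambda>x. V x * complex_of_real (partial j \<phi> x))"
    "integrable lborel (\<lambda>x. charge_grad E f t j x * complex_of_real (\<phi> x))"
    "(\<integral>x. V x * complex_of_real (partial j \<phi> x) \<partial>lborel) = - (\<integral>x. charge_grad E f t j x * complex_of_real (\<phi> x) \<partial>lborel)"
proof -
  have [measurable]: "f \<in> borel_measurable borel" by (rule Lp_memD_measurable[OF f])
  define c where "c = charge E (\<lambda>s. heat f s 0)"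
  have [measurable]: "c \<in> borel_measurable borel" unfolding c_def by (rule charge_heat_measurable) simp
  have [measurable]: "\<phi> \<in> borel_measurable borel" "partial j \<phi> \<in> borel_measurable borel" by (rule test_fun_measurable[OF \<phi>])+
  obtain B R where B0: "0 \<le> B" "\<And>x. \<bar>\<phi> x\<bar> \<le> B * indicator (cball 0 R) x" "\<And>x. \<bar>partial j \<phi> x\<bar> \<le> B * indicator (cball 0 R) x"
    using test_fun_bounds[OF \<phi>, of j] by blast
  have B: "\<bar>\<phi> x\<bar> \<le> B" "\<bar>partial j \<phi> x\<bar> \<le> B" for x
    using B0(1) order_trans[OF B0(2)[of x], of B] order_trans[OF B0(3)[of x], of B] by (auto split: split_indicator simp: mult_left_le)
  define M where "M = (12 * pi + 8 / (pi * (1 - 1 / 2))) * Lp_norm 2 f"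
  have M: "0 \<le> M" by (simp add: M_def)
  have cb: "norm (c r) \<le> M * r powr (- (1 / 2))" if "0 < r" for r
    unfolding c_def M_def using charge_heat_bound[OF f _ E that] by simp
  have c0: "c r = 0" if "r \<le> 0" for r unfolding c_def by (rule charge_heat_nonpos[OF that])
  \<comment> \<open>Exponent \<open>a = 0\<close> serves the kernel and \<open>a = 1 / 2\<close> its
    derivative. Either way the time integral is of Beta type, with the charge singularity
    \<open>r powr (- 1 / 2)\<close> at the other end.\<close>
  have gen: "(\<integral>\<^sup>+ x. \<integral>\<^sup>+ r. ennreal (norm (c r) * k r x * \<bar>\<psi> x\<bar>) \<partial>lborel \<partial>lborel) < \<infinity>"
    if km: "(\<lambda>z. k (snd z) (fst z)) \<in> borel_measurable (borel \<Otimes>\<^sub>M borel)" and pm: "\<psi> \<in> borel_measurable borel"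
      and k: "\<And>r x. 0 \<le> k r x" "\<And>r x. k r x \<le> 2 * (t - r) powr (- a) * hk (d * (t - r)) x" "0 < d" and a: "0 \<le> a" "a < 1"
      and \<psi>: "\<And>x. \<bar>\<psi> x\<bar> \<le> B"
    for k :: "real \<Rightarrow> R2 \<Rightarrow> real" and \<psi> :: "R2 \<Rightarrow> real" and a d :: real
  proof -
    have [measurable]: "(\<lambda>z. k (snd z) (fst z)) \<in> borel_measurable (borel \<Otimes>\<^sub>M borel)" "\<psi> \<in> borel_measurable borel" using km pm by auto
    have "(\<integral>\<^sup>+ x. \<integral>\<^sup>+ r. ennreal (norm (c r) * k r x * \<bar>\<psi> x\<bar>) \<partial>lborel \<partial>lborel) = (\<integral>\<^sup>+ r. \<integral>\<^sup>+ x. ennreal (norm (c r) * k r x * \<bar>\<psi> x\<bar>) \<partial>lborel \<partial>lborel)"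
      by (rule lborel_Tonelli) simp
    also have "\<dots> \<le> (\<integral>\<^sup>+ r. ennreal (2 * M * B) * ennreal (indicator {0<..<t} r * (r powr (- (1 / 2)) * (t - r) powr (- a))) \<partial>lborel)"
    proof (rule nn_integral_mono)
      fix r :: real
      show "(\<integral>\<^sup>+ x. ennreal (norm (c r) * k r x * \<bar>\<psi> x\<bar>) \<partial>lborel) \<le> ennreal (2 * M * B) * ennreal (indicator {0<..<t} r * (r powr (- (1 / 2)) * (t - r) powr (- a)))"
      proof (cases "r \<in> {0<..<t}")
        case True
        have "(\<integral>\<^sup>+ x. ennreal (norm (c r) * k r x * \<bar>\<psi> x\<bar>) \<partial>lborel) \<le> (\<integral>\<^sup>+ x. ennreal (2 * M * B * (r powr (- (1 / 2)) * (t - r) powr (- a))) * ennreal (hk (d * (t - r)) x) \<partial>lborel)"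
        proof (rule nn_integral_mono)
          fix x
          have "norm (c r) * k r x * \<bar>\<psi> x\<bar> \<le> (M * r powr (- (1 / 2))) * (2 * (t - r) powr (- a) * hk (d * (t - r)) x) * B"
            using True k cb[of r] \<psi> M B0(1) by (intro mult_mono mult_nonneg_nonneg) auto
          then have "ennreal (norm (c r) * k r x * \<bar>\<psi> x\<bar>) \<le> ennreal (2 * M * B * (r powr (- (1 / 2)) * (t - r) powr (- a)) * hk (d * (t - r)) x)"
            by (intro ennreal_leI) (simp add: mult_ac)
          also have "\<dots> = ennreal (2 * M * B * (r powr (- (1 / 2)) * (t - r) powr (- a))) * ennreal (hk (d * (t - r)) x)"
            using M B0(1) by (intro ennreal_mult') auto
          finally show "ennreal (norm (c r) * k r x * \<bar>\<psi> x\<bar>) \<le> ennreal (2 * M * B * (r powr (- (1 / 2)) * (t - r) powr (- a))) * ennreal (hk (d * (t - r)) x)" .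
        qed
        also have "\<dots> = ennreal (2 * M * B * (r powr (- (1 / 2)) * (t - r) powr (- a)))"
          using True k by (subst nn_integral_cmult) (auto simp: nn_integral_hk)
        also have "\<dots> = ennreal (2 * M * B) * ennreal (r powr (- (1 / 2)) * (t - r) powr (- a))"
          using M B0(1) by (intro ennreal_mult') auto
        finally show ?thesis using True by simp
      next
        case False
        have "norm (c r) * k r x * \<bar>\<psi> x\<bar> = 0" for x
        proof (cases "r \<le> 0")
          case True
          then show ?thesis using c0 by simp
        next
          case False': False
          then have "d * (t - r) \<le> 0" using False k(3) by (auto simp: mult_le_0_iff)
          then have "k r x = 0" using k(1,2)[of r x] by simp
          then show ?thesis by simp
        qed
        then have "(\<integral>\<^sup>+ x. ennreal (norm (c r) * k r x * \<bar>\<psi> x\<bar>) \<partial>lborel) = 0"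
          by (simp only: ennreal_0 nn_integral_const mult_zero_left)
        then show ?thesis by simp
      qed
    qed
    also have "\<dots> = ennreal (2 * M * B) * (\<integral>\<^sup>+ r. ennreal (indicator {0<..<t} r * (r powr (- (1 / 2)) * (t - r) powr (- a))) \<partial>lborel)"
      by (intro nn_integral_cmult) simp
    also have "\<dots> < \<infinity>"
      using le_less_trans[OF nn_integral_Beta_bound[of a "1 / 2" t]] a t by (auto simp: ennreal_mult_less_top)
    finally show ?thesis .
  qed
  have fin1: "(\<integral>\<^sup>+ x. \<integral>\<^sup>+ r. ennreal (norm (c r) * hk (t - r) (x - 0) * \<bar>partial j \<phi> x\<bar>) \<partial>lborel \<partial>lborel) < \<infinity>"
  proof (rule gen[where a = 0 and d = 1])
    show "hk (t - r) (x - 0) \<le> 2 * (t - r) powr (- 0) * hk (1 * (t - r)) x" for r x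
      by (cases "r < t") auto
  qed (use B in auto)
  have fin2: "(\<integral>\<^sup>+ x. \<integral>\<^sup>+ r. ennreal (norm (c r) * \<bar>dhk j (t - r) (x - 0)\<bar> * \<bar>\<phi> x\<bar>) \<partial>lborel \<partial>lborel) < \<infinity>"
  proof (rule gen[where a = "1 / 2" and d = 2])
    show "\<bar>dhk j (t - r) (x - 0)\<bar> \<le> 2 * (t - r) powr (- (1 / 2)) * hk (2 * (t - r)) x" for r x
      using dhk_le[of "t - r" j x] by (cases "r < t") auto
  qed (use B in auto)
  note S = superposition_integrable[where c = c and \<sigma> = "\<lambda>r. t - r" and y = "\<lambda>_. 0", OF \<phi> _ _ _ fin1 fin2]
    superposition_by_parts[where c = c and \<sigma> = "\<lambda>r. t - r" and y = "\<lambda>_. 0", OF \<phi> _ _ _ fin1 fin2]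
  have Vd: "V x = (\<integral>r. complex_of_real (hk (t - r) (x - 0)) * c r \<partial>lborel)" for x
    by (simp add: V_def hconv_def c_def)
  have Gd: "charge_grad E f t j x = (\<integral>r. complex_of_real (dhk j (t - r) (x - 0)) * c r \<partial>lborel)" for x
    by (simp add: charge_grad_def c_def)
  show "integrable lborel (\<lambda>x. V x * complex_of_real (partial j \<phi> x))" unfolding Vd by (rule S(1)) auto
  show "integrable lborel (\<lambda>x. charge_grad E f t j x * complex_of_real (\<phi> x))" unfolding Gd by (rule S(2)) auto
  show "(\<integral>x. V x * complex_of_real (partial j \<phi> x) \<partial>lborel) = - (\<integral>x. charge_grad E f t j x * complex_of_real (\<phi> x) \<partial>lborel)"
    unfolding Vd Gd by (rule S(3)) auto
qed

definition evol_grad :: "real \<Rightarrow> (R2 \<Rightarrow> complex) \<Rightarrow> real \<Rightarrow> R2 \<Rightarrow> complex^2" where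
  "evol_grad E f t x = (\<chi> j. heat_grad f t j x + charge_grad E f t j x)"

lemma evol_weak_grad:
  assumes f: "Lp_mem 2 f" and E: "0 < E" and t: "0 < t"
  shows "weak_grad (evol E f t) (evol_grad E f t)"
  unfolding weak_grad_def
proof (intro conjI allI impI)
  have [measurable]: "f \<in> borel_measurable borel" by (rule Lp_memD_measurable[OF f])
  show "(\<lambda>x. evol_grad E f t x $ j) \<in> borel_measurable lborel" for j
    unfolding evol_grad_def by simp
  fix \<phi> j assume \<phi>: "test_fun \<phi>"
  show "(\<integral>x. evol E f t x * complex_of_real (partial j \<phi> x) \<partial>lborel) = - (\<integral>x. evol_grad E f t x $ j * complex_of_real (\<phi> x) \<partial>lborel)"
    unfolding evol_def evol_grad_def distrib_right vec_lambda_beta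
    using heat_weak_partial[OF f t \<phi>, of j] charge_weak_partial[OF f E t \<phi>, of j] by simp
qed

text \<open>Pointwise the gradient is at most \<open>2 * t powr (- (1 / 2))\<close> times the flow
  \<open>H\<close> of \<open>norm (f y)\<close> at time \<open>2 * t\<close>. The gain from
  \<open>q\<close> to \<open>p\<close> comes from splitting \<open>H powr p\<close> into
  \<open>H powr (p - q)\<close>, bounded by the supremum estimate \<open>heat_bound\<close>, and
  \<open>H powr q\<close>, integrated by \<open>heat_Lp\<close>.\<close>

lemma heat_grad_Lp:
  assumes f: "Lp_mem q f" and pq: "1 < q" "q < p" and t: "0 < t"
  shows "(\<integral>\<^sup>+ x. ennreal (norm (heat_grad f t j x) powr p) \<partial>lborel)
     \<le> ennreal (2 powr p * (t powr (- (1 / 2) - (1 / q - 1 / p)) * Lp_norm q f) powr p)"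
proof -
  have [measurable]: "f \<in> borel_measurable borel" by (rule Lp_memD_measurable[OF f])
  define F where "F y = complex_of_real (norm (f y))" for y
  have F: "Lp_mem q F" using f unfolding F_def Lp_mem_def by auto
  have FN: "Lp_norm q F = Lp_norm q f" by (simp add: F_def Lp_norm_def)
  have [measurable]: "F \<in> borel_measurable borel" by (rule Lp_memD_measurable[OF F])
  define N where "N = Lp_norm q f"
  have N: "0 \<le> N" by (simp add: N_def)
  define H where "H x = norm (heat F (2 * t) x)" for x
  have [measurable]: "H \<in> borel_measurable borel" unfolding H_def by measurable
  have H0: "0 \<le> H x" for x by (simp add: H_def)
  have hi: "integrable lborel (\<lambda>y. hk (2 * t) (x - y) * norm (f y))" for x
    using integrable_norm[OF heat_integrable[OF f, of "2 * t" x]] t pq by (simp add: norm_mult)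
  have Hd: "(\<integral>y. hk (2 * t) (x - y) * norm (f y) \<partial>lborel) \<le> H x" for x
    unfolding H_def heat_def F_def of_real_mult[symmetric] integral_complex_of_real norm_of_real by simp
  have gb: "norm (heat_grad f t j x) \<le> 2 * t powr (- (1 / 2)) * H x" for x
  proof -
    have "norm (heat_grad f t j x) \<le> (\<integral>y. 2 * t powr (- (1 / 2)) * (hk (2 * t) (x - y) * norm (f y)) \<partial>lborel)"
      unfolding heat_grad_def
    proof (rule norm_integral_le)
      fix y
      have "\<bar>dhk j t (x - y)\<bar> * norm (f y) \<le> 2 * t powr (- (1 / 2)) * hk (2 * t) (x - y) * norm (f y)"
        by (intro mult_right_mono dhk_le t) auto
      then show "norm (complex_of_real (dhk j t (x - y)) * f y) \<le> 2 * t powr (- (1 / 2)) * (hk (2 * t) (x - y) * norm (f y))"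
        by (simp add: norm_mult mult.assoc)
    qed (use hi in simp)
    also have "\<dots> = 2 * t powr (- (1 / 2)) * (\<integral>y. hk (2 * t) (x - y) * norm (f y) \<partial>lborel)" by simp
    also have "\<dots> \<le> 2 * t powr (- (1 / 2)) * H x" by (intro mult_left_mono Hd) auto
    finally show ?thesis .
  qed
  have Hb: "H x \<le> N * t powr (- (1 / q))" for x
  proof -
    have "H x \<le> N * (2 * t) powr (- (1 / q))" unfolding H_def N_def FN[symmetric] using t pq by (intro heat_bound[OF F]) auto
    also have "\<dots> \<le> N * t powr (- (1 / q))" using t pq N by (intro mult_left_mono powr_mono2') auto
    finally show ?thesis .
  qed
  define K where "K = (2 * t powr (- (1 / 2))) powr p * (N * t powr (- (1 / q))) powr (p - q)"
  have "(\<integral>\<^sup>+ x. ennreal (norm (heat_grad f t j x) powr p) \<partial>lborel) \<le> (\<integral>\<^sup>+ x. ennreal K * ennreal (norm (heat F (2 * t) x) powr q) \<partial>lborel)"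
  proof (rule nn_integral_mono)
    fix x
    have "norm (heat_grad f t j x) powr p \<le> (2 * t powr (- (1 / 2)) * H x) powr p" using gb pq by (intro powr_mono2) auto
    also have "\<dots> = (2 * t powr (- (1 / 2))) powr p * H x powr p" using H0 by (intro powr_mult)
    also have "H x powr p = H x powr (p - q) * H x powr q" by (simp add: powr_add[symmetric])
    also have "\<dots> \<le> (N * t powr (- (1 / q))) powr (p - q) * H x powr q" using Hb H0 pq by (intro mult_right_mono powr_mono2) auto
    finally have "norm (heat_grad f t j x) powr p \<le> K * norm (heat F (2 * t) x) powr q" by (simp add: K_def H_def mult_left_mono mult.assoc)
    then show "ennreal (norm (heat_grad f t j x) powr p) \<le> ennreal K * ennreal (norm (heat F (2 * t) x) powr q)"
      by (subst ennreal_mult'[symmetric]) (auto simp: K_def intro!: ennreal_leI)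
  qed
  also have "\<dots> = ennreal K * (\<integral>\<^sup>+ x. ennreal (norm (heat F (2 * t) x) powr q) \<partial>lborel)" by (intro nn_integral_cmult) simp
  also have "\<dots> \<le> ennreal K * ennreal (N powr q)"
    using heat_Lp[OF F, of "2 * t"] pq t unfolding FN N_def[symmetric] by (intro mult_left_mono) auto
  also have "\<dots> = ennreal (K * N powr q)" by (rule ennreal_mult'[symmetric]) (simp add: K_def)
  also have "K * N powr q = 2 powr p * (t powr (- (1 / 2) - (1 / q - 1 / p)) * N) powr p"
  proof -
    have "K * N powr q = 2 powr p * (t powr (- (1 / 2) * p) * t powr (- (1 / q) * (p - q))) * (N powr (p - q) * N powr q)"
      using t N by (simp add: K_def powr_mult powr_powr mult_ac)
    also have "N powr (p - q) * N powr q = N powr p" by (simp add: powr_add[symmetric])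
    also have "t powr (- (1 / 2) * p) * t powr (- (1 / q) * (p - q)) = t powr ((- (1 / 2) - (1 / q - 1 / p)) * p)"
    proof -
      have "- (1 / 2) * p + - (1 / q) * (p - q) = (- (1 / 2) - (1 / q - 1 / p)) * p" using pq by (simp add: field_simps)
      then show ?thesis unfolding powr_add[symmetric] by (simp only:)
    qed
    finally show ?thesis using t N by (simp add: powr_mult powr_powr)
  qed
  finally show ?thesis by (simp add: N_def)
qed

text \<open>The case \<open>k = 1 / 2\<close>, \<open>b = 1 / q\<close> of
  \<open>hk_hconv_Lp_bound\<close>: its condition \<open>p * k < 1\<close> reads
  \<open>p < 2\<close>, and its exponent \<open>1 - p / q - p / 2\<close> is \<open>p\<close> times
  the exponent claimed for \<open>t\<close>.\<close>

lemma charge_grad_Lp: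
  assumes pq: "1 < q" "q < p" "p < 2" and E: "0 < E"
  obtains C where "0 \<le> C" "\<And>f t j. Lp_mem q f \<Longrightarrow> 0 < t \<Longrightarrow>
     (\<integral>\<^sup>+ x. ennreal (norm (charge_grad E f t j x) powr p) \<partial>lborel)
     \<le> ennreal (C * (t powr (- (1 / 2) - (1 / q - 1 / p)) * Lp_norm q f) powr p)"
proof -
  obtain C where C: "0 \<le> C" "\<And>t M (g :: real \<Rightarrow> R2 \<Rightarrow> complex). 0 < t \<Longrightarrow> 0 \<le> M \<Longrightarrow>
     (\<And>\<tau> x. norm (g \<tau> x) \<le> indicator {0<..<t} \<tau> * (M * ((t - \<tau>) powr (- (1 / 2)) * hk (2 * (t - \<tau>)) x * \<tau> powr (- (1 / q))))) \<Longrightarrow>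
     (\<integral>\<^sup>+ x. ennreal (norm (\<integral>\<tau>. g \<tau> x \<partial>lborel) powr p) \<partial>lborel) \<le> ennreal (C * M powr p * t powr (1 - p * (1 / q) - p * (1 / 2)))"
    by (rule hk_hconv_Lp_bound[of p "1 / 2" "1 / q" 2]) (use pq in auto)
  define A0 where "A0 = 12 * pi + 8 / (pi * (1 - 1 / q))"
  define A where "A = 2 * A0"
  have A: "0 \<le> A" using pq by (simp add: A_def A0_def)
  show thesis
  proof
    show "0 \<le> C * A powr p" using C by simp
    fix f :: "R2 \<Rightarrow> complex" and t j assume f: "Lp_mem q f" and t: "(0::real) < t"
    define M where "M = A * Lp_norm q f"
    have M: "0 \<le> M" using A by (simp add: M_def)
    have "(\<integral>\<^sup>+ x. ennreal (norm (charge_grad E f t j x) powr p) \<partial>lborel) \<le> ennreal (C * M powr p * t powr (1 - p * (1 / q) - p * (1 / 2)))"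
      unfolding charge_grad_def
    proof (rule C(2)[OF t M])
      fix r x
      show "norm (complex_of_real (dhk j (t - r) x) * charge E (\<lambda>s. heat f s 0) r) \<le> indicator {0<..<t} r * (M * ((t - r) powr (- (1 / 2)) * hk (2 * (t - r)) x * r powr (- (1 / q))))"
      proof (cases "r \<in> {0<..<t}")
        case True
        have "\<bar>dhk j (t - r) x\<bar> * norm (charge E (\<lambda>s. heat f s 0) r)
           \<le> (2 * (t - r) powr (- (1 / 2)) * hk (2 * (t - r)) x) * (A0 * Lp_norm q f * r powr (- (1 / q)))"
          unfolding A0_def using True pq by (intro mult_mono dhk_le charge_heat_bound[OF f _ E]) auto
        then show ?thesis using True by (simp add: norm_mult M_def A_def mult_ac)
      next
        case False
        then have "dhk j (t - r) x = 0 \<or> charge E (\<lambda>s. heat f s 0) r = 0"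
          by (auto simp: charge_heat_nonpos not_less)
        then show ?thesis using False by auto
      qed
    qed
    also have "C * M powr p * t powr (1 - p * (1 / q) - p * (1 / 2)) = C * A powr p * (t powr (- (1 / 2) - (1 / q - 1 / p)) * Lp_norm q f) powr p"
    proof -
      have "1 - p * (1 / q) - p * (1 / 2) = (- (1 / 2) - (1 / q - 1 / p)) * p" using pq by (simp add: field_simps)
      then have "t powr (1 - p * (1 / q) - p * (1 / 2)) = (t powr (- (1 / 2) - (1 / q - 1 / p))) powr p"
        by (simp only: powr_powr)
      then show ?thesis using A by (simp add: M_def powr_mult mult_ac)
    qed
    finally show "(\<integral>\<^sup>+ x. ennreal (norm (charge_grad E f t j x) powr p) \<partial>lborel)
     \<le> ennreal (C * A powr p * (t powr (- (1 / 2) - (1 / q - 1 / p)) * Lp_norm q f) powr p)" .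
  qed
qed

lemma norm_vec2_le: "norm (v :: 'a::real_normed_vector ^ 2) \<le> norm (v $ 1) + norm (v $ 2)"
  unfolding norm_vec_def using L2_set_le_sum[of UNIV "\<lambda>i. norm (v $ i)"] by (simp add: UNIV_2)

lemma evol_grad_Lp:
  assumes pq: "1 < q" "q < p" "p < 2" and E: "0 < E"
  obtains C where "0 \<le> C" "\<And>f t. Lp_mem q f \<Longrightarrow> 0 < t \<Longrightarrow> Lp_mem p (evol_grad E f t) \<and>
     Lp_norm p (evol_grad E f t) \<le> C * t powr (- (1 / 2) - (1 / q - 1 / p)) * Lp_norm q f"
proof -
  obtain C where C: "0 \<le> C" "\<And>f t j. Lp_mem q f \<Longrightarrow> 0 < t \<Longrightarrow>
     (\<integral>\<^sup>+ x. ennreal (norm (charge_grad E f t j x) powr p) \<partial>lborel)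
     \<le> ennreal (C * (t powr (- (1 / 2) - (1 / q - 1 / p)) * Lp_norm q f) powr p)"
    using charge_grad_Lp[OF pq E] by blast
  \<comment> \<open>One \<open>2 powr p\<close> for each of the two quasi-triangle steps, the inner
    one over free and singular part, the outer one over the two coordinates, which also contribute
    the factor 2. The inner \<open>2 powr p + C\<close> adds the constants of the two parts.\<close>
  define K where "K = 2 powr p * (2 * (2 powr p * (2 powr p + C)))"
  have K: "0 \<le> K" using C by (simp add: K_def)
  show thesis
  proof
    show "0 \<le> K powr (1 / p)" by simp
    fix f :: "R2 \<Rightarrow> complex" and t assume f: "Lp_mem q f" and t: "(0::real) < t"
    have [measurable]: "f \<in> borel_measurable borel" by (rule Lp_memD_measurable[OF f])
    define G where "G = t powr (- (1 / 2) - (1 / q - 1 / p)) * Lp_norm q f"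
    have G: "0 \<le> G" by (simp add: G_def)
    let ?I = "\<lambda>h. \<integral>\<^sup>+ x. ennreal (norm (h x) powr p) \<partial>lborel"
    define g where "g j x = heat_grad f t j x + charge_grad E f t j x" for j x
    have [measurable]: "g j \<in> borel_measurable borel" for j unfolding g_def by measurable
    have gI: "?I (g j) \<le> ennreal (2 powr p * (2 powr p + C) * G powr p)" for j
    proof -
      have "?I (g j) \<le> ennreal (2 powr p) * (?I (heat_grad f t j) + ?I (charge_grad E f t j))"
        using pq by (intro nn_integral_add_powr_le) (auto simp: g_def norm_triangle_ineq)
      also have "\<dots> \<le> ennreal (2 powr p) * (ennreal (2 powr p * G powr p) + ennreal (C * G powr p))"
        unfolding G_def by (intro mult_left_mono add_mono heat_grad_Lp[OF f pq(1,2) t] C(2)[OF f t]) auto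
      also have "ennreal (2 powr p * G powr p) + ennreal (C * G powr p) = ennreal (2 powr p * G powr p + C * G powr p)"
        using C(1) by (intro ennreal_plus[symmetric]) auto
      also have "ennreal (2 powr p) * \<dots> = ennreal (2 powr p * (2 powr p * G powr p + C * G powr p))"
        by (rule ennreal_mult'[symmetric]) simp
      finally show ?thesis by (simp add: distrib_right mult.assoc)
    qed
    have h: "norm (evol_grad E f t x) \<le> norm (g 1 x) + norm (g 2 x)" for x
      using norm_vec2_le[of "evol_grad E f t x"] by (simp add: evol_grad_def g_def)
    have "?I (evol_grad E f t) \<le> ennreal (2 powr p) * (?I (g 1) + ?I (g 2))"
      using pq h by (intro nn_integral_add_powr_le) auto
    also have "\<dots> \<le> ennreal (2 powr p) * (ennreal (2 powr p * (2 powr p + C) * G powr p) + ennreal (2 powr p * (2 powr p + C) * G powr p))"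
      by (intro mult_left_mono add_mono gI) simp
    also have "ennreal (2 powr p * (2 powr p + C) * G powr p) + ennreal (2 powr p * (2 powr p + C) * G powr p) = ennreal (2 powr p * (2 powr p + C) * G powr p + 2 powr p * (2 powr p + C) * G powr p)"
      using C(1) by (intro ennreal_plus[symmetric]) auto
    also have "ennreal (2 powr p) * \<dots> = ennreal (2 powr p * (2 powr p * (2 powr p + C) * G powr p + 2 powr p * (2 powr p + C) * G powr p))"
      by (rule ennreal_mult'[symmetric]) simp
    also have "2 powr p * (2 powr p * (2 powr p + C) * G powr p + 2 powr p * (2 powr p + C) * G powr p) = (K powr (1 / p) * G) powr p"
    proof -
      have "(K powr (1 / p) * G) powr p = K * G powr p" using K G pq by (simp add: powr_mult powr_powr)
      then show ?thesis by (simp add: K_def algebra_simps)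
    qed
    finally have I: "?I (evol_grad E f t) \<le> ennreal ((K powr (1 / p) * G) powr p)" .
    have meas: "evol_grad E f t \<in> borel_measurable borel"
    proof -
      \<comment> \<open>Measurability of the vector-valued map is reduced to its coordinates through
        the continuous embeddings \<open>axis\<close>.\<close>
      have eq: "evol_grad E f t = (\<lambda>x. axis 1 (g 1 x) + axis 2 (g 2 x))"
      proof
        fix x show "evol_grad E f t x = axis 1 (g 1 x) + axis 2 (g 2 x)"
          unfolding vec_eq_iff forall_2 by (simp add: evol_grad_def g_def axis_def)
      qed
      have ax: "(\<lambda>c :: complex. axis i c :: complex^2) \<in> borel_measurable borel" for i
      proof (intro borel_measurable_continuous_onI)
        show "continuous_on UNIV (\<lambda>c :: complex. axis i c :: complex^2)"
          unfolding axis_def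
        proof (intro continuous_on_vec_lambda)
          show "continuous_on UNIV (\<lambda>c :: complex. if k = i then c else 0)" for k by (cases "k = i") auto
        qed
      qed
      show ?thesis unfolding eq
        by (intro borel_measurable_add measurable_compose[OF _ ax]) simp_all
    qed
    show "Lp_mem p (evol_grad E f t) \<and> Lp_norm p (evol_grad E f t) \<le> K powr (1 / p) * t powr (- (1 / 2) - (1 / q - 1 / p)) * Lp_norm q f"
    proof
      show "Lp_mem p (evol_grad E f t)" unfolding Lp_mem_def using meas le_less_trans[OF I] by simp
      have "Lp_norm p (evol_grad E f t) \<le> K powr (1 / p) * G" using G pq by (intro Lp_norm_le[OF I]) auto
      then show "Lp_norm p (evol_grad E f t) \<le> K powr (1 / p) * t powr (- (1 / 2) - (1 / q - 1 / p)) * Lp_norm q f"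
        by (simp add: G_def mult.assoc)
    qed
  qed
qed

lemma weak_grad_cong_AE:
  assumes h: "weak_grad v h" and ae: "AE x in lborel. u x = v x"
    and [measurable]: "u \<in> borel_measurable borel" "v \<in> borel_measurable borel"
  shows "weak_grad u h"
  unfolding weak_grad_def
proof (intro conjI allI impI)
  show "(\<lambda>x. h x $ j) \<in> borel_measurable lborel" for j using h by (simp add: weak_grad_def)
  fix \<phi> j assume \<phi>: "test_fun \<phi>"
  have [measurable]: "partial j \<phi> \<in> borel_measurable borel" by (rule test_fun_measurable[OF \<phi>])
  have "(\<integral>x. u x * complex_of_real (partial j \<phi> x) \<partial>lborel) = (\<integral>x. v x * complex_of_real (partial j \<phi> x) \<partial>lborel)"
    using ae by (intro integral_cong_AE) auto
  then show "(\<integral>x. u x * complex_of_real (partial j \<phi> x) \<partial>lborel) = - (\<integral>x. h x $ j * complex_of_real (\<phi> x) \<partial>lborel)"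
    using h \<phi> by (simp add: weak_grad_def)
qed

section \<open>The projection off the eigenfunction\<close>

lemma Pac_Lp_mem:
  assumes g: "Lp_mem p g" and p: "1 < p" "p < 3"
  shows "Lp_mem p (Pac alpha g)"
proof -
  have [measurable]: "g \<in> borel_measurable borel" by (rule Lp_memD_measurable[OF g])
  \<comment> \<open>The coefficient is a fixed number, so the correction is a multiple of
    \<open>Gk\<close>, whose integrability \<open>Gk_Lp\<close> supplies for exponents below
    3.\<close>
  define c where "c = (\<integral>y. g y * complex_of_real (psi alpha y) \<partial>lborel) / complex_of_real (Lp_norm 2 (Gk (Ealpha alpha)))"
  have P: "Pac alpha g x = g x - c * complex_of_real (Gk (Ealpha alpha) x)" for x
    by (simp add: Pac_def Pd_def psi_def c_def)
  define k where "k x = c * complex_of_real (Gk (Ealpha alpha) x)" for x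
  have [measurable]: "k \<in> borel_measurable borel" unfolding k_def by measurable
  let ?I = "\<lambda>h. \<integral>\<^sup>+ x. ennreal (norm (h x :: complex) powr p) \<partial>lborel"
  have "?I k = (\<integral>\<^sup>+ x. ennreal (norm c powr p) * ennreal (Gk (Ealpha alpha) x powr p) \<partial>lborel)"
    by (intro nn_integral_cong) (simp add: k_def norm_mult powr_mult ennreal_mult')
  also have "\<dots> = ennreal (norm c powr p) * (\<integral>\<^sup>+ x. ennreal (Gk (Ealpha alpha) x powr p) \<partial>lborel)"
    by (intro nn_integral_cmult) simp
  also have "\<dots> < \<infinity>" using Gk_Lp[OF Ealpha_pos p] by (simp add: ennreal_mult_less_top)
  finally have k: "?I k < \<infinity>" .
  have "?I (Pac alpha g) \<le> ennreal (2 powr p) * (?I g + ?I k)"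
    using p by (intro nn_integral_add_powr_le) (auto simp: P k_def norm_triangle_ineq4)
  also have "\<dots> < \<infinity>" using k g by (simp add: ennreal_mult_less_top Lp_mem_def)
  finally have "?I (Pac alpha g) < \<infinity>" .
  moreover have "Pac alpha g \<in> borel_measurable borel" unfolding P[abs_def] by measurable
  ultimately show ?thesis by (simp add: Lp_mem_def)
qed

text \<open>The usual projection identity for the normalised \<open>Gk\<close>. It rests on the norm
  being nonzero: division by 0 would make \<open>psi\<close> vanish and \<open>Pac\<close> the
  identity.\<close>

lemma Pac_orthogonal:
  assumes g: "Lp_mem 2 g"
  shows "(\<integral>y. complex_of_real (Gk (Ealpha alpha) y) * Pac alpha g y \<partial>lborel) = 0"
proof -
  define E where "E = Ealpha alpha"
  have E: "0 < E" by (simp add: E_def)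
  have gk: "(\<integral>\<^sup>+ x. ennreal (Gk E x powr 2) \<partial>lborel) < \<infinity>" by (rule Gk_Lp[OF E]) auto
  define N where "N = Lp_norm 2 (Gk E)"
  have gkm: "Lp_mem 2 (Gk E)" using gk unfolding Lp_mem_def by simp
  have NI: "(\<integral>\<^sup>+ x. ennreal (Gk E x powr 2) \<partial>lborel) = ennreal (N powr 2)"
    using nn_integral_Lp_norm[OF gkm] by (simp add: N_def)
  have N0: "N \<noteq> 0"
  proof
    assume "N = 0"
    then have "(\<integral>\<^sup>+ x. ennreal (Gk E x powr 2) \<partial>lborel) = 0" unfolding NI by simp
    then have ae: "AE x in lborel. Gk E x = 0" by (subst (asm) nn_integral_0_iff_AE) auto
    \<comment> \<open>Nonvanishing is read off from a pairing already computed: against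
      \<open>Gk (2 * E)\<close> the value is \<open>(cc (2 * E) - cc E) / E\<close>, positive
      because \<open>cc\<close> increases.\<close>
    have "(\<integral>\<^sup>+ y. ennreal (Gk (2 * E) (0 - y) * Gk E y) \<partial>lborel) = 0"
      using ae by (subst nn_integral_0_iff_AE) (auto elim!: eventually_mono)
    moreover have "(\<integral>\<^sup>+ y. ennreal (Gk (2 * E) (0 - y) * Gk E y) \<partial>lborel) = ennreal ((cc (2 * E) - cc E) / (2 * E - E))"
      using E nn_integral_Gk_conv[of E "2 * E" 0] nn_integral_exp_diff_hk_0[of E "2 * E"] by simp
    moreover have "0 < (cc (2 * E) - cc E) / (2 * E - E)"
      using E by (simp add: cc_def divide_strict_right_mono)
    ultimately show False by (simp add: ennreal_eq_0_iff)
  qed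
  define I where "I = (\<integral>y. complex_of_real (Gk E y) * g y \<partial>lborel)"
  have i1: "integrable lborel (\<lambda>y. complex_of_real (Gk E y) * g y)"
    using Gk_integrable[OF g _ E, of 0] by simp
  have i2r: "integrable lborel (\<lambda>y. Gk E y * Gk E y)"
    using gk by (intro integrableI_nonneg) (auto simp: power2_eq_square)
  then have i2: "integrable lborel (\<lambda>y. complex_of_real (Gk E y * Gk E y))" by (rule integrable_of_real)
  have GG: "(\<integral>y. complex_of_real (Gk E y * Gk E y) \<partial>lborel) = complex_of_real (N * N)"
  proof -
    have "(\<integral>y. Gk E y * Gk E y \<partial>lborel) = N * N"
      using NI by (subst integral_eq_nn_integral) (auto simp: power2_eq_square N_def)
    then show ?thesis by (simp only: integral_complex_of_real)
  qed
  define c where "c = (\<integral>y. g y * complex_of_real (psi alpha y) \<partial>lborel)"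
  have c: "c = I / complex_of_real N"
  proof -
    have "c = (\<integral>y. (complex_of_real (Gk E y) * g y) / complex_of_real N \<partial>lborel)"
      unfolding c_def psi_def E_def[symmetric] N_def[symmetric] by (intro Bochner_Integration.integral_cong) (auto simp: mult_ac)
    then show ?thesis by (simp add: I_def)
  qed
  have "(\<integral>y. complex_of_real (Gk E y) * Pac alpha g y \<partial>lborel) = (\<integral>y. complex_of_real (Gk E y) * g y - c / complex_of_real N * complex_of_real (Gk E y * Gk E y) \<partial>lborel)"
  proof (intro Bochner_Integration.integral_cong refl)
    fix y
    have "Pac alpha g y = g y - c * complex_of_real (psi alpha y)" by (simp only: Pac_def Pd_def c_def)
    then have eq: "Pac alpha g y = g y - c * complex_of_real (Gk E y / N)" by (simp only: psi_def E_def N_def)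
    show "complex_of_real (Gk E y) * Pac alpha g y = complex_of_real (Gk E y) * g y - c / complex_of_real N * complex_of_real (Gk E y * Gk E y)"
      unfolding eq by (simp add: algebra_simps)
  qed
  also have "\<dots> = I - c / complex_of_real N * complex_of_real (N * N)"
    unfolding Bochner_Integration.integral_diff[OF i1 integrable_mult_right[OF i2]] integral_mult_right_zero GG I_def ..
  also have "\<dots> = 0" using N0 by (simp add: c)
  finally show ?thesis by (simp add: E_def)
qed

text \<open>The semigroup is encoded as a relation, so existence of some \<open>u\<close> and the
  bound for every \<open>u\<close> are claimed together. All such \<open>u\<close> agree almost
  everywhere with the explicit evolution and hence share its weak gradient; the constant is the one
  from \<open>evol_grad_Lp\<close>.\<close>

theorem theorem2p9:
  fixes alpha p q :: real
  assumes "1 < q" and "q < p" and "p < 2"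
  shows "\<exists>C. \<forall>t > 0. \<forall>g :: R2 \<Rightarrow> complex. Lp_mem 2 g \<and> Lp_mem q g \<longrightarrow>
           (\<exists>u. heat_sg alpha t (Pac alpha g) u) \<and>
           (\<forall>u. heat_sg alpha t (Pac alpha g) u \<longrightarrow>
              (\<exists>h. weak_grad u h \<and> Lp_mem p h \<and>
                   Lp_norm p h \<le> C * t powr (- 1 / 2 - (1 / q - 1 / p)) * Lp_norm q (Pac alpha g)))"
proof -
  define E where "E = Ealpha alpha"
  have E: "0 < E" by (simp add: E_def)
  obtain C where C: "\<And>f t. Lp_mem q f \<Longrightarrow> 0 < t \<Longrightarrow> Lp_mem p (evol_grad E f t) \<and>
     Lp_norm p (evol_grad E f t) \<le> C * t powr (- (1 / 2) - (1 / q - 1 / p)) * Lp_norm q f"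
    using evol_grad_Lp[OF assms E] by blast
  show ?thesis
  proof (intro exI[of _ C] allI impI, elim conjE)
    fix t :: real and g :: "R2 \<Rightarrow> complex"
    assume t: "0 < t" and g: "Lp_mem 2 g" "Lp_mem q g"
    define f where "f = Pac alpha g"
    have f: "Lp_mem 2 f" "Lp_mem q f" unfolding f_def using assms by (auto intro!: Pac_Lp_mem g)
    have orth: "(\<integral>y. complex_of_real (Gk (Ealpha alpha) y) * f y \<partial>lborel) = 0"
      unfolding f_def by (rule Pac_orthogonal[OF g(1)])
    have "\<exists>h. weak_grad u h \<and> Lp_mem p h \<and> Lp_norm p h \<le> C * t powr (- 1 / 2 - (1 / q - 1 / p)) * Lp_norm q f"
      if u: "heat_sg alpha t f u" for u
    proof (intro exI conjI)
      have um: "Lp_mem 2 u" using u by (simp add: heat_sg_def)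
      show "weak_grad u (evol_grad E f t)"
        by (rule weak_grad_cong_AE[OF evol_weak_grad[OF f(1) E t]])
          (use heat_sg_unique[OF f(1) orth t u] Lp_memD_measurable[OF um] Lp_memD_measurable[OF evol_Lp_mem[OF f(1) E t]] in \<open>auto simp: E_def\<close>)
    qed (use C[OF f(2) t] in auto)
    then show "(\<exists>u. heat_sg alpha t (Pac alpha g) u) \<and>
      (\<forall>u. heat_sg alpha t (Pac alpha g) u \<longrightarrow>
        (\<exists>h. weak_grad u h \<and> Lp_mem p h \<and> Lp_norm p h \<le> C * t powr (- 1 / 2 - (1 / q - 1 / p)) * Lp_norm q (Pac alpha g)))"
      using heat_sg_evol[OF f(1) orth t] unfolding f_def by blast
  qed
qed

end
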